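(* Let $(\bm{u},\xi,p)$ be the solution of the continuous variational problem (CP) and let $(\bm{u}_h^{n+1},\xi_h^{n+1},p_h^{n+1})$, $n=0,\dots,N$, be the solution of the fully discrete scheme (Method 1), both given in the context. Assume that $\bm{u} \in L^{\infty}(0,T;\bm{H}^{k+1}_{0,\Gamma_d}(\Omega))$, $\partial_{t}\bm{u} \in L^{2}(0,T;\bm{H}^{k+1}_{0,\Gamma_d}(\Omega))$, $\partial_{tt}\bm{u} \in L^{2}(0,T;\bm{H}^{1}_{0,\Gamma_d}(\Omega))$, $\xi \in L^{\infty}(0,T;H^{k}(\Omega))$, $\partial_t \xi \in L^{2}(0,T;H^{k}(\Omega))$, $\partial_{tt}\xi \in L^{2}(0,T;L^{2}(\Omega))$, $p \in L^{\infty}(0,T;H^{l+1}_{0,\Gamma_p}(\Omega))$, $\partial_{t}p \in L^{2}(0,T;H^{l+1}_{0,\Gamma_p}(\Omega))$, $\partial_{tt}p \in L^{2}(0,T;L^{2}(\Omega))$. Let $e_{\bm{u}}^{N+1}=\bm{u}(t_{N+1})-\bm{u}_h^{N+1}$, $e_{\xi}^{N+1}=\xi(t_{N+1})-\xi_h^{N+1}$, $e_p^{N+1}=p(t_{N+1})-p_h^{N+1}$. Then $$\| \varepsilon(e_{\bm{u}}^{N+1})\|_{L^2(\Omega)} + \|e_{\xi}^{N+1}\|_{L^2(\Omega)} + \|e_{p}^{N+1}\|_{L^2(\Omega)} \lesssim \Delta t + h^{k} + h^{l+1},$$ $$\| \nabla e_p^{N+1}\|_{L^2(\Omega)} \lesssim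 \Delta t + h^{k} + h^{l}.$$
   Context: Setting. $\Omega\subset\mathbb{R}^d$ ($d=2$ or $3$) is a bounded polygonal (polyhedral) domain with $\partial\Omega=\Gamma_d\cup\Gamma_t=\Gamma_p\cup\Gamma_f$, $|\Gamma_d|>0$, $|\Gamma_p|>0$; $T>0$ is the final time. $H^m_{0,\Gamma}(\Omega)$ is the subspace of $H^m(\Omega)$ with vanishing trace on $\Gamma\subset\partial\Omega$; bold letters denote vector-valued ($\mathbb{R}^d$-valued) versions. $(\cdot,\cdot)$ is the $L^2(\Omega)$ inner product and $\langle\cdot,\cdot\rangle_{\Gamma}$ the $L^2(\Gamma)$ inner product. $\varepsilon(\bm{v})=\frac12[\nabla\bm{v}+(\nabla\bm{v})^T]$. Physical parameters are constants $\mu>0$, $\lambda>0$, $\alpha>0$, $c_0\ge 0$, $K>0$. Gravity is taken to be zero. Data: body force $\bm{f}$, traction $\bm{h}$ on $\Gamma_t$, source $Q_s$, flux $g_2$ on $\Gamma_f$, initial values $\bm{u}^0,p^0$, and $\xi^0=\alpha p^0-\lambda\,\mathrm{div}\,\bm{u}^0$. Bilinear forms: $a_1(\bm{u},\bm{v})=2\mu\int_\Omega\varepsilon(\bm{u}):\varepsilon(\bm{v})$, $b(\bm{v},\phi)=\int_\Omega\phi\,\mathrm{div}\,\bm{v}$, $a_2(\xi,\phi)=\frac1\lambda\int_\Omega\xi\phi$, $c(p,\phi)=\frac{\alpha}{\lambda}\int_\Omega p\phi$, $a_3(p,\psi)=(c_0+\frac{\alpha^2}{\lambda})\int_\Omega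 p\psi$, $d(p,\psi)=K\int_\Omega\nabla p\cdot\nabla\psi$. Continuous problem (CP). $\bm{V}=\bm{H}^1_{0,\Gamma_d}(\Omega)$, $W=L^2(\Omega)$, $M=H^1_{0,\Gamma_p}(\Omega)$. For $t\in[0,T]$, $(\bm{u},\xi,p)(t)\in\bm{V}\times W\times M$ satisfies, with $\bm{u}(0)=\bm{u}^0$, $\xi(0)=\xi^0$, $p(0)=p^0$, $a_1(\bm{u},\bm{v})-b(\bm{v},\xi)=(\bm{f},\bm{v})+\langle\bm{h},\bm{v}\rangle_{\Gamma_t}$ for all $\bm{v}\in\bm{V}$; $b(\bm{u},\phi)+a_2(\xi,\phi)-c(p,\phi)=0$ for all $\phi\in W$; $a_3(\partial_t p,\psi)-c(\psi,\partial_t\xi)+d(p,\psi)=(Q_s,\psi)+\langle g_2,\psi\rangle_{\Gamma_f}$ for all $\psi\in M$. Discrete spaces. $\mathcal{T}_h$ is a partition of $\Omega$ into triangles/tetrahedra with maximum element diameter $h$; $k\ge2$, $l\ge1$ are integers; $\bm{V}_h\subset\bm{V}$, $W_h\subset W$, $M_h\subset M$ are the spaces of continuous functions that are on each element polynomials of degree at most $k$, $k-1$, $l$, respectively (Taylor–Hood pair $(\bm{V}_h,W_h)$, Lagrange space $M_h$; functions in $\bm{V}_h$ vanish on $\Gamma_d$, in $M_h$ on $\Gamma_p$). Projections. $(\bm{R}_{\bm{u}}\bm{u},R_\xi\xi)\in\bm{V}_h\times W_h$ is defined by $a_1(\bm{R}_{\bm{u}}\bm{u},\bm{v}_h)-b(\bm{v}_h,R_\xi\xi)=a_1(\bm{u},\bm{v}_h)-b(\bm{v}_h,\xi)$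 for all $\bm{v}_h\in\bm{V}_h$ and $b(\bm{R}_{\bm{u}}\bm{u},\phi_h)=b(\bm{u},\phi_h)$ for all $\phi_h\in W_h$; $R_pp\in M_h$ by $d(R_pp,\psi_h)=d(p,\psi_h)$ for all $\psi_h\in M_h$. Standing facts assumed for the family of meshes. Korn's inequality $\|\bm{v}\|_{H^1(\Omega)}\le C_k\|\varepsilon(\bm{v})\|_{L^2(\Omega)}$ on $\bm{V}$; the inf-sup condition $\sup_{\bm{v}\in\bm{V}} b(\bm{v},\phi)/\|\bm{v}\|_{H^1(\Omega)}\ge\beta\|\phi\|_{L^2(\Omega)}$ for all $\phi\in W$, with $\beta>0$ depending only on $\Omega,\Gamma_d$; the discrete inf-sup condition $\sup_{\bm{v}_h\in\bm{V}_h} b(\bm{v}_h,\phi_h)/\|\bm{v}_h\|_{H^1(\Omega)}\ge\tilde\beta\|\phi_h\|_{L^2(\Omega)}$ for all $\phi_h\in W_h$, with $\tilde\beta>0$ independent of $h$; and, for $\bm{u}\in\bm{H}^{k+1}_{0,\Gamma_d}(\Omega)$, $\xi\in H^k(\Omega)$, $p\in H^{l+1}_{0,\Gamma_p}(\Omega)$, $\|\bm{u}-\bm{R}_{\bm{u}}\bm{u}\|_{H^1}+\|\xi-R_\xi\xi\|_{L^2}\le Ch^k(\|\bm{u}\|_{H^{k+1}}+\|\xi\|_{H^k})$, $\|p-R_pp\|_{H^1}\le Ch^l\|p\|_{H^{l+1}}$, $\|p-R_pp\|_{L^2}\le Ch^{l+1}\|p\|_{H^{l+1}}$. Time grid. $0=t_0<t_1<\dots<t_{N+1}=T$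 is equidistant with step $\Delta t$. A superscript $n$ on a continuous quantity denotes its value at $t_n$. Discrete initial data: $\bm{u}_h^0=\bm{R}_{\bm{u}}\bm{u}^0$, $\xi_h^0=R_\xi\xi^0$, $p_h^0=R_pp^0$. Method 1 (backward Euler). For $n=0,\dots,N$, given $(\bm{u}_h^n,\xi_h^n,p_h^n)$, find $(\bm{u}_h^{n+1},\xi_h^{n+1},p_h^{n+1})\in\bm{V}_h\times W_h\times M_h$ such that $a_1(\bm{u}_h^{n+1},\bm{v}_h)-b(\bm{v}_h,\xi_h^{n+1})=(\bm{f}^{n+1},\bm{v}_h)+\langle\bm{h}^{n+1},\bm{v}_h\rangle_{\Gamma_t}$ for all $\bm{v}_h\in\bm{V}_h$; $b(\bm{u}_h^{n+1},\phi_h)+a_2(\xi_h^{n+1},\phi_h)-c(p_h^{n+1},\phi_h)=0$ for all $\phi_h\in W_h$; $a_3\big(\frac{p_h^{n+1}-p_h^n}{\Delta t},\psi_h\big)-c\big(\psi_h,\frac{\xi_h^{n+1}-\xi_h^n}{\Delta t}\big)+d(p_h^{n+1},\psi_h)=(Q_s^{n+1},\psi_h)+\langle g_2^{n+1},\psi_h\rangle_{\Gamma_f}$ for all $\psi_h\in M_h$. Convention. $x\lesssim y$ means $x\le Cy$ with a generic constant $C>0$ independent of the mesh sizes ($h$ and $\Delta t$). *)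

theory Defs
  imports "HOL-Analysis.Analysis"
begin

text \<open>
  Elements of $L^2$, Sobolev and Bochner spaces are represented by functions on the whole type;
  values outside the domain of integration are irrelevant and functions that agree almost
  everywhere have the same (semi)norms.
\<close>

section \<open>Square-integrable functions\<close>

definition L2 :: "'a measure \<Rightarrow> ('a \<Rightarrow> 'b::euclidean_space) set" where
  "L2 M = {f. f \<in> borel_measurable M \<and> integrable M (\<lambda>x. (norm (f x))\<^sup>2)}"

definition L2_norm :: "'a measure \<Rightarrow> ('a \<Rightarrow> 'b::euclidean_space) \<Rightarrow> real" where
  "L2_norm M f = sqrt (LINT x|M. (norm (f x))\<^sup>2)"

definition L2_inner :: "'a measure \<Rightarrow> ('a \<Rightarrow> 'b::euclidean_space) \<Rightarrow> ('a \<Rightarrow> 'b) \<Rightarrow> real" where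
  "L2_inner M f g = (LINT x|M. f x \<bullet> g x)"


section \<open>Smooth functions, weak derivatives, Sobolev spaces\<close>

primrec iter_deriv :: "'a::euclidean_space list \<Rightarrow> ('a \<Rightarrow> 'b::real_normed_vector) \<Rightarrow> 'a \<Rightarrow> 'b" where
  "iter_deriv [] f = f"
| "iter_deriv (v # vs) f = (\<lambda>x. frechet_derivative (iter_deriv vs f) (at x) v)"

text \<open>
  Differentiability (hence continuity) of all iterated partial derivatives on the whole space is
  $C^\infty$; the induction is well founded because \<open>iter_deriv (v # vs) f\<close> is only a genuine
  derivative once \<open>iter_deriv vs f\<close> is differentiable, which is also required.
\<close>

definition smooth :: "('a::euclidean_space \<Rightarrow> 'b::real_normed_vector) \<Rightarrow> bool" where
  "smooth f \<longleftrightarrow> (\<forall>vs. set vs \<subseteq> Basis \<longrightarrow> iter_deriv vs f differentiable_on UNIV)"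

definition test_functions :: "'a::euclidean_space set \<Rightarrow> ('a \<Rightarrow> real) set" where
  "test_functions U = {\<phi>. smooth \<phi> \<and> compact (closure {x. \<phi> x \<noteq> 0}) \<and> closure {x. \<phi> x \<noteq> 0} \<subseteq> U}"

text \<open>
  Iterated partial derivatives in $\mathbb{R}^d$ are indexed by lists of coordinate directions
  instead of multi-indices. Accordingly the $H^m$-norm below is
  $(\sum_{j \le m} \|\nabla^j v\|_{L^2}^2)^{1/2}$ with the full tensors of $j$-th derivatives; it
  counts mixed derivatives with multiplicity.
\<close>

definition has_weak_deriv ::
    "(real^'d) set \<Rightarrow> 'd list \<Rightarrow> (real^'d \<Rightarrow> 'b::euclidean_space) \<Rightarrow> (real^'d \<Rightarrow> 'b) \<Rightarrow> bool" where
  "has_weak_deriv \<Omega> js v g \<longleftrightarrow>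
    (\<forall>\<phi>\<in>test_functions \<Omega>.
      (LINT x|lebesgue_on \<Omega>. iter_deriv (map (\<lambda>j. axis j 1) js) \<phi> x *\<^sub>R v x) =
      (-1) ^ length js *\<^sub>R (LINT x|lebesgue_on \<Omega>. \<phi> x *\<^sub>R g x))"

definition weak_deriv ::
    "(real^'d) set \<Rightarrow> 'd list \<Rightarrow> (real^'d \<Rightarrow> 'b::euclidean_space) \<Rightarrow> real^'d \<Rightarrow> 'b" where
  "weak_deriv \<Omega> js v = (SOME g. g \<in> L2 (lebesgue_on \<Omega>) \<and> has_weak_deriv \<Omega> js v g)"

definition Sobolev :: "(real^'d) set \<Rightarrow> nat \<Rightarrow> (real^'d \<Rightarrow> 'b::euclidean_space) set" where
  "Sobolev \<Omega> m = {v \<in> L2 (lebesgue_on \<Omega>). \<forall>js. length js \<le> m \<longrightarrow>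
              (\<exists>g \<in> L2 (lebesgue_on \<Omega>). has_weak_deriv \<Omega> js v g)}"

definition Sobolev_norm :: "(real^'d) set \<Rightarrow> nat \<Rightarrow> (real^'d \<Rightarrow> 'b::euclidean_space) \<Rightarrow> real" where
  "Sobolev_norm \<Omega> m v =
    sqrt (\<Sum>js | length js \<le> m. (L2_norm (lebesgue_on \<Omega>) (weak_deriv \<Omega> js v))\<^sup>2)"

definition grad :: "(real^'d) set \<Rightarrow> (real^'d \<Rightarrow> real) \<Rightarrow> real^'d \<Rightarrow> real^'d" where
  "grad \<Omega> p x = (\<chi> i. weak_deriv \<Omega> [i] p x)"

definition divergence :: "(real^'d) set \<Rightarrow> (real^'d \<Rightarrow> real^'d) \<Rightarrow> real^'d \<Rightarrow> real" where
  "divergence \<Omega> v x = (\<Sum>i\<in>UNIV. weak_deriv \<Omega> [i] v x $ i)"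

definition jacobian :: "(real^'d) set \<Rightarrow> (real^'d \<Rightarrow> real^'d) \<Rightarrow> real^'d \<Rightarrow> real^'d^'d" where
  "jacobian \<Omega> v x = (\<chi> i j. weak_deriv \<Omega> [j] v x $ i)"

definition strain :: "(real^'d) set \<Rightarrow> (real^'d \<Rightarrow> real^'d) \<Rightarrow> real^'d \<Rightarrow> real^'d^'d" where
  "strain \<Omega> v x = (1/2) *\<^sub>R (jacobian \<Omega> v x + transpose (jacobian \<Omega> v x))"


section \<open>Surface measure and traces\<close>

text \<open>
  The surface measure on the boundary is the $(d-1)$-dimensional Hausdorff measure, normalised so
  that it is the area measure on hyperplanes. \<open>hausdorff_outer\<close> is meant for $s \ge 1$ (for $s = 0$
  empty covering sets would be counted). Its restriction to the Borel sets is countably additive,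
  so \<open>measure_of\<close> does not default to the null measure.
\<close>

definition hausdorff_outer :: "nat \<Rightarrow> 'a::metric_space set \<Rightarrow> ennreal" where
  "hausdorff_outer s A =
    (SUP \<delta>\<in>{0<..}.
      INF U\<in>{U :: nat \<Rightarrow> 'a set. (\<forall>i. bounded (U i) \<and> diameter (U i) \<le> \<delta>) \<and> A \<subseteq> (\<Union>i. U i)}.
        (\<Sum>i. ennreal (unit_ball_vol (real s) * (diameter (U i) / 2) ^ s)))"

definition hausdorff_measure :: "nat \<Rightarrow> 'a::metric_space measure" where
  "hausdorff_measure s = measure_of UNIV (sets borel) (hausdorff_outer s)"

definition surface :: "(real^'d) set \<Rightarrow> (real^'d) measure" where
  "surface \<Gamma> = restrict_space (hausdorff_measure (CARD('d) - 1)) \<Gamma>"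

definition is_trace ::
    "(real^'d) set \<Rightarrow> (real^'d \<Rightarrow> 'b::euclidean_space) \<Rightarrow> (real^'d \<Rightarrow> 'b) \<Rightarrow> bool" where
  "is_trace \<Omega> v \<gamma> \<longleftrightarrow> \<gamma> \<in> L2 (surface (frontier \<Omega>)) \<and>
    (\<exists>w :: nat \<Rightarrow> real^'d \<Rightarrow> 'b. (\<forall>j. smooth (w j)) \<and>
       (\<lambda>j. Sobolev_norm \<Omega> 1 (\<lambda>x. w j x - v x)) \<longlonglongrightarrow> 0 \<and>
       (\<lambda>j. \<integral>\<^sup>+x. ennreal ((norm (w j x - \<gamma> x))\<^sup>2) \<partial>surface (frontier \<Omega>)) \<longlonglongrightarrow> 0)"

definition bdry_trace :: "(real^'d) set \<Rightarrow> (real^'d \<Rightarrow> 'b::euclidean_space) \<Rightarrow> real^'d \<Rightarrow> 'b" where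
  "bdry_trace \<Omega> v = (SOME \<gamma>. is_trace \<Omega> v \<gamma>)"

definition Sobolev0 :: "(real^'d) set \<Rightarrow> nat \<Rightarrow> (real^'d) set \<Rightarrow> (real^'d \<Rightarrow> 'b::euclidean_space) set" where
  "Sobolev0 \<Omega> m \<Gamma> = {v \<in> Sobolev \<Omega> m. \<exists>\<gamma>. is_trace \<Omega> v \<gamma> \<and> (AE x in surface \<Gamma>. \<gamma> x = 0)}"


section \<open>Functions of time with values in a function space\<close>

text \<open>
  A function space is given by its carrier \<open>X\<close> and its norm \<open>N\<close>. The definitions follow
  \<^const>\<open>has_bochner_integral\<close>, which is not applicable because a function space on a variable
  domain is not a type.
\<close>

definition bochner_simple ::
    "real measure \<Rightarrow> ('a \<Rightarrow> 'b) set \<Rightarrow> (real \<Rightarrow> 'a \<Rightarrow> 'b) \<Rightarrow> bool" where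
  "bochner_simple M X s \<longleftrightarrow> simple_function M s \<and> s ` space M \<subseteq> X"

definition strongly_measurable ::
    "real measure \<Rightarrow> ('a \<Rightarrow> 'b::real_vector) set \<Rightarrow> (('a \<Rightarrow> 'b) \<Rightarrow> real) \<Rightarrow> (real \<Rightarrow> 'a \<Rightarrow> 'b) \<Rightarrow> bool"
  where
  "strongly_measurable M X N u \<longleftrightarrow> (AE t in M. u t \<in> X) \<and>
    (\<exists>s :: nat \<Rightarrow> real \<Rightarrow> 'a \<Rightarrow> 'b. (\<forall>n. bochner_simple M X (s n)) \<and>
       (AE t in M. (\<lambda>n. N (\<lambda>x. s n t x - u t x)) \<longlonglongrightarrow> 0))"

definition has_time_integral ::
    "real measure \<Rightarrow> ('a \<Rightarrow> 'b::real_vector) set \<Rightarrow> (('a \<Rightarrow> 'b) \<Rightarrow> real) \<Rightarrow>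
     (real \<Rightarrow> 'a \<Rightarrow> 'b) \<Rightarrow> ('a \<Rightarrow> 'b) \<Rightarrow> bool" where
  "has_time_integral M X N u J \<longleftrightarrow> J \<in> X \<and> strongly_measurable M X N u \<and>
    (\<exists>s :: nat \<Rightarrow> real \<Rightarrow> 'a \<Rightarrow> 'b. (\<forall>n. bochner_simple M X (s n)) \<and>
       (\<lambda>n. \<integral>\<^sup>+t. ennreal (N (\<lambda>x. s n t x - u t x)) \<partial>M) \<longlonglongrightarrow> 0 \<and>
       (\<lambda>n. N (\<lambda>x. (\<Sum>y\<in>s n ` space M. measure M {t\<in>space M. s n t = y} *\<^sub>R y x) - J x))
         \<longlonglongrightarrow> 0)"

definition L2_time ::
    "real \<Rightarrow> ('a \<Rightarrow> 'b::real_vector) set \<Rightarrow> (('a \<Rightarrow> 'b) \<Rightarrow> real) \<Rightarrow> (real \<Rightarrow> 'a \<Rightarrow> 'b) set" where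
  "L2_time T X N = {u. strongly_measurable (lebesgue_on {0<..<T}) X N u \<and>
                       integrable (lebesgue_on {0<..<T}) (\<lambda>t. (N (u t))\<^sup>2)}"

definition Linf_time ::
    "real \<Rightarrow> ('a \<Rightarrow> 'b::real_vector) set \<Rightarrow> (('a \<Rightarrow> 'b) \<Rightarrow> real) \<Rightarrow> (real \<Rightarrow> 'a \<Rightarrow> 'b) set" where
  "Linf_time T X N = {u. strongly_measurable (lebesgue_on {0<..<T}) X N u \<and>
                         (\<exists>B. AE t in lebesgue_on {0<..<T}. N (u t) \<le> B)}"

text \<open>
  Weak time derivative: $\int_0^T \varphi' u\,dt = -\int_0^T \varphi v\,dt$ for all
  $\varphi \in C_c^\infty(0,T)$, as Bochner integrals in $L^2(\Omega)$, into which all spaces used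
  here are embedded.
\<close>

definition has_weak_time_deriv ::
    "real \<Rightarrow> (real^'d) set \<Rightarrow> (real \<Rightarrow> real^'d \<Rightarrow> 'b::euclidean_space) \<Rightarrow>
     (real \<Rightarrow> real^'d \<Rightarrow> 'b) \<Rightarrow> bool" where
  "has_weak_time_deriv T \<Omega> u v \<longleftrightarrow>
    (\<forall>\<phi>\<in>test_functions {0<..<T}. \<exists>J.
       has_time_integral (lebesgue_on {0<..<T}) (L2 (lebesgue_on \<Omega>)) (L2_norm (lebesgue_on \<Omega>))
         (\<lambda>t x. deriv \<phi> t *\<^sub>R u t x) J \<and>
       has_time_integral (lebesgue_on {0<..<T}) (L2 (lebesgue_on \<Omega>)) (L2_norm (lebesgue_on \<Omega>))
         (\<lambda>t x. \<phi> t *\<^sub>R v t x) (\<lambda>x. - J x))"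

definition time_continuous ::
    "real \<Rightarrow> (real^'d) set \<Rightarrow> (real \<Rightarrow> real^'d \<Rightarrow> 'b::euclidean_space) \<Rightarrow> bool" where
  "time_continuous T \<Omega> u \<longleftrightarrow>
    (\<forall>t\<in>{0..T}. u t \<in> L2 (lebesgue_on \<Omega>) \<and>
       ((\<lambda>s. L2_norm (lebesgue_on \<Omega>) (\<lambda>x. u s x - u t x)) \<longlongrightarrow> 0) (at t within {0..T}))"


section \<open>Polyhedral domains, meshes, finite element spaces\<close>

text \<open>The condition \<open>interior (closure \<Omega>) = \<Omega>\<close> excludes slits, so that \<open>\<Omega>\<close> lies on one side
  of each boundary facet.\<close>

definition polyhedral_domain :: "(real^'d) set \<Rightarrow> bool" where
  "polyhedral_domain \<Omega> \<longleftrightarrow> open \<Omega> \<and> connected \<Omega> \<and> bounded \<Omega> \<and> \<Omega> \<noteq> {} \<and>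
     interior (closure \<Omega>) = \<Omega> \<and>
     (\<exists>F. finite F \<and> (\<forall>P\<in>F. polytope P) \<and> closure \<Omega> = \<Union>F)"

text \<open>Only a partition into simplices is required; the triangulations without hanging nodes are
  those \<open>\<T>\<close> for which \<^term>\<open>triangulation \<T>\<close> holds in addition.\<close>

definition mesh_of :: "(real^'d) set \<Rightarrow> (real^'d) set set \<Rightarrow> bool" where
  "mesh_of \<Omega> \<T> \<longleftrightarrow> finite \<T> \<and> (\<forall>K\<in>\<T>. int CARD('d) simplex K) \<and> \<Union>\<T> = closure \<Omega> \<and>
     (\<forall>K\<in>\<T>. \<forall>K'\<in>\<T>. K \<noteq> K' \<longrightarrow> interior K \<inter> interior K' = {})"

definition mesh_size :: "(real^'d) set set \<Rightarrow> real" where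
  "mesh_size \<T> = Max (diameter ` \<T>)"

definition polys :: "nat \<Rightarrow> (real^'d \<Rightarrow> 'b::real_vector) set" where
  "polys k = {q. \<exists>c :: ('d \<Rightarrow> nat) \<Rightarrow> 'b.
     q = (\<lambda>x. \<Sum>\<alpha> | (\<Sum>i\<in>UNIV. \<alpha> i) \<le> k. (\<Prod>i\<in>UNIV. (x $ i) ^ \<alpha> i) *\<^sub>R c \<alpha>)}"

definition lagrange_space ::
    "(real^'d) set \<Rightarrow> (real^'d) set set \<Rightarrow> nat \<Rightarrow> (real^'d \<Rightarrow> 'b::real_normed_vector) set" where
  "lagrange_space \<Omega> \<T> k = {v. continuous_on (closure \<Omega>) v \<and> (\<forall>K\<in>\<T>. \<exists>q\<in>polys k. \<forall>x\<in>K. v x = q x)}"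


section \<open>The poroelasticity problem\<close>

record 'd biot =
  dom :: "(real^'d) set"
  Gam_d :: "(real^'d) set"
  Gam_t :: "(real^'d) set"
  Gam_p :: "(real^'d) set"
  Gam_f :: "(real^'d) set"
  mu :: real
  lam :: real
  alph :: real
  c0 :: real
  perm :: real  \<comment> \<open>the constant $K$\<close>
  T_end :: real
  body_force :: "real \<Rightarrow> real^'d \<Rightarrow> real^'d"
  traction :: "real \<Rightarrow> real^'d \<Rightarrow> real^'d"
  source :: "real \<Rightarrow> real^'d \<Rightarrow> real"
  flux :: "real \<Rightarrow> real^'d \<Rightarrow> real"
  u_init :: "real^'d \<Rightarrow> real^'d"
  p_init :: "real^'d \<Rightarrow> real"

abbreviation vol :: "'d::finite biot \<Rightarrow> (real^'d) measure" where
  "vol P \<equiv> lebesgue_on (dom P)"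

definition V_space :: "'d::finite biot \<Rightarrow> (real^'d \<Rightarrow> real^'d) set" where
  "V_space P = Sobolev0 (dom P) 1 (Gam_d P)"

definition W_space :: "'d::finite biot \<Rightarrow> (real^'d \<Rightarrow> real) set" where
  "W_space P = L2 (vol P)"

definition M_space :: "'d::finite biot \<Rightarrow> (real^'d \<Rightarrow> real) set" where
  "M_space P = Sobolev0 (dom P) 1 (Gam_p P)"

definition biot_setting :: "'d::finite biot \<Rightarrow> bool" where
  "biot_setting P \<longleftrightarrow>
     (CARD('d) = 2 \<or> CARD('d) = 3) \<and> polyhedral_domain (dom P) \<and>
     Gam_d P \<in> sets borel \<and> Gam_t P \<in> sets borel \<and>
     Gam_p P \<in> sets borel \<and> Gam_f P \<in> sets borel \<and>
     frontier (dom P) = Gam_d P \<union> Gam_t P \<and> frontier (dom P) = Gam_p P \<union> Gam_f P \<and>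
     emeasure (hausdorff_measure (CARD('d) - 1)) (Gam_d P) > 0 \<and>
     emeasure (hausdorff_measure (CARD('d) - 1)) (Gam_p P) > 0 \<and>
     mu P > 0 \<and> lam P > 0 \<and> alph P > 0 \<and> c0 P \<ge> 0 \<and> perm P > 0 \<and> T_end P > 0 \<and>
     (\<forall>t\<in>{0..T_end P}. body_force P t \<in> L2 (vol P) \<and> traction P t \<in> L2 (surface (Gam_t P)) \<and>
        source P t \<in> L2 (vol P) \<and> flux P t \<in> L2 (surface (Gam_f P))) \<and>
     u_init P \<in> V_space P \<and> p_init P \<in> M_space P"

definition xi_init :: "'d::finite biot \<Rightarrow> real^'d \<Rightarrow> real" where
  "xi_init P x = alph P * p_init P x - lam P * divergence (dom P) (u_init P) x"

definition form_a1 :: "'d::finite biot \<Rightarrow> (real^'d \<Rightarrow> real^'d) \<Rightarrow> (real^'d \<Rightarrow> real^'d) \<Rightarrow> real" where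
  "form_a1 P u v = 2 * mu P * L2_inner (vol P) (strain (dom P) u) (strain (dom P) v)"

definition form_b :: "'d::finite biot \<Rightarrow> (real^'d \<Rightarrow> real^'d) \<Rightarrow> (real^'d \<Rightarrow> real) \<Rightarrow> real" where
  "form_b P v \<phi> = L2_inner (vol P) \<phi> (divergence (dom P) v)"

definition form_a2 :: "'d::finite biot \<Rightarrow> (real^'d \<Rightarrow> real) \<Rightarrow> (real^'d \<Rightarrow> real) \<Rightarrow> real" where
  "form_a2 P \<xi> \<phi> = 1 / lam P * L2_inner (vol P) \<xi> \<phi>"

definition form_c :: "'d::finite biot \<Rightarrow> (real^'d \<Rightarrow> real) \<Rightarrow> (real^'d \<Rightarrow> real) \<Rightarrow> real" where
  "form_c P p \<phi> = alph P / lam P * L2_inner (vol P) p \<phi>"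

definition form_a3 :: "'d::finite biot \<Rightarrow> (real^'d \<Rightarrow> real) \<Rightarrow> (real^'d \<Rightarrow> real) \<Rightarrow> real" where
  "form_a3 P p \<psi> = (c0 P + (alph P)\<^sup>2 / lam P) * L2_inner (vol P) p \<psi>"

definition form_d :: "'d::finite biot \<Rightarrow> (real^'d \<Rightarrow> real) \<Rightarrow> (real^'d \<Rightarrow> real) \<Rightarrow> real" where
  "form_d P p \<psi> = perm P * L2_inner (vol P) (grad (dom P) p) (grad (dom P) \<psi>)"

definition load_term :: "'d::finite biot \<Rightarrow> real \<Rightarrow> (real^'d \<Rightarrow> real^'d) \<Rightarrow> real" where
  "load_term P t v = L2_inner (vol P) (body_force P t) v
     + L2_inner (surface (Gam_t P)) (traction P t) (bdry_trace (dom P) v)"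

definition supply_term :: "'d::finite biot \<Rightarrow> real \<Rightarrow> (real^'d \<Rightarrow> real) \<Rightarrow> real" where
  "supply_term P t \<psi> = L2_inner (vol P) (source P t) \<psi>
     + L2_inner (surface (Gam_f P)) (flux P t) (bdry_trace (dom P) \<psi>)"

text \<open>
  The equations are imposed at every \<open>t\<close>, so \<open>u\<close>, \<open>\<xi>\<close>, \<open>p\<close> and the weak derivatives \<open>\<xi>t\<close>, \<open>pt\<close>
  stand for their representatives that are continuous in time with values in $L^2(\Omega)$. These
  exist whenever the respective next time derivative is in $L^2(0,T;L^2(\Omega))$.
\<close>

definition cp_solution ::
    "'d::finite biot \<Rightarrow> (real \<Rightarrow> real^'d \<Rightarrow> real^'d) \<Rightarrow> (real \<Rightarrow> real^'d \<Rightarrow> real) \<Rightarrow>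
     (real \<Rightarrow> real^'d \<Rightarrow> real) \<Rightarrow> (real \<Rightarrow> real^'d \<Rightarrow> real) \<Rightarrow> (real \<Rightarrow> real^'d \<Rightarrow> real) \<Rightarrow> bool" where
  "cp_solution P u \<xi> p \<xi>t pt \<longleftrightarrow>
     time_continuous (T_end P) (dom P) u \<and> time_continuous (T_end P) (dom P) \<xi> \<and>
     time_continuous (T_end P) (dom P) p \<and>
     has_weak_time_deriv (T_end P) (dom P) \<xi> \<xi>t \<and> time_continuous (T_end P) (dom P) \<xi>t \<and>
     has_weak_time_deriv (T_end P) (dom P) p pt \<and> time_continuous (T_end P) (dom P) pt \<and>
     (AE x in vol P. u 0 x = u_init P x) \<and> (AE x in vol P. \<xi> 0 x = xi_init P x) \<and>
     (AE x in vol P. p 0 x = p_init P x) \<and>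
     (\<forall>t\<in>{0..T_end P}.
        u t \<in> V_space P \<and> \<xi> t \<in> W_space P \<and> p t \<in> M_space P \<and>
        (\<forall>v\<in>V_space P. form_a1 P (u t) v - form_b P v (\<xi> t) = load_term P t v) \<and>
        (\<forall>\<phi>\<in>W_space P. form_b P (u t) \<phi> + form_a2 P (\<xi> t) \<phi> - form_c P (p t) \<phi> = 0) \<and>
        (\<forall>\<psi>\<in>M_space P. form_a3 P (pt t) \<psi> - form_c P \<psi> (\<xi>t t) + form_d P (p t) \<psi> = supply_term P t \<psi>))"


section \<open>Discretisation\<close>

definition V_h :: "'d::finite biot \<Rightarrow> nat \<Rightarrow> (real^'d) set set \<Rightarrow> (real^'d \<Rightarrow> real^'d) set" where
  "V_h P k \<T> = lagrange_space (dom P) \<T> k \<inter> V_space P"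

definition W_h :: "'d::finite biot \<Rightarrow> nat \<Rightarrow> (real^'d) set set \<Rightarrow> (real^'d \<Rightarrow> real) set" where
  "W_h P k \<T> = lagrange_space (dom P) \<T> (k - 1) \<inter> W_space P"

definition M_h :: "'d::finite biot \<Rightarrow> nat \<Rightarrow> (real^'d) set set \<Rightarrow> (real^'d \<Rightarrow> real) set" where
  "M_h P l \<T> = lagrange_space (dom P) \<T> l \<inter> M_space P"

definition is_stokes_projection ::
    "'d::finite biot \<Rightarrow> nat \<Rightarrow> (real^'d) set set \<Rightarrow> (real^'d \<Rightarrow> real^'d) \<Rightarrow> (real^'d \<Rightarrow> real) \<Rightarrow>
     (real^'d \<Rightarrow> real^'d) \<Rightarrow> (real^'d \<Rightarrow> real) \<Rightarrow> bool" where
  "is_stokes_projection P k \<T> u \<xi> w \<zeta> \<longleftrightarrow> w \<in> V_h P k \<T> \<and> \<zeta> \<in> W_h P k \<T> \<and>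
     (\<forall>v\<in>V_h P k \<T>. form_a1 P w v - form_b P v \<zeta> = form_a1 P u v - form_b P v \<xi>) \<and>
     (\<forall>\<phi>\<in>W_h P k \<T>. form_b P w \<phi> = form_b P u \<phi>)"

definition is_elliptic_projection ::
    "'d::finite biot \<Rightarrow> nat \<Rightarrow> (real^'d) set set \<Rightarrow> (real^'d \<Rightarrow> real) \<Rightarrow> (real^'d \<Rightarrow> real) \<Rightarrow> bool" where
  "is_elliptic_projection P l \<T> p r \<longleftrightarrow> r \<in> M_h P l \<T> \<and> (\<forall>\<psi>\<in>M_h P l \<T>. form_d P r \<psi> = form_d P p \<psi>)"

text \<open>There are \<open>N + 1\<close> time steps.\<close>

definition time_step :: "'d::finite biot \<Rightarrow> nat \<Rightarrow> real" where
  "time_step P N = T_end P / real (N + 1)"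

definition grid :: "'d::finite biot \<Rightarrow> nat \<Rightarrow> nat \<Rightarrow> real" where
  "grid P N n = real n * time_step P N"

definition backward_euler ::
    "'d::finite biot \<Rightarrow> nat \<Rightarrow> nat \<Rightarrow> (real^'d) set set \<Rightarrow> nat \<Rightarrow> (nat \<Rightarrow> real^'d \<Rightarrow> real^'d) \<Rightarrow>
     (nat \<Rightarrow> real^'d \<Rightarrow> real) \<Rightarrow> (nat \<Rightarrow> real^'d \<Rightarrow> real) \<Rightarrow> bool" where
  "backward_euler P k l \<T> N uh \<xi>h ph \<longleftrightarrow>
     (\<forall>n\<le>N.
        uh (n + 1) \<in> V_h P k \<T> \<and> \<xi>h (n + 1) \<in> W_h P k \<T> \<and> ph (n + 1) \<in> M_h P l \<T> \<and>
        (\<forall>v\<in>V_h P k \<T>.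
           form_a1 P (uh (n + 1)) v - form_b P v (\<xi>h (n + 1)) = load_term P (grid P N (n + 1)) v) \<and>
        (\<forall>\<phi>\<in>W_h P k \<T>.
           form_b P (uh (n + 1)) \<phi> + form_a2 P (\<xi>h (n + 1)) \<phi> - form_c P (ph (n + 1)) \<phi> = 0) \<and>
        (\<forall>\<psi>\<in>M_h P l \<T>.
           form_a3 P (\<lambda>x. (ph (n + 1) x - ph n x) / time_step P N) \<psi>
           - form_c P \<psi> (\<lambda>x. (\<xi>h (n + 1) x - \<xi>h n x) / time_step P N)
           + form_d P (ph (n + 1)) \<psi> = supply_term P (grid P N (n + 1)) \<psi>))"

end

theory Submission
  imports Defs "HOL-Library.Function_Algebras" "HOL-Computational_Algebra.Polynomial"
begin

text \<open>
  The error of the scheme is split into the distance of the solution from discrete comparison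
  functions and the distance of these from the discrete solution. The first part is bounded by the
  approximation properties of the projections. The second part, a triple \<open>(U, X, Q)\<close> of discrete
  errors of displacement, total pressure and pressure, solves the scheme itself, with data that
  consist of projection errors and of the error of the difference quotients; it is bounded by the
  stability of the scheme.

  Comparison functions. On the time grid they are the sums of the projections of the increments of
  the solution, starting from the projected initial values. Such sums satisfy the defining
  equations of the projections (\<open>stokes_projection_add\<close>, \<open>elliptic_projection_add\<close>), so that the
  spatial derivatives of the projection errors drop out of the error equations, and by construction
  the increments of the projection errors are as small as the increments of the solution times a
  power of \<open>h\<close>.

  Stability. The scheme is a backward Euler step for the inner product
  \<open>c\<^sub>0 (Q, Q') + (\<alpha> Q - X, \<alpha> Q' - X') / \<lambda> + a\<^sub>1(U, U')\<close>. Tested with the new error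
  (\<open>step_identity\<close>), a step lets the square of this energy norm grow by at most a constant times the
  size of its data times the new energy norm. Summed up to the time of the largest energy norm, one
  factor cancels, and the energy norm is bounded by the sum of the data, without the exponential
  factor of Gronwall's inequality (\<open>energy_summation\<close>). The discrete inf-sup condition bounds \<open>X\<close> by the strain of \<open>U\<close>
  (\<open>discrete_pressure_control\<close>), and then the coupling term bounds \<open>Q\<close> even if \<open>c\<^sub>0 = 0\<close>
  (\<open>energy_control\<close>).

  The first step. The projected initial values in general violate the discrete constraint equation, so
  the data of the first step contain the projection errors themselves, of order \<open>h^k + h^(l + 1)\<close> without a
  factor \<open>\<tau>\<close>. In the energy estimate this occurs once and is harmless. The gradient of \<open>Q\<close> is
  estimated by testing with increments, where the squared data are divided by \<open>\<tau>\<close>; there the first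
  step has to be avoided. The energy estimate also bounds the time average of the squared gradients,
  hence the gradient is small at some positive grid time, from which the second estimate is started.

  Regularity in time. Pairing a function of time with a fixed \<open>w\<close> in $L^2(\Omega)$ turns its weak time
  derivative into a weak derivative of a scalar function, for which the fundamental theorem of
  calculus holds (\<open>weak_derivative_fundamental_theorem\<close>). So the increments of the solution are Bochner
  integrals of its derivative, and since $H^m(\Omega)$ is complete, these integrals are formed in
  $H^m(\Omega)$. This bounds the increments in $H^m(\Omega)$ (\<open>time_increment_Sobolev\<close>) and the errors of
  the difference quotients (\<open>backward_difference_error\<close>) by integrals of norms of derivatives over
  the time steps. By the Cauchy--Schwarz inequality the sum of the squares of these integrals is of
  order \<open>\<tau>\<close> (\<open>uniform_partition_integrals\<close>), which compensates the division by \<open>\<tau>\<close>.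
\<close>

section \<open>Function spaces as vector spaces\<close>

text \<open>With pointwise scalar multiplication the function spaces become subspaces of a vector space, and
  the general theory of subspaces applies to them.\<close>

instantiation "fun" :: (type, scaleR) scaleR
begin
definition scaleR_fun_def: "c *\<^sub>R f = (\<lambda>x. c *\<^sub>R f x)"
instance ..
end

lemma scaleR_fun_apply [simp]: "(c *\<^sub>R f) x = c *\<^sub>R f x"
  by (simp add: scaleR_fun_def)

instance "fun" :: (type, real_vector) real_vector
  by standard (simp_all add: fun_eq_iff algebra_simps)

section \<open>Semi-inner products on subspaces\<close>

text \<open>$L^2$, the Sobolev spaces, the elastic and the flow energy and the energy of the coupled problem all
  carry an inner product on a subspace of a space of functions. It is only semidefinite, as functions
  are not identified when they agree almost everywhere.\<close>

locale semi_inner =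
  fixes S :: "'v::real_vector set" and B :: "'v \<Rightarrow> 'v \<Rightarrow> real"
  assumes subspace: "subspace S"
    and sym: "\<And>x y. x \<in> S \<Longrightarrow> y \<in> S \<Longrightarrow> B x y = B y x"
    and add: "\<And>x y z. x \<in> S \<Longrightarrow> y \<in> S \<Longrightarrow> z \<in> S \<Longrightarrow> B (x + y) z = B x z + B y z"
    and scale: "\<And>c x y. x \<in> S \<Longrightarrow> y \<in> S \<Longrightarrow> B (c *\<^sub>R x) y = c * B x y"
    and nonneg: "\<And>x. x \<in> S \<Longrightarrow> 0 \<le> B x x"
begin

definition nrm :: "'v \<Rightarrow> real" where "nrm x = sqrt (B x x)"

lemma closed [simp, intro]:
  "0 \<in> S" "x \<in> S \<Longrightarrow> y \<in> S \<Longrightarrow> x + y \<in> S" "x \<in> S \<Longrightarrow> y \<in> S \<Longrightarrow> x - y \<in> S"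
  "x \<in> S \<Longrightarrow> c *\<^sub>R x \<in> S" "x \<in> S \<Longrightarrow> - x \<in> S"
  using subspace by (auto simp: subspace_0 subspace_add subspace_diff subspace_scale subspace_neg)

lemma diff: "x \<in> S \<Longrightarrow> y \<in> S \<Longrightarrow> z \<in> S \<Longrightarrow> B (x - y) z = B x z - B y z"
  using add[of x "(-1) *\<^sub>R y" z] scale[of y z "-1"] by simp

lemma add_right: "x \<in> S \<Longrightarrow> y \<in> S \<Longrightarrow> z \<in> S \<Longrightarrow> B z (x + y) = B z x + B z y"
  using add sym by (metis closed(2))

lemma diff_right: "x \<in> S \<Longrightarrow> y \<in> S \<Longrightarrow> z \<in> S \<Longrightarrow> B z (x - y) = B z x - B z y"
  using diff sym by (metis closed(3))

lemma scale_right: "x \<in> S \<Longrightarrow> y \<in> S \<Longrightarrow> B y (c *\<^sub>R x) = c * B y x"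
  using scale sym by (metis closed(4))

lemmas expand = add diff scale add_right diff_right scale_right

lemma zero [simp]: "x \<in> S \<Longrightarrow> B 0 x = 0" "x \<in> S \<Longrightarrow> B x 0 = 0"
  using scale[of 0 x 0] scale_right[of 0 x 0] by auto

lemma nrm_sq: "x \<in> S \<Longrightarrow> (nrm x)\<^sup>2 = B x x"
  by (simp add: nrm_def nonneg)

lemma nrm_nonneg: "x \<in> S \<Longrightarrow> 0 \<le> nrm x"
  by (simp add: nrm_def nonneg)

lemma Cauchy_Schwarz: assumes x: "x \<in> S" and y: "y \<in> S" shows "\<bar>B x y\<bar> \<le> nrm x * nrm y"
proof -
  \<comment> \<open>the discriminant of the nonnegative quadratic polynomial \<open>t \<mapsto> B (x - t y) (x - t y)\<close>\<close>
  have quad: "0 \<le> B x x - 2 * t * B x y + t\<^sup>2 * B y y" for t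
    using nonneg[of "x - t *\<^sub>R y"] x y sym[of x y]
    by (simp add: expand algebra_simps power2_eq_square)
  have "(B x y)\<^sup>2 \<le> B x x * B y y"
  proof (cases "B y y = 0")
    case True
    have "B x y = 0"
    proof (rule ccontr)
      assume "B x y \<noteq> 0"
      then show False
        using quad[of "(B x x + 1) / (2 * B x y)"] True by (simp add: field_simps)
    qed
    then show ?thesis using True by simp
  next
    case False
    then have "B y y > 0" using nonneg[OF y] by simp
    then show ?thesis using quad[of "B x y / B y y"]
      by (simp add: field_simps power2_eq_square)
  qed
  then have "sqrt ((B x y)\<^sup>2) \<le> sqrt (B x x * B y y)" by (rule real_sqrt_le_mono)
  then show ?thesis by (simp add: nrm_def real_sqrt_mult)
qed

lemma triangle: assumes "x \<in> S" "y \<in> S" shows "nrm (x + y) \<le> nrm x + nrm y"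
proof (rule power2_le_imp_le)
  show "(nrm (x + y))\<^sup>2 \<le> (nrm x + nrm y)\<^sup>2"
    using Cauchy_Schwarz[OF assms] assms sym[of x y] 
    by (simp add: nrm_sq power2_sum expand)
qed (use assms in \<open>simp add: nrm_nonneg\<close>)

lemma nrm_scale: "x \<in> S \<Longrightarrow> nrm (c *\<^sub>R x) = \<bar>c\<bar> * nrm x"
  by (simp add: nrm_def expand real_sqrt_mult flip: power2_eq_square mult.assoc)

lemma triangle_diff: assumes "x \<in> S" "y \<in> S" shows "nrm (x - y) \<le> nrm x + nrm y"
  using triangle[of x "(-1) *\<^sub>R y"] nrm_scale[of y "-1"] assms by simp

lemma nrm_zero [simp]: "nrm 0 = 0"
  by (simp add: nrm_def)

lemma nrm_minus: "x \<in> S \<Longrightarrow> nrm (- x) = nrm x"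
  using nrm_scale[of x "-1"] by simp

lemma nrm_diff_commute: "x \<in> S \<Longrightarrow> y \<in> S \<Longrightarrow> nrm (x - y) = nrm (y - x)"
  using nrm_minus[of "x - y"] by simp

lemma nrm_sum: "finite I \<Longrightarrow> (\<And>i. i \<in> I \<Longrightarrow> f i \<in> S) \<Longrightarrow> nrm (sum f I) \<le> (\<Sum>i\<in>I. nrm (f i))"
proof (induction I rule: finite_induct)
  case (insert i I)
  have "sum f I \<in> S" using insert.prems by (intro subspace_sum subspace) auto
  then show ?case using insert triangle[of "f i" "sum f I"] by force
qed simp

end

text \<open>The vectors are functions here: the integral of a simple function with values in such a space can
  be formed pointwise.\<close>

locale function_semi_inner = semi_inner S B
  for S :: "('x \<Rightarrow> 'y::real_vector) set" and B

section \<open>The space of square-integrable functions\<close>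

lemma L2_measurable [measurable_dest]: "f \<in> L2 M \<Longrightarrow> f \<in> borel_measurable M"
  by (simp add: L2_def)

lemma L2_norm_sq_integrable: "f \<in> L2 M \<Longrightarrow> integrable M (\<lambda>x. (norm (f x))\<^sup>2)"
  by (simp add: L2_def)

lemma L2_inner_integrable: assumes "f \<in> L2 M" "g \<in> L2 M" shows "integrable M (\<lambda>x. f x \<bullet> g x)"
proof (rule Bochner_Integration.integrable_bound)
  show "integrable M (\<lambda>x. (norm (f x))\<^sup>2 + (norm (g x))\<^sup>2)" 
    using assms by (intro Bochner_Integration.integrable_add L2_norm_sq_integrable)
  show "(\<lambda>x. f x \<bullet> g x) \<in> borel_measurable M" using assms by measurable
  have "\<bar>f x \<bullet> g x\<bar> \<le> (norm (f x))\<^sup>2 + (norm (g x))\<^sup>2" for x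
    using Cauchy_Schwarz_ineq2[of "f x" "g x"] sum_squares_bound[of "norm (f x)" "norm (g x)"]
      mult_nonneg_nonneg[OF norm_ge_zero norm_ge_zero, of "f x" "g x"] by linarith
  then show "AE x in M. norm (f x \<bullet> g x) \<le> norm ((norm (f x))\<^sup>2 + (norm (g x))\<^sup>2)" by auto
qed

lemma subspace_L2: "subspace (L2 M)"
proof (rule subspaceI)
  fix f g :: "'a \<Rightarrow> 'b::euclidean_space" assume f: "f \<in> L2 M" and g: "g \<in> L2 M"
  have "integrable M (\<lambda>x. (norm (f x + g x))\<^sup>2)"
    using L2_inner_integrable[OF f g] L2_inner_integrable[OF f f] L2_inner_integrable[OF g g]
    by (simp add: power2_norm_eq_inner inner_add_left inner_add_right inner_commute)
  moreover have "(\<lambda>x. f x + g x) \<in> borel_measurable M" using f g by measurable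
  ultimately show "f + g \<in> L2 M" by (simp add: L2_def plus_fun_def)
next
  fix f :: "'a \<Rightarrow> 'b::euclidean_space" and c :: real assume f: "f \<in> L2 M"
  have "(\<lambda>x. c *\<^sub>R f x) \<in> borel_measurable M" using f by measurable
  moreover have "integrable M (\<lambda>x. (norm (c *\<^sub>R f x))\<^sup>2)" using f by (simp add: L2_def power_mult_distrib)
  ultimately show "c *\<^sub>R f \<in> L2 M" unfolding L2_def scaleR_fun_def by blast
qed (simp add: L2_def zero_fun_def)

lemma L2_norm_inner: "L2_norm M f = sqrt (L2_inner M f f)"
  by (simp add: L2_norm_def L2_inner_def power2_norm_eq_inner)

lemma L2_semi_inner: "semi_inner (L2 M) (L2_inner M)"
proof
  fix f g h :: "'a \<Rightarrow> 'b::euclidean_space"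
  assume "f \<in> L2 M" "g \<in> L2 M" "h \<in> L2 M"
  then show "L2_inner M (f + g) h = L2_inner M f h + L2_inner M g h"
    by (simp add: L2_inner_def inner_add_left L2_inner_integrable)
qed (auto simp: subspace_L2 L2_inner_def inner_commute)

interpretation L2: function_semi_inner "L2 M" "L2_inner M"
  rewrites "semi_inner.nrm (L2_inner M) = L2_norm M"
  by (simp_all add: function_semi_inner_def L2_semi_inner semi_inner.nrm_def[OF L2_semi_inner] fun_eq_iff L2_norm_inner)

lemma L2_norm_nonneg [simp]: "0 \<le> L2_norm M f"
  by (simp add: L2_norm_def)

lemma L2_norm_cong_AE: 
  assumes "AE x in M. f x = g x" "f \<in> borel_measurable M" "g \<in> borel_measurable M"
  shows "L2_norm M f = L2_norm M g"
  unfolding L2_norm_def using assms by (intro arg_cong[where f=sqrt] integral_cong_AE) auto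

lemma L2_inner_cong_AE: 
  assumes "AE x in M. f x = g x" "f \<in> borel_measurable M" "g \<in> borel_measurable M"
    "h \<in> borel_measurable M"
  shows "L2_inner M f h = L2_inner M g h" "L2_inner M h f = L2_inner M h g"
  unfolding L2_inner_def using assms by (intro integral_cong_AE; auto)+

lemma L2_norm_eq_0_AE: assumes "f \<in> L2 M" "L2_norm M f = 0" shows "AE x in M. f x = 0"
  using assms integral_nonneg_eq_0_iff_AE[of M "\<lambda>x. (norm (f x))\<^sup>2"] by (simp add: L2_norm_def L2_def)

lemma L2_cong_AE: 
  assumes "AE x in M. f x = g x" "f \<in> L2 M" "g \<in> borel_measurable M"
  shows "g \<in> L2 M"
proof -
  have [measurable]: "f \<in> borel_measurable M" using assms by (auto simp: L2_def)
  have "integrable M (\<lambda>x. (norm (g x))\<^sup>2)"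
    using assms by (subst integrable_cong_AE[where g="\<lambda>x. (norm (f x))\<^sup>2"]) (auto simp: L2_def)
  then show ?thesis using assms by (simp add: L2_def)
qed

lemma L2_bounded: 
  fixes f :: "'a \<Rightarrow> 'b::euclidean_space"
  assumes "finite_measure M" "f \<in> borel_measurable M" "\<And>x. x \<in> space M \<Longrightarrow> norm (f x) \<le> C"
  shows "f \<in> L2 M"
proof -
  interpret finite_measure M by fact
  have "integrable M (\<lambda>x. (norm (f x))\<^sup>2)"
    using assms by (intro integrable_const_bound[where B="C\<^sup>2"]) (auto intro!: power_mono)
  then show ?thesis using assms by (simp add: L2_def)
qed

lemma L2_integrable_scaleR: 
  fixes f :: "'a \<Rightarrow> 'b::euclidean_space"
  assumes "f \<in> L2 M" "\<phi> \<in> L2 M" shows "integrable M (\<lambda>x. \<phi> x *\<^sub>R f x)"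
proof (rule Bochner_Integration.integrable_bound)
  show "integrable M (\<lambda>x. (norm (f x))\<^sup>2 + (norm (\<phi> x))\<^sup>2)" 
    using assms by (intro Bochner_Integration.integrable_add L2_norm_sq_integrable)
  show "(\<lambda>x. \<phi> x *\<^sub>R f x) \<in> borel_measurable M" using assms by measurable
  have "norm (\<phi> x *\<^sub>R f x) \<le> (norm (f x))\<^sup>2 + (norm (\<phi> x))\<^sup>2" for x
  proof -
    have "2 * (norm (\<phi> x) * norm (f x)) \<le> (norm (f x))\<^sup>2 + (norm (\<phi> x))\<^sup>2"
      using sum_squares_bound[of "norm (f x)" "norm (\<phi> x)"] by (simp add: ac_simps)
    moreover have "0 \<le> norm (\<phi> x) * norm (f x)" by simp
    ultimately show ?thesis unfolding norm_scaleR real_norm_def by linarith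
  qed
  then show "AE x in M. norm (\<phi> x *\<^sub>R f x) \<le> norm ((norm (f x))\<^sup>2 + (norm (\<phi> x))\<^sup>2)" by auto
qed

lemma L2_integrable: 
  fixes f :: "'a \<Rightarrow> 'b::euclidean_space"
  assumes "finite_measure M" "f \<in> L2 M" shows "integrable M f"
  using L2_integrable_scaleR[OF assms(2) L2_bounded[OF assms(1), of "\<lambda>_. 1::real" 1]] by simp

text \<open>$L^2$ is contained in $L^1$ on a finite measure space; in time, this Cauchy--Schwarz inequality gives
  the factor \<open>\<tau>\<close> in the sum of squared increments.\<close>

lemma L2_integral_norm_le: 
  assumes "finite_measure M" "f \<in> L2 M" 
  shows "(LINT x|M. norm (f x)) \<le> sqrt (measure M (space M)) * L2_norm M f"
proof -
  have 1: "(\<lambda>_. 1::real) \<in> L2 M" by (rule L2_bounded[OF assms(1)]) auto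
  have n: "(\<lambda>x. norm (f x)) \<in> L2 M" using assms by (auto simp: L2_def)
  have "\<bar>L2_inner M (\<lambda>x. 1) (\<lambda>x. norm (f x))\<bar> \<le> L2_norm M (\<lambda>x. 1::real) * L2_norm M (\<lambda>x. norm (f x))"
    by (rule L2.Cauchy_Schwarz[OF 1 n])
  then show ?thesis by (simp add: L2_inner_def L2_norm_def)
qed

text \<open>Completeness of $L^2$ (Riesz--Fischer): a fast subsequence of a Cauchy sequence converges
  almost everywhere, since the sum of its increments is integrable, and Fatou's lemma turns the
  pointwise limit into the limit in norm.\<close>

lemma L2_complete:
  fixes f :: "nat \<Rightarrow> 'a \<Rightarrow> 'b::euclidean_space"
  assumes fin: "finite_measure M" and f: "\<And>n. f n \<in> L2 M"
    and cauchy: "\<And>e. e > 0 \<Longrightarrow> \<exists>N. \<forall>m\<ge>N. \<forall>n\<ge>N. L2_norm M (f m - f n) < e"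
  shows "\<exists>g\<in>L2 M. (\<lambda>n. L2_norm M (f n - g)) \<longlonglongrightarrow> 0"
proof -
  have [measurable]: "f n \<in> borel_measurable M" for n using f by (simp add: L2_def)
  have "\<exists>r::nat\<Rightarrow>nat. \<forall>n. (\<forall>m\<ge>r n. \<forall>k\<ge>r n. L2_norm M (f m - f k) < (1/2)^n) \<and> r n < r (Suc n)"
  proof (rule dependent_nat_choice)
    show "\<exists>x. \<forall>m\<ge>x. \<forall>k\<ge>x. L2_norm M (f m - f k) < (1/2)^0" using cauchy[of 1] by simp
  next
    fix x n
    obtain N where "\<forall>m\<ge>N. \<forall>k\<ge>N. L2_norm M (f m - f k) < (1/2)^Suc n"
      using cauchy[of "(1/2)^Suc n"] by auto
    then show "\<exists>y. (\<forall>m\<ge>y. \<forall>k\<ge>y. L2_norm M (f m - f k) < (1/2)^Suc n) \<and> x < y"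
      by (intro exI[of _ "max N (Suc x)"]) auto
  qed
  then obtain r where r: "\<And>n m k. m \<ge> r n \<Longrightarrow> k \<ge> r n \<Longrightarrow> L2_norm M (f m - f k) < (1/2)^n"
    and r_mono: "\<And>n. r n < r (Suc n)" by blast
  have "strict_mono r" using r_mono by (simp add: strict_mono_Suc_iff)
  define c where "c = sqrt (measure M (space M))"
  have c: "c \<ge> 0" by (simp add: c_def)
  define d where "d n x = f (r (Suc n)) x - f (r n) x" for n x
  have d: "d n \<in> L2 M" for n using L2.closed(3)[OF f f, of "r (Suc n)" "r n"] 
    by (simp add: d_def [abs_def] fun_diff_def)
  have [measurable]: "d n \<in> borel_measurable M" for n using d by (simp add: L2_def)
  have dint: "(LINT x|M. norm (d n x)) \<le> c * (1/2)^n" for n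
  proof -
    have "L2_norm M (d n) \<le> (1/2)^n"
      using r[of n "r (Suc n)" "r n"] r_mono[of n] by (simp add: d_def [abs_def] fun_diff_def)
    then have "c * L2_norm M (d n) \<le> c * (1/2)^n" using c by (rule mult_left_mono)
    then show ?thesis using L2_integral_norm_le[OF fin d, of n] unfolding c_def by linarith
  qed
  have dnn: "(\<integral>\<^sup>+x. ennreal (norm (d n x)) \<partial>M) \<le> ennreal (c * (1/2)^n)" for n
    using dint[of n] L2_integrable[OF fin d, of n]
    by (subst nn_integral_eq_integral) (auto intro: ennreal_leI)
  have "(\<integral>\<^sup>+x. (\<Sum>n. ennreal (norm (d n x))) \<partial>M) = (\<Sum>n. \<integral>\<^sup>+x. ennreal (norm (d n x)) \<partial>M)"
    by (rule nn_integral_suminf) auto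
  also have "\<dots> \<le> (\<Sum>n. ennreal (c * (1/2)^n))" by (intro suminf_le dnn) auto
  also have "\<dots> < \<infinity>"
    using c by (subst suminf_ennreal2) (auto intro!: summable_mult summable_geometric)
  finally have "(\<integral>\<^sup>+x. (\<Sum>n. ennreal (norm (d n x))) \<partial>M) \<noteq> \<infinity>" by simp
  then have "AE x in M. (\<Sum>n. ennreal (norm (d n x))) \<noteq> \<infinity>"
    by (intro nn_integral_noteq_infinite) auto
  then have conv: "AE x in M. convergent (\<lambda>n. f (r n) x)"
  proof eventually_elim
    case (elim x)
    have "summable (\<lambda>n. norm (d n x))" using elim by (intro summable_suminf_not_top) auto
    then have "summable (\<lambda>n. d n x)" by (rule summable_norm_cancel)
    then have "convergent (\<lambda>n. \<Sum>i<n. d i x)" by (simp add: summable_iff_convergent)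
    then have "convergent (\<lambda>n. f (r n) x - f (r 0) x)" 
      by (simp add: d_def sum_lessThan_telescope[of "\<lambda>n. f (r n) x"])
    then show ?case using convergent_diff_const_right_iff by blast
  qed
  define g where "g x = lim (\<lambda>n. f (r n) x)" for x
  have [measurable]: "g \<in> borel_measurable M" unfolding g_def by measurable
  have lim: "AE x in M. (\<lambda>n. f (r n) x) \<longlonglongrightarrow> g x"
    using conv unfolding g_def by eventually_elim (simp add: convergent_LIMSEQ_iff)
  have fatou: "(\<integral>\<^sup>+x. ennreal ((norm (f m x - g x))\<^sup>2) \<partial>M) \<le> ennreal (((1/2)^n)\<^sup>2)" if "m \<ge> r n" for m n
  proof -
    have "(\<integral>\<^sup>+x. ennreal ((norm (f m x - g x))\<^sup>2) \<partial>M)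
       = (\<integral>\<^sup>+x. liminf (\<lambda>j. ennreal ((norm (f m x - f (r j) x))\<^sup>2)) \<partial>M)"
    proof (rule nn_integral_cong_AE, use lim in eventually_elim)
      case (elim x)
      then have "(\<lambda>j. ennreal ((norm (f m x - f (r j) x))\<^sup>2)) \<longlonglongrightarrow> ennreal ((norm (f m x - g x))\<^sup>2)"
        by (intro tendsto_intros)
      then show ?case by (rule lim_imp_Liminf[OF sequentially_bot, symmetric])
    qed
    also have "\<dots> \<le> liminf (\<lambda>j. \<integral>\<^sup>+x. ennreal ((norm (f m x - f (r j) x))\<^sup>2) \<partial>M)"
      by (rule nn_integral_liminf) auto
    also have "\<dots> \<le> ennreal (((1/2)^n)\<^sup>2)"
    proof -
      have le: "(\<integral>\<^sup>+x. ennreal ((norm (f m x - f (r j) x))\<^sup>2) \<partial>M) \<le> ennreal (((1/2)^n)\<^sup>2)" if "j \<ge> n" for j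
      proof -
        have "r j \<ge> r n" using that \<open>strict_mono r\<close> by (simp add: strict_mono_less_eq)
        then have *: "L2_norm M (f m - f (r j)) < (1/2)^n" using r \<open>m \<ge> r n\<close> by blast
        have "f m - f (r j) \<in> L2 M" using f by auto
        then have "(\<integral>\<^sup>+x. ennreal ((norm (f m x - f (r j) x))\<^sup>2) \<partial>M) 
            = ennreal ((L2_norm M (f m - f (r j)))\<^sup>2)"
          by (subst nn_integral_eq_integral) (auto simp: L2_def L2_norm_def)
        then show ?thesis using * by (auto intro!: ennreal_leI power_mono)
      qed
      have "eventually (\<lambda>j. (\<integral>\<^sup>+x. ennreal ((norm (f m x - f (r j) x))\<^sup>2) \<partial>M) \<le> ennreal (((1/2)^n)\<^sup>2)) sequentially"
        using le eventually_sequentially by blast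
      then have "liminf (\<lambda>j. \<integral>\<^sup>+x. ennreal ((norm (f m x - f (r j) x))\<^sup>2) \<partial>M) \<le> liminf (\<lambda>j. ennreal (((1/2)^n)\<^sup>2))"
        by (rule Liminf_mono)
      then show ?thesis by (simp add: Liminf_const)
    qed
    finally show ?thesis .
  qed
  have diff: "f m - g \<in> L2 M" if "m \<ge> r n" for m n
  proof -
    have "f m - g \<in> borel_measurable M" unfolding fun_diff_def by measurable
    moreover have "integrable M (\<lambda>x. (norm (f m x - g x))\<^sup>2)"
      using le_less_trans[OF fatou[OF that]] by (intro integrableI_bounded) auto
    ultimately show ?thesis by (simp add: L2_def)
  qed
  have "f (r 0) - (f (r 0) - g) \<in> L2 M" using diff[of 0 "r 0"] f by blast
  then have g: "g \<in> L2 M" by (simp add: fun_diff_def)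
  have bnd: "L2_norm M (f m - g) \<le> (1/2)^n" if "m \<ge> r n" for m n
  proof -
    have "ennreal ((L2_norm M (f m - g))\<^sup>2) \<le> ennreal (((1/2)^n)\<^sup>2)"
      using fatou[OF that] diff[OF that]
      by (subst (asm) nn_integral_eq_integral) (auto simp: L2_def L2_norm_def)
    then show ?thesis by (simp add: power2_le_iff_abs_le)
  qed
  have "(\<lambda>n. L2_norm M (f n - g)) \<longlonglongrightarrow> 0"
  proof (rule LIMSEQ_I)
    fix e :: real assume "e > 0"
    then obtain n where "(1/2)^n < e" using real_arch_pow_inv[of e "1/2"] by auto
    then show "\<exists>no. \<forall>n\<ge>no. norm (L2_norm M (f n - g) - 0) < e"
      using bnd[of n] by (intro exI[of _ "r n"]) (auto intro: le_less_trans)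
  qed
  with g show ?thesis by blast
qed

section \<open>Smooth cut-off functions\<close>

text \<open>Smoothness of functions of one real variable, in a form that is proved by induction on the order for
  sums, products, reciprocals and affine substitutions.\<close>

primrec times_differentiable :: "nat \<Rightarrow> (real \<Rightarrow> real) \<Rightarrow> bool" where
  "times_differentiable 0 f \<longleftrightarrow> True"
| "times_differentiable (Suc n) f \<longleftrightarrow> 
    (\<exists>f'. (\<forall>x. (f has_real_derivative f' x) (at x)) \<and> times_differentiable n f')"

lemma times_differentiable_Suc_D: "times_differentiable (Suc n) f \<Longrightarrow> times_differentiable n f"
proof (induction n arbitrary: f)
  case (Suc n)
  then show ?case by (metis times_differentiable.simps(2))
qed simp

lemma times_differentiable_const: "times_differentiable n (\<lambda>x. c)"
proof (induction n arbitrary: c)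
  case (Suc n)
  show ?case using Suc[of 0] by (auto intro!: exI[of _ "\<lambda>_. 0"])
qed simp

lemma times_differentiable_add:
  "times_differentiable n f \<Longrightarrow> times_differentiable n g \<Longrightarrow> times_differentiable n (\<lambda>x. f x + g x)"
proof (induction n arbitrary: f g)
  case (Suc n)
  then obtain f' g' where *: "\<forall>x. (f has_real_derivative f' x) (at x)" "times_differentiable n f'"
    "\<forall>x. (g has_real_derivative g' x) (at x)" "times_differentiable n g'" by auto
  have "\<forall>x. ((\<lambda>x. f x + g x) has_real_derivative (f' x + g' x)) (at x)"
    using * by (auto intro!: derivative_intros)
  then show ?case using Suc.IH[OF *(2,4)] by auto
qed simp

lemma times_differentiable_mult:
  "times_differentiable n f \<Longrightarrow> times_differentiable n g \<Longrightarrow> times_differentiable n (\<lambda>x. f x * g x)"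
proof (induction n arbitrary: f g)
  case (Suc n)
  then obtain f' g' where *: "\<forall>x. (f has_real_derivative f' x) (at x)" "times_differentiable n f'"
    "\<forall>x. (g has_real_derivative g' x) (at x)" "times_differentiable n g'" by auto
  have "\<forall>x. ((\<lambda>x. f x * g x) has_real_derivative (f x * g' x + f' x * g x)) (at x)"
    using * by (auto intro!: derivative_eq_intros)
  moreover have "times_differentiable n (\<lambda>x. f x * g' x + f' x * g x)"
    using Suc * times_differentiable_Suc_D by (intro times_differentiable_add Suc.IH) blast+
  ultimately show ?case by auto
qed simp

lemma times_differentiable_inverse:
  "times_differentiable n f \<Longrightarrow> (\<And>x. f x \<noteq> 0) \<Longrightarrow> times_differentiable n (\<lambda>x. inverse (f x))"
proof (induction n arbitrary: f)
  case (Suc n)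
  then obtain f' where *: "\<forall>x. (f has_real_derivative f' x) (at x)" "times_differentiable n f'"  by auto
  have "\<forall>x. ((\<lambda>x. inverse (f x)) has_real_derivative (-1) * (f' x * (inverse (f x) * inverse (f x)))) (at x)"
    using * Suc.prems(2) by (auto intro!: derivative_eq_intros)
  moreover have "times_differentiable n (\<lambda>x. (-1) * (f' x * (inverse (f x) * inverse (f x))))"
    using Suc.IH[OF times_differentiable_Suc_D] Suc.prems *(2)
    by (intro times_differentiable_mult times_differentiable_const) auto
  ultimately show ?case by auto
qed simp

lemma times_differentiable_affine:
  "times_differentiable n f \<Longrightarrow> times_differentiable n (\<lambda>x. f (c * x + d))"
proof (induction n arbitrary: f)
  case (Suc n)
  then obtain f' where *: "\<And>x. (f has_real_derivative f' x) (at x)" "times_differentiable n f'"  by auto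
  have "((\<lambda>x. c * x + d) has_real_derivative c) (at x)" for x
    by (auto intro!: derivative_eq_intros)
  then have "\<forall>x. ((\<lambda>x. f (c * x + d)) has_real_derivative c * f' (c * x + d)) (at x)"
    using DERIV_chain2[OF *(1)] by (simp only: mult.commute[of c "f' _"]) blast
  then show ?case using times_differentiable_mult[OF times_differentiable_const Suc.IH[OF *(2)]] by auto
qed simp

definition smooth1 :: "(real \<Rightarrow> real) \<Rightarrow> bool" where "smooth1 f \<longleftrightarrow> (\<forall>n. times_differentiable n f)"

lemma smooth1_has_derivative:
  assumes "smooth1 f" shows "(f has_real_derivative deriv f x) (at x)" "smooth1 (deriv f)"
proof -
  have *: "\<exists>f'. (\<forall>x. (f has_real_derivative f' x) (at x)) \<and> times_differentiable n f'" for n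
    using assms times_differentiable.simps(2) unfolding smooth1_def by blast
  have d: "f' = deriv f" if "\<forall>x. (f has_real_derivative f' x) (at x)" for f'
    using that by (auto simp: fun_eq_iff intro!: DERIV_imp_deriv[symmetric])
  show "(f has_real_derivative deriv f x) (at x)" using *[of 0] d by auto
  show "smooth1 (deriv f)" unfolding smooth1_def using * d by metis
qed

text \<open>The functions $p(1/x)\,e^{-1/x}$, extended by zero to $x \le 0$, form a class closed under
  differentiation; this makes $e^{-1/x}$ smooth at the origin.\<close>

definition flat :: "real poly \<Rightarrow> real \<Rightarrow> real" where
  "flat p x = (if x > 0 then poly p (1/x) * exp (- (1/x)) else 0)"

lemma poly_exp_tendsto_0: "((\<lambda>y. poly p y * exp (-y)) \<longlongrightarrow> (0::real)) at_top"
proof -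
  have "((\<lambda>y. coeff p i * (y ^ i / exp y)) \<longlongrightarrow> 0) at_top" for i
    using tendsto_mult_right_zero[OF tendsto_power_div_exp_0[of i]] by simp
  then have "((\<lambda>y. \<Sum>i\<le>degree p. coeff p i * (y ^ i / exp y)) \<longlongrightarrow> 0) at_top"
    by (intro tendsto_null_sum) auto
  moreover have "(\<lambda>y. \<Sum>i\<le>degree p. coeff p i * (y ^ i / exp y)) = (\<lambda>y. poly p y * exp (-y))"
    by (simp add: fun_eq_iff poly_altdef sum_distrib_right exp_minus divide_inverse mult.assoc)
  ultimately show ?thesis by simp
qed

lemma flat_derivative: "(flat p has_real_derivative flat ([:0,0,1:] * (p - pderiv p)) x) (at x)"
proof (cases x "0::real" rule: linorder_cases)
  case less
  have "((\<lambda>_. 0) has_real_derivative 0) (at x)" by simp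
  then have "(flat p has_real_derivative 0) (at x)"
    by (rule has_field_derivative_transform_within_open[where S="{..<0}"]) (use less in \<open>auto simp: flat_def\<close>)
  then show ?thesis using less by (simp add: flat_def)
next
  case greater
  have "((\<lambda>x. poly p (1/x) * exp (- (1/x))) has_real_derivative 
      poly p (1/x) * (exp (- (1/x)) * (1/x\<^sup>2)) + poly (pderiv p) (1/x) * (- 1/x\<^sup>2) * exp (- (1/x))) (at x)"
    using greater
    by (auto intro!: derivative_eq_intros DERIV_chain2[OF poly_DERIV] simp: power2_eq_square)
  then have "(flat p has_real_derivative poly p (1/x) * (exp (- (1/x)) * (1/x\<^sup>2)) 
      + poly (pderiv p) (1/x) * (- 1/x\<^sup>2) * exp (- (1/x))) (at x)"
    by (rule has_field_derivative_transform_within_open[where S="{0<..}"]) (use greater in \<open>auto simp: flat_def\<close>)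
  then show ?thesis using greater 
    by (simp add: flat_def algebra_simps power2_eq_square)
next
  case equal
  have "((\<lambda>h. poly ([:0,1:] * p) (inverse h) * exp (- inverse h)) \<longlongrightarrow> (0::real)) (at_right 0)"
    using filterlim_compose[OF poly_exp_tendsto_0 filterlim_inverse_at_top_right] .
  then have "((\<lambda>h. (flat p h - flat p 0) / (h - 0)) \<longlongrightarrow> 0) (at_right 0)"
  proof (rule tendsto_cong[THEN iffD1, rotated])
    show "\<forall>\<^sub>F h in at_right 0. poly ([:0,1:] * p) (inverse h) * exp (- inverse h) = (flat p h - flat p 0) / (h - 0)"
      by (auto simp: flat_def eventually_at_right_less inverse_eq_divide intro!: eventually_at_rightI[of 0 1])
  qed
  moreover have "((\<lambda>h. (flat p h - flat p 0) / (h - 0)) \<longlongrightarrow> 0) (at_left 0)"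
    by (rule tendsto_eventually) (auto simp: flat_def intro!: eventually_at_leftI[of "-1"])
  ultimately have "((\<lambda>h. (flat p h - flat p 0) / (h - 0)) \<longlongrightarrow> 0) (at 0)"
    by (rule filterlim_split_at_real[rotated])
  then show ?thesis using equal by (simp add: has_field_derivative_iff flat_def)
qed

lemma times_differentiable_flat: "times_differentiable n (flat p)"
proof (induction n arbitrary: p)
  case (Suc n)
  then show ?case using flat_derivative[of p] by auto
qed simp

text \<open>A smooth step from \<open>0\<close> to \<open>1\<close> on the unit interval.\<close>

definition cutoff :: "real \<Rightarrow> real" where
  "cutoff x = flat 1 x * inverse (flat 1 x + flat 1 (1 - x))"

lemma flat_one_denominator: "flat 1 x + flat 1 (1 - x) > 0"
  by (auto simp: flat_def add_pos_nonneg add_nonneg_pos)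

lemma smooth1_cutoff_affine: "smooth1 (\<lambda>x. cutoff (c * x + d))"
proof -
  have "times_differentiable n (\<lambda>x. flat 1 ((-1) * x + 1))" for n
    by (rule times_differentiable_affine[OF times_differentiable_flat])
  then have "times_differentiable n cutoff" for n
    unfolding cutoff_def
    by (intro times_differentiable_mult times_differentiable_inverse times_differentiable_add
        times_differentiable_flat) (use flat_one_denominator less_imp_neq in \<open>fastforce simp: add.commute\<close>)+
  then show ?thesis unfolding smooth1_def using times_differentiable_affine by blast
qed

lemma smooth1_cutoff: "smooth1 cutoff"
  using smooth1_cutoff_affine[of 1 0] by simp

lemma smooth1_mult: "smooth1 f \<Longrightarrow> smooth1 g \<Longrightarrow> smooth1 (\<lambda>x. f x * g x)"
  by (simp add: smooth1_def times_differentiable_mult)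

lemma smooth1_diff: assumes "smooth1 f" "smooth1 g" shows "smooth1 (\<lambda>x. f x - g x)"
proof -
  have "times_differentiable n (\<lambda>x. f x + (-1) * g x)" for n
    using assms by (intro times_differentiable_add times_differentiable_mult times_differentiable_const)
      (auto simp: smooth1_def)
  then show ?thesis by (simp add: smooth1_def)
qed

lemma cutoff_eq_0: "x \<le> 0 \<Longrightarrow> cutoff x = 0"
  by (simp add: cutoff_def flat_def)

lemma cutoff_eq_1: "x \<ge> 1 \<Longrightarrow> cutoff x = 1"
  by (simp add: cutoff_def flat_def)

lemma cutoff_bounds: "0 \<le> cutoff x" "cutoff x \<le> 1"
proof -
  have "0 \<le> flat 1 y" for y by (simp add: flat_def)
  then show "0 \<le> cutoff x" "cutoff x \<le> 1"
    using flat_one_denominator[of x] by (auto simp: cutoff_def field_simps)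
qed

lemma cutoff_step_tendsto: "(\<lambda>n. cutoff (real n * (x - a))) \<longlonglongrightarrow> indicator {a<..} x"
proof (cases "x > a")
  case True
  have "eventually (\<lambda>n. real n > 1 / (x - a)) sequentially"
    using filterlim_real_sequentially unfolding filterlim_at_top_dense by blast
  then have "eventually (\<lambda>n. cutoff (real n * (x - a)) = 1) sequentially"
    by eventually_elim (use True in \<open>auto intro!: cutoff_eq_1 simp: field_simps\<close>)
  then show ?thesis using True by (simp add: tendsto_eventually)
next
  case False
  then have "cutoff (real n * (x - a)) = 0" for n
    by (intro cutoff_eq_0) (simp add: mult_nonneg_nonpos)
  then show ?thesis using False by simp
qed

lemma deriv_cutoff_eq_0: assumes "x < 0 \<or> x > 1" shows "deriv cutoff x = 0"
proof -
  have "(cutoff has_real_derivative 0) (at x)"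
    using assms
  proof
    assume "x < 0"
    then show ?thesis
      by (intro has_field_derivative_transform_within_open[where S="{..<0}" and f="\<lambda>_. 0" and g=cutoff]) 
        (auto simp: cutoff_eq_0)
  next
    assume "x > 1"
    then show ?thesis
      by (intro has_field_derivative_transform_within_open[where S="{1<..}" and f="\<lambda>_. 1" and g=cutoff]) 
        (auto simp: cutoff_eq_1)
  qed
  then show ?thesis by (rule DERIV_imp_deriv)
qed

lemma deriv_cutoff_bounded: "\<exists>C\<ge>0. \<forall>x. \<bar>deriv cutoff x\<bar> \<le> C"
proof -
  have "continuous_on {0..1} (deriv cutoff)"
    using smooth1_has_derivative(1)[OF smooth1_has_derivative(2)[OF smooth1_cutoff]]
    by (meson DERIV_isCont continuous_at_imp_continuous_on)
  then have "bounded (deriv cutoff ` {0..1})"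
    by (intro compact_imp_bounded compact_continuous_image) auto
  then obtain C where C: "\<And>x. x \<in> {0..1} \<Longrightarrow> \<bar>deriv cutoff x\<bar> \<le> C"
    by (metis bounded_iff image_eqI real_norm_def)
  have "\<bar>deriv cutoff x\<bar> \<le> C" for x
  proof (cases "x \<in> {0..1}")
    case False
    then have "deriv cutoff x = 0" by (intro deriv_cutoff_eq_0) auto
    then show ?thesis using C[of 0] by simp
  qed (use C in auto)
  moreover have "C \<ge> 0" using C[of 0] by (auto intro: order_trans[OF abs_ge_zero])
  ultimately show ?thesis by blast
qed

text \<open>Products of smooth functions of one coordinate each are closed under partial derivatives.\<close>

lemma smooth_coordinate_product:
  fixes g :: "'a::euclidean_space \<Rightarrow> real \<Rightarrow> real"
  assumes "\<And>i. i \<in> Basis \<Longrightarrow> smooth1 (g i)"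
  shows "smooth (\<lambda>x::'a. \<Prod>i\<in>Basis. g i (x \<bullet> i))"
proof -
  have der: "((\<lambda>x::'a. \<Prod>i\<in>Basis. g i (x \<bullet> i)) has_derivative
      (\<lambda>y. \<Sum>i\<in>Basis. (deriv (g i) (x \<bullet> i) * (y \<bullet> i)) * (\<Prod>j\<in>Basis - {i}. g j (x \<bullet> j)))) (at x)"
    if g: "\<And>i. i \<in> Basis \<Longrightarrow> smooth1 (g i)" for g and x :: 'a
  proof (rule has_derivative_prod)
    fix i :: 'a assume "i \<in> Basis"
    then have "(g i has_derivative (*) (deriv (g i) (x \<bullet> i))) (at (x \<bullet> i))"
      using smooth1_has_derivative(1)[OF g] by (simp add: has_field_derivative_def)
    moreover have "((\<lambda>x. x \<bullet> i) has_derivative (\<lambda>y. y \<bullet> i)) (at x)"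
      by (auto intro!: derivative_eq_intros)
    ultimately show "((\<lambda>x. g i (x \<bullet> i)) has_derivative (\<lambda>y. deriv (g i) (x \<bullet> i) * (y \<bullet> i))) (at x)"
      using has_derivative_compose by blast
  qed
  have "\<exists>h. (\<forall>i\<in>Basis. smooth1 (h i)) \<and> 
      iter_deriv vs (\<lambda>x::'a. \<Prod>i\<in>Basis. g i (x \<bullet> i)) = (\<lambda>x. \<Prod>i\<in>Basis. h i (x \<bullet> i))"
    if "set vs \<subseteq> Basis" for vs
    using that
  proof (induction vs)
    case Nil
    then show ?case using assms by auto
  next
    case (Cons v vs)
    then have v: "v \<in> Basis" by simp
    from Cons obtain h where h: "\<And>i. i \<in> Basis \<Longrightarrow> smooth1 (h i)"
      and eq: "iter_deriv vs (\<lambda>x::'a. \<Prod>i\<in>Basis. g i (x \<bullet> i)) = (\<lambda>x. \<Prod>i\<in>Basis. h i (x \<bullet> i))" by auto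
    define k where "k = h(v := deriv (h v))"
    have "frechet_derivative (\<lambda>x::'a. \<Prod>i\<in>Basis. h i (x \<bullet> i)) (at x) v = (\<Prod>i\<in>Basis. k i (x \<bullet> i))" for x
    proof -
      have "frechet_derivative (\<lambda>x::'a. \<Prod>i\<in>Basis. h i (x \<bullet> i)) (at x) v
          = (\<Sum>i\<in>Basis. (deriv (h i) (x \<bullet> i) * (v \<bullet> i)) * (\<Prod>j\<in>Basis - {i}. h j (x \<bullet> j)))"
        by (subst frechet_derivative_at[OF der[OF h], symmetric]) auto
      also have "\<dots> = (\<Sum>i\<in>Basis. if i = v then deriv (h v) (x \<bullet> v) * (\<Prod>j\<in>Basis - {v}. h j (x \<bullet> j)) else 0)"
        by (intro sum.cong refl) (auto simp: inner_Basis v)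
      also have "\<dots> = deriv (h v) (x \<bullet> v) * (\<Prod>j\<in>Basis - {v}. h j (x \<bullet> j))"
        using v by simp
      also have "\<dots> = k v (x \<bullet> v) * (\<Prod>j\<in>Basis - {v}. k j (x \<bullet> j))"
        by (simp add: k_def)
      also have "\<dots> = (\<Prod>i\<in>Basis. k i (x \<bullet> i))"
        using v by (simp add: prod.remove)
      finally show ?thesis .
    qed
    moreover have "\<forall>i\<in>Basis. smooth1 (k i)"
      using h v by (auto simp: k_def smooth1_has_derivative)
    ultimately show ?case by (intro exI[of _ k]) (simp add: eq)
  qed
  moreover have "(\<lambda>x::'a. \<Prod>i\<in>Basis. h i (x \<bullet> i)) differentiable_on UNIV" if "\<forall>i\<in>Basis. smooth1 (h i)" for h
    using der[of h] that by (intro differentiable_at_imp_differentiable_on) (auto simp: differentiable_def)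
  ultimately show ?thesis unfolding smooth_def by metis
qed

lemma smooth_real_line: "smooth1 f \<Longrightarrow> smooth (f :: real \<Rightarrow> real)"
  using smooth_coordinate_product[where 'a=real, of "\<lambda>_. f"] by simp

lemma test_functionI:
  assumes "smooth \<phi>" "compact K" "K \<subseteq> U" "\<And>x. \<phi> x \<noteq> 0 \<Longrightarrow> x \<in> K"
  shows "\<phi> \<in> test_functions U"
proof -
  have "closure {x. \<phi> x \<noteq> 0} \<subseteq> K"
    using assms by (intro closure_minimal) (auto intro: compact_imp_closed)
  then show ?thesis using assms unfolding test_functions_def
    using compact_Int_closed[of K "closure {x. \<phi> x \<noteq> 0}"] by (auto simp: Int_absorb1)
qed

text \<open>A product of one-dimensional cut-offs that rise from \<open>0\<close> to \<open>1\<close> over the distance \<open>1 / n\<close> from each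
  face of the box. The approximations are supported in the closed box and bounded by \<open>1\<close>, so that they
  serve as test functions and dominated convergence applies.\<close>

lemma box_indicator_limit:
  fixes a b :: "'a::euclidean_space"
  assumes "cbox a b \<subseteq> U"
  obtains \<phi> where "\<And>n::nat. \<phi> n \<in> test_functions U" "\<And>n x. \<bar>\<phi> n x\<bar> \<le> 1" 
    "\<And>x. (\<lambda>n. \<phi> n x) \<longlonglongrightarrow> indicator (box a b) x"
proof
  define \<phi> where "\<phi> n x = (\<Prod>i\<in>Basis. cutoff (real n * (x \<bullet> i - a \<bullet> i)) * cutoff (real n * (b \<bullet> i - x \<bullet> i)))" 
    for n and x :: 'a
  have sm: "smooth (\<phi> n)" for n
    unfolding \<phi>_def[abs_def]
  proof (rule smooth_coordinate_product)
    fix i :: 'a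
    have "smooth1 (\<lambda>x. cutoff (real n * x + (- real n * (a \<bullet> i))) * cutoff (- real n * x + real n * (b \<bullet> i)))"
      by (intro smooth1_mult smooth1_cutoff_affine)
    then show "smooth1 (\<lambda>x. cutoff (real n * (x - a \<bullet> i)) * cutoff (real n * (b \<bullet> i - x)))"
      by (simp add: algebra_simps)
  qed
  show "\<phi> n \<in> test_functions U" for n
  proof (rule test_functionI[OF sm compact_cbox assms])
    fix x assume "\<phi> n x \<noteq> 0"
    then have *: "cutoff (real n * (x \<bullet> i - a \<bullet> i)) \<noteq> 0" "cutoff (real n * (b \<bullet> i - x \<bullet> i)) \<noteq> 0" 
      if "i \<in> Basis" for i using that by (auto simp: \<phi>_def)
    have "a \<bullet> i \<le> x \<bullet> i" "x \<bullet> i \<le> b \<bullet> i" if "i \<in> Basis" for i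
      using *[OF that] cutoff_eq_0 by (metis diff_ge_0_iff_ge linorder_linear mult_nonneg_nonpos of_nat_0_le_iff diff_le_0_iff_le)+
    then show "x \<in> cbox a b" by (simp add: mem_box)
  qed
  show "\<bar>\<phi> n x\<bar> \<le> 1" for n x
    unfolding \<phi>_def abs_prod using cutoff_bounds by (intro prod_le_1) (auto simp: abs_mult mult_le_one)
  show "(\<lambda>n. \<phi> n x) \<longlonglongrightarrow> indicator (box a b) x" for x
  proof -
    have "(\<lambda>n. cutoff (real n * (b \<bullet> i - x \<bullet> i))) \<longlonglongrightarrow> indicator {- (b \<bullet> i)<..} (- (x \<bullet> i))" for i
      using cutoff_step_tendsto[of "- (x \<bullet> i)" "- (b \<bullet> i)"] by (simp add: algebra_simps)
    then have "(\<lambda>n. \<phi> n x) \<longlonglongrightarrow> (\<Prod>i\<in>Basis. indicator {a \<bullet> i<..} (x \<bullet> i) * indicator {- (b \<bullet> i)<..} (- (x \<bullet> i)))"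
      unfolding \<phi>_def by (intro tendsto_prod tendsto_mult cutoff_step_tendsto)
    also have "(\<Prod>i\<in>Basis. indicator {a \<bullet> i<..} (x \<bullet> i) * indicator {- (b \<bullet> i)<..} (- (x \<bullet> i))) = (indicator (box a b) x :: real)"
      by (cases "x \<in> box a b") (auto simp: mem_box indicator_def)
    finally show ?thesis .
  qed
qed

section \<open>The fundamental lemma of the calculus of variations\<close>

lemma sigma_finite_lebesgue: "sigma_finite_measure (lebesgue :: 'a::euclidean_space measure)"
proof
  obtain A :: "'a set set" where A: "countable A" "A \<subseteq> sets lborel" "\<Union>A = space lborel" 
    "\<forall>a\<in>A. emeasure lborel a \<noteq> \<infinity>"
    using lborel.sigma_finite_countable by blast
  then show "\<exists>A :: 'a set set. countable A \<and> A \<subseteq> sets lebesgue \<and> \<Union>A = space lebesgue \<and> 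
      (\<forall>a\<in>A. emeasure lebesgue a \<noteq> \<infinity>)"
    by (intro exI[of _ A]) (auto simp: subset_iff)
qed

text \<open>By the approximation of indicator functions, the integral of \<open>g\<close> vanishes over every box whose
  closure lies in \<open>U\<close>, hence over every measurable subset of such a box, and \<open>U\<close> is a countable union of
  closed boxes with negligible boundaries.\<close>

lemma fundamental_lemma:
  fixes g :: "'a::euclidean_space \<Rightarrow> 'b::euclidean_space"
  assumes "open U" and g: "integrable (lebesgue_on U) g"
    and zero: "\<And>\<phi>. \<phi> \<in> test_functions U \<Longrightarrow> (LINT x|lebesgue_on U. \<phi> x *\<^sub>R g x) = 0"
  shows "AE x in lebesgue_on U. g x = 0"
proof -
  have U [measurable]: "U \<in> sets lebesgue" using \<open>open U\<close> by auto
  define G where "G x = indicator U x *\<^sub>R g x" for x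
  have G: "integrable lebesgue G"
    using g U by (simp add: G_def[abs_def] integrable_restrict_space)
  have [measurable]: "G \<in> borel_measurable lebesgue" using G by auto
  have box0: "(LINT x|lebesgue. indicator (box c d) x *\<^sub>R G x) = 0" if cd: "cbox c d \<subseteq> U" for c d
  proof -
    obtain \<phi> where \<phi>: "\<And>n::nat. \<phi> n \<in> test_functions U" "\<And>n x. \<bar>\<phi> n x\<bar> \<le> 1" 
      "\<And>x. (\<lambda>n. \<phi> n x) \<longlonglongrightarrow> indicator (box c d) x" using box_indicator_limit[OF cd] by blast
    have [measurable]: "\<phi> n \<in> borel_measurable lebesgue" for n
    proof -
      have "\<phi> n differentiable_on UNIV" using \<phi>(1)[of n]
        unfolding test_functions_def smooth_def by (auto dest: spec[of _ "[]"])
      then have "continuous_on UNIV (\<phi> n)" by (rule differentiable_imp_continuous_on)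
      then have "\<phi> n \<in> borel_measurable borel" by (rule borel_measurable_continuous_onI)
      then show ?thesis by (simp add: measurable_completion)
    qed
    have "(\<lambda>n. LINT x|lebesgue. \<phi> n x *\<^sub>R G x) \<longlonglongrightarrow> (LINT x|lebesgue. indicator (box c d) x *\<^sub>R G x)"
    proof (rule integral_dominated_convergence[where w="\<lambda>x. norm (G x)"])
      show "AE x in lebesgue. (\<lambda>n. \<phi> n x *\<^sub>R G x) \<longlonglongrightarrow> indicator (box c d) x *\<^sub>R G x"
        using \<phi>(3) by (auto intro!: tendsto_intros)
      show "AE x in lebesgue. norm (\<phi> n x *\<^sub>R G x) \<le> norm (G x)" for n
        using \<phi>(2)[of n] by (auto simp: mult_left_le_one_le)
      show "(\<lambda>x. indicator (box c d) x *\<^sub>R G x) \<in> borel_measurable lebesgue"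
        by (intro borel_measurable_integrable integrable_mult_indicator G) auto
    qed (use G in auto)
    moreover have "(LINT x|lebesgue. \<phi> n x *\<^sub>R G x) = 0" for n
      using zero[OF \<phi>(1)[of n]] U
      by (simp add: integral_restrict_space G_def mult.commute)
    ultimately show ?thesis by (simp add: LIMSEQ_const_iff)
  qed
  \<comment> \<open>Inside a box, Dynkin's lemma passes from sub-boxes to all measurable sets.\<close>
  have AE_box: "AE x in lebesgue. x \<in> box a b \<longrightarrow> G x = 0" if ab: "cbox a b \<subseteq> U" for a b
  proof -
    define H where "H x = indicator (box a b) x *\<^sub>R G x" for x
    have H: "integrable lebesgue H" unfolding H_def[abs_def] using G by (intro integrable_mult_indicator) auto
    have Hint: "integrable lebesgue (\<lambda>x. indicator A x *\<^sub>R H x)" if "A \<in> sets borel" for A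
      using H that by (intro integrable_mult_indicator) auto
    have borel0: "(LINT x|lebesgue. indicator A x *\<^sub>R H x) = 0" if "A \<in> sets borel" for A
    proof -
      let ?E = "range (\<lambda>(a, b). box a b :: 'a set)"
      have in_E: "box c d \<in> ?E" for c d by (rule range_eqI[of _ _ "(c, d)"]) simp
      have stable: "Int_stable ?E"
      proof (rule Int_stableI)
        fix A B assume "A \<in> ?E" "B \<in> ?E"
        then show "A \<inter> B \<in> ?E" by (auto simp: box_Int_box intro: in_E simp del: image_iff)
      qed
      have "A \<in> sigma_sets UNIV ?E" using that by (simp add: borel_eq_box)
      have "?E \<subseteq> Pow UNIV" by simp
      from stable this \<open>A \<in> sigma_sets UNIV ?E\<close> show ?thesis
      proof (induction A rule: sigma_sets_induct_disjoint)
        case (basic A)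
        then obtain c d where A: "A = box c d" by auto
        obtain e f where ef: "box c d \<inter> box a b = box e f" 
          by (simp only: box_Int_box)
        show ?case
        proof (cases "box e f = {}")
          case True
          then have "(\<lambda>x. indicator A x *\<^sub>R H x) = (\<lambda>_. 0)"
            using ef A by (auto simp: H_def indicator_def fun_eq_iff)
          then show ?thesis by (simp only: Bochner_Integration.integral_zero)
        next
          case False
          have "box e f \<subseteq> cbox a b" using ef box_subset_cbox by blast
          then have "cbox e f \<subseteq> cbox a b"
            using False closure_minimal[OF _ closed_cbox, of "box e f" a b] by (simp add: closure_box)
          then have "(LINT x|lebesgue. indicator (box e f) x *\<^sub>R G x) = 0" using box0 ab by blast
          moreover have "(\<lambda>x. indicator A x *\<^sub>R H x) = (\<lambda>x. indicator (box e f) x *\<^sub>R G x)"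
            using A by (auto simp: H_def fun_eq_iff indicator_inter_arith simp flip: ef)
          ultimately show ?thesis by simp
        qed
      next
        case empty
        then show ?case by simp
      next
        case (compl A)
        then have A: "A \<in> sets borel" by (simp add: borel_eq_box)
        have "(\<lambda>x. indicator (UNIV - A) x *\<^sub>R H x) = (\<lambda>x. H x - indicator A x *\<^sub>R H x)"
          by (auto simp: fun_eq_iff indicator_def)
        moreover have "(LINT x|lebesgue. H x) = 0" unfolding H_def using box0[OF ab] .
        ultimately show ?case using compl H Hint[OF A] by simp
      next
        case (union A)
        then have A: "\<And>i. A i \<in> sets borel" by (simp add: borel_eq_box image_subset_iff)
        have "(LINT x:(\<Union>i. A i)|lebesgue. H x) = (\<Sum>i. LINT x:A i|lebesgue. H x)"
          using A union.hyps(1) Hint[of "\<Union>i. A i"] 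
          by (intro lebesgue_integral_countable_add) (auto simp: set_integrable_def disjoint_family_on_def)
        then show ?case using union by (simp add: set_lebesgue_integral_def)
      qed
    qed
    have "AE x in lebesgue. H x = 0"
    proof (rule sigma_finite_measure.density_zero[OF sigma_finite_lebesgue H])
      fix A :: "'a set" assume "A \<in> sets lebesgue"
      then obtain S N N' where SN: "A = S \<union> N" "N \<subseteq> N'" "N' \<in> null_sets lborel" "S \<in> sets lborel"
        using sets_completionE by blast
      have "AE x in lebesgue. x \<notin> N'" 
        using SN(3) by (intro AE_not_in null_sets_completionI)
      then have "(LINT x|lebesgue. indicator A x *\<^sub>R H x) = (LINT x|lebesgue. indicator S x *\<^sub>R H x)"
      proof (intro integral_cong_AE)
        show "(\<lambda>x. indicator A x *\<^sub>R H x) \<in> borel_measurable lebesgue"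
          "(\<lambda>x. indicator S x *\<^sub>R H x) \<in> borel_measurable lebesgue"
          using \<open>A \<in> sets lebesgue\<close> SN(4) H
          by (auto intro!: borel_measurable_integrable integrable_mult_indicator simp del: real_scaleR_def)
      qed (use SN in \<open>auto simp: indicator_def elim!: eventually_mono\<close>)
      then show "set_lebesgue_integral lebesgue A H = 0"
        using borel0[of S] SN by (simp add: set_lebesgue_integral_def)
    qed
    then show ?thesis by eventually_elim (auto simp: H_def)
  qed
  obtain D where D: "countable D" "D \<subseteq> Pow U" "\<And>X. X \<in> D \<Longrightarrow> \<exists>a b. X = cbox a b" "\<Union>D = U"
    using open_countable_Union_open_cbox[OF \<open>open U\<close>] by metis
  have AEx: "AE x in lebesgue. x \<in> X \<longrightarrow> G x = 0" if XD: "X \<in> D" for X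
  proof -
    obtain a b where X: "X = cbox a b" using D XD by blast
    have "cbox a b - box a b \<in> null_sets lebesgue"
      using negligible_frontier_interval[of a b] by (simp add: negligible_iff_null_sets)
    then have "AE x in lebesgue. x \<notin> cbox a b - box a b" by (rule AE_not_in)
    moreover have "AE x in lebesgue. x \<in> box a b \<longrightarrow> G x = 0" using AE_box[of a b] X XD D(2) by blast
    ultimately show ?thesis unfolding X by eventually_elim auto
  qed
  have "AE x in lebesgue. \<forall>X\<in>D. x \<in> X \<longrightarrow> G x = 0"
    by (subst AE_ball_countable[OF D(1)]) (use AEx in blast)
  then have "AE x in lebesgue. x \<in> U \<longrightarrow> g x = 0"
  proof eventually_elim
    case (elim x)
    show ?case
    proof
      assume "x \<in> U"
      then obtain X where "X \<in> D" "x \<in> X" using D(4) by blast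
      then show "g x = 0" using elim \<open>x \<in> U\<close> by (auto simp: G_def)
    qed
  qed
  then show ?thesis using U by (simp add: AE_restrict_space_iff)
qed

section \<open>Calculus of smooth functions and integration by parts\<close>

lemma smooth_differentiable: 
  "smooth f \<Longrightarrow> set vs \<subseteq> Basis \<Longrightarrow> iter_deriv vs f differentiable (at x)"
  unfolding smooth_def by (auto simp: differentiable_on_def)

lemma smooth_has_derivative: 
  "smooth f \<Longrightarrow> set vs \<subseteq> Basis \<Longrightarrow> 
    (iter_deriv vs f has_derivative frechet_derivative (iter_deriv vs f) (at x)) (at x)"
  using smooth_differentiable frechet_derivative_works by blast

lemma smooth_continuous: 
  "smooth f \<Longrightarrow> set vs \<subseteq> Basis \<Longrightarrow> continuous_on S (iter_deriv vs f)"
  using smooth_differentiable differentiable_imp_continuous_within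
  by (metis continuous_at_imp_continuous_on)

lemma iter_deriv_lincomb:
  assumes "smooth f" "smooth g" "set vs \<subseteq> Basis"
  shows "iter_deriv vs (a *\<^sub>R f + b *\<^sub>R g) = a *\<^sub>R iter_deriv vs f + b *\<^sub>R iter_deriv vs g"
  using assms(3)
proof (induction vs)
  case (Cons v vs)
  then have vs: "set vs \<subseteq> Basis" by simp
  have "((\<lambda>x. a *\<^sub>R iter_deriv vs f x + b *\<^sub>R iter_deriv vs g x) has_derivative 
     (\<lambda>h. a *\<^sub>R frechet_derivative (iter_deriv vs f) (at x) h
        + b *\<^sub>R frechet_derivative (iter_deriv vs g) (at x) h)) (at x)" for x
    by (intro has_derivative_add has_derivative_scaleR_right smooth_has_derivative assms vs)
  from frechet_derivative_at[OF this, symmetric]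
  have "frechet_derivative (a *\<^sub>R iter_deriv vs f + b *\<^sub>R iter_deriv vs g) (at x)
      = (\<lambda>h. a *\<^sub>R frechet_derivative (iter_deriv vs f) (at x) h
        + b *\<^sub>R frechet_derivative (iter_deriv vs g) (at x) h)" for x
    by (simp add: plus_fun_def scaleR_fun_def)
  then show ?case unfolding iter_deriv.simps Cons.IH[OF vs] by (simp add: fun_eq_iff)
qed simp

lemma subspace_smooth: "subspace {f. smooth f}"
proof (rule subspaceI; clarify?)
  have "iter_deriv vs (\<lambda>x::'a. 0::'b) = (\<lambda>x. 0)" for vs
    by (induction vs) simp_all
  then show "smooth (0 :: 'a \<Rightarrow> 'b)" by (simp add: smooth_def zero_fun_def)
next
  fix f g :: "'a \<Rightarrow> 'b" assume fg: "smooth f" "smooth g"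
  have "iter_deriv vs (f + g) = iter_deriv vs f + iter_deriv vs g" if "set vs \<subseteq> Basis" for vs
    using iter_deriv_lincomb[OF fg that, of 1 1] by simp
  then show "smooth (f + g)" using fg unfolding smooth_def
    by (simp add: plus_fun_def differentiable_on_add)
next
  fix f :: "'a \<Rightarrow> 'b" and c assume f: "smooth f"
  have "iter_deriv vs (c *\<^sub>R f) = c *\<^sub>R iter_deriv vs f" if "set vs \<subseteq> Basis" for vs
    using iter_deriv_lincomb[OF f f that, of c 0] by simp
  then show "smooth (c *\<^sub>R f)" using f unfolding smooth_def
    by (simp add: scaleR_fun_def differentiable_on_scaleR)
qed

lemma test_function_support:
  assumes "\<phi> \<in> test_functions U"
  obtains K where "compact K" "K \<subseteq> U" "\<And>vs x. x \<notin> K \<Longrightarrow> iter_deriv vs \<phi> x = 0"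
proof
  let ?K = "closure {x. \<phi> x \<noteq> 0}"
  show "compact ?K" "?K \<subseteq> U" using assms by (auto simp: test_functions_def)
  show "iter_deriv vs \<phi> x = 0" if "x \<notin> ?K" for vs x
    using that
  proof (induction vs arbitrary: x)
    case Nil
    then show ?case using closure_subset[of "{x. \<phi> x \<noteq> 0}"] by auto
  next
    case (Cons v vs)
    have "((\<lambda>_. 0) has_derivative (\<lambda>_. 0)) (at x)" by simp
    then have "(iter_deriv vs \<phi> has_derivative (\<lambda>_. 0)) (at x)"
      by (rule has_derivative_transform_within_open[where s="- ?K"]) (use Cons in auto)
    from frechet_derivative_at[OF this, symmetric] show ?case by simp
  qed
qed

lemma test_function_bounded:
  assumes "\<phi> \<in> test_functions U" "set vs \<subseteq> Basis"
  obtains C where "\<And>x. \<bar>iter_deriv vs \<phi> x\<bar> \<le> C"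
proof -
  obtain K where K: "compact K" "K \<subseteq> U" "\<And>vs x. x \<notin> K \<Longrightarrow> iter_deriv vs \<phi> x = 0"
    using test_function_support[OF assms(1)] by blast
  have "smooth \<phi>" using assms by (simp add: test_functions_def)
  then have "bounded (iter_deriv vs \<phi> ` K)"
    by (intro compact_imp_bounded compact_continuous_image smooth_continuous assms K)
  then obtain C where "\<forall>x\<in>K. \<bar>iter_deriv vs \<phi> x\<bar> \<le> C" unfolding bounded_iff by auto
  then have "\<bar>iter_deriv vs \<phi> x\<bar> \<le> max C 0" for x
    using K(3) by (cases "x \<in> K") fastforce+
  then show thesis using that by blast
qed

lemma test_function_measurable:
  assumes "\<phi> \<in> test_functions U" "set vs \<subseteq> Basis"
  shows "iter_deriv vs \<phi> \<in> borel_measurable borel"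
  using assms by (intro borel_measurable_continuous_onI smooth_continuous) (auto simp: test_functions_def)

lemma borel_imp_lebesgue_on: 
  "f \<in> borel_measurable borel \<Longrightarrow> f \<in> borel_measurable (lebesgue_on U)"
  by (intro measurable_restrict_space1) (simp add: measurable_completion)

lemma test_function_L2:
  assumes "\<phi> \<in> test_functions U" "set vs \<subseteq> Basis" "finite_measure (lebesgue_on U)"
  shows "iter_deriv vs \<phi> \<in> L2 (lebesgue_on U)"
proof -
  obtain C where "\<And>x. \<bar>iter_deriv vs \<phi> x\<bar> \<le> C" using test_function_bounded assms by metis
  then show ?thesis
    by (intro L2_bounded[OF assms(3), where C=C] borel_imp_lebesgue_on test_function_measurable[OF assms(1,2)]) auto
qed

text \<open>The integral of a difference quotient vanishes by translation invariance of Lebesgue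
  measure; difference quotients converge boundedly to the derivative.\<close>

lemma integral_directional_derivative_zero:
  fixes F D :: "'a::euclidean_space \<Rightarrow> real"
  assumes der: "\<And>x. ((\<lambda>t. F (x + t *\<^sub>R v)) has_real_derivative D x) (at 0)"
    and cont: "continuous_on UNIV F" "continuous_on UNIV D"
    and K: "compact K" "\<And>x. x \<notin> K \<Longrightarrow> F x = 0" "\<And>x. x \<notin> K \<Longrightarrow> D x = 0"
  shows "(LINT x|lborel. D x) = 0"
proof -
  have [measurable]: "F \<in> borel_measurable borel" "D \<in> borel_measurable borel"
    using cont by (auto intro: borel_measurable_continuous_onI)
  have "bounded (D ` K)"
    using K(1) cont(2) continuous_on_subset by (blast intro: compact_imp_bounded compact_continuous_image)
  then obtain B0 where B0: "\<And>x. x \<in> K \<Longrightarrow> \<bar>D x\<bar> \<le> B0" 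
    unfolding bounded_iff by (metis image_eqI real_norm_def)
  define B where "B = max B0 0"
  have B: "\<bar>D x\<bar> \<le> B" for x
    using B0[of x] K(3)[of x] by (cases "x \<in> K") (auto simp: B_def)
  obtain r where "\<forall>x\<in>K. norm x \<le> r" using compact_imp_bounded[OF K(1)] unfolding bounded_iff by blast
  then have r: "K \<subseteq> cball 0 r" by auto
  define R where "R = r + norm v"
  have intF: "integrable lborel F"
  proof -
    have "integrable lborel (\<lambda>x. indicator K x *\<^sub>R F x)"
      using K(1) cont(1) continuous_on_subset by (intro borel_integrable_compact) blast+
    moreover have "(\<lambda>x. indicator K x *\<^sub>R F x) = F" using K(2) by (auto simp: fun_eq_iff indicator_def)
    ultimately show ?thesis by simp
  qed
  define h where "h n = 1 / real (Suc n)" for n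
  have h: "h n > 0" "h n \<le> 1" for n by (auto simp: h_def)
  define q where "q n x = (F (h n *\<^sub>R v + x) - F x) / h n" for n x
  have q0: "(LINT x|lborel. q n x) = 0" for n
  proof -
    have "integrable (distr lborel borel ((+) (h n *\<^sub>R v))) F" using intF by (simp add: lborel_distr_plus)
    then have i: "integrable lborel (\<lambda>x. F (h n *\<^sub>R v + x))" by (subst (asm) integrable_distr_eq) auto
    have "(LINT x|lborel. F (h n *\<^sub>R v + x)) = (LINT x|distr lborel borel ((+) (h n *\<^sub>R v)). F x)"
      by (rule integral_distr[symmetric]) auto
    then have "(LINT x|lborel. F (h n *\<^sub>R v + x)) = (LINT x|lborel. F x)" by (simp add: lborel_distr_plus)
    then show ?thesis using i intF unfolding q_def by simp
  qed
  have "(\<lambda>n. LINT x|lborel. q n x) \<longlonglongrightarrow> (LINT x|lborel. D x)"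
  proof (rule integral_dominated_convergence[where w="\<lambda>x. B * indicator (cball 0 R) x"])
    show "integrable lborel (\<lambda>x::'a. B * indicator (cball 0 R) x)"
      by (intro integrable_mult_right integrable_real_indicator) 
        (use emeasure_bounded_finite[of "cball 0 R :: 'a set"] in \<open>auto simp: emeasure_lborel_cbox_eq\<close>)
    show "AE x in lborel. (\<lambda>n. q n x) \<longlonglongrightarrow> D x"
    proof (rule AE_I2)
      fix x
      have "((\<lambda>t. (F (x + t *\<^sub>R v) - F x) / t) \<longlongrightarrow> D x) (at 0)"
        using der[of x] by (simp add: has_field_derivative_iff)
      moreover have "filterlim h (at 0) sequentially"
        unfolding h_def filterlim_at using LIMSEQ_inverse_real_of_nat by (auto simp: inverse_eq_divide)
      ultimately have "(\<lambda>n. (F (x + h n *\<^sub>R v) - F x) / h n) \<longlonglongrightarrow> D x"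
        by (rule filterlim_compose)
      then show "(\<lambda>n. q n x) \<longlonglongrightarrow> D x" by (simp add: q_def add.commute)
    qed
    show "AE x in lborel. norm (q n x) \<le> B * indicator (cball 0 R) x" for n
    proof (rule AE_I2)
      fix x
      show "norm (q n x) \<le> B * indicator (cball 0 R) x"
      proof (cases "x \<in> cball 0 R")
        case True
        have "((\<lambda>t. F (x + t *\<^sub>R v)) has_real_derivative D (x + t *\<^sub>R v)) (at t)" for t
        proof -
          have "((\<lambda>s. F ((x + t *\<^sub>R v) + (s - t) *\<^sub>R v)) has_real_derivative D (x + t *\<^sub>R v) * 1) (at t)"
            by (rule DERIV_chain2[where f="\<lambda>t'. F ((x + t *\<^sub>R v) + t' *\<^sub>R v)"])
               (auto intro!: derivative_eq_intros der)
          then show ?thesis by (simp add: algebra_simps)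
        qed
        then obtain z where "F (x + h n *\<^sub>R v) - F (x + 0 *\<^sub>R v) = (h n - 0) * D (x + z *\<^sub>R v)"
          using MVT2[of 0 "h n" "\<lambda>t. F (x + t *\<^sub>R v)" "\<lambda>t. D (x + t *\<^sub>R v)"] h by blast
        then have "q n x = D (x + z *\<^sub>R v)" using h[of n] by (simp add: q_def add.commute)
        then show ?thesis using True B by simp
      next
        case False
        have "norm (h n *\<^sub>R v) \<le> norm v" using h[of n] by (simp add: mult_left_le_one_le)
        moreover have "norm x \<le> norm (h n *\<^sub>R v + x) + norm (h n *\<^sub>R v)"
          by (metis add.commute norm_triangle_ineq4 add_diff_cancel_left')
        moreover have "norm x > r + norm v" using False by (simp add: R_def)
        ultimately have "norm (h n *\<^sub>R v + x) > r" "norm x > r" using norm_ge_zero[of v] by linarith+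
        then have "h n *\<^sub>R v + x \<notin> K" "x \<notin> K" using r by (auto simp: subset_iff not_le)
        then show ?thesis using K(2) False by (simp add: q_def)
      qed
    qed
  qed (auto simp: q_def)
  then show ?thesis using q0 by (simp add: LIMSEQ_const_iff)
qed

lemma integral_lebesgue_on_eq_lborel:
  fixes f :: "'a::euclidean_space \<Rightarrow> 'b::euclidean_space"
  assumes "U \<in> sets lebesgue" "f \<in> borel_measurable borel" "\<And>x. x \<notin> U \<Longrightarrow> f x = 0"
  shows "(LINT x|lebesgue_on U. f x) = (LINT x|lborel. f x)"
proof -
  have "(LINT x|lebesgue_on U. f x) = (LINT x|lebesgue. indicator U x *\<^sub>R f x)"
    using assms(1) by (simp add: integral_restrict_space)
  also have "(\<lambda>x. indicator U x *\<^sub>R f x) = f" using assms(3) by (auto simp: fun_eq_iff indicator_def)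
  finally show ?thesis using assms(2) by (simp add: integral_completion)
qed

text \<open>The directional derivative of each component of \<open>\<phi> w\<close> has integral zero because the support of \<open>\<phi>\<close>
  is a compact subset of \<open>U\<close>.\<close>

lemma integration_by_parts_test_function:
  fixes w :: "'a::euclidean_space \<Rightarrow> 'b::euclidean_space"
  assumes U: "U \<in> sets lebesgue" and \<phi>: "\<phi> \<in> test_functions U" and w: "smooth w" and v: "v \<in> Basis"
  shows "(LINT x|lebesgue_on U. iter_deriv [v] \<phi> x *\<^sub>R w x) 
    = - (LINT x|lebesgue_on U. \<phi> x *\<^sub>R iter_deriv [v] w x)" (is "?L = - ?R")
proof -
  have sm: "smooth \<phi>" using \<phi> by (simp add: test_functions_def)
  obtain K where K: "compact K" "K \<subseteq> U" "\<And>vs x. x \<notin> K \<Longrightarrow> iter_deriv vs \<phi> x = 0"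
    using test_function_support[OF \<phi>] by blast
  have c: "continuous_on UNIV \<phi>" "continuous_on UNIV w" 
    "continuous_on UNIV (iter_deriv [v] \<phi>)" "continuous_on UNIV (iter_deriv [v] w)"
    using smooth_continuous[of \<phi> "[]"] smooth_continuous[of w "[]"] smooth_continuous[of \<phi> "[v]"] 
      smooth_continuous[of w "[v]"] sm w v by auto
  let ?f = "\<lambda>x. iter_deriv [v] \<phi> x *\<^sub>R w x" and ?g = "\<lambda>x. \<phi> x *\<^sub>R iter_deriv [v] w x"
  have cf: "continuous_on UNIV ?f" and cg: "continuous_on UNIV ?g"
    by (intro continuous_intros c)+
  have f0: "?f x = 0" and g0: "?g x = 0" if "x \<notin> K" for x
    using K(3)[OF that, of "[v]"] K(3)[OF that, of "[]"] by auto
  have int: "integrable lborel h" if "continuous_on UNIV h" "\<And>x. x \<notin> K \<Longrightarrow> h x = 0" for h :: "'a \<Rightarrow> 'b"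
  proof -
    have "integrable lborel (\<lambda>x. indicator K x *\<^sub>R h x)"
      using K(1) that(1) continuous_on_subset by (intro borel_integrable_compact) blast+
    moreover have "(\<lambda>x. indicator K x *\<^sub>R h x) = h" using that(2) by (auto simp: fun_eq_iff indicator_def)
    ultimately show ?thesis by simp
  qed
  have L: "?L = (LINT x|lborel. ?f x)" and R: "?R = (LINT x|lborel. ?g x)"
    using f0 g0 K(2) cf cg by (intro integral_lebesgue_on_eq_lborel U borel_measurable_continuous_onI; blast)+
  have "(LINT x|lborel. ?f x + ?g x) = 0"
  proof (rule euclidean_eqI)
    fix b :: 'b
    have "(LINT x|lborel. ?f x + ?g x) \<bullet> b = (LINT x|lborel. (?f x + ?g x) \<bullet> b)"
      by (rule integral_inner_left[symmetric]) (use int cf cg f0 g0 in auto)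
    also have "\<dots> = 0"
    proof (rule integral_directional_derivative_zero[where F="\<lambda>x. \<phi> x * (w x \<bullet> b)" and v=v, OF _ _ _ K(1)])
      fix x
      have p: "(\<phi> has_derivative frechet_derivative \<phi> (at x)) (at x)"
        "(w has_derivative frechet_derivative w (at x)) (at x)"
        using smooth_has_derivative[of \<phi> "[]"] smooth_has_derivative[of w "[]"] sm w by auto
      have l: "((\<lambda>t. x + t *\<^sub>R v) has_derivative (\<lambda>t. t *\<^sub>R v)) (at 0)" 
        by (auto intro!: derivative_eq_intros)
      have p\<phi>: "((\<lambda>t. \<phi> (x + t *\<^sub>R v)) has_derivative (\<lambda>t. frechet_derivative \<phi> (at x) (t *\<^sub>R v))) (at 0)"
        by (rule has_derivative_compose[OF l]) (use p in simp)
      have pw: "((\<lambda>t. w (x + t *\<^sub>R v)) has_derivative (\<lambda>t. frechet_derivative w (at x) (t *\<^sub>R v))) (at 0)"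
        by (rule has_derivative_compose[OF l]) (use p in simp)
      have prod: "((\<lambda>t. \<phi> (x + t *\<^sub>R v) * (w (x + t *\<^sub>R v) \<bullet> b)) has_derivative 
          (\<lambda>t. \<phi> (x + 0 *\<^sub>R v) * (frechet_derivative w (at x) (t *\<^sub>R v) \<bullet> b)
             + frechet_derivative \<phi> (at x) (t *\<^sub>R v) * (w (x + 0 *\<^sub>R v) \<bullet> b))) (at 0)"
        by (intro has_derivative_mult has_derivative_inner_left p\<phi> pw)
      have lin: "frechet_derivative \<phi> (at x) (t *\<^sub>R v) = t * frechet_derivative \<phi> (at x) v"
        "frechet_derivative w (at x) (t *\<^sub>R v) = t *\<^sub>R frechet_derivative w (at x) v" for t
        using has_derivative_linear[OF p(1)] has_derivative_linear[OF p(2)] linear_cmul by fastforce+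
      show "((\<lambda>t. \<phi> (x + t *\<^sub>R v) * (w (x + t *\<^sub>R v) \<bullet> b)) has_real_derivative (?f x + ?g x) \<bullet> b) (at 0)"
        unfolding has_field_derivative_def
        by (rule has_derivative_eq_rhs[OF prod]) (simp add: lin fun_eq_iff inner_add_left algebra_simps)
    next
      show "continuous_on UNIV (\<lambda>x. \<phi> x * (w x \<bullet> b))" "continuous_on UNIV (\<lambda>x. (?f x + ?g x) \<bullet> b)"
        by (intro continuous_intros c)+
    next
      fix x assume "x \<notin> K"
      then show "(?f x + ?g x) \<bullet> b = 0" "\<phi> x * (w x \<bullet> b) = 0"
        using K(3)[of x "[]"] K(3)[of x "[v]"] by auto
    qed
    finally show "(LINT x|lborel. ?f x + ?g x) \<bullet> b = 0 \<bullet> b" by simp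
  qed
  then have "(LINT x|lborel. ?f x) + (LINT x|lborel. ?g x) = 0"
    using int[OF cf f0] int[OF cg g0] by simp
  then show ?thesis by (simp only: L R eq_neg_iff_add_eq_0)
qed

section \<open>Operators into $L^2$ that are linear almost everywhere\<close>

text \<open>Weak derivatives are chosen representatives, hence linear only up to null sets, which depend on the
  arguments. Inner products in $L^2$ of such operators are nevertheless bilinear.\<close>

definition ae_linear :: "'v::real_vector set \<Rightarrow> 'a measure \<Rightarrow> ('v \<Rightarrow> 'a \<Rightarrow> 'b::euclidean_space) \<Rightarrow> bool" where
  "ae_linear S M A \<longleftrightarrow> subspace S \<and> (\<forall>x\<in>S. A x \<in> L2 M) \<and>
     (\<forall>x\<in>S. \<forall>y\<in>S. AE t in M. A (x + y) t = A x t + A y t) \<and>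
     (\<forall>c. \<forall>x\<in>S. AE t in M. A (c *\<^sub>R x) t = c *\<^sub>R A x t)"

lemma ae_linear_L2: "ae_linear S M A \<Longrightarrow> x \<in> S \<Longrightarrow> A x \<in> L2 M"
  by (simp add: ae_linear_def)

lemma ae_linear_inner:
  assumes A: "ae_linear S M A" and "x \<in> S" "y \<in> S" and z: "z \<in> L2 M"
  shows "L2_inner M (A (x + y)) z = L2_inner M (A x) z + L2_inner M (A y) z"
    and "L2_inner M (A (c *\<^sub>R x)) z = c * L2_inner M (A x) z"
proof -
  have m: "x + y \<in> S" "c *\<^sub>R x \<in> S" using assms by (auto simp: ae_linear_def subspace_add subspace_scale)
  have L: "A x \<in> L2 M" "A y \<in> L2 M" "A (x + y) \<in> L2 M" "A (c *\<^sub>R x) \<in> L2 M" 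
    using A assms m by (auto simp: ae_linear_def)
  note [measurable] = L[THEN L2_measurable] z[THEN L2_measurable]
  have "L2_inner M (A (x + y)) z = L2_inner M (A x + A y) z"
    by (rule L2_inner_cong_AE) (use assms in \<open>auto simp: ae_linear_def plus_fun_def\<close>)
  then show "L2_inner M (A (x + y)) z = L2_inner M (A x) z + L2_inner M (A y) z"
    using L z by (simp add: L2.add)
  have "L2_inner M (A (c *\<^sub>R x)) z = L2_inner M (c *\<^sub>R A x) z"
    by (rule L2_inner_cong_AE) (use assms in \<open>auto simp: ae_linear_def scaleR_fun_def\<close>)
  then show "L2_inner M (A (c *\<^sub>R x)) z = c * L2_inner M (A x) z"
    using L z by (simp add: L2.scale)
qed

lemma ae_linear_semi_inner:
  assumes A: "ae_linear S M A" 
  shows "semi_inner S (\<lambda>x y. L2_inner M (A x) (A y))"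
proof
  show "subspace S" using A by (simp add: ae_linear_def)
qed (use assms in \<open>auto simp: ae_linear_inner ae_linear_L2 L2.sym L2.nonneg\<close>)

lemma ae_linear_combination:
  fixes A :: "'i \<Rightarrow> 'v::real_vector \<Rightarrow> 'a \<Rightarrow> 'b::euclidean_space" and F :: "'i \<Rightarrow> 'b \<Rightarrow> 'c::euclidean_space"
  assumes "finite I" "subspace S" "\<And>i. i \<in> I \<Longrightarrow> ae_linear S M (A i)" 
    "\<And>i. i \<in> I \<Longrightarrow> bounded_linear (F i)"
  shows "ae_linear S M (\<lambda>x t. \<Sum>i\<in>I. F i (A i x t))"
  using assms
proof (induction I rule: finite_induct)
  case empty
  have "(\<lambda>t. 0::'c) \<in> L2 M" by (simp add: L2_def)
  then show ?case using empty by (simp add: ae_linear_def)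
next
  case (insert i I)
  let ?G = "\<lambda>x t. \<Sum>i\<in>I. F i (A i x t)"
  have G: "ae_linear S M ?G" using insert by simp
  have A: "ae_linear S M (A i)" and F: "bounded_linear (F i)" using insert by auto
  interpret F: bounded_linear "F i" by fact
  have eq: "(\<lambda>x t. \<Sum>i\<in>insert i I. F i (A i x t)) = (\<lambda>x t. F i (A i x t) + ?G x t)"
    using insert by simp
  have FL2: "(\<lambda>t. F i (f t)) \<in> L2 M" if "f \<in> L2 M" for f
  proof -
    obtain K where K: "\<And>y. norm (F i y) \<le> norm y * K" using F.bounded by blast
    have meas: "(\<lambda>t. F i (f t)) \<in> borel_measurable M" using that
      by (intro borel_measurable_continuous_on[OF F.continuous_on[OF continuous_on_id]]) (simp add: L2_def)
    have "integrable M (\<lambda>t. (norm (F i (f t)))\<^sup>2)"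
    proof (rule Bochner_Integration.integrable_bound)
      show "integrable M (\<lambda>t. K\<^sup>2 * (norm (f t))\<^sup>2)" using that by (simp add: L2_def)
      have "(norm (F i (f t)))\<^sup>2 \<le> K\<^sup>2 * (norm (f t))\<^sup>2" for t
        using power_mono[OF K[of "f t"], of 2] by (simp add: power_mult_distrib mult.commute)
      then show "AE t in M. norm ((norm (F i (f t)))\<^sup>2) \<le> norm (K\<^sup>2 * (norm (f t))\<^sup>2)" by simp
    qed (use meas in measurable)
    with meas show ?thesis by (simp add: L2_def)
  qed
  show ?case unfolding eq ae_linear_def
  proof (intro conjI ballI allI)
    fix x assume x: "x \<in> S"
    have "(\<lambda>t. F i (A i x t)) + ?G x \<in> L2 M"
      using FL2 ae_linear_L2[OF A x] ae_linear_L2[OF G x] by blast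
    then show "(\<lambda>t. F i (A i x t) + ?G x t) \<in> L2 M" by (simp add: plus_fun_def)
    fix c
    have "AE t in M. A i (c *\<^sub>R x) t = c *\<^sub>R A i x t" "AE t in M. ?G (c *\<^sub>R x) t = c *\<^sub>R ?G x t"
      using A G x by (auto simp: ae_linear_def)
    then show "AE t in M. F i (A i (c *\<^sub>R x) t) + ?G (c *\<^sub>R x) t = c *\<^sub>R (F i (A i x t) + ?G x t)"
      by eventually_elim (simp only: F.scaleR scaleR_add_right)
    fix y assume y: "y \<in> S"
    have "AE t in M. A i (x + y) t = A i x t + A i y t" "AE t in M. ?G (x + y) t = ?G x t + ?G y t"
      using A G x y by (auto simp: ae_linear_def)
    then show "AE t in M. F i (A i (x + y) t) + ?G (x + y) t = F i (A i x t) + ?G x t + (F i (A i y t) + ?G y t)"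
      by eventually_elim (simp only: F.add ac_simps)
  qed (use insert in auto)
qed

lemma semi_inner_sum:
  assumes "subspace S" "\<And>i. i \<in> I \<Longrightarrow> semi_inner S (B i)"
  shows "semi_inner S (\<lambda>x y. \<Sum>i\<in>I. B i x y)"
proof
  show "(\<Sum>i\<in>I. B i x y) = (\<Sum>i\<in>I. B i y x)" if "x \<in> S" "y \<in> S" for x y
    using semi_inner.sym[OF assms(2)] that by (intro sum.cong) auto
  show "(\<Sum>i\<in>I. B i (x + y) z) = (\<Sum>i\<in>I. B i x z) + (\<Sum>i\<in>I. B i y z)" 
    if "x \<in> S" "y \<in> S" "z \<in> S" for x y z
    unfolding sum.distrib[symmetric] using semi_inner.add[OF assms(2)] that by (intro sum.cong) auto
  show "(\<Sum>i\<in>I. B i (c *\<^sub>R x) y) = c * (\<Sum>i\<in>I. B i x y)" if "x \<in> S" "y \<in> S" for c x y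
    unfolding sum_distrib_left using semi_inner.scale[OF assms(2)] that by (intro sum.cong) auto
  show "0 \<le> (\<Sum>i\<in>I. B i x x)" if "x \<in> S" for x
    using semi_inner.nonneg[OF assms(2)] that by (intro sum_nonneg) auto
qed (use assms in auto)

lemma semi_inner_scale:
  assumes "semi_inner S B" "c \<ge> 0" shows "semi_inner S (\<lambda>x y. c * B x y)"
proof -
  interpret semi_inner S B by fact
  show ?thesis
    by standard (use assms(2) in \<open>auto simp: subspace sym expand nonneg algebra_simps\<close>)
qed

text \<open>Continuity of the pairing with a test function, which makes weak derivatives closed under limits.\<close>

lemma L2_tendsto_integral_scaleR:
  fixes f :: "nat \<Rightarrow> 'a \<Rightarrow> 'b::euclidean_space"
  assumes \<phi>: "\<phi> \<in> L2 M" and f: "\<And>n. f n \<in> L2 M" "g \<in> L2 M" 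
    and lim: "(\<lambda>n. L2_norm M (f n - g)) \<longlonglongrightarrow> 0"
  shows "(\<lambda>n. LINT x|M. \<phi> x *\<^sub>R f n x) \<longlonglongrightarrow> (LINT x|M. \<phi> x *\<^sub>R g x)"
proof (rule LIM_zero_cancel, rule Lim_null_comparison)
  show "(\<lambda>n. L2_norm M \<phi> * L2_norm M (f n - g)) \<longlonglongrightarrow> 0"
    using tendsto_mult_right_zero[OF lim] by simp
  have "norm ((LINT x|M. \<phi> x *\<^sub>R f n x) - (LINT x|M. \<phi> x *\<^sub>R g x)) \<le> L2_norm M \<phi> * L2_norm M (f n - g)" for n
  proof -
    have d: "f n - g \<in> L2 M" using f by auto
    have a: "(\<lambda>x. \<bar>\<phi> x\<bar>) \<in> L2 M" "(\<lambda>x. norm ((f n - g) x)) \<in> L2 M"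
      using \<phi> d measurable_compose[OF L2_measurable[OF d] borel_measurable_norm] 
      by (auto simp: L2_def)
    have "(LINT x|M. \<phi> x *\<^sub>R f n x) - (LINT x|M. \<phi> x *\<^sub>R g x) = (LINT x|M. \<phi> x *\<^sub>R (f n - g) x)"
      using L2_integrable_scaleR[OF f(1) \<phi>] L2_integrable_scaleR[OF f(2) \<phi>]
      by (simp add: scaleR_diff_right)
    also have "norm \<dots> \<le> (LINT x|M. norm (\<phi> x *\<^sub>R (f n - g) x))" by (rule integral_norm_bound)
    also have "\<dots> = L2_inner M (\<lambda>x. \<bar>\<phi> x\<bar>) (\<lambda>x. norm ((f n - g) x))" by (simp add: L2_inner_def)
    also have "\<dots> \<le> L2_norm M (\<lambda>x. \<bar>\<phi> x\<bar>) * L2_norm M (\<lambda>x. norm ((f n - g) x))"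
      using L2.Cauchy_Schwarz[OF a] by linarith
    also have "\<dots> = L2_norm M \<phi> * L2_norm M (f n - g)" by (simp add: L2_norm_def)
    finally show ?thesis .
  qed
  then show "\<forall>\<^sub>F n in sequentially. norm ((LINT x|M. \<phi> x *\<^sub>R f n x) - (LINT x|M. \<phi> x *\<^sub>R g x)) 
      \<le> L2_norm M \<phi> * L2_norm M (f n - g)" by simp
qed

section \<open>Sobolev spaces on a bounded domain\<close>

lemma set_axes_subset_Basis: "set (map (\<lambda>j. axis j (1::real)) js) \<subseteq> (Basis :: (real^'d) set)"
  by (auto simp: axis_in_Basis_iff)

text \<open>The inner product whose norm is the Sobolev norm.\<close>

definition Sobolev_inner :: "(real^'d) set \<Rightarrow> nat \<Rightarrow> (real^'d \<Rightarrow> 'b::euclidean_space) \<Rightarrow> (real^'d \<Rightarrow> 'b) \<Rightarrow> real" where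
  "Sobolev_inner \<Omega> m v w = 
     (\<Sum>js | length js \<le> m. L2_inner (lebesgue_on \<Omega>) (weak_deriv \<Omega> js v) (weak_deriv \<Omega> js w))"

lemma finite_short_lists: "finite {js :: 'd::finite list. length js \<le> m}"
  using finite_lists_length_le[of "UNIV :: 'd set" m] by simp

locale bounded_domain =
  fixes \<Omega> :: "(real^'d) set"
  assumes open_dom: "open \<Omega>" and bounded_dom: "bounded \<Omega>"
begin

lemma dom_measurable: "\<Omega> \<in> sets lebesgue"
  using open_dom by auto

lemma finite_vol: "finite_measure (lebesgue_on \<Omega>)"
  using open_dom bounded_dom by (intro finite_measure_lebesgue_on lmeasurable_open)

lemma test_L2: "\<phi> \<in> test_functions \<Omega> \<Longrightarrow> iter_deriv (map (\<lambda>j. axis j 1) js) \<phi> \<in> L2 (lebesgue_on \<Omega>)"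
  "\<phi> \<in> test_functions \<Omega> \<Longrightarrow> \<phi> \<in> L2 (lebesgue_on \<Omega>)"
  using test_function_L2[OF _ set_axes_subset_Basis finite_vol, of \<phi>] 
    test_function_L2[OF _ set_axes_subset_Basis finite_vol, of \<phi> "[]"] by auto

lemma has_weak_deriv_lincomb:
  fixes v w g h :: "real^'d \<Rightarrow> 'b::euclidean_space"
  assumes L: "v \<in> L2 (lebesgue_on \<Omega>)" "w \<in> L2 (lebesgue_on \<Omega>)" "g \<in> L2 (lebesgue_on \<Omega>)" "h \<in> L2 (lebesgue_on \<Omega>)"
    and "has_weak_deriv \<Omega> js v g" "has_weak_deriv \<Omega> js w h"
  shows "has_weak_deriv \<Omega> js (a *\<^sub>R v + b *\<^sub>R w) (a *\<^sub>R g + b *\<^sub>R h)"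
  unfolding has_weak_deriv_def
proof
  fix \<phi> assume \<phi>: "\<phi> \<in> test_functions \<Omega>"
  have lin: "(LINT x|lebesgue_on \<Omega>. f x *\<^sub>R (a *\<^sub>R p + b *\<^sub>R q) x) 
      = a *\<^sub>R (LINT x|lebesgue_on \<Omega>. f x *\<^sub>R p x) + b *\<^sub>R (LINT x|lebesgue_on \<Omega>. f x *\<^sub>R q x)"
    if "f \<in> L2 (lebesgue_on \<Omega>)" "p \<in> L2 (lebesgue_on \<Omega>)" "q \<in> L2 (lebesgue_on \<Omega>)" 
    for f and p q :: "real^'d \<Rightarrow> 'b"
  proof -
    have "(\<lambda>x. f x *\<^sub>R (a *\<^sub>R p + b *\<^sub>R q) x) = (\<lambda>x. a *\<^sub>R (f x *\<^sub>R p x) + b *\<^sub>R (f x *\<^sub>R q x))"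
      by (simp add: fun_eq_iff algebra_simps)
    then show ?thesis using L2_integrable_scaleR[OF that(2,1)] L2_integrable_scaleR[OF that(3,1)]
      by (simp del: scaleR_scaleR)
  qed
  show "(LINT x|lebesgue_on \<Omega>. iter_deriv (map (\<lambda>j. axis j 1) js) \<phi> x *\<^sub>R (a *\<^sub>R v + b *\<^sub>R w) x) =
        (- 1) ^ length js *\<^sub>R (LINT x|lebesgue_on \<Omega>. \<phi> x *\<^sub>R (a *\<^sub>R g + b *\<^sub>R h) x)"
    using assms \<phi> by (simp only: lin test_L2 has_weak_deriv_def) (simp add: scaleR_add_right mult.commute)
qed

text \<open>Both candidates have the same integrals against test functions, so the fundamental lemma applies.\<close>

lemma has_weak_deriv_unique:
  fixes v g :: "real^'d \<Rightarrow> 'b::euclidean_space"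
  assumes "g \<in> L2 (lebesgue_on \<Omega>)" "h \<in> L2 (lebesgue_on \<Omega>)" 
    and "has_weak_deriv \<Omega> js v g" "has_weak_deriv \<Omega> js v h"
  shows "AE x in lebesgue_on \<Omega>. g x = h x"
proof -
  have "AE x in lebesgue_on \<Omega>. g x - h x = 0"
  proof (rule fundamental_lemma[OF open_dom])
    show "integrable (lebesgue_on \<Omega>) (\<lambda>x. g x - h x)"
      using assms L2_integrable finite_vol by (intro Bochner_Integration.integrable_diff) auto
    fix \<phi> assume \<phi>: "\<phi> \<in> test_functions \<Omega>"
    have "(- 1) ^ length js *\<^sub>R (LINT x|lebesgue_on \<Omega>. \<phi> x *\<^sub>R g x) = (- 1) ^ length js *\<^sub>R (LINT x|lebesgue_on \<Omega>. \<phi> x *\<^sub>R h x)"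
      using assms(3,4)[unfolded has_weak_deriv_def, rule_format, OF \<phi>] by simp
    then show "(LINT x|lebesgue_on \<Omega>. \<phi> x *\<^sub>R (g x - h x)) = 0"
      using L2_integrable_scaleR[OF assms(1) test_L2(2)[OF \<phi>]] L2_integrable_scaleR[OF assms(2) test_L2(2)[OF \<phi>]]
      by (simp add: scaleR_diff_right)
  qed
  then show ?thesis by simp
qed

lemma has_weak_deriv_limit:
  fixes v g :: "nat \<Rightarrow> real^'d \<Rightarrow> 'b::euclidean_space"
  assumes L: "\<And>n. v n \<in> L2 (lebesgue_on \<Omega>)" "\<And>n. g n \<in> L2 (lebesgue_on \<Omega>)" 
      "v' \<in> L2 (lebesgue_on \<Omega>)" "g' \<in> L2 (lebesgue_on \<Omega>)"
    and lim: "(\<lambda>n. L2_norm (lebesgue_on \<Omega>) (v n - v')) \<longlonglongrightarrow> 0" "(\<lambda>n. L2_norm (lebesgue_on \<Omega>) (g n - g')) \<longlonglongrightarrow> 0"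
    and weak: "\<And>n. has_weak_deriv \<Omega> js (v n) (g n)"
  shows "has_weak_deriv \<Omega> js v' g'"
  unfolding has_weak_deriv_def
proof
  fix \<phi> assume \<phi>: "\<phi> \<in> test_functions \<Omega>"
  let ?D = "iter_deriv (map (\<lambda>j. axis j 1) js) \<phi>"
  have "(\<lambda>n. LINT x|lebesgue_on \<Omega>. ?D x *\<^sub>R v n x) \<longlonglongrightarrow> (LINT x|lebesgue_on \<Omega>. ?D x *\<^sub>R v' x)"
    by (rule L2_tendsto_integral_scaleR[OF test_L2(1)[OF \<phi>] L(1) L(3) lim(1)])
  moreover have "(\<lambda>n. LINT x|lebesgue_on \<Omega>. \<phi> x *\<^sub>R g n x) \<longlonglongrightarrow> (LINT x|lebesgue_on \<Omega>. \<phi> x *\<^sub>R g' x)"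
    by (rule L2_tendsto_integral_scaleR[OF test_L2(2)[OF \<phi>] L(2) L(4) lim(2)])
  then have "(\<lambda>n. (- 1) ^ length js *\<^sub>R (LINT x|lebesgue_on \<Omega>. \<phi> x *\<^sub>R g n x)) \<longlonglongrightarrow>
      (- 1) ^ length js *\<^sub>R (LINT x|lebesgue_on \<Omega>. \<phi> x *\<^sub>R g' x)" 
    by (intro tendsto_intros)
  ultimately show "(LINT x|lebesgue_on \<Omega>. ?D x *\<^sub>R v' x) = (- 1) ^ length js *\<^sub>R (LINT x|lebesgue_on \<Omega>. \<phi> x *\<^sub>R g' x)"
    using weak \<phi> unfolding has_weak_deriv_def by (simp add: LIMSEQ_unique)
qed

text \<open>The defining identity contains the function only under an integral. Hence equal almost everywhere
  means equal derivatives, even as chosen representatives.\<close>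

lemma has_weak_deriv_cong:
  assumes "AE x in lebesgue_on \<Omega>. v x = w x" 
    "v \<in> borel_measurable (lebesgue_on \<Omega>)" "w \<in> borel_measurable (lebesgue_on \<Omega>)"
  shows "has_weak_deriv \<Omega> js v = has_weak_deriv \<Omega> js w"
proof -
  note [measurable] = assms(2,3)
  have "(LINT x|lebesgue_on \<Omega>. iter_deriv (map (\<lambda>j. axis j 1) js) \<phi> x *\<^sub>R v x) 
      = (LINT x|lebesgue_on \<Omega>. iter_deriv (map (\<lambda>j. axis j 1) js) \<phi> x *\<^sub>R w x)" 
    if "\<phi> \<in> test_functions \<Omega>" for \<phi>
  proof -
    have [measurable]: "iter_deriv (map (\<lambda>j. axis j 1) js) \<phi> \<in> borel_measurable (lebesgue_on \<Omega>)"
      using test_L2(1)[OF that] by (rule L2_measurable)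
    show ?thesis by (rule integral_cong_AE) (use assms in auto)
  qed
  then show ?thesis unfolding has_weak_deriv_def by (auto simp: fun_eq_iff)
qed

lemma weak_deriv_cong:
  assumes "AE x in lebesgue_on \<Omega>. v x = w x" 
    "v \<in> borel_measurable (lebesgue_on \<Omega>)" "w \<in> borel_measurable (lebesgue_on \<Omega>)"
  shows "weak_deriv \<Omega> js v = weak_deriv \<Omega> js w"
  unfolding weak_deriv_def has_weak_deriv_cong[OF assms] ..

lemma Sobolev_cong:
  assumes "AE x in lebesgue_on \<Omega>. v x = w x" "v \<in> Sobolev \<Omega> m" "w \<in> borel_measurable (lebesgue_on \<Omega>)"
  shows "w \<in> Sobolev \<Omega> m"
proof -
  have v: "v \<in> L2 (lebesgue_on \<Omega>)" using assms by (simp add: Sobolev_def)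
  have "w \<in> L2 (lebesgue_on \<Omega>)" by (rule L2_cong_AE[OF assms(1) v assms(3)])
  then show ?thesis using assms has_weak_deriv_cong[OF assms(1) L2_measurable[OF v] assms(3)]
    by (simp add: Sobolev_def)
qed

lemma Sobolev_L2: "v \<in> Sobolev \<Omega> m \<Longrightarrow> v \<in> L2 (lebesgue_on \<Omega>)"
  by (simp add: Sobolev_def)

lemma Sobolev_mono: "m \<le> n \<Longrightarrow> Sobolev \<Omega> n \<subseteq> Sobolev \<Omega> m"
  by (auto simp: Sobolev_def)

lemma weak_deriv_Sobolev:
  assumes "v \<in> Sobolev \<Omega> m" "length js \<le> m"
  shows "weak_deriv \<Omega> js v \<in> L2 (lebesgue_on \<Omega>)" "has_weak_deriv \<Omega> js v (weak_deriv \<Omega> js v)"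
  using someI_ex[of "\<lambda>g. g \<in> L2 (lebesgue_on \<Omega>) \<and> has_weak_deriv \<Omega> js v g"] assms
  unfolding weak_deriv_def Sobolev_def by blast+

lemma weak_deriv_AE:
  assumes "g \<in> L2 (lebesgue_on \<Omega>)" "has_weak_deriv \<Omega> js v g"
  shows "weak_deriv \<Omega> js v \<in> L2 (lebesgue_on \<Omega>)" "AE x in lebesgue_on \<Omega>. weak_deriv \<Omega> js v x = g x"
proof -
  have *: "weak_deriv \<Omega> js v \<in> L2 (lebesgue_on \<Omega>) \<and> has_weak_deriv \<Omega> js v (weak_deriv \<Omega> js v)"
    unfolding weak_deriv_def by (rule someI[of _ g]) (use assms in blast)
  then show "weak_deriv \<Omega> js v \<in> L2 (lebesgue_on \<Omega>)" 
    "AE x in lebesgue_on \<Omega>. weak_deriv \<Omega> js v x = g x"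
    using has_weak_deriv_unique assms by blast+
qed

lemma has_weak_deriv_Nil: "has_weak_deriv \<Omega> [] v v"
  by (simp add: has_weak_deriv_def)

lemma subspace_Sobolev: "subspace (Sobolev \<Omega> m :: (real^'d \<Rightarrow> 'b::euclidean_space) set)"
proof -
  have lin: "a *\<^sub>R v + b *\<^sub>R w \<in> Sobolev \<Omega> m" if v: "v \<in> Sobolev \<Omega> m" and w: "w \<in> Sobolev \<Omega> m" 
    for a b and v w :: "real^'d \<Rightarrow> 'b"
  proof -
    have "\<exists>g\<in>L2 (lebesgue_on \<Omega>). has_weak_deriv \<Omega> js (a *\<^sub>R v + b *\<^sub>R w) g" if "length js \<le> m" for js
    proof
      note v' = weak_deriv_Sobolev[OF v that] and w' = weak_deriv_Sobolev[OF w that]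
      show "has_weak_deriv \<Omega> js (a *\<^sub>R v + b *\<^sub>R w) (a *\<^sub>R weak_deriv \<Omega> js v + b *\<^sub>R weak_deriv \<Omega> js w)"
        using v w v' w' by (intro has_weak_deriv_lincomb) (auto simp: Sobolev_L2)
      show "a *\<^sub>R weak_deriv \<Omega> js v + b *\<^sub>R weak_deriv \<Omega> js w \<in> L2 (lebesgue_on \<Omega>)"
        using v' w' by auto
    qed
    moreover have "a *\<^sub>R v + b *\<^sub>R w \<in> L2 (lebesgue_on \<Omega>)" using v w Sobolev_L2 by blast
    ultimately show ?thesis unfolding Sobolev_def by blast
  qed
  have "has_weak_deriv \<Omega> js 0 (0 :: real^'d \<Rightarrow> 'b)" for js by (simp add: has_weak_deriv_def)
  then have 0: "(0 :: real^'d \<Rightarrow> 'b) \<in> Sobolev \<Omega> m" unfolding Sobolev_def using L2.closed(1) by blast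
  show ?thesis
  proof (rule subspaceI)
    fix v w :: "real^'d \<Rightarrow> 'b" and c assume *: "v \<in> Sobolev \<Omega> m" "w \<in> Sobolev \<Omega> m"
    show "v + w \<in> Sobolev \<Omega> m" using lin[OF *, of 1 1] by simp
  next
    fix v :: "real^'d \<Rightarrow> 'b" and c assume *: "v \<in> Sobolev \<Omega> m"
    show "c *\<^sub>R v \<in> Sobolev \<Omega> m" using lin[OF * *, of c 0] by simp
  qed (rule 0)
qed

lemma ae_linear_weak_deriv:
  assumes "length js \<le> m" 
  shows "ae_linear (Sobolev \<Omega> m :: (real^'d \<Rightarrow> 'b::euclidean_space) set) (lebesgue_on \<Omega>) (weak_deriv \<Omega> js)"
proof -
  have lin: "AE x in lebesgue_on \<Omega>. weak_deriv \<Omega> js (a *\<^sub>R v + b *\<^sub>R w) x = (a *\<^sub>R weak_deriv \<Omega> js v + b *\<^sub>R weak_deriv \<Omega> js w) x"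
    if v: "v \<in> Sobolev \<Omega> m" and w: "w \<in> Sobolev \<Omega> m" for v w :: "real^'d \<Rightarrow> 'b" and a b
  proof (rule weak_deriv_AE)
    note v' = weak_deriv_Sobolev[OF v assms] and w' = weak_deriv_Sobolev[OF w assms]
    show "has_weak_deriv \<Omega> js (a *\<^sub>R v + b *\<^sub>R w) (a *\<^sub>R weak_deriv \<Omega> js v + b *\<^sub>R weak_deriv \<Omega> js w)"
      using v w v' w' by (intro has_weak_deriv_lincomb) (auto simp: Sobolev_L2)
    show "a *\<^sub>R weak_deriv \<Omega> js v + b *\<^sub>R weak_deriv \<Omega> js w \<in> L2 (lebesgue_on \<Omega>)"
      using v' w' by auto
  qed
  show ?thesis unfolding ae_linear_def
  proof (intro conjI ballI allI)
    fix v w :: "real^'d \<Rightarrow> 'b" assume "v \<in> Sobolev \<Omega> m" "w \<in> Sobolev \<Omega> m"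
    from lin[OF this, of 1 1] show "AE t in lebesgue_on \<Omega>. weak_deriv \<Omega> js (v + w) t = weak_deriv \<Omega> js v t + weak_deriv \<Omega> js w t"
      by simp
  next
    fix v :: "real^'d \<Rightarrow> 'b" and c assume "v \<in> Sobolev \<Omega> m"
    from lin[OF this this, of c 0] show "AE t in lebesgue_on \<Omega>. weak_deriv \<Omega> js (c *\<^sub>R v) t = c *\<^sub>R weak_deriv \<Omega> js v t"
      by simp
  qed (use weak_deriv_Sobolev assms subspace_Sobolev in auto)
qed

lemma Sobolev_semi_inner: "semi_inner (Sobolev \<Omega> m) (Sobolev_inner \<Omega> m)"
  unfolding Sobolev_inner_def[abs_def]
  by (rule semi_inner_sum[OF subspace_Sobolev]) (auto intro: ae_linear_semi_inner ae_linear_weak_deriv)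

lemma Sobolev_norm_inner: "Sobolev_norm \<Omega> m = semi_inner.nrm (Sobolev_inner \<Omega> m)"
  by (simp add: fun_eq_iff semi_inner.nrm_def[OF Sobolev_semi_inner] Sobolev_norm_def Sobolev_inner_def
      L2_norm_inner L2_inner_def flip: power2_norm_eq_inner)

sublocale Sob: function_semi_inner "Sobolev \<Omega> m" "Sobolev_inner \<Omega> m"
  rewrites "semi_inner.nrm (Sobolev_inner \<Omega> m) = Sobolev_norm \<Omega> m" for m
  by (simp_all add: function_semi_inner_def Sobolev_semi_inner Sobolev_norm_inner)

lemma L2_norm_weak_deriv_le:
  assumes "length js \<le> m"
  shows "L2_norm (lebesgue_on \<Omega>) (weak_deriv \<Omega> js v) \<le> Sobolev_norm \<Omega> m v"
proof -
  have "(L2_norm (lebesgue_on \<Omega>) (weak_deriv \<Omega> js v))\<^sup>2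
      \<le> (\<Sum>js | length js \<le> m. (L2_norm (lebesgue_on \<Omega>) (weak_deriv \<Omega> js v))\<^sup>2)"
    using assms finite_short_lists
    by (intro member_le_sum[where f="\<lambda>js. (L2_norm (lebesgue_on \<Omega>) (weak_deriv \<Omega> js v))\<^sup>2"]) auto
  then show ?thesis unfolding Sobolev_norm_def by (simp add: real_le_rsqrt)
qed

lemma Sobolev_norm_nonneg [simp]: "0 \<le> Sobolev_norm \<Omega> m v"
  unfolding Sobolev_norm_def by (simp add: sum_nonneg)

lemma L2_norm_le_Sobolev_norm:
  assumes "v \<in> L2 (lebesgue_on \<Omega>)"
  shows "L2_norm (lebesgue_on \<Omega>) v \<le> Sobolev_norm \<Omega> m v"
proof -
  have "L2_norm (lebesgue_on \<Omega>) v = L2_norm (lebesgue_on \<Omega>) (weak_deriv \<Omega> [] v)"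
    using weak_deriv_AE[OF assms has_weak_deriv_Nil] assms
    by (intro L2_norm_cong_AE) (auto simp: L2_def)
  also have "\<dots> \<le> Sobolev_norm \<Omega> m v" by (rule L2_norm_weak_deriv_le) simp
  finally show ?thesis .
qed

lemma Sobolev_norm_cong:
  assumes "AE x in lebesgue_on \<Omega>. v x = w x" 
    "v \<in> borel_measurable (lebesgue_on \<Omega>)" "w \<in> borel_measurable (lebesgue_on \<Omega>)"
  shows "Sobolev_norm \<Omega> m v = Sobolev_norm \<Omega> m w"
  unfolding Sobolev_norm_def weak_deriv_cong[OF assms] ..

text \<open>All weak derivatives up to order \<open>m\<close> converge in $L^2$, and the limits are the weak derivatives of the
  limit because weak derivatives are closed under limits.\<close>

lemma Sobolev_complete:
  fixes v :: "nat \<Rightarrow> real^'d \<Rightarrow> 'b::euclidean_space"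
  assumes v: "\<And>n. v n \<in> Sobolev \<Omega> m"
    and cauchy: "\<And>e. e > 0 \<Longrightarrow> \<exists>N. \<forall>i\<ge>N. \<forall>j\<ge>N. Sobolev_norm \<Omega> m (v i - v j) < e"
  shows "\<exists>z\<in>Sobolev \<Omega> m. (\<lambda>n. Sobolev_norm \<Omega> m (v n - z)) \<longlonglongrightarrow> 0"
proof -
  let ?M = "lebesgue_on \<Omega>"
  have diff_AE: "AE x in ?M. weak_deriv \<Omega> js (w - z) x = (weak_deriv \<Omega> js w - weak_deriv \<Omega> js z) x"
    if "length js \<le> m" "w \<in> Sobolev \<Omega> m" "z \<in> Sobolev \<Omega> m" for js and w z :: "real^'d \<Rightarrow> 'b"
    using weak_deriv_AE(2)[OF _ has_weak_deriv_lincomb[of w z _ _ js 1 "-1"]] 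
      weak_deriv_Sobolev[OF that(2,1)] weak_deriv_Sobolev[OF that(3,1)] that Sobolev_L2
    by auto
  have diff: "L2_norm ?M (weak_deriv \<Omega> js w - weak_deriv \<Omega> js z) = L2_norm ?M (weak_deriv \<Omega> js (w - z))"
    if "length js \<le> m" "w \<in> Sobolev \<Omega> m" "z \<in> Sobolev \<Omega> m" for js and w z :: "real^'d \<Rightarrow> 'b"
  proof (rule L2_norm_cong_AE)
    show "AE x in ?M. (weak_deriv \<Omega> js w - weak_deriv \<Omega> js z) x = weak_deriv \<Omega> js (w - z) x"
      using diff_AE[OF that] by eventually_elim simp
    have "weak_deriv \<Omega> js w - weak_deriv \<Omega> js z \<in> L2 ?M"
      using weak_deriv_Sobolev[OF that(2,1)] weak_deriv_Sobolev[OF that(3,1)] by auto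
    then show "weak_deriv \<Omega> js w - weak_deriv \<Omega> js z \<in> borel_measurable ?M" by (rule L2_measurable)
    show "weak_deriv \<Omega> js (w - z) \<in> borel_measurable ?M"
      using weak_deriv_Sobolev(1)[OF Sob.closed(3)[OF that(2,3)] that(1)] by (rule L2_measurable)
  qed
  have "\<exists>g\<in>L2 ?M. (\<lambda>n. L2_norm ?M (weak_deriv \<Omega> js (v n) - g)) \<longlonglongrightarrow> 0" if "length js \<le> m" for js
  proof (rule L2_complete[OF finite_vol])
    show "weak_deriv \<Omega> js (v n) \<in> L2 ?M" for n using weak_deriv_Sobolev v that by blast
    fix e :: real assume "e > 0"
    then obtain N where N: "\<forall>i\<ge>N. \<forall>j\<ge>N. Sobolev_norm \<Omega> m (v i - v j) < e" using cauchy by blast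
    have "L2_norm ?M (weak_deriv \<Omega> js (v i) - weak_deriv \<Omega> js (v j)) < e" if "i \<ge> N" "j \<ge> N" for i j
      using N that diff[OF \<open>length js \<le> m\<close> v v] L2_norm_weak_deriv_le[OF \<open>length js \<le> m\<close>]
      by (metis le_less_trans)
    then show "\<exists>N. \<forall>i\<ge>N. \<forall>j\<ge>N. L2_norm ?M (weak_deriv \<Omega> js (v i) - weak_deriv \<Omega> js (v j)) < e" by blast
  qed
  then obtain g where g: "\<And>js. length js \<le> m \<Longrightarrow> g js \<in> L2 ?M"
    "\<And>js. length js \<le> m \<Longrightarrow> (\<lambda>n. L2_norm ?M (weak_deriv \<Omega> js (v n) - g js)) \<longlonglongrightarrow> 0" by metis
  define z where "z = g []"
  have zL: "z \<in> L2 ?M" using g(1) by (simp add: z_def)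
  have "L2_norm ?M (weak_deriv \<Omega> [] (v n) - z) = L2_norm ?M (v n - z)" for n
    using weak_deriv_AE[OF Sobolev_L2[OF v] has_weak_deriv_Nil, of n] Sobolev_L2[OF v, of n] zL
      L2_measurable[OF L2.closed(3)[OF _ zL]]
    by (intro L2_norm_cong_AE) auto
  then have zlim: "(\<lambda>n. L2_norm ?M (v n - z)) \<longlonglongrightarrow> 0" using g(2)[of "[]"] by (simp add: z_def)
  have wd: "has_weak_deriv \<Omega> js z (g js)" if "length js \<le> m" for js
    by (rule has_weak_deriv_limit[OF Sobolev_L2[OF v] weak_deriv_Sobolev(1)[OF v that] zL g(1)[OF that] zlim g(2)[OF that]
          weak_deriv_Sobolev(2)[OF v that]])
  have z: "z \<in> Sobolev \<Omega> m" using wd g(1) zL unfolding Sobolev_def by blast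
  have lim: "(\<lambda>n. L2_norm ?M (weak_deriv \<Omega> js (v n - z))) \<longlonglongrightarrow> 0" if "length js \<le> m" for js
  proof -
    have "L2_norm ?M (weak_deriv \<Omega> js (v n - z)) = L2_norm ?M (weak_deriv \<Omega> js (v n) - g js)" for n
    proof -
      have "L2_norm ?M (weak_deriv \<Omega> js (v n) - weak_deriv \<Omega> js z) = L2_norm ?M (weak_deriv \<Omega> js (v n) - g js)"
      proof (rule L2_norm_cong_AE)
        show "AE x in ?M. (weak_deriv \<Omega> js (v n) - weak_deriv \<Omega> js z) x = (weak_deriv \<Omega> js (v n) - g js) x"
          using weak_deriv_AE(2)[OF g(1)[OF that] wd[OF that]] by eventually_elim simp
      qed (use L2_measurable[OF L2.closed(3)] weak_deriv_Sobolev(1)[OF v that] weak_deriv_Sobolev(1)[OF z that] g(1)[OF that] in blast)+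
      then show ?thesis using diff[OF that v z] by simp
    qed
    then show ?thesis using g(2)[OF that] by simp
  qed
  have "(\<lambda>n. \<Sum>js | length js \<le> m. (L2_norm ?M (weak_deriv \<Omega> js (v n - z)))\<^sup>2) \<longlonglongrightarrow> 0"
    using tendsto_power[OF lim, of _ 2] by (intro tendsto_null_sum) auto
  then have "(\<lambda>n. Sobolev_norm \<Omega> m (v n - z)) \<longlonglongrightarrow> sqrt 0"
    unfolding Sobolev_norm_def by (rule tendsto_real_sqrt)
  then show ?thesis using z by auto
qed

end

section \<open>Traces and finite element spaces\<close>

lemma sets_surface: "sets (surface \<Gamma>) = sets (restrict_space borel \<Gamma>)"
  unfolding surface_def hausdorff_measure_def
  by (rule sets_restrict_space_cong) (simp add: sets_measure_of_conv sets.sigma_sets_eq[of borel, simplified])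

lemma borel_imp_surface:
  "f \<in> borel_measurable borel \<Longrightarrow> f \<in> borel_measurable (surface \<Gamma>)"
  using measurable_cong_sets[OF sets_surface refl] measurable_restrict_space1 by blast

context bounded_domain
begin

text \<open>The triangle inequality for the smooth functions that approximate a function in the definition of
  its trace requires them to belong to the space.\<close>

lemma smooth_in_Sobolev_1:
  fixes w :: "real^'d \<Rightarrow> 'b::euclidean_space"
  assumes w: "smooth w" shows "w \<in> Sobolev \<Omega> 1"
proof -
  have L: "iter_deriv vs w \<in> L2 (lebesgue_on \<Omega>)" if "set vs \<subseteq> Basis" for vs
  proof -
    have "compact (iter_deriv vs w ` closure \<Omega>)"
      using bounded_dom by (intro compact_continuous_image smooth_continuous w that) (simp add: compact_closure)
    then have "bounded (iter_deriv vs w ` closure \<Omega>)" by (rule compact_imp_bounded)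
    then obtain C where C: "\<forall>x\<in>closure \<Omega>. norm (iter_deriv vs w x) \<le> C" unfolding bounded_iff by blast
    show ?thesis
    proof (rule L2_bounded[OF finite_vol])
      show "iter_deriv vs w \<in> borel_measurable (lebesgue_on \<Omega>)"
        by (intro borel_imp_lebesgue_on borel_measurable_continuous_onI smooth_continuous w that)
      show "norm (iter_deriv vs w x) \<le> C" if "x \<in> space (lebesgue_on \<Omega>)" for x
        using C that closure_subset[of \<Omega>] by auto
    qed
  qed
  have "\<exists>g\<in>L2 (lebesgue_on \<Omega>). has_weak_deriv \<Omega> js w g" if "length js \<le> 1" for js
  proof (cases js)
    case Nil
    then show ?thesis using L[of "[]"] has_weak_deriv_Nil by auto
  next
    case (Cons j js')
    then have js: "js = [j]" using that by simp
    have ax: "axis j (1::real) \<in> Basis" by (simp add: axis_in_Basis_iff)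
    have "has_weak_deriv \<Omega> [j] w (iter_deriv [axis j 1] w)"
      using integration_by_parts_test_function[OF dom_measurable _ w ax]
      unfolding has_weak_deriv_def by simp
    then show ?thesis using L[of "[axis j 1]"] ax js by auto
  qed
  then show ?thesis using L[of "[]"] unfolding Sobolev_def by auto
qed

lemma is_trace_iff:
  "is_trace \<Omega> v \<gamma> \<longleftrightarrow> \<gamma> \<in> L2 (surface (frontier \<Omega>)) \<and>
    (\<exists>w. (\<forall>j. smooth (w j)) \<and> (\<lambda>j. Sobolev_norm \<Omega> 1 (w j - v)) \<longlonglongrightarrow> 0 \<and>
       (\<lambda>j. \<integral>\<^sup>+x. ennreal ((norm (w j x - \<gamma> x))\<^sup>2) \<partial>surface (frontier \<Omega>)) \<longlonglongrightarrow> 0)"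
  by (simp add: is_trace_def fun_diff_def)

text \<open>The linear combinations of the approximating functions converge in $H^1(\Omega)$ and on the boundary.
  Hence the functions with a vanishing trace form a subspace.\<close>

lemma is_trace_lincomb:
  fixes v v' :: "real^'d \<Rightarrow> 'b::euclidean_space"
  assumes v: "v \<in> Sobolev \<Omega> 1" "is_trace \<Omega> v \<gamma>" and v': "v' \<in> Sobolev \<Omega> 1" "is_trace \<Omega> v' \<gamma>'"
  shows "is_trace \<Omega> (a *\<^sub>R v + b *\<^sub>R v') (a *\<^sub>R \<gamma> + b *\<^sub>R \<gamma>')"
proof -
  let ?S = "surface (frontier \<Omega>)"
  obtain w where w: "\<And>j. smooth (w j)" "(\<lambda>j. Sobolev_norm \<Omega> 1 (w j - v)) \<longlonglongrightarrow> 0"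
    "(\<lambda>j. \<integral>\<^sup>+x. ennreal ((norm (w j x - \<gamma> x))\<^sup>2) \<partial>?S) \<longlonglongrightarrow> 0" and \<gamma>: "\<gamma> \<in> L2 ?S"
    using v(2) unfolding is_trace_iff by blast
  obtain w' where w': "\<And>j. smooth (w' j)" "(\<lambda>j. Sobolev_norm \<Omega> 1 (w' j - v')) \<longlonglongrightarrow> 0"
    "(\<lambda>j. \<integral>\<^sup>+x. ennreal ((norm (w' j x - \<gamma>' x))\<^sup>2) \<partial>?S) \<longlonglongrightarrow> 0" and \<gamma>': "\<gamma>' \<in> L2 ?S"
    using v'(2) unfolding is_trace_iff by blast
  let ?w = "\<lambda>j. a *\<^sub>R w j + b *\<^sub>R w' j"
  have sm: "smooth (?w j)" for j
    using subspace_smooth w(1) w'(1) by (metis mem_Collect_eq subspace_add subspace_scale)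
  have "(\<lambda>j. Sobolev_norm \<Omega> 1 (?w j - (a *\<^sub>R v + b *\<^sub>R v'))) \<longlonglongrightarrow> 0"
  proof (rule Lim_null_comparison)
    show "(\<lambda>j. \<bar>a\<bar> * Sobolev_norm \<Omega> 1 (w j - v) + \<bar>b\<bar> * Sobolev_norm \<Omega> 1 (w' j - v')) \<longlonglongrightarrow> 0"
      by (intro tendsto_add_zero tendsto_mult_right_zero w w')
    have "norm (Sobolev_norm \<Omega> 1 (?w j - (a *\<^sub>R v + b *\<^sub>R v'))) 
        \<le> \<bar>a\<bar> * Sobolev_norm \<Omega> 1 (w j - v) + \<bar>b\<bar> * Sobolev_norm \<Omega> 1 (w' j - v')" for j
    proof -
      have d: "w j - v \<in> Sobolev \<Omega> 1" "w' j - v' \<in> Sobolev \<Omega> 1"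
        using v(1) v'(1) smooth_in_Sobolev_1[OF w(1)] smooth_in_Sobolev_1[OF w'(1)] by blast+
      have "?w j - (a *\<^sub>R v + b *\<^sub>R v') = a *\<^sub>R (w j - v) + b *\<^sub>R (w' j - v')"
        by (simp add: algebra_simps)
      then show ?thesis
        using Sob.triangle[of "a *\<^sub>R (w j - v)" 1 "b *\<^sub>R (w' j - v')"] d
          Sob.nrm_scale[OF d(1)] Sob.nrm_scale[OF d(2)] by auto
    qed
    then show "\<forall>\<^sub>F j in sequentially. norm (Sobolev_norm \<Omega> 1 (?w j - (a *\<^sub>R v + b *\<^sub>R v'))) 
        \<le> \<bar>a\<bar> * Sobolev_norm \<Omega> 1 (w j - v) + \<bar>b\<bar> * Sobolev_norm \<Omega> 1 (w' j - v')" by simp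
  qed
  moreover have "(\<lambda>j. \<integral>\<^sup>+x. ennreal ((norm (?w j x - (a *\<^sub>R \<gamma> + b *\<^sub>R \<gamma>') x))\<^sup>2) \<partial>?S) \<longlonglongrightarrow> 0"
  proof -
    let ?u = "\<lambda>j. ennreal (2 * a\<^sup>2) * (\<integral>\<^sup>+x. ennreal ((norm (w j x - \<gamma> x))\<^sup>2) \<partial>?S)
      + ennreal (2 * b\<^sup>2) * (\<integral>\<^sup>+x. ennreal ((norm (w' j x - \<gamma>' x))\<^sup>2) \<partial>?S)"
    have "?u \<longlonglongrightarrow> ennreal (2 * a\<^sup>2) * 0 + ennreal (2 * b\<^sup>2) * 0"
      by (intro tendsto_add ennreal_tendsto_cmult w w') auto
    then have u: "?u \<longlonglongrightarrow> 0" by simp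
    have meas: "w j \<in> borel_measurable ?S" "w' j \<in> borel_measurable ?S" for j
      using smooth_continuous[OF w(1), of "[]"] smooth_continuous[OF w'(1), of "[]"]
      by (auto intro!: borel_imp_surface borel_measurable_continuous_onI)
    note [measurable] = meas L2_measurable[OF \<gamma>] L2_measurable[OF \<gamma>']
    have "(\<integral>\<^sup>+x. ennreal ((norm (?w j x - (a *\<^sub>R \<gamma> + b *\<^sub>R \<gamma>') x))\<^sup>2) \<partial>?S) \<le> ?u j" for j
    proof -
      have "(norm (?w j x - (a *\<^sub>R \<gamma> + b *\<^sub>R \<gamma>') x))\<^sup>2 
          \<le> 2 * a\<^sup>2 * (norm (w j x - \<gamma> x))\<^sup>2 + 2 * b\<^sup>2 * (norm (w' j x - \<gamma>' x))\<^sup>2" for x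
      proof -
        have e: "?w j x - (a *\<^sub>R \<gamma> + b *\<^sub>R \<gamma>') x = a *\<^sub>R (w j x - \<gamma> x) + b *\<^sub>R (w' j x - \<gamma>' x)"
          by (simp add: algebra_simps)
        have "norm (?w j x - (a *\<^sub>R \<gamma> + b *\<^sub>R \<gamma>') x) \<le> \<bar>a\<bar> * norm (w j x - \<gamma> x) + \<bar>b\<bar> * norm (w' j x - \<gamma>' x)"
          unfolding e using norm_triangle_ineq[of "a *\<^sub>R (w j x - \<gamma> x)" "b *\<^sub>R (w' j x - \<gamma>' x)"] by simp
        then have "(norm (?w j x - (a *\<^sub>R \<gamma> + b *\<^sub>R \<gamma>') x))\<^sup>2 \<le> (\<bar>a\<bar> * norm (w j x - \<gamma> x) + \<bar>b\<bar> * norm (w' j x - \<gamma>' x))\<^sup>2"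
          by (rule power_mono) simp
        also have "\<dots> \<le> 2 * (\<bar>a\<bar> * norm (w j x - \<gamma> x))\<^sup>2 + 2 * (\<bar>b\<bar> * norm (w' j x - \<gamma>' x))\<^sup>2"
          using sum_squares_bound[of "\<bar>a\<bar> * norm (w j x - \<gamma> x)" "\<bar>b\<bar> * norm (w' j x - \<gamma>' x)"]
          by (simp add: power2_sum)
        finally show ?thesis by (simp add: power_mult_distrib)
      qed
      then have "(\<integral>\<^sup>+x. ennreal ((norm (?w j x - (a *\<^sub>R \<gamma> + b *\<^sub>R \<gamma>') x))\<^sup>2) \<partial>?S)
          \<le> (\<integral>\<^sup>+x. ennreal (2 * a\<^sup>2 * (norm (w j x - \<gamma> x))\<^sup>2 + 2 * b\<^sup>2 * (norm (w' j x - \<gamma>' x))\<^sup>2) \<partial>?S)"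
        by (intro nn_integral_mono ennreal_leI)
      also have "\<dots> = (\<integral>\<^sup>+x. ennreal (2 * a\<^sup>2) * ennreal ((norm (w j x - \<gamma> x))\<^sup>2) + ennreal (2 * b\<^sup>2) * ennreal ((norm (w' j x - \<gamma>' x))\<^sup>2) \<partial>?S)"
        by (simp add: ennreal_mult)
      also have "\<dots> = ?u j" by (subst nn_integral_add) (auto simp: nn_integral_cmult)
      finally show ?thesis .
    qed
    then have le: "\<forall>\<^sub>F j in sequentially. (\<integral>\<^sup>+x. ennreal ((norm (?w j x - (a *\<^sub>R \<gamma> + b *\<^sub>R \<gamma>') x))\<^sup>2) \<partial>?S) \<le> ?u j" by simp
    show ?thesis by (rule tendsto_sandwich[OF _ le tendsto_const u]) simp
  qed
  ultimately show ?thesis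
    using sm \<gamma> \<gamma>' unfolding is_trace_iff by (intro conjI exI[of _ ?w]) blast+
qed

lemma Sobolev0_subset: "Sobolev0 \<Omega> m \<Gamma> \<subseteq> Sobolev \<Omega> m"
  by (auto simp: Sobolev0_def)

lemma subspace_Sobolev0:
  assumes "m \<ge> 1"
  shows "subspace (Sobolev0 \<Omega> m \<Gamma> :: (real^'d \<Rightarrow> 'b::euclidean_space) set)"
proof -
  have "smooth (0 :: real^'d \<Rightarrow> 'b)" using subspace_0[OF subspace_smooth] by simp
  then have 0: "is_trace \<Omega> (0 :: real^'d \<Rightarrow> 'b) 0"
    unfolding is_trace_iff by (intro conjI exI[of _ "\<lambda>_. 0"]) auto
  have lin: "a *\<^sub>R v + b *\<^sub>R w \<in> Sobolev0 \<Omega> m \<Gamma>" if v: "v \<in> Sobolev0 \<Omega> m \<Gamma>" and w: "w \<in> Sobolev0 \<Omega> m \<Gamma>" 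
    for a b and v w :: "real^'d \<Rightarrow> 'b"
  proof -
    obtain \<gamma> \<gamma>' where \<gamma>: "is_trace \<Omega> v \<gamma>" "AE x in surface \<Gamma>. \<gamma> x = 0" "is_trace \<Omega> w \<gamma>'" "AE x in surface \<Gamma>. \<gamma>' x = 0"
      using v w unfolding Sobolev0_def by blast
    have "v \<in> Sobolev \<Omega> 1" "w \<in> Sobolev \<Omega> 1" using v w Sobolev0_subset Sobolev_mono[OF assms] by blast+
    then have "is_trace \<Omega> (a *\<^sub>R v + b *\<^sub>R w) (a *\<^sub>R \<gamma> + b *\<^sub>R \<gamma>')" using \<gamma> is_trace_lincomb by blast
    moreover have "AE x in surface \<Gamma>. (a *\<^sub>R \<gamma> + b *\<^sub>R \<gamma>') x = 0" using \<gamma>(2,4) by eventually_elim simp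
    moreover have "a *\<^sub>R v + b *\<^sub>R w \<in> Sobolev \<Omega> m" using v w Sobolev0_subset by blast
    ultimately show ?thesis unfolding Sobolev0_def by blast
  qed
  show ?thesis
  proof (rule subspaceI)
    show "(0 :: real^'d \<Rightarrow> 'b) \<in> Sobolev0 \<Omega> m \<Gamma>" using 0 Sob.closed(1)[of m] by (auto simp: Sobolev0_def)
  next
    fix v w :: "real^'d \<Rightarrow> 'b" assume "v \<in> Sobolev0 \<Omega> m \<Gamma>" "w \<in> Sobolev0 \<Omega> m \<Gamma>"
    from lin[OF this, of 1 1] show "v + w \<in> Sobolev0 \<Omega> m \<Gamma>" by simp
  next
    fix v :: "real^'d \<Rightarrow> 'b" and c assume "v \<in> Sobolev0 \<Omega> m \<Gamma>"
    from lin[OF this this, of c 0] show "c *\<^sub>R v \<in> Sobolev0 \<Omega> m \<Gamma>" by simp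
  qed
qed

end

lemma subspace_polys: "subspace (polys k :: (real^'d \<Rightarrow> 'b::real_vector) set)"
proof (rule subspaceI)
  have "(0 :: real^'d \<Rightarrow> 'b) = (\<lambda>x. \<Sum>\<alpha> | (\<Sum>i\<in>UNIV. \<alpha> i) \<le> k. (\<Prod>i\<in>UNIV. (x $ i) ^ \<alpha> i) *\<^sub>R 0)"
    by (simp add: fun_eq_iff)
  then show "(0 :: real^'d \<Rightarrow> 'b) \<in> polys k" unfolding polys_def by (intro CollectI exI[of _ "\<lambda>_. 0"])
next
  fix p q :: "real^'d \<Rightarrow> 'b" assume "p \<in> polys k" "q \<in> polys k"
  then obtain c d where "p = (\<lambda>x. \<Sum>\<alpha> | (\<Sum>i\<in>UNIV. \<alpha> i) \<le> k. (\<Prod>i\<in>UNIV. (x $ i) ^ \<alpha> i) *\<^sub>R c \<alpha>)"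
    "q = (\<lambda>x. \<Sum>\<alpha> | (\<Sum>i\<in>UNIV. \<alpha> i) \<le> k. (\<Prod>i\<in>UNIV. (x $ i) ^ \<alpha> i) *\<^sub>R d \<alpha>)"
    unfolding polys_def by blast
  then have "p + q = (\<lambda>x. \<Sum>\<alpha> | (\<Sum>i\<in>UNIV. \<alpha> i) \<le> k. (\<Prod>i\<in>UNIV. (x $ i) ^ \<alpha> i) *\<^sub>R (c \<alpha> + d \<alpha>))"
    by (simp add: fun_eq_iff scaleR_add_right sum.distrib)
  then show "p + q \<in> polys k" unfolding polys_def by (intro CollectI exI)
next
  fix p :: "real^'d \<Rightarrow> 'b" and a assume "p \<in> polys k"
  then obtain c where "p = (\<lambda>x. \<Sum>\<alpha> | (\<Sum>i\<in>UNIV. \<alpha> i) \<le> k. (\<Prod>i\<in>UNIV. (x $ i) ^ \<alpha> i) *\<^sub>R c \<alpha>)"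
    unfolding polys_def by blast
  then have "a *\<^sub>R p = (\<lambda>x. \<Sum>\<alpha> | (\<Sum>i\<in>UNIV. \<alpha> i) \<le> k. (\<Prod>i\<in>UNIV. (x $ i) ^ \<alpha> i) *\<^sub>R (a *\<^sub>R c \<alpha>))"
    by (simp add: fun_eq_iff scaleR_sum_right mult.commute)
  then show "a *\<^sub>R p \<in> polys k" unfolding polys_def by (intro CollectI exI)
qed

lemma subspace_lagrange_space: "subspace (lagrange_space \<Omega> \<T> k :: (real^'d \<Rightarrow> 'b::real_normed_vector) set)"
proof (rule subspaceI)
  show "(0 :: real^'d \<Rightarrow> 'b) \<in> lagrange_space \<Omega> \<T> k"
    using subspace_0[OF subspace_polys, of k] by (auto simp: lagrange_space_def zero_fun_def)
next
  fix v w :: "real^'d \<Rightarrow> 'b" assume vw: "v \<in> lagrange_space \<Omega> \<T> k" "w \<in> lagrange_space \<Omega> \<T> k"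
  have "\<exists>q\<in>polys k. \<forall>x\<in>K. v x + w x = q x" if K: "K \<in> \<T>" for K
  proof -
    obtain p q where "p \<in> polys k" "q \<in> polys k" "\<forall>x\<in>K. v x = p x" "\<forall>x\<in>K. w x = q x"
      using vw K unfolding lagrange_space_def by blast
    then show ?thesis using subspace_add[OF subspace_polys, of p k q] by (intro bexI[of _ "p + q"]) auto
  qed
  then show "v + w \<in> lagrange_space \<Omega> \<T> k" using vw unfolding lagrange_space_def plus_fun_def
    by (auto intro: continuous_on_add)
next
  fix v :: "real^'d \<Rightarrow> 'b" and a assume v: "v \<in> lagrange_space \<Omega> \<T> k"
  have "\<exists>q\<in>polys k. \<forall>x\<in>K. a *\<^sub>R v x = q x" if K: "K \<in> \<T>" for K
  proof -
    obtain p where "p \<in> polys k" "\<forall>x\<in>K. v x = p x" using v K unfolding lagrange_space_def by blast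
    then show ?thesis using subspace_scale[OF subspace_polys, of p k a] by (intro bexI[of _ "a *\<^sub>R p"]) auto
  qed
  then show "a *\<^sub>R v \<in> lagrange_space \<Omega> \<T> k" using v unfolding lagrange_space_def scaleR_fun_def
    by (auto intro: continuous_on_scaleR)
qed

section \<open>First-order differential operators and the bilinear forms\<close>

context bounded_domain
begin

text \<open>Gradient, divergence and strain are linear functions of the first weak derivatives.\<close>

lemma ae_linear_first_order:
  fixes F :: "'d \<Rightarrow> 'b::euclidean_space \<Rightarrow> 'c::euclidean_space"
  assumes "\<And>i. linear (F i)"
  shows "ae_linear (Sobolev \<Omega> 1) (lebesgue_on \<Omega>) (\<lambda>v t. \<Sum>i\<in>UNIV. F i (weak_deriv \<Omega> [i] v t))"
  using assms by (intro ae_linear_combination ae_linear_weak_deriv subspace_Sobolev) (auto simp: linear_conv_bounded_linear)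

lemma ae_linear_grad: "ae_linear (Sobolev \<Omega> 1) (lebesgue_on \<Omega>) (grad \<Omega>)"
proof -
  have "grad \<Omega> = (\<lambda>p x. \<Sum>i\<in>UNIV. weak_deriv \<Omega> [i] p x *\<^sub>R axis i 1)"
    by (simp add: fun_eq_iff grad_def vec_eq_iff axis_def if_distrib cong: if_cong)
  then show ?thesis using ae_linear_first_order[of "\<lambda>i y. y *\<^sub>R axis i 1"]
    by (simp add: linear_iff scaleR_add_left)
qed

lemma ae_linear_divergence: "ae_linear (Sobolev \<Omega> 1) (lebesgue_on \<Omega>) (divergence \<Omega>)"
proof -
  have "divergence \<Omega> = (\<lambda>v x. \<Sum>i\<in>UNIV. weak_deriv \<Omega> [i] v x $ i)"
    by (simp add: fun_eq_iff divergence_def)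
  then show ?thesis using ae_linear_first_order[of "\<lambda>i y. y $ i"] by (simp add: linear_iff)
qed

lemma ae_linear_strain: "ae_linear (Sobolev \<Omega> 1) (lebesgue_on \<Omega>) (strain \<Omega>)"
proof -
  define F :: "'d \<Rightarrow> real^'d \<Rightarrow> real^'d^'d" where 
    "F k y = (\<chi> i j. (if j = k then y $ i / 2 else 0) + (if i = k then y $ j / 2 else 0))" for k y
  have lin: "linear (F k)" for k
    by (rule linearI) (auto simp: F_def vec_eq_iff algebra_simps)
  have "strain \<Omega> = (\<lambda>v x. \<Sum>i\<in>UNIV. F i (weak_deriv \<Omega> [i] v x))"
    by (auto simp: fun_eq_iff strain_def F_def vec_eq_iff jacobian_def transpose_def sum.distrib)
  then show ?thesis using ae_linear_first_order[OF lin] by simp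
qed

lemma sum_first_derivatives_le:
  "(\<Sum>i\<in>UNIV. (L2_norm (lebesgue_on \<Omega>) (weak_deriv \<Omega> [i] v))\<^sup>2) \<le> (Sobolev_norm \<Omega> 1 v)\<^sup>2"
proof -
  have "(\<Sum>i\<in>UNIV. (L2_norm (lebesgue_on \<Omega>) (weak_deriv \<Omega> [i] v))\<^sup>2) 
      = (\<Sum>js\<in>range (\<lambda>i::'d. [i]). (L2_norm (lebesgue_on \<Omega>) (weak_deriv \<Omega> js v))\<^sup>2)"
    by (subst sum.reindex) (auto simp: inj_on_def)
  also have "\<dots> \<le> (\<Sum>js | length js \<le> 1. (L2_norm (lebesgue_on \<Omega>) (weak_deriv \<Omega> js v))\<^sup>2)"
    by (intro sum_mono2 finite_short_lists) auto
  also have "\<dots> = (Sobolev_norm \<Omega> 1 v)\<^sup>2"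
    unfolding Sobolev_norm_def by (simp add: sum_nonneg)
  finally show ?thesis .
qed

lemma L2_norm_grad_le:
  assumes p: "p \<in> Sobolev \<Omega> 1" shows "L2_norm (lebesgue_on \<Omega>) (grad \<Omega> p) \<le> Sobolev_norm \<Omega> 1 p"
proof -
  have L: "weak_deriv \<Omega> [i] p \<in> L2 (lebesgue_on \<Omega>)" for i by (rule weak_deriv_Sobolev[OF p]) simp
  have "(L2_norm (lebesgue_on \<Omega>) (grad \<Omega> p))\<^sup>2 = (LINT x|lebesgue_on \<Omega>. (\<Sum>i\<in>UNIV. (norm (weak_deriv \<Omega> [i] p x))\<^sup>2))"
    unfolding L2_norm_def by (simp add: grad_def norm_vec_def L2_set_def sum_nonneg)
  also have "\<dots> = (\<Sum>i\<in>UNIV. (L2_norm (lebesgue_on \<Omega>) (weak_deriv \<Omega> [i] p))\<^sup>2)"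
    using L unfolding L2_norm_def by (subst Bochner_Integration.integral_sum) (auto simp: L2_def)
  also have "\<dots> \<le> (Sobolev_norm \<Omega> 1 p)\<^sup>2" by (rule sum_first_derivatives_le)
  finally show ?thesis by (simp add: power2_le_iff_abs_le)
qed

lemma L2_norm_strain_le:
  assumes v: "v \<in> Sobolev \<Omega> 1" shows "L2_norm (lebesgue_on \<Omega>) (strain \<Omega> v) \<le> Sobolev_norm \<Omega> 1 v"
proof -
  have L: "weak_deriv \<Omega> [i] v \<in> L2 (lebesgue_on \<Omega>)" for i by (rule weak_deriv_Sobolev[OF v]) simp
  have bound: "(norm (strain \<Omega> v x))\<^sup>2 \<le> (\<Sum>i\<in>UNIV. (norm (weak_deriv \<Omega> [i] v x))\<^sup>2)" for x
  proof -
    have n: "(norm A)\<^sup>2 = (\<Sum>i\<in>UNIV. \<Sum>j\<in>UNIV. (A $ i $ j)\<^sup>2)" for A :: "real^'d^'d"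
      by (simp add: norm_vec_def L2_set_def sum_nonneg)
    have t: "norm (transpose (jacobian \<Omega> v x)) = norm (jacobian \<Omega> v x)"
    proof -
      have "(norm (transpose (jacobian \<Omega> v x)))\<^sup>2 = (norm (jacobian \<Omega> v x))\<^sup>2"
        unfolding n by (subst sum.swap) (simp add: transpose_def)
      then show ?thesis by simp
    qed
    have "norm (strain \<Omega> v x) \<le> norm (jacobian \<Omega> v x)"
      unfolding strain_def using norm_triangle_ineq[of "jacobian \<Omega> v x" "transpose (jacobian \<Omega> v x)"] t by simp
    then have "(norm (strain \<Omega> v x))\<^sup>2 \<le> (norm (jacobian \<Omega> v x))\<^sup>2" by (rule power_mono) simp
    also have "\<dots> = (\<Sum>j\<in>UNIV. \<Sum>i\<in>UNIV. (weak_deriv \<Omega> [j] v x $ i)\<^sup>2)"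
      unfolding n by (subst sum.swap) (simp add: jacobian_def)
    also have "\<dots> = (\<Sum>i\<in>UNIV. (norm (weak_deriv \<Omega> [i] v x))\<^sup>2)"
      by (simp add: norm_vec_def L2_set_def sum_nonneg)
    finally show ?thesis .
  qed
  have S: "strain \<Omega> v \<in> L2 (lebesgue_on \<Omega>)" by (rule ae_linear_L2[OF ae_linear_strain v])
  have "(L2_norm (lebesgue_on \<Omega>) (strain \<Omega> v))\<^sup>2 \<le> (LINT x|lebesgue_on \<Omega>. (\<Sum>i\<in>UNIV. (norm (weak_deriv \<Omega> [i] v x))\<^sup>2))"
  proof -
    have "(L2_norm (lebesgue_on \<Omega>) (strain \<Omega> v))\<^sup>2 = (LINT x|lebesgue_on \<Omega>. (norm (strain \<Omega> v x))\<^sup>2)"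
      by (simp add: L2_norm_def)
    also have "\<dots> \<le> (LINT x|lebesgue_on \<Omega>. (\<Sum>i\<in>UNIV. (norm (weak_deriv \<Omega> [i] v x))\<^sup>2))"
      using S L by (intro integral_mono bound Bochner_Integration.integrable_sum L2_norm_sq_integrable)
    finally show ?thesis .
  qed
  also have "\<dots> = (\<Sum>i\<in>UNIV. (L2_norm (lebesgue_on \<Omega>) (weak_deriv \<Omega> [i] v))\<^sup>2)"
    using L unfolding L2_norm_def by (subst Bochner_Integration.integral_sum) (auto simp: L2_def)
  also have "\<dots> \<le> (Sobolev_norm \<Omega> 1 v)\<^sup>2" by (rule sum_first_derivatives_le)
  finally show ?thesis by (simp add: power2_le_iff_abs_le)
qed

end

section \<open>Bochner integrals in function spaces\<close>

lemma LIMSEQ_dominated: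
  fixes f :: "nat \<Rightarrow> real"
  assumes "\<And>n. \<bar>f n - l\<bar> \<le> g n" "g \<longlonglongrightarrow> 0" shows "f \<longlonglongrightarrow> l"
  by (rule LIM_zero_cancel, rule Lim_null_comparison[OF _ assms(2)]) (use assms(1) in simp)

lemma complete_measure_lebesgue_on:
  assumes "A \<in> sets lebesgue" shows "complete_measure (lebesgue_on A)"
proof
  fix B C assume BC: "B \<subseteq> C" "C \<in> null_sets (lebesgue_on A)"
  have "C \<subseteq> A" and C: "C \<in> null_sets lebesgue"
    using BC(2) assms by (simp_all add: null_sets_restrict_space)
  have "B \<in> null_sets lebesgue" by (rule completion.complete2[OF BC(1) C])
  moreover have "B \<subseteq> A" using BC(1) \<open>C \<subseteq> A\<close> by (rule order_trans)
  ultimately show "B \<in> sets (lebesgue_on A)" using assms by (simp add: sets_restrict_space_iff null_setsD2)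
qed

lemma (in complete_measure) borel_measurable_AE_cong:
  fixes f g :: "'a \<Rightarrow> 'b::topological_space"
  assumes f: "f \<in> borel_measurable M" and ae: "AE x in M. f x = g x" shows "g \<in> borel_measurable M"
proof (rule measurableI)
  fix S :: "'b set" assume "S \<in> sets borel"
  then have "f -` S \<inter> space M \<in> sets M" using f by (rule measurable_sets[rotated])
  moreover have "AE x in M. x \<in> f -` S \<inter> space M \<longleftrightarrow> x \<in> g -` S \<inter> space M" 
    using ae by eventually_elim auto
  ultimately show "g -` S \<inter> space M \<in> sets M" using in_sets_AE by blast
qed simp

lemma (in complete_measure) borel_measurable_AE_limit:
  fixes f :: "nat \<Rightarrow> 'a \<Rightarrow> real"
  assumes [measurable]: "\<And>n. f n \<in> borel_measurable M" and lim: "AE x in M. (\<lambda>n. f n x) \<longlonglongrightarrow> g x"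
  shows "g \<in> borel_measurable M"
proof (rule borel_measurable_AE_cong)
  show "(\<lambda>x. lim (\<lambda>n. f n x)) \<in> borel_measurable M" by measurable
  show "AE x in M. lim (\<lambda>n. f n x) = g x" using lim by eventually_elim (rule limI)
qed

lemma simple_function_integral:
  fixes G :: "'b \<Rightarrow> 'c::euclidean_space"
  assumes fin: "finite_measure M" and s: "simple_function M s"
  shows "integrable M (\<lambda>t. G (s t))"
    and "(LINT t|M. G (s t)) = (\<Sum>y\<in>s ` space M. measure M {t\<in>space M. s t = y} *\<^sub>R G y)"
proof -
  interpret finite_measure M by fact
  let ?A = "\<lambda>y. {t\<in>space M. s t = y}"
  have fin': "finite (s ` space M)" and A: "?A y \<in> sets M" if "y \<in> s ` space M" for y
  proof -
    show "finite (s ` space M)" using s by (simp add: simple_function_def)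
    have "s -` {y} \<inter> space M \<in> sets M" using s that unfolding simple_function_def by blast
    also have "s -` {y} \<inter> space M = ?A y" by auto
    finally show "?A y \<in> sets M" .
  qed
  have fin'': "finite (s ` space M)" using s by (simp add: simple_function_def)
  have eq: "G (s t) = (\<Sum>y\<in>s ` space M. indicator (?A y) t *\<^sub>R G y)" if "t \<in> space M" for t
  proof -
    have "(\<Sum>y\<in>s ` space M. indicator (?A y) t *\<^sub>R G y) = (\<Sum>y\<in>s ` space M. if y = s t then G y else 0)"
      using that by (intro sum.cong) (auto simp: indicator_def)
    then show ?thesis using that fin'' by simp
  qed
  have int: "integrable M (\<lambda>t. indicator (?A y) t *\<^sub>R G y)" if "y \<in> s ` space M" for y
    using A[OF that] by (intro integrable_scaleR_left integrable_real_indicator) (auto simp: emeasure_finite less_top[symmetric])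
  show "integrable M (\<lambda>t. G (s t))"
    by (subst Bochner_Integration.integrable_cong[OF refl eq]) (auto intro!: Bochner_Integration.integrable_sum int)
  have "(LINT t|M. G (s t)) = (LINT t|M. (\<Sum>y\<in>s ` space M. indicator (?A y) t *\<^sub>R G y))"
    by (rule Bochner_Integration.integral_cong[OF refl eq])
  also have "\<dots> = (\<Sum>y\<in>s ` space M. (LINT t|M. indicator (?A y) t *\<^sub>R G y))"
    by (intro Bochner_Integration.integral_sum int)
  also have "\<dots> = (\<Sum>y\<in>s ` space M. measure M (?A y) *\<^sub>R G y)"
    using A by (intro sum.cong refl) (simp add: emeasure_finite less_top[symmetric])
  finally show "(LINT t|M. G (s t)) = (\<Sum>y\<in>s ` space M. measure M (?A y) *\<^sub>R G y)" .
qed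

lemma sum_fun_apply: "(\<Sum>i\<in>I. f i) x = (\<Sum>i\<in>I. f i x)"
  by (induction I rule: infinite_finite_induct) auto

lemma (in semi_inner) sum_scaleR_left:
  assumes "w \<in> S" "finite I" "I \<subseteq> S"
  shows "B (\<Sum>y\<in>I. c y *\<^sub>R y) w = (\<Sum>y\<in>I. c y * B y w)"
  using assms(2,3)
proof (induction I rule: finite_induct)
  case (insert y I)
  have "(\<Sum>y\<in>I. c y *\<^sub>R y) \<in> S" using insert by (intro subspace_sum subspace) auto
  then show ?case using insert assms(1) by (simp add: add scale)
qed (use assms in simp)

text \<open>The integral of a simple function with values in \<open>X\<close> is formed pointwise; it lies in
  \<open>X\<close>, commutes with inner products and satisfies the triangle inequality.\<close>

lemma (in function_semi_inner) simple_integral: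
  fixes J assumes fin: "finite_measure M" and s: "bochner_simple M X \<sigma>" and X: "subspace X" "X \<subseteq> S"
    and J: "J = (\<Sum>y\<in>\<sigma> ` space M. measure M {t\<in>space M. \<sigma> t = y} *\<^sub>R y)"
  shows "J \<in> X" and "w \<in> S \<Longrightarrow> B J w = (LINT t|M. B (\<sigma> t) w)" and "nrm J \<le> (LINT t|M. nrm (\<sigma> t))"
proof -
  have fs: "finite (\<sigma> ` space M)" and sub: "\<sigma> ` space M \<subseteq> X" and sf: "simple_function M \<sigma>"
    using s by (auto simp: bochner_simple_def simple_function_def)
  show "J \<in> X" unfolding J using sub X(1) by (intro subspace_sum subspace_scale) auto
  show "B J w = (LINT t|M. B (\<sigma> t) w)" if "w \<in> S"
    unfolding J using sum_scaleR_left[OF that fs] sub X(2) simple_function_integral(2)[OF fin sf, of "\<lambda>y. B y w"] by auto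
  have "nrm J \<le> (\<Sum>y\<in>\<sigma> ` space M. nrm (measure M {t\<in>space M. \<sigma> t = y} *\<^sub>R y))"
    unfolding J using sub X(2) by (intro nrm_sum fs) blast
  also have "\<dots> = (\<Sum>y\<in>\<sigma> ` space M. measure M {t\<in>space M. \<sigma> t = y} * nrm y)"
  proof (rule sum.cong[OF refl])
    fix y assume "y \<in> \<sigma> ` space M"
    then have "y \<in> S" using sub X(2) by blast
    then show "nrm (measure M {t\<in>space M. \<sigma> t = y} *\<^sub>R y) = measure M {t\<in>space M. \<sigma> t = y} * nrm y"
      by (simp only: nrm_scale) simp
  qed
  also have "\<dots> = (LINT t|M. nrm (\<sigma> t))"
    using simple_function_integral(2)[OF fin sf, of nrm] by simp
  finally show "nrm J \<le> (LINT t|M. nrm (\<sigma> t))" .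
qed

lemma (in function_semi_inner) reverse_triangle:
  assumes "x \<in> S" "y \<in> S" shows "\<bar>nrm x - nrm y\<bar> \<le> nrm (x - y)"
  using triangle[of "x - y" y] triangle[of "y - x" x] nrm_diff_commute[of x y] assms by auto

text \<open>A strongly measurable \<open>v\<close> with integrable norm is the $L^1$-limit of simple functions:
  set the approximants to zero wherever their norm exceeds twice that of \<open>v\<close>, so that the
  dominated convergence theorem applies.\<close>

lemma (in function_semi_inner) simple_L1_approximation:
  assumes M: "complete_measure M" and X: "subspace X" "X \<subseteq> S"
    and meas: "strongly_measurable M X nrm v" and int: "integrable M (\<lambda>t. nrm (v t))"
  obtains \<sigma> where "\<And>n. bochner_simple M X (\<sigma> n)" "\<And>n. integrable M (\<lambda>t. nrm (\<sigma> n t - v t))"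
    "(\<lambda>n. LINT t|M. nrm (\<sigma> n t - v t)) \<longlonglongrightarrow> 0" "AE t in M. (\<lambda>n. nrm (\<sigma> n t - v t)) \<longlonglongrightarrow> 0"
proof -
  interpret M: complete_measure M by fact
  obtain s where s: "\<And>n::nat. bochner_simple M X (s n)" and lim: "AE t in M. (\<lambda>n. nrm (s n t - v t)) \<longlonglongrightarrow> 0"
    and vX: "AE t in M. v t \<in> X"
    using meas unfolding strongly_measurable_def fun_diff_def by blast
  have sf: "simple_function M (s n)" and sX: "\<And>t. t \<in> space M \<Longrightarrow> s n t \<in> X" for n 
    using s[of n] by (auto simp: bochner_simple_def)
  have mv [measurable]: "(\<lambda>t. nrm (v t)) \<in> borel_measurable M" using int by auto
  have ms [measurable]: "(\<lambda>t. nrm (s n t)) \<in> borel_measurable M" for n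
    by (rule borel_measurable_simple_function[OF simple_function_compose1[OF sf, where g=nrm]])
  define \<sigma> where "\<sigma> n t = (if nrm (s n t) \<le> 2 * nrm (v t) then s n t else 0)" for n t
  have \<sigma>sf: "simple_function M (\<sigma> n)" for n
    unfolding \<sigma>_def[abs_def]
    by (intro simple_function_If sf simple_function_const borel_measurable_le ms borel_measurable_times borel_measurable_const mv)
  have \<sigma>X: "\<sigma> n t \<in> X" if "t \<in> space M" for n t
    using sX[OF that] subspace_0[OF X(1)] by (simp add: \<sigma>_def)
  have \<sigma>: "bochner_simple M X (\<sigma> n)" for n
    using \<sigma>sf \<sigma>X by (auto simp: bochner_simple_def)
  have lim\<sigma>: "AE t in M. (\<lambda>n. nrm (\<sigma> n t - v t)) \<longlonglongrightarrow> 0"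
    using lim vX AE_space
  proof eventually_elim
    case (elim t)
    have vS: "v t \<in> S" and sS: "\<And>n. s n t \<in> S" using elim X(2) sX by blast+
    show ?case
    proof (cases "nrm (v t) = 0")
      case True
      have "nrm (\<sigma> n t - v t) \<le> nrm (s n t - v t)" for n
        using True vS sS[of n] nrm_nonneg[of "s n t - v t"] nrm_minus[OF vS] by (auto simp: \<sigma>_def)
      moreover have "0 \<le> nrm (\<sigma> n t - v t)" for n
        using \<sigma>X[OF elim(3)] X(2) vS by (intro nrm_nonneg) blast
      ultimately show ?thesis using elim(1) by (intro tendsto_sandwich[OF _ _ tendsto_const elim(1)]) auto
    next
      case False
      then have pos: "nrm (v t) > 0" using nrm_nonneg[OF vS] by simp
      have "eventually (\<lambda>n. nrm (s n t - v t) < nrm (v t)) sequentially"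
        by (rule order_tendstoD(2)[OF elim(1) pos])
      then have "eventually (\<lambda>n. nrm (s n t - v t) = nrm (\<sigma> n t - v t)) sequentially"
      proof eventually_elim
        case (elim n)
        then have "nrm (s n t) \<le> 2 * nrm (v t)" using reverse_triangle[OF sS[of n] vS] by linarith
        then show ?case by (simp add: \<sigma>_def)
      qed
      then show ?thesis using elim(1) by (rule Lim_transform_eventually[rotated])
    qed
  qed
  have md: "(\<lambda>t. nrm (\<sigma> n t - v t)) \<in> borel_measurable M" for n
  proof (rule M.borel_measurable_AE_limit)
    show "(\<lambda>t. nrm (\<sigma> n t - s j t)) \<in> borel_measurable M" for j
      by (rule borel_measurable_simple_function[OF simple_function_compose2[OF \<sigma>sf sf, where h="\<lambda>a b. nrm (a - b)"]])
    show "AE t in M. (\<lambda>j. nrm (\<sigma> n t - s j t)) \<longlonglongrightarrow> nrm (\<sigma> n t - v t)"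
      using lim vX AE_space
    proof eventually_elim
      case (elim t)
      have S: "v t \<in> S" "\<sigma> n t \<in> S" "\<And>j. s j t \<in> S" using elim X(2) sX \<sigma>X by blast+
      have "\<bar>nrm (\<sigma> n t - s j t) - nrm (\<sigma> n t - v t)\<bar> \<le> nrm (s j t - v t)" for j
        using reverse_triangle[of "\<sigma> n t - s j t" "\<sigma> n t - v t"] S nrm_diff_commute[OF S(1) S(3)] by auto
      then show ?case
        using elim(1) by (rule LIMSEQ_dominated)
    qed
  qed
  have bound: "AE t in M. norm (nrm (\<sigma> n t - v t)) \<le> 3 * nrm (v t)" for n
    using vX AE_space
  proof eventually_elim
    case (elim t)
    have S: "v t \<in> S" "\<sigma> n t \<in> S" using elim X(2) \<sigma>X by blast+
    have "nrm (\<sigma> n t) \<le> 2 * nrm (v t)" using nrm_nonneg[OF S(1)] by (simp add: \<sigma>_def)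
    then show ?case using triangle_diff[OF S(2,1)] nrm_nonneg[of "\<sigma> n t - v t"] S by auto
  qed
  have i: "integrable M (\<lambda>t. nrm (\<sigma> n t - v t))" for n
  proof (rule Bochner_Integration.integrable_bound[OF _ md])
    show "integrable M (\<lambda>t. 3 * nrm (v t))" using int by simp
    show "AE t in M. norm (nrm (\<sigma> n t - v t)) \<le> norm (3 * nrm (v t))"
      using bound[of n] by eventually_elim simp
  qed
  have "(\<lambda>n. LINT t|M. nrm (\<sigma> n t - v t)) \<longlonglongrightarrow> (LINT t|M. 0)"
    by (rule integral_dominated_convergence[where w="\<lambda>t. 3 * nrm (v t)"]) (use md int lim\<sigma> bound in simp_all)
  then have "(\<lambda>n. LINT t|M. nrm (\<sigma> n t - v t)) \<longlonglongrightarrow> 0" by simp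
  then show thesis using that \<sigma> i lim\<sigma> by blast
qed

text \<open>The pairings with the approximating simple functions are measurable and converge almost everywhere;
  the measure is complete.\<close>

lemma strongly_measurable_inner:
  fixes v :: "real \<Rightarrow> 'a \<Rightarrow> 'b::euclidean_space"
  assumes M: "complete_measure M" and meas: "strongly_measurable M X N v" 
    and X: "subspace X" "X \<subseteq> L2 L" "\<And>f. f \<in> X \<Longrightarrow> L2_norm L f \<le> N f" and w: "w \<in> L2 L"
  shows "(\<lambda>t. L2_inner L (v t) w) \<in> borel_measurable M"
proof -
  interpret M: complete_measure M by fact
  obtain s where s: "\<And>n::nat. bochner_simple M X (s n)" and lim: "AE t in M. (\<lambda>n. N (s n t - v t)) \<longlonglongrightarrow> 0"
    and vX: "AE t in M. v t \<in> X"
    using meas unfolding strongly_measurable_def fun_diff_def by blast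
  have sf: "simple_function M (s n)" and sX: "\<And>t. t \<in> space M \<Longrightarrow> s n t \<in> X" for n 
    using s[of n] by (auto simp: bochner_simple_def)
  show ?thesis
  proof (rule M.borel_measurable_AE_limit)
    show "(\<lambda>t. L2_inner L (s n t) w) \<in> borel_measurable M" for n
      by (rule borel_measurable_simple_function[OF simple_function_compose1[OF sf, where g="\<lambda>f. L2_inner L f w"]])
    show "AE t in M. (\<lambda>n. L2_inner L (s n t) w) \<longlonglongrightarrow> L2_inner L (v t) w"
      using lim vX AE_space
    proof eventually_elim
      case (elim t)
      have "norm (L2_inner L (s n t) w - L2_inner L (v t) w) \<le> N (s n t - v t) * L2_norm L w" for n
      proof -
        have m: "s n t \<in> L2 L" "v t \<in> L2 L" "s n t - v t \<in> X" 
          using sX[OF elim(3)] elim(2) X(2) subspace_diff[OF X(1)] by blast+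
        have "\<bar>L2_inner L (s n t - v t) w\<bar> \<le> L2_norm L (s n t - v t) * L2_norm L w"
          using m(3) X(2) w by (intro L2.Cauchy_Schwarz) auto
        also have "\<dots> \<le> N (s n t - v t) * L2_norm L w" using X(3)[OF m(3)] by (intro mult_right_mono) auto
        finally show ?thesis using m w by (simp add: L2.diff)
      qed
      moreover have "(\<lambda>n. N (s n t - v t) * L2_norm L w) \<longlonglongrightarrow> 0" using elim(1) by (rule tendsto_mult_left_zero)
      ultimately show ?case unfolding real_norm_def by (rule LIMSEQ_dominated)
    qed
  qed
qed

text \<open>Bochner integrals commute with the continuous linear functionals of $L^2$: this holds for simple
  functions and passes to the limit.\<close>

lemma has_time_integral_inner:
  fixes v :: "real \<Rightarrow> 'a \<Rightarrow> 'b::euclidean_space"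
  assumes M: "complete_measure M" "finite_measure M"
    and J: "has_time_integral M (L2 L) (L2_norm L) v J" and w: "w \<in> L2 L"
  shows "integrable M (\<lambda>t. L2_inner L (v t) w)" "(LINT t|M. L2_inner L (v t) w) = L2_inner L J w"
proof -
  obtain s where s: "\<And>n::nat. bochner_simple M (L2 L) (s n)" 
    and lim: "(\<lambda>n. \<integral>\<^sup>+t. ennreal (L2_norm L (s n t - v t)) \<partial>M) \<longlonglongrightarrow> 0"
    and limJ: "(\<lambda>n. L2_norm L ((\<Sum>y\<in>s n ` space M. measure M {t\<in>space M. s n t = y} *\<^sub>R y) - J)) \<longlonglongrightarrow> 0"
    and sm: "strongly_measurable M (L2 L) (L2_norm L) v" and JL: "J \<in> L2 L"
    using J unfolding has_time_integral_def fun_diff_def by (auto simp: sum_fun_apply)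
  have vX: "AE t in M. v t \<in> L2 L" using sm unfolding strongly_measurable_def by blast
  have mv [measurable]: "(\<lambda>t. L2_inner L (v t) w) \<in> borel_measurable M"
    by (rule strongly_measurable_inner[OF M(1) sm subspace_L2]) (use w in auto)
  have sf: "simple_function M (s n)" and sX: "\<And>t. t \<in> space M \<Longrightarrow> s n t \<in> L2 L" for n 
    using s[of n] by (auto simp: bochner_simple_def)
  have si: "integrable M (\<lambda>t. L2_inner L (s n t) w)" for n
    by (rule simple_function_integral(1)[OF M(2) sf, where G="\<lambda>f. L2_inner L f w"])
  define c where "c = L2_norm L w + 1"
  have c: "c > 0" "L2_norm L w \<le> c" by (simp_all add: c_def add_nonneg_pos)
  have le: "(\<integral>\<^sup>+t. ennreal (\<bar>L2_inner L (s n t) w - L2_inner L (v t) w\<bar> / c) \<partial>M)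
      \<le> (\<integral>\<^sup>+t. ennreal (L2_norm L (s n t - v t)) \<partial>M)" for n
  proof (rule nn_integral_mono_AE, use vX AE_space in eventually_elim)
    case (elim t)
    have m: "s n t \<in> L2 L" using sX elim by blast
    have "\<bar>L2_inner L (s n t - v t) w\<bar> \<le> L2_norm L (s n t - v t) * L2_norm L w"
      using m elim w by (intro L2.Cauchy_Schwarz) auto
    also have "\<dots> \<le> L2_norm L (s n t - v t) * c" using c(2) by (rule mult_left_mono) simp
    finally show ?case using m elim w c(1) by (intro ennreal_leI) (simp add: L2.diff field_simps)
  qed
  have "(\<lambda>n. \<integral>\<^sup>+t. ennreal (\<bar>L2_inner L (s n t) w - L2_inner L (v t) w\<bar> / c) \<partial>M) \<longlonglongrightarrow> 0"
    by (rule tendsto_sandwich[OF _ _ tendsto_const lim]) (use le in auto)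
  then have "(\<lambda>n. ennreal c * (\<integral>\<^sup>+t. ennreal (\<bar>L2_inner L (s n t) w - L2_inner L (v t) w\<bar> / c) \<partial>M)) \<longlonglongrightarrow> ennreal c * 0"
    by (intro ennreal_tendsto_cmult) auto
  moreover have "ennreal c * (\<integral>\<^sup>+t. ennreal (\<bar>L2_inner L (s n t) w - L2_inner L (v t) w\<bar> / c) \<partial>M)
    = (\<integral>\<^sup>+t. ennreal (norm (L2_inner L (s n t) w - L2_inner L (v t) w)) \<partial>M)" for n
    using si[of n] c by (subst nn_integral_cmult[symmetric]) (auto simp flip: ennreal_mult intro!: nn_integral_cong)
  ultimately have L1: "(\<lambda>n. \<integral>\<^sup>+t. ennreal (norm (L2_inner L (s n t) w - L2_inner L (v t) w)) \<partial>M) \<longlonglongrightarrow> 0"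
    by simp
  have "eventually (\<lambda>n. (\<integral>\<^sup>+t. ennreal (norm (L2_inner L (s n t) w - L2_inner L (v t) w)) \<partial>M) < 1) sequentially"
    by (rule order_tendstoD(2)[OF L1]) simp
  then obtain n where "(\<integral>\<^sup>+t. ennreal (norm (L2_inner L (s n t) w - L2_inner L (v t) w)) \<partial>M) < 1"
    by (auto simp: eventually_sequentially)
  then have "integrable M (\<lambda>t. L2_inner L (s n t) w - L2_inner L (v t) w)"
    using si[of n] by (intro integrableI_bounded) (auto intro: less_trans)
  from Bochner_Integration.integrable_diff[OF si[of n] this]
  show iv: "integrable M (\<lambda>t. L2_inner L (v t) w)" by simp
  have "(\<lambda>n. LINT t|M. L2_inner L (s n t) w) \<longlonglongrightarrow> (LINT t|M. L2_inner L (v t) w)"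
    by (rule tendsto_L1_int[OF si iv]) (use L1 in simp)
  moreover have "(\<lambda>n. LINT t|M. L2_inner L (s n t) w) \<longlonglongrightarrow> L2_inner L J w"
  proof -
    let ?J = "\<lambda>n. \<Sum>y\<in>s n ` space M. measure M {t\<in>space M. s n t = y} *\<^sub>R y"
    have Jn: "?J n \<in> L2 L" "L2_inner L (?J n) w = (LINT t|M. L2_inner L (s n t) w)" for n
      using L2.simple_integral(1,2)[OF M(2) s subspace_L2 order_refl refl] w by blast+
    have "norm (L2_inner L (?J n) w - L2_inner L J w) \<le> L2_norm L (?J n - J) * L2_norm L w" for n
      using L2.Cauchy_Schwarz[OF L2.closed(3)[OF Jn(1) JL] w, of n] Jn JL w by (simp add: L2.diff)
    then have "(\<lambda>n. L2_inner L (?J n) w) \<longlonglongrightarrow> L2_inner L J w"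
      unfolding real_norm_def by (rule LIMSEQ_dominated[OF _ tendsto_mult_left_zero[OF limJ]])
    then show ?thesis using Jn(2) by simp
  qed
  ultimately show "(LINT t|M. L2_inner L (v t) w) = L2_inner L J w" by (rule LIMSEQ_unique)
qed

text \<open>Existence of the Bochner integral in the Sobolev space. The integrals of approximating simple
  functions form a Cauchy sequence in the Sobolev norm, and the norm bound is the limit of the
  triangle inequality. Pairing with functions in $L^2$ identifies the limit.\<close>

lemma (in bounded_domain) Bochner_integral_Sobolev:
  fixes v :: "real \<Rightarrow> real^'d \<Rightarrow> 'b::euclidean_space"
  assumes M: "complete_measure M" "finite_measure M"
    and X: "subspace X" "X \<subseteq> Sobolev \<Omega> m"
    and meas: "strongly_measurable M X (Sobolev_norm \<Omega> m) v" 
    and int: "integrable M (\<lambda>t. Sobolev_norm \<Omega> m (v t))"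
  shows "\<exists>z\<in>Sobolev \<Omega> m. Sobolev_norm \<Omega> m z \<le> (LINT t|M. Sobolev_norm \<Omega> m (v t)) \<and>
     (\<forall>w\<in>L2 (lebesgue_on \<Omega>). L2_inner (lebesgue_on \<Omega>) z w = (LINT t|M. L2_inner (lebesgue_on \<Omega>) (v t) w))"
proof -
  let ?L = "lebesgue_on \<Omega>" and ?N = "Sobolev_norm \<Omega> m"
  obtain \<sigma> where \<sigma>: "\<And>n. bochner_simple M X (\<sigma> n)" "\<And>n. integrable M (\<lambda>t. ?N (\<sigma> n t - v t))"
    "(\<lambda>n. LINT t|M. ?N (\<sigma> n t - v t)) \<longlonglongrightarrow> 0" "AE t in M. (\<lambda>n. ?N (\<sigma> n t - v t)) \<longlonglongrightarrow> 0"
    by (rule Sob.simple_L1_approximation[OF M(1) X meas int]) (rule that, assumption+)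
  have vX: "AE t in M. v t \<in> X" using meas unfolding strongly_measurable_def by blast
  have sf: "simple_function M (\<sigma> n)" and \<sigma>X: "\<And>t. t \<in> space M \<Longrightarrow> \<sigma> n t \<in> X" for n 
    using \<sigma>(1)[of n] by (auto simp: bochner_simple_def)
  have XL: "X \<subseteq> L2 ?L" using X(2) Sobolev_L2 by blast
  define J where "J n = (\<Sum>y\<in>\<sigma> n ` space M. measure M {t\<in>space M. \<sigma> n t = y} *\<^sub>R y)" for n
  have JX: "J n \<in> Sobolev \<Omega> m" and JN: "?N (J n) \<le> (LINT t|M. ?N (\<sigma> n t))" for n
    using Sob.simple_integral[OF M(2) \<sigma>(1) X J_def] X(2) by auto
  have Jw: "L2_inner ?L (J n) w = (LINT t|M. L2_inner ?L (\<sigma> n t) w)" if "w \<in> L2 ?L" for n w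
    using L2.simple_integral(2)[OF M(2) \<sigma>(1) X(1) XL J_def that] .
  \<comment> \<open>Evaluated pointwise, the integrals of simple functions are linear.\<close>
  have Jx: "J n x = (LINT t|M. \<sigma> n t x)" for n x
    using simple_function_integral(2)[OF M(2) sf, of "\<lambda>y. y x"] by (simp add: J_def sum_fun_apply)
  have Jdiff: "?N (J i - J j) \<le> (LINT t|M. ?N (\<sigma> i t - v t)) + (LINT t|M. ?N (\<sigma> j t - v t))" for i j
  proof -
    let ?s = "\<lambda>t. \<sigma> i t - \<sigma> j t"
    have s2: "simple_function M ?s" by (rule simple_function_compose2[OF sf sf, where h="\<lambda>a b. a - b"])
    have bs: "bochner_simple M X ?s"
      unfolding bochner_simple_def using s2 \<sigma>X subspace_diff[OF X(1)] by auto
    have "J i - J j = (\<Sum>y\<in>?s ` space M. measure M {t\<in>space M. ?s t = y} *\<^sub>R y)"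
    proof
      fix x
      have "(J i - J j) x = (LINT t|M. \<sigma> i t x - \<sigma> j t x)"
        using simple_function_integral(1)[OF M(2) sf, of "\<lambda>y. y x"] by (simp add: Jx)
      then show "(J i - J j) x = (\<Sum>y\<in>?s ` space M. measure M {t\<in>space M. ?s t = y} *\<^sub>R y) x"
        using simple_function_integral(2)[OF M(2) s2, of "\<lambda>y. y x"] by (simp add: sum_fun_apply)
    qed
    then have "?N (J i - J j) \<le> (LINT t|M. ?N (?s t))"
      using Sob.simple_integral(3)[OF M(2) bs X] by blast
    also have "\<dots> \<le> (LINT t|M. ?N (\<sigma> i t - v t) + ?N (\<sigma> j t - v t))"
    proof (rule integral_mono_AE)
      show "integrable M (\<lambda>t. ?N (?s t))" by (rule simple_function_integral(1)[OF M(2) s2, where G="?N"])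
      show "AE t in M. ?N (?s t) \<le> ?N (\<sigma> i t - v t) + ?N (\<sigma> j t - v t)"
        using vX AE_space
      proof eventually_elim
        case (elim t)
        then have m: "\<sigma> i t - v t \<in> Sobolev \<Omega> m" "\<sigma> j t - v t \<in> Sobolev \<Omega> m" 
          using \<sigma>X X(2) by blast+
        show ?case using Sob.triangle_diff[OF m] by simp
      qed
    qed (use \<sigma>(2) in auto)
    also have "\<dots> = (LINT t|M. ?N (\<sigma> i t - v t)) + (LINT t|M. ?N (\<sigma> j t - v t))"
      using \<sigma>(2) by simp
    finally show ?thesis .
  qed
  have "\<exists>z\<in>Sobolev \<Omega> m. (\<lambda>n. ?N (J n - z)) \<longlonglongrightarrow> 0"
  proof (rule Sobolev_complete[OF JX])
    fix e :: real assume "e > 0"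
    then have "eventually (\<lambda>n. (LINT t|M. ?N (\<sigma> n t - v t)) < e / 2) sequentially"
      by (intro order_tendstoD(2)[OF \<sigma>(3)]) simp
    then obtain K where K: "\<And>n. n \<ge> K \<Longrightarrow> (LINT t|M. ?N (\<sigma> n t - v t)) < e / 2"
      by (auto simp: eventually_sequentially)
    have "?N (J i - J j) < e" if "i \<ge> K" "j \<ge> K" for i j
      using Jdiff[of i j] K[OF that(1)] K[OF that(2)] by linarith
    then show "\<exists>N. \<forall>i\<ge>N. \<forall>j\<ge>N. ?N (J i - J j) < e" by blast
  qed
  then obtain z where z: "z \<in> Sobolev \<Omega> m" and zlim: "(\<lambda>n. ?N (J n - z)) \<longlonglongrightarrow> 0" by blast
  have "?N z \<le> (LINT t|M. ?N (v t))"
  proof (rule LIMSEQ_le_const)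
    show "(\<lambda>n. ?N (J n - z) + ((LINT t|M. ?N (\<sigma> n t - v t)) + (LINT t|M. ?N (v t)))) \<longlonglongrightarrow> (LINT t|M. ?N (v t))"
      using tendsto_add[OF zlim tendsto_add[OF \<sigma>(3) tendsto_const]] by simp
    have "?N z \<le> ?N (J n - z) + ((LINT t|M. ?N (\<sigma> n t - v t)) + (LINT t|M. ?N (v t)))" for n
    proof -
      have "?N z \<le> ?N (J n - z) + ?N (J n)"
        using Sob.triangle_diff[OF JX[of n] Sob.closed(3)[OF JX[of n] z]] by simp
      moreover have "(LINT t|M. ?N (\<sigma> n t)) \<le> (LINT t|M. ?N (\<sigma> n t - v t) + ?N (v t))"
      proof (rule integral_mono_AE)
        show "integrable M (\<lambda>t. ?N (\<sigma> n t))" by (rule simple_function_integral(1)[OF M(2) sf, where G="?N"])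
        show "AE t in M. ?N (\<sigma> n t) \<le> ?N (\<sigma> n t - v t) + ?N (v t)"
          using vX AE_space
        proof eventually_elim
          case (elim t)
          then have m: "\<sigma> n t - v t \<in> Sobolev \<Omega> m" "v t \<in> Sobolev \<Omega> m" using \<sigma>X X(2) by blast+
          show ?case using Sob.triangle[OF m] by simp
        qed
      qed (use \<sigma>(2) int in auto)
      ultimately show ?thesis using JN[of n] \<sigma>(2) int by simp
    qed
    then show "\<exists>N. \<forall>n\<ge>N. ?N z \<le> ?N (J n - z) + ((LINT t|M. ?N (\<sigma> n t - v t)) + (LINT t|M. ?N (v t)))" by blast
  qed
  moreover have "L2_inner ?L z w = (LINT t|M. L2_inner ?L (v t) w)" if w: "w \<in> L2 ?L" for w
  proof -
    have mv: "(\<lambda>t. L2_inner ?L (v t) w) \<in> borel_measurable M"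
      by (rule strongly_measurable_inner[OF M(1) meas X(1) XL _ w]) (use X(2) Sobolev_L2 L2_norm_le_Sobolev_norm in blast)
    have CS: "\<bar>L2_inner ?L f w\<bar> \<le> ?N f * L2_norm ?L w" if "f \<in> Sobolev \<Omega> m" for f
      using L2.Cauchy_Schwarz[OF Sobolev_L2[OF that] w] L2_norm_le_Sobolev_norm[OF Sobolev_L2[OF that], of m]
      by (meson L2_norm_nonneg mult_right_mono order_trans)
    have iv: "integrable M (\<lambda>t. L2_inner ?L (v t) w)"
    proof (rule Bochner_Integration.integrable_bound[OF _ mv])
      show "integrable M (\<lambda>t. ?N (v t) * L2_norm ?L w)" using int by simp
      show "AE t in M. norm (L2_inner ?L (v t) w) \<le> norm (?N (v t) * L2_norm ?L w)"
        using vX by eventually_elim (use CS X(2) in \<open>auto simp: abs_mult\<close>)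
    qed
    have si: "integrable M (\<lambda>t. L2_inner ?L (\<sigma> n t) w)" for n 
      by (rule simple_function_integral(1)[OF M(2) sf, where G="\<lambda>f. L2_inner ?L f w"])
    have d: "norm ((LINT t|M. L2_inner ?L (\<sigma> n t) w) - (LINT t|M. L2_inner ?L (v t) w)) 
        \<le> (LINT t|M. ?N (\<sigma> n t - v t)) * L2_norm ?L w" for n
    proof -
      have "norm ((LINT t|M. L2_inner ?L (\<sigma> n t) w) - (LINT t|M. L2_inner ?L (v t) w)) 
          = norm (LINT t|M. L2_inner ?L (\<sigma> n t) w - L2_inner ?L (v t) w)"
        using si iv by simp
      also have "\<dots> \<le> (LINT t|M. norm (L2_inner ?L (\<sigma> n t) w - L2_inner ?L (v t) w))" by (rule integral_norm_bound)
      also have "\<dots> \<le> (LINT t|M. ?N (\<sigma> n t - v t) * L2_norm ?L w)"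
      proof (rule integral_mono_AE)
        show "AE t in M. norm (L2_inner ?L (\<sigma> n t) w - L2_inner ?L (v t) w) \<le> ?N (\<sigma> n t - v t) * L2_norm ?L w"
          using vX AE_space
        proof eventually_elim
          case (elim t)
          then have m: "\<sigma> n t \<in> L2 ?L" "v t \<in> L2 ?L" "\<sigma> n t - v t \<in> Sobolev \<Omega> m" using \<sigma>X X(2) XL by blast+
          show ?case using CS[OF m(3)] m w by (simp add: L2.diff)
        qed
      qed (use si iv \<sigma>(2) in auto)
      finally show ?thesis by simp
    qed
    have "(\<lambda>n. LINT t|M. L2_inner ?L (\<sigma> n t) w) \<longlonglongrightarrow> (LINT t|M. L2_inner ?L (v t) w)"
      using d unfolding real_norm_def by (rule LIMSEQ_dominated[OF _ tendsto_mult_left_zero[OF \<sigma>(3)]])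
    moreover have "(\<lambda>n. L2_inner ?L (J n) w) \<longlonglongrightarrow> L2_inner ?L z w"
    proof -
      have "norm (L2_inner ?L (J n) w - L2_inner ?L z w) \<le> ?N (J n - z) * L2_norm ?L w" for n
        using CS[OF Sob.closed(3)[OF JX[of n] z]] Sobolev_L2[OF JX[of n]] Sobolev_L2[OF z] w by (simp add: L2.diff)
      then show ?thesis
        unfolding real_norm_def by (rule LIMSEQ_dominated[OF _ tendsto_mult_left_zero[OF zlim]])
    qed
    ultimately show ?thesis using Jw[OF w] by (simp add: LIMSEQ_unique)
  qed
  ultimately show ?thesis using z by blast
qed

section \<open>Weak time derivatives\<close>

lemma continuous_deriv_cutoff: "continuous_on S (\<lambda>r. deriv cutoff (c * (r - a)))"
proof -
  have "continuous_on UNIV (deriv cutoff)"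
    using smooth1_has_derivative(1)[OF smooth1_has_derivative(2)[OF smooth1_cutoff]]
    by (meson DERIV_isCont continuous_at_imp_continuous_on)
  then show ?thesis by (rule continuous_on_compose2) (auto intro!: continuous_intros)
qed

lemma cutoff_affine_derivative:
  "((\<lambda>r. cutoff (c * (r - a))) has_real_derivative c * deriv cutoff (c * (r - a))) (at r)"
proof -
  have "((\<lambda>r. c * (r - a)) has_real_derivative c) (at r)" by (auto intro!: derivative_eq_intros)
  from DERIV_chain2[OF smooth1_has_derivative(1)[OF smooth1_cutoff] this] 
  show ?thesis by (simp add: mult.commute)
qed

text \<open>The rescaled derivatives of the cut-off function form an approximate identity.\<close>

lemma cutoff_derivative_concentrates:
  assumes a: "0 < a" "a < T" and U: "continuous_on {0..T} U"
  shows "(\<lambda>n. integral {0..T} (\<lambda>r. (real n * deriv cutoff (real n * (r - a))) * U r)) \<longlonglongrightarrow> U a"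
proof (rule LIMSEQ_I)
  have inverse_less: "1 / y < x" if "1 / x < y" "x > 0" for x y :: real
  proof -
    have "0 < 1 / x" using that by simp
    then have "y > 0" using that by linarith
    then show ?thesis using that by (simp add: field_simps)
  qed
  fix e :: real assume e: "e > 0"
  obtain C where C: "C \<ge> 0" "\<And>x. \<bar>deriv cutoff x\<bar> \<le> C" using deriv_cutoff_bounded by blast
  have "a \<in> {0..T}" using a by auto
  then obtain \<delta> where \<delta>: "\<delta> > 0" "\<And>r. r \<in> {0..T} \<Longrightarrow> dist r a < \<delta> \<Longrightarrow> dist (U r) (U a) < e / (C + 1)"
    using U[unfolded continuous_on_iff, rule_format, of a "e / (C + 1)"] e C by auto
  obtain K where K: "real K > 1 / min \<delta> (T - a)" using reals_Archimedean2 by blast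
  have "norm (integral {0..T} (\<lambda>r. (real n * deriv cutoff (real n * (r - a))) * U r) - U a) < e" if n: "n \<ge> K" for n
  proof -
    let ?I = "{a..a + 1 / real n}" and ?g = "\<lambda>r. real n * deriv cutoff (real n * (r - a))"
    have min: "min \<delta> (T - a) > 0" using \<delta> a by auto
    have "real n > 1 / min \<delta> (T - a)" using K n by linarith
    moreover then have n0: "real n > 0" using min by (meson less_trans zero_less_divide_1_iff)
    ultimately have "1 / real n < min \<delta> (T - a)" using min inverse_less by blast
    then have small: "1 / real n < \<delta>" "1 / real n < T - a" by auto
    have IT: "?I \<subseteq> {0..T}" using small a by auto
    have g0: "?g r = 0" if "r \<notin> ?I" for r
      using that n0 deriv_cutoff_eq_0[of "real n * (r - a)"] by (auto simp: field_simps mult_less_0_iff)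
    have cg: "continuous_on ?I ?g" by (intro continuous_intros continuous_deriv_cutoff)
    have cU: "continuous_on ?I U" using U IT continuous_on_subset by blast
    have "(?g has_integral cutoff (real n * (a + 1 / real n - a)) - cutoff (real n * (a - a))) ?I"
      using n0 cutoff_affine_derivative
      by (intro fundamental_theorem_of_calculus) (auto simp: has_real_derivative_iff_has_vector_derivative intro: has_vector_derivative_at_within)
    then have g1: "(?g has_integral 1) ?I" using n0 by (simp add: cutoff_eq_0 cutoff_eq_1)
    have "(\<lambda>r. ?g r * U r) integrable_on ?I" 
      by (intro integrable_continuous_real continuous_intros cg cU)
    then have "((\<lambda>r. ?g r * U r) has_integral integral ?I (\<lambda>r. ?g r * U r)) ?I"
      by (rule integrable_integral)
    then have "((\<lambda>r. ?g r * U r) has_integral integral ?I (\<lambda>r. ?g r * U r)) {0..T}"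
    proof (rule has_integral_on_superset[OF _ _ IT])
      fix r assume "r \<notin> ?I"
      from g0[OF this] show "?g r * U r = 0" by simp
    qed
    then have eq: "integral {0..T} (\<lambda>r. ?g r * U r) = integral ?I (\<lambda>r. ?g r * U r)" by (rule integral_unique)
    have "((\<lambda>r. ?g r * U a) has_integral 1 * U a) ?I" using g1 by (rule has_integral_mult_left)
    then have "((\<lambda>r. ?g r * U r - ?g r * U a) has_integral integral ?I (\<lambda>r. ?g r * U r) - 1 * U a) ?I"
      using \<open>(\<lambda>r. ?g r * U r) integrable_on ?I\<close> by (intro has_integral_diff) (auto simp: has_integral_integral)
    then have "integral ?I (\<lambda>r. ?g r * U r) - U a = integral ?I (\<lambda>r. ?g r * (U r - U a))"
      by (simp add: integral_unique right_diff_distrib)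
    also have "norm \<dots> \<le> (real n * C * (e / (C + 1))) * (a + 1 / real n - a)"
    proof (rule integral_bound)
      show "continuous_on ?I (\<lambda>r. ?g r * (U r - U a))" by (intro continuous_intros cg cU)
      fix r assume r: "r \<in> ?I"
      then have "dist r a < \<delta>" "r \<in> {0..T}" using small IT by (auto simp: dist_real_def)
      then have "\<bar>U r - U a\<bar> \<le> e / (C + 1)" using \<delta>(2)[of r] by (simp add: dist_real_def)
      moreover have "\<bar>?g r\<bar> \<le> real n * C" using C(2)[of "real n * (r - a)"] n0 by (simp add: abs_mult)
      ultimately show "norm (?g r * (U r - U a)) \<le> real n * C * (e / (C + 1))"
        unfolding real_norm_def abs_mult using n0 C(1) by (intro mult_mono) auto
    qed (use n0 in auto)
    also have "\<dots> = (C / (C + 1)) * e" using n0 C(1) by (simp add: field_simps)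
    also have "\<dots> < 1 * e" using C(1) e by (intro mult_strict_right_mono) auto
    finally show ?thesis using eq by simp
  qed
  then show "\<exists>no. \<forall>n\<ge>no. norm (integral {0..T} (\<lambda>r. (real n * deriv cutoff (real n * (r - a))) * U r) - U a) < e" by blast
qed

text \<open>A continuous function with integrable weak derivative is the integral of that derivative:
  test with smooth approximations of the indicator function of an interval.\<close>

lemma weak_derivative_fundamental_theorem:
  fixes U V :: "real \<Rightarrow> real"
  assumes T: "T > 0" and U: "continuous_on {0..T} U" and V: "integrable (lebesgue_on {0<..<T}) V"
    and weak: "\<And>\<phi>. \<phi> \<in> test_functions {0<..<T} \<Longrightarrow>
      integral {0..T} (\<lambda>r. deriv \<phi> r * U r) = - (LINT r|lebesgue_on {0<..<T}. \<phi> r * V r)"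
    and st: "0 \<le> s" "s \<le> t" "t \<le> T"
  shows "U t - U s = integral {s..t} V"
proof -
  let ?M = "lebesgue_on {0<..<T}"
  have VT: "V integrable_on {0..T}"
    using integrable_on_lebesgue_on[OF V] by (simp add: integrable_on_Icc_iff_Ioo)
  have [measurable]: "V \<in> borel_measurable ?M" using V by auto
  have interior: "U t - U s = integral {s..t} V" if st: "0 < s" "s \<le> t" "t < T" for s t
  proof -
    obtain K where K: "real K > 1 / (T - t)" using reals_Archimedean2 by blast
    define m where "m n = real (n + K)" for n
    have m: "m n > 0" "1 / m n < T - t" for n
    proof -
      have "1 / (T - t) > 0" using st by simp
      then have "real K > 0" using K by linarith
      moreover have *: "m n \<ge> real K" by (simp add: m_def)
      ultimately show m0: "m n > 0" by linarith
      have "m n > 1 / (T - t)" using K * by linarith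
      then show "1 / m n < T - t" using m0 st by (simp add: field_simps)
    qed
    \<comment> \<open>A smoothed indicator function of the interval from \<open>s\<close> to \<open>t\<close>; by the choice of \<open>K\<close> its support stays below \<open>T\<close>.\<close>
    define \<phi> where "\<phi> n r = cutoff (m n * (r - s)) - cutoff (m n * (r - t))" for n r
    have \<phi>d: "(\<phi> n has_real_derivative m n * deriv cutoff (m n * (r - s)) - m n * deriv cutoff (m n * (r - t))) (at r)" for n r
      unfolding \<phi>_def[abs_def] by (intro DERIV_diff cutoff_affine_derivative)
    have test: "\<phi> n \<in> test_functions {0<..<T}" for n
    proof (rule test_functionI[where K="{s..t + 1 / m n}"])
      have "smooth1 (\<lambda>r. cutoff (m n * r + (- m n * s)) - cutoff (m n * r + (- m n * t)))"
        by (intro smooth1_diff smooth1_cutoff_affine)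
      then show "smooth (\<phi> n)" unfolding \<phi>_def[abs_def] by (intro smooth_real_line) (simp add: algebra_simps)
      show "{s..t + 1 / m n} \<subseteq> {0<..<T}" using m[of n] st by auto
      fix r assume nz: "\<phi> n r \<noteq> 0"
      show "r \<in> {s..t + 1 / m n}"
      proof (rule ccontr)
        assume "r \<notin> {s..t + 1 / m n}"
        then consider "r < s" | "r > t + 1 / m n" by fastforce
        then show False
        proof cases
          case 1
          then have "m n * (r - s) \<le> 0" "m n * (r - t) \<le> 0" using m(1)[of n] st by (auto simp: mult_le_0_iff)
          then show False using nz by (simp add: \<phi>_def cutoff_eq_0)
        next
          case 2
          then have "m n * (r - t) \<ge> 1" using m(1)[of n] by (simp add: field_simps)
          moreover have "m n * (r - s) \<ge> m n * (r - t)" using m(1)[of n] st by (intro mult_left_mono) auto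
          ultimately show False using nz by (simp add: \<phi>_def cutoff_eq_1)
        qed
      qed
    qed simp
    have "(\<lambda>n. integral {0..T} (\<lambda>r. (m n * deriv cutoff (m n * (r - a))) * U r)) \<longlonglongrightarrow> U a" if "0 < a" "a < T" for a
      using LIMSEQ_ignore_initial_segment[OF cutoff_derivative_concentrates[OF that U], of K] by (simp add: m_def)
    then have "(\<lambda>n. integral {0..T} (\<lambda>r. (m n * deriv cutoff (m n * (r - s))) * U r) 
        - integral {0..T} (\<lambda>r. (m n * deriv cutoff (m n * (r - t))) * U r)) \<longlonglongrightarrow> U s - U t"
      using st by (intro tendsto_diff) auto
    moreover have "integral {0..T} (\<lambda>r. (m n * deriv cutoff (m n * (r - s))) * U r) 
        - integral {0..T} (\<lambda>r. (m n * deriv cutoff (m n * (r - t))) * U r)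
      = - (LINT r|?M. \<phi> n r * V r)" for n
    proof -
      have "integral {0..T} (\<lambda>r. (m n * deriv cutoff (m n * (r - s))) * U r) 
        - integral {0..T} (\<lambda>r. (m n * deriv cutoff (m n * (r - t))) * U r)
        = integral {0..T} (\<lambda>r. (m n * deriv cutoff (m n * (r - s))) * U r - (m n * deriv cutoff (m n * (r - t))) * U r)"
        by (intro Henstock_Kurzweil_Integration.integral_diff[symmetric] integrable_continuous_real continuous_intros continuous_deriv_cutoff U)
      also have "\<dots> = integral {0..T} (\<lambda>r. deriv (\<phi> n) r * U r)"
        by (simp add: DERIV_imp_deriv[OF \<phi>d] left_diff_distrib)
      finally show ?thesis using weak[OF test] by simp
    qed
    ultimately have "(\<lambda>n. - (LINT r|?M. \<phi> n r * V r)) \<longlonglongrightarrow> U s - U t" by simp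
    then have lim1: "(\<lambda>n. LINT r|?M. \<phi> n r * V r) \<longlonglongrightarrow> U t - U s" using tendsto_minus by fastforce
    have "(\<lambda>n. LINT r|?M. \<phi> n r * V r) \<longlonglongrightarrow> (LINT r|?M. indicator {s<..t} r * V r)"
    proof (rule integral_dominated_convergence[where w="\<lambda>r. \<bar>V r\<bar>"])
      show "AE r in ?M. (\<lambda>n. \<phi> n r * V r) \<longlonglongrightarrow> indicator {s<..t} r * V r"
      proof (rule AE_I2)
        fix r
        have c: "(\<lambda>n. cutoff (m n * (r - a))) \<longlonglongrightarrow> indicator {a<..} r" for a
          using LIMSEQ_ignore_initial_segment[OF cutoff_step_tendsto[of r a], of K] by (simp add: m_def)
        have "(\<lambda>n. \<phi> n r) \<longlonglongrightarrow> indicator {s<..} r - indicator {t<..} r"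
          unfolding \<phi>_def by (intro tendsto_diff c)
        also have "indicator {s<..} r - indicator {t<..} r = (indicator {s<..t} r :: real)"
          using st by (auto simp: indicator_def)
        finally show "(\<lambda>n. \<phi> n r * V r) \<longlonglongrightarrow> indicator {s<..t} r * V r" by (intro tendsto_mult_right)
      qed
      show "AE r in ?M. norm (\<phi> n r * V r) \<le> \<bar>V r\<bar>" for n
      proof (rule AE_I2)
        fix r
        have "\<bar>\<phi> n r\<bar> \<le> 1" using cutoff_bounds[of "m n * (r - s)"] cutoff_bounds[of "m n * (r - t)"] by (simp add: \<phi>_def)
        then show "norm (\<phi> n r * V r) \<le> \<bar>V r\<bar>" by (simp add: abs_mult mult_left_le_one_le)
      qed
      show "(\<lambda>r. \<phi> n r * V r) \<in> borel_measurable ?M" for n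
        using borel_imp_lebesgue_on[OF test_function_measurable[OF test, of "[]" n]] by simp
      have [measurable]: "(indicator {s<..t} :: real \<Rightarrow> real) \<in> borel_measurable ?M"
        by (rule borel_imp_lebesgue_on) auto
      show "(\<lambda>r. indicator {s<..t} r * V r) \<in> borel_measurable ?M" by measurable
    qed (use V in auto)
    moreover have "(LINT r|?M. indicator {s<..t} r * V r) = integral {s..t} V"
    proof -
      have "integrable ?M (\<lambda>r. indicator {s<..t} r * V r)"
      proof -
        have "{s<..t} \<subseteq> {0<..<T}" using st by auto
        then show ?thesis using V integrable_real_mult_indicator[of "{s<..t}" ?M V]
          by (simp add: mult.commute sets_restrict_space_iff)
      qed
      then have "(LINT r|?M. indicator {s<..t} r * V r) = integral {0<..<T} (\<lambda>r. indicator {s<..t} r * V r)"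
        by (rule lebesgue_integral_eq_integral) auto
      also have "\<dots> = integral {0<..<T} (\<lambda>r. if r \<in> {s<..t} then V r else 0)"
        by (intro arg_cong2[where f=integral]) (auto simp: indicator_def fun_eq_iff)
      also have "\<dots> = integral {s<..t} V"
        unfolding integral_restrict_Int using st by (intro arg_cong2[where f=integral]) auto
      also have "\<dots> = integral {s..t} V"
      proof (rule integral_subset_negligible)
        have "{s..t} - {s<..t} \<subseteq> {s}" by auto
        then show "negligible ({s..t} - {s<..t})" using negligible_sing negligible_subset by blast
      qed auto
      finally show ?thesis .
    qed
    ultimately show ?thesis using lim1 LIMSEQ_unique by metis
  qed
  \<comment> \<open>By continuity the identity extends to the end points of the time interval.\<close>
  define F where "F r = integral {0..r} V" for r
  have F: "integral {s..t} V = F t - F s" if "0 \<le> s" "s \<le> t" "t \<le> T" for s t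
    using Henstock_Kurzweil_Integration.integral_combine[of 0 s t V] that integrable_on_subinterval[OF VT, of 0 t]
    by (auto simp: F_def)
  define H where "H r = U r - F r" for r
  have "continuous_on {0..T} H"
    unfolding H_def F_def by (intro continuous_intros U indefinite_integral_continuous_1 VT)
  then have cont: "continuous_on (closure {0<..<T}) H" using T by (simp add: closure_greaterThanLessThan)
  have const: "H r = H (T / 2)" if "r \<in> {0<..<T}" for r
  proof -
    have eq: "H a = H b" if "0 < a" "a \<le> b" "b < T" for a b
      using interior[of a b] F[of a b] that by (simp add: H_def)
    show ?thesis using eq[of r "T / 2"] eq[of "T / 2" r] that T by (cases "r \<le> T / 2") auto
  qed
  have "H r = H (T / 2)" if "r \<in> {0..T}" for r
  proof -
    have "r \<in> closure {0<..<T}" using that T closure_greaterThanLessThan[of 0 T] by simp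
    from continuous_constant_on_closure[OF cont const this] show ?thesis by simp
  qed
  from this[of s] this[of t] have "H s = H t" using st by simp
  then show ?thesis using F[OF st] by (simp add: H_def)
qed


section \<open>Increments of functions with weak time derivatives\<close>

lemma L2_inner_scaleR_left: "L2_inner M (\<lambda>x. c *\<^sub>R f x) w = c * L2_inner M f w"
  by (simp add: L2_inner_def)

lemma L2_inner_minus_left: "L2_inner M (\<lambda>x. - f x) w = - L2_inner M f w"
  by (simp add: L2_inner_def)

lemma integral_subinterval:
  fixes f :: "real \<Rightarrow> real"
  assumes f: "integrable (lebesgue_on {0<..<T}) f" and st: "0 \<le> s" "t \<le> T"
  shows "integrable (lebesgue_on {s<..<t}) f" "(LINT r|lebesgue_on {s<..<t}. f r) = integral {s..t} f"
proof -
  have "set_integrable lebesgue {0<..<T} f"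
    using f by (simp add: integrable_restrict_space set_integrable_def)
  then have "set_integrable lebesgue {s<..<t} f"
    by (rule set_integrable_subset) (use st in auto)
  then show i: "integrable (lebesgue_on {s<..<t}) f" by (simp add: integrable_restrict_space set_integrable_def)
  have "(LINT r|lebesgue_on {s<..<t}. f r) = integral {s<..<t} f"
    by (rule lebesgue_integral_eq_integral[OF i]) simp
  then show "(LINT r|lebesgue_on {s<..<t}. f r) = integral {s..t} f" by (simp add: integral_open_interval_real)
qed

lemma finite_measure_interval: "finite_measure (lebesgue_on {a<..<b::real})"
  by (intro finite_measure_lebesgue_on) (simp add: lmeasurable_box flip: box_real)

lemma strongly_measurable_subset:
  assumes v: "strongly_measurable (lebesgue_on A) X N v" and AB: "B \<subseteq> A" "A \<in> sets lebesgue" "B \<in> sets lebesgue"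
  shows "strongly_measurable (lebesgue_on B) X N v"
proof -
  have ae: "AE t in lebesgue_on B. Q t" if "AE t in lebesgue_on A. Q t" for Q
    using that AB by (auto simp: AE_restrict_space_iff elim!: eventually_mono)
  obtain s where s: "\<And>n::nat. bochner_simple (lebesgue_on A) X (s n)" 
    and lim: "AE t in lebesgue_on A. (\<lambda>n. N (\<lambda>x. s n t x - v t x)) \<longlonglongrightarrow> 0"
    using v unfolding strongly_measurable_def by blast
  have "bochner_simple (lebesgue_on B) X (s n)" for n
  proof -
    have sA: "finite (s n ` A)" "\<And>x. x \<in> s n ` A \<Longrightarrow> s n -` {x} \<inter> A \<in> sets (lebesgue_on A)" "s n ` A \<subseteq> X"
      using s[of n] unfolding bochner_simple_def simple_function_def by auto
    have "s n -` {x} \<inter> B \<in> sets (lebesgue_on B)" if "x \<in> s n ` B" for x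
    proof -
      have "s n -` {x} \<inter> A \<in> sets lebesgue" using sA(2)[of x] that AB by (auto simp: sets_restrict_space_iff)
      then have "(s n -` {x} \<inter> A) \<inter> B \<in> sets lebesgue" using AB by blast
      moreover have "(s n -` {x} \<inter> A) \<inter> B = s n -` {x} \<inter> B" using AB by blast
      ultimately show ?thesis using AB by (simp add: sets_restrict_space_iff)
    qed
    moreover have "finite (s n ` B)" using finite_subset[OF image_mono[OF AB(1)] sA(1)] .
    moreover have "s n ` B \<subseteq> X" using image_mono[OF AB(1)] sA(3) by (rule order_trans)
    ultimately show ?thesis unfolding bochner_simple_def simple_function_def by auto
  qed
  then show ?thesis using v ae[OF lim] ae unfolding strongly_measurable_def by blast
qed

lemma L2_time_integrable_norm:
  assumes v: "v \<in> L2_time T X N" and N: "\<And>f. 0 \<le> N f"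
  shows "integrable (lebesgue_on {0<..<T}) (\<lambda>t. N (v t))"
proof -
  let ?M = "lebesgue_on {0<..<T}"
  interpret finite_measure ?M by (rule finite_measure_interval)
  have sq: "integrable ?M (\<lambda>t. (N (v t))\<^sup>2)" using v by (simp add: L2_time_def)
  have "(\<lambda>t. sqrt ((N (v t))\<^sup>2)) \<in> borel_measurable ?M" using borel_measurable_integrable[OF sq] by measurable
  then have m: "(\<lambda>t. N (v t)) \<in> borel_measurable ?M" using N by simp
  show ?thesis
  proof (rule Bochner_Integration.integrable_bound[OF _ m])
    show "integrable ?M (\<lambda>t. 1 + (N (v t))\<^sup>2)" using sq by (intro Bochner_Integration.integrable_add) auto
    have "norm y \<le> norm (1 + y\<^sup>2)" for y :: real
      using sum_squares_bound[of "\<bar>y\<bar>" 1] by (simp add: add_nonneg_nonneg)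
    then show "AE t in ?M. norm (N (v t)) \<le> norm (1 + (N (v t))\<^sup>2)" by simp
  qed
qed

context bounded_domain
begin

abbreviation "dx \<equiv> lebesgue_on \<Omega>"

text \<open>The spaces in which the time derivatives take their values: bounds in their norms control the
  pairings with functions in $L^2(\Omega)$.\<close>

definition dominating_norm :: "(real^'d \<Rightarrow> 'b::euclidean_space) set \<Rightarrow> ((real^'d \<Rightarrow> 'b) \<Rightarrow> real) \<Rightarrow> bool" where
  "dominating_norm X N \<longleftrightarrow> subspace X \<and> X \<subseteq> L2 dx \<and> (\<forall>f. 0 \<le> N f) \<and> (\<forall>f\<in>X. L2_norm dx f \<le> N f)"

lemma dominating_norm_Sobolev:
  assumes "subspace X" "X \<subseteq> Sobolev \<Omega> m" shows "dominating_norm X (Sobolev_norm \<Omega> m)"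
  unfolding dominating_norm_def
proof (intro conjI ballI allI)
  show "X \<subseteq> L2 dx" using assms(2) Sobolev_L2 by blast
  show "L2_norm dx f \<le> Sobolev_norm \<Omega> m f" if "f \<in> X" for f
    using that assms(2) by (intro L2_norm_le_Sobolev_norm Sobolev_L2[of f m]) blast
qed (use assms in auto)

lemma dominating_norm_L2: "dominating_norm (L2 dx) (L2_norm dx)"
  by (simp add: dominating_norm_def subspace_L2)

lemma inner_le_dominating_norm:
  assumes "dominating_norm X N" "f \<in> X" "w \<in> L2 dx"
  shows "\<bar>L2_inner dx f w\<bar> \<le> N f * L2_norm dx w"
proof -
  have "\<bar>L2_inner dx f w\<bar> \<le> L2_norm dx f * L2_norm dx w"
    using assms by (intro L2.Cauchy_Schwarz) (auto simp: dominating_norm_def)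
  also have "\<dots> \<le> N f * L2_norm dx w" using assms by (intro mult_right_mono) (auto simp: dominating_norm_def)
  finally show ?thesis .
qed

lemma L2_time_integrable_inner:
  fixes v :: "real \<Rightarrow> real^'d \<Rightarrow> 'b::euclidean_space"
  assumes v: "v \<in> L2_time T X N" and X: "dominating_norm X N" and w: "w \<in> L2 dx"
  shows "integrable (lebesgue_on {0<..<T}) (\<lambda>t. L2_inner dx (v t) w)"
proof (rule Bochner_Integration.integrable_bound)
  have sm: "strongly_measurable (lebesgue_on {0<..<T}) X N v" using v by (simp add: L2_time_def)
  show "integrable (lebesgue_on {0<..<T}) (\<lambda>t. N (v t) * L2_norm dx w)"
    using X by (intro integrable_mult_left L2_time_integrable_norm[OF v]) (simp add: dominating_norm_def)
  show "(\<lambda>t. L2_inner dx (v t) w) \<in> borel_measurable (lebesgue_on {0<..<T})"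
    by (rule strongly_measurable_inner[OF complete_measure_lebesgue_on sm _ _ _ w])
       (use X in \<open>auto simp: dominating_norm_def\<close>)
  have "AE t in lebesgue_on {0<..<T}. v t \<in> X" using sm by (simp add: strongly_measurable_def)
  then show "AE t in lebesgue_on {0<..<T}. norm (L2_inner dx (v t) w) \<le> norm (N (v t) * L2_norm dx w)"
  proof eventually_elim
    case (elim t)
    show ?case using inner_le_dominating_norm[OF X elim w] by simp
  qed
qed

lemma time_continuous_inner:
  assumes u: "time_continuous T \<Omega> u" and w: "w \<in> L2 dx"
  shows "continuous_on {0..T} (\<lambda>t. L2_inner dx (u t) w)"
  unfolding continuous_on_def
proof
  fix t assume t: "t \<in> {0..T}"
  have lim: "((\<lambda>s. L2_norm dx (u s - u t) * L2_norm dx w) \<longlongrightarrow> 0) (at t within {0..T})"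
    using u t unfolding time_continuous_def fun_diff_def by (intro tendsto_mult_left_zero) blast
  have "\<forall>\<^sub>F s in at t within {0..T}. norm (L2_inner dx (u s) w - L2_inner dx (u t) w) \<le> L2_norm dx (u s - u t) * L2_norm dx w"
    unfolding eventually_at_filter
  proof (intro always_eventually allI impI)
    fix s assume "s \<in> {0..T}"
    then have m: "u s \<in> L2 dx" "u t \<in> L2 dx" using u t by (auto simp: time_continuous_def)
    show "norm (L2_inner dx (u s) w - L2_inner dx (u t) w) \<le> L2_norm dx (u s - u t) * L2_norm dx w"
      using L2.Cauchy_Schwarz[OF L2.closed(3)[OF m] w] m w by (simp add: L2.diff)
  qed
  then show "((\<lambda>t. L2_inner dx (u t) w) \<longlongrightarrow> L2_inner dx (u t) w) (at t within {0..T})"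
    by (rule LIM_zero_cancel[OF Lim_null_comparison[OF _ lim]])
qed

text \<open>Scalarization: for each fixed \<open>w\<close> the weak time derivative is a weak derivative of the scalar function
  \<open>t \<mapsto> (u(t), w)\<close>, which is continuous.\<close>

lemma weak_time_deriv_inner:
  fixes u v :: "real \<Rightarrow> real^'d \<Rightarrow> 'b::euclidean_space"
  assumes T: "T > 0" and u: "time_continuous T \<Omega> u" and uv: "has_weak_time_deriv T \<Omega> u v" 
    and v: "v \<in> L2_time T X N" "dominating_norm X N" and w: "w \<in> L2 dx" and st: "0 \<le> s" "s \<le> t" "t \<le> T"
  shows "L2_inner dx (u t - u s) w = integral {s..t} (\<lambda>r. L2_inner dx (v r) w)"
proof -
  let ?M = "lebesgue_on {0<..<T}"
  have "L2_inner dx (u t) w - L2_inner dx (u s) w = integral {s..t} (\<lambda>r. L2_inner dx (v r) w)"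
  proof (rule weak_derivative_fundamental_theorem[OF T time_continuous_inner[OF u w] L2_time_integrable_inner[OF v w] _ st])
    fix \<phi> assume "\<phi> \<in> test_functions {0<..<T}"
    then obtain J where J: "has_time_integral ?M (L2 dx) (L2_norm dx) (\<lambda>t x. deriv \<phi> t *\<^sub>R u t x) J"
      "has_time_integral ?M (L2 dx) (L2_norm dx) (\<lambda>t x. \<phi> t *\<^sub>R v t x) (\<lambda>x. - J x)"
      using uv unfolding has_weak_time_deriv_def by blast
    have M: "complete_measure ?M" "finite_measure ?M" 
      by (auto intro: complete_measure_lebesgue_on finite_measure_interval)
    have 1: "integrable ?M (\<lambda>t. deriv \<phi> t * L2_inner dx (u t) w)" "(LINT t|?M. deriv \<phi> t * L2_inner dx (u t) w) = L2_inner dx J w"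
      using has_time_integral_inner[OF M J(1) w] by (simp_all add: L2_inner_scaleR_left)
    have 2: "(LINT t|?M. \<phi> t * L2_inner dx (v t) w) = - L2_inner dx J w"
      using has_time_integral_inner[OF M J(2) w] by (simp_all add: L2_inner_scaleR_left L2_inner_minus_left)
    have "integral {0..T} (\<lambda>t. deriv \<phi> t * L2_inner dx (u t) w) = (LINT t|?M. deriv \<phi> t * L2_inner dx (u t) w)"
      using lebesgue_integral_eq_integral[OF 1(1)] by (simp add: integral_open_interval_real)
    then show "integral {0..T} (\<lambda>t. deriv \<phi> t * L2_inner dx (u t) w) = - (LINT t|?M. \<phi> t * L2_inner dx (v t) w)"
      using 1 2 by simp
  qed
  moreover have "u t \<in> L2 dx" "u s \<in> L2 dx" using u st by (auto simp: time_continuous_def)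
  ultimately show ?thesis using w by (simp add: L2.diff)
qed

lemma time_increment_inner_le:
  fixes u v :: "real \<Rightarrow> real^'d \<Rightarrow> 'b::euclidean_space"
  assumes T: "T > 0" and u: "time_continuous T \<Omega> u" and uv: "has_weak_time_deriv T \<Omega> u v" 
    and v: "v \<in> L2_time T X N" "dominating_norm X N" and w: "w \<in> L2 dx" and st: "0 \<le> s" "s \<le> t" "t \<le> T"
  shows "\<bar>L2_inner dx (u t - u s) w\<bar> \<le> integral {s..t} (\<lambda>r. N (v r)) * L2_norm dx w"
proof -
  let ?M = "lebesgue_on {s<..<t}"
  have iv: "integrable (lebesgue_on {0<..<T}) (\<lambda>r. N (v r))"
    using v by (intro L2_time_integrable_norm) (auto simp: dominating_norm_def)
  note i = L2_time_integrable_inner[OF v w]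
  have "\<bar>L2_inner dx (u t - u s) w\<bar> = norm (LINT r|?M. L2_inner dx (v r) w)"
    using weak_time_deriv_inner[OF T u uv v w st] integral_subinterval(2)[OF i, of s t] st by simp
  also have "\<dots> \<le> (LINT r|?M. norm (L2_inner dx (v r) w))" by (rule integral_norm_bound)
  also have "\<dots> \<le> (LINT r|?M. N (v r) * L2_norm dx w)"
  proof (rule integral_mono_AE)
    show "integrable ?M (\<lambda>r. norm (L2_inner dx (v r) w))" 
      using integral_subinterval(1)[OF i, of s t] st by auto
    show "integrable ?M (\<lambda>r. N (v r) * L2_norm dx w)"
      using integral_subinterval(1)[OF iv, of s t] st by auto
    have "strongly_measurable (lebesgue_on {0<..<T}) X N v" using v by (simp add: L2_time_def)
    then have "strongly_measurable ?M X N v" by (rule strongly_measurable_subset) (use st in auto)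
    then have "AE r in ?M. v r \<in> X" by (simp add: strongly_measurable_def)
    then show "AE r in ?M. norm (L2_inner dx (v r) w) \<le> N (v r) * L2_norm dx w"
      by eventually_elim (use inner_le_dominating_norm[OF v(2) _ w] in simp)
  qed
  also have "\<dots> = integral {s..t} (\<lambda>r. N (v r)) * L2_norm dx w"
    using integral_subinterval(2)[OF iv, of s t] st by simp
  finally show ?thesis .
qed

text \<open>The increment and the Bochner integral of the derivative in the Sobolev space have the same inner
  products with all functions in $L^2$, hence agree almost everywhere.\<close>

lemma time_increment_Sobolev:
  fixes u v :: "real \<Rightarrow> real^'d \<Rightarrow> 'b::euclidean_space"
  assumes T: "T > 0" and u: "time_continuous T \<Omega> u" and uv: "has_weak_time_deriv T \<Omega> u v" 
    and v: "v \<in> L2_time T X (Sobolev_norm \<Omega> m)" and X: "subspace X" "X \<subseteq> Sobolev \<Omega> m"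
    and st: "0 \<le> s" "s \<le> t" "t \<le> T"
  shows "u t - u s \<in> Sobolev \<Omega> m" 
    and "Sobolev_norm \<Omega> m (u t - u s) \<le> integral {s..t} (\<lambda>r. Sobolev_norm \<Omega> m (v r))"
proof -
  let ?M = "lebesgue_on {s<..<t}" and ?N = "Sobolev_norm \<Omega> m"
  have dom: "dominating_norm X ?N" by (rule dominating_norm_Sobolev[OF X])
  have iv: "integrable (lebesgue_on {0<..<T}) (\<lambda>r. ?N (v r))"
    by (rule L2_time_integrable_norm[OF v]) simp
  have "strongly_measurable (lebesgue_on {0<..<T}) X ?N v" using v by (simp add: L2_time_def)
  then have sm: "strongly_measurable ?M X ?N v" by (rule strongly_measurable_subset) (use st in auto)
  obtain z where z: "z \<in> Sobolev \<Omega> m" "?N z \<le> (LINT r|?M. ?N (v r))"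
    and zw: "\<forall>w\<in>L2 dx. L2_inner dx z w = (LINT r|?M. L2_inner dx (v r) w)"
    using Bochner_integral_Sobolev[OF complete_measure_lebesgue_on finite_measure_interval X sm
        integral_subinterval(1)[OF iv st(1,3)]] by auto
  have uL: "u t \<in> L2 dx" "u s \<in> L2 dx" using u st by (auto simp: time_continuous_def)
  have zL: "z \<in> L2 dx" by (rule Sobolev_L2[OF z(1)])
  define d where "d = (u t - u s) - z"
  have d: "d \<in> L2 dx" using uL zL by (auto simp: d_def)
  have "L2_inner dx (u t - u s) d = L2_inner dx z d"
    using weak_time_deriv_inner[OF T u uv v dom d st] zw d integral_subinterval(2)[OF L2_time_integrable_inner[OF v dom d] st(1,3)]
    by simp
  then have "L2_inner dx d d = 0" using uL zL d L2.diff[of "u t - u s" dx z d] by (simp add: d_def)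
  then have "AE x in dx. d x = 0" using d by (intro L2_norm_eq_0_AE) (auto simp: L2_norm_inner)
  then have ae: "AE x in dx. z x = (u t - u s) x" by eventually_elim (simp add: d_def)
  have mu: "u t - u s \<in> borel_measurable dx" using uL by (intro L2_measurable L2.closed)
  show "u t - u s \<in> Sobolev \<Omega> m" by (rule Sobolev_cong[OF ae z(1) mu])
  have "?N (u t - u s) = ?N z" using Sobolev_norm_cong[OF ae L2_measurable[OF zL] mu] by simp
  then show "?N (u t - u s) \<le> integral {s..t} (\<lambda>r. ?N (v r))"
    using z(2) integral_subinterval(2)[OF iv st(1,3)] by simp
qed

text \<open>Consistency of the backward difference quotient. Let \<open>e\<close> be its error, multiplied by the step
  size. Then \<open>(e, e)\<close> is the integral of \<open>(v(r) - v(t), e)\<close> over the time step, and the increments of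
  \<open>v\<close>, tested with \<open>e\<close>, are bounded by the integral of the norm of the second derivative.\<close>

lemma backward_difference_error:
  fixes u v :: "real \<Rightarrow> real^'d \<Rightarrow> 'b::euclidean_space"
  assumes T: "T > 0" and u: "time_continuous T \<Omega> u" and uv: "has_weak_time_deriv T \<Omega> u v" 
    and v: "v \<in> L2_time T X N" "dominating_norm X N" and vc: "time_continuous T \<Omega> v"
    and vz: "has_weak_time_deriv T \<Omega> v z" and z: "z \<in> L2_time T Y N'" "dominating_norm Y N'" 
    and st: "0 \<le> s" "s \<le> t" "t \<le> T"
  shows "L2_norm dx (u t - u s - (t - s) *\<^sub>R v t) \<le> (t - s) * integral {s..t} (\<lambda>r. N' (z r))"
proof -
  define e where "e = u t - u s - (t - s) *\<^sub>R v t"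
  let ?I = "integral {s..t} (\<lambda>r. N' (z r))"
  have L: "u t \<in> L2 dx" "u s \<in> L2 dx" "\<And>r. r \<in> {0..T} \<Longrightarrow> v r \<in> L2 dx" 
    using u vc st by (auto simp: time_continuous_def)
  have e: "e \<in> L2 dx" unfolding e_def using L st by (intro L2.closed) auto
  have N0: "\<And>f. 0 \<le> N' f" using z(2) by (simp add: dominating_norm_def)
  have iz: "integrable (lebesgue_on {0<..<T}) (\<lambda>r. N' (z r))"
    by (rule L2_time_integrable_norm[OF z(1) N0])
  have hk: "(\<lambda>r. N' (z r)) integrable_on {a..b}" if "0 \<le> a" "b \<le> T" for a b
    using integrable_on_lebesgue_on[OF integral_subinterval(1)[OF iz that]] by (simp add: integrable_on_Icc_iff_Ioo)
  have c: "continuous_on {s..t} (\<lambda>r. L2_inner dx (v r) e)"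
    using continuous_on_subset[OF time_continuous_inner[OF vc e], of "{s..t}"] st by auto
  have "integral {s..t} (\<lambda>r. L2_inner dx (v r) e - L2_inner dx (v t) e) 
      = L2_inner dx (u t - u s) e - (t - s) * L2_inner dx (v t) e"
    using st weak_time_deriv_inner[OF T u uv v e st]
    by (subst Henstock_Kurzweil_Integration.integral_diff) (auto intro: integrable_continuous_real c)
  also have "\<dots> = L2_inner dx e e"
  proof -
    have vt: "v t \<in> L2 dx" using L st by auto
    have "L2_inner dx e e = L2_inner dx (u t - u s) e - L2_inner dx ((t - s) *\<^sub>R v t) e"
      using L(1,2) vt e L2.diff[of "u t - u s" dx "(t - s) *\<^sub>R v t" e] by (simp add: e_def[symmetric])
    then show ?thesis using vt e by (simp add: L2.scale)
  qed
  also have "\<dots> = (L2_norm dx e)\<^sup>2" using e by (simp add: L2.nrm_sq)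
  finally have "(L2_norm dx e)\<^sup>2 = integral {s..t} (\<lambda>r. L2_inner dx (v r) e - L2_inner dx (v t) e)" by simp
  also have "\<dots> \<le> norm (integral {s..t} (\<lambda>r. L2_inner dx (v r) e - L2_inner dx (v t) e))" by simp
  also have "\<dots> \<le> (?I * L2_norm dx e) * (t - s)"
  proof (rule integral_bound[OF st(2)])
    show "continuous_on {s..t} (\<lambda>r. L2_inner dx (v r) e - L2_inner dx (v t) e)" by (intro continuous_intros c)
    fix r assume r: "r \<in> {s..t}"
    have "\<bar>L2_inner dx (v t - v r) e\<bar> \<le> integral {r..t} (\<lambda>r. N' (z r)) * L2_norm dx e"
      using r st by (intro time_increment_inner_le[OF T vc vz z e]) auto
    also have "\<dots> \<le> ?I * L2_norm dx e"
      using r st hk N0 by (intro mult_right_mono integral_subset_le) auto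
    finally show "norm (L2_inner dx (v r) e - L2_inner dx (v t) e) \<le> ?I * L2_norm dx e"
      using L r st e by (simp add: L2.diff)
  qed
  finally have sq: "L2_norm dx e * L2_norm dx e \<le> ((t - s) * ?I) * L2_norm dx e"
    by (simp add: power2_eq_square mult_ac)
  have "L2_norm dx e \<le> (t - s) * ?I"
  proof (cases "L2_norm dx e = 0")
    case True
    have "0 \<le> ?I" using hk[of s t] st N0 by (intro Henstock_Kurzweil_Integration.integral_nonneg) auto
    then show ?thesis using True st by simp
  next
    case False
    then have "L2_norm dx e > 0" by (simp add: less_le)
    with sq show ?thesis by (simp add: mult_le_cancel_right)
  qed
  then show ?thesis by (simp add: e_def)
qed

end

section \<open>The discrete energy estimate\<close>

text \<open>Summation of the energy inequalities: \<open>e n\<close> is the energy norm of the discrete error,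
  \<open>D n\<close> the squared seminorm of its pressure gradient and \<open>s n\<close> the size of the data of step
  \<open>n\<close>. For the first bound, the inequalities are summed up to the time of the largest energy norm,
  by which one can then divide. For the second, the first inequality bounds the time average of \<open>D\<close>,
  so that some \<open>D m\<close> with \<open>m \<ge> 1\<close> is small, and the second inequality propagates this from \<open>m\<close> to the
  final time. In this way the square of \<open>s 0\<close>, which for the scheme is not of order \<open>\<tau>\<close>, is divided by
  the final time and not by the step size.\<close>

lemma energy_summation:
  fixes e D s :: "nat \<Rightarrow> real"
  assumes e0: "e 0 = 0" and e: "\<And>n. 0 \<le> e n" and D: "\<And>n. 0 \<le> D n" and s: "\<And>n. 0 \<le> s n" 
    and \<tau>: "\<tau> > 0" and C: "C \<ge> 0"
    and energy: "\<And>n. n \<le> N \<Longrightarrow> (e (Suc n))\<^sup>2 - (e n)\<^sup>2 + 2 * \<tau> * D (Suc n) \<le> 2 * C * s n * e (Suc n)"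
    and grad: "\<And>n. 1 \<le> n \<Longrightarrow> n \<le> N \<Longrightarrow> D (Suc n) - D n \<le> C\<^sup>2 * (s n)\<^sup>2 / \<tau>"
  shows "e (Suc N) \<le> 2 * C * (\<Sum>n\<le>N. s n)"
    and "D (Suc N) \<le> 2 * C\<^sup>2 * (\<Sum>n\<le>N. s n)\<^sup>2 / (real (N + 1) * \<tau>) + C\<^sup>2 * (\<Sum>n=1..N. (s n)\<^sup>2) / \<tau>"
proof -
  define m where "m = Max (e ` {..Suc N})"
  have m: "e n \<le> m" if "n \<le> Suc N" for n using that by (simp add: m_def)
  have m0: "0 \<le> m" using m[of 0] e0 by simp
  let ?S = "\<Sum>n\<le>N. s n"
  have S0: "0 \<le> ?S" using s by (simp add: sum_nonneg)
  have tele: "(e j)\<^sup>2 + 2 * \<tau> * (\<Sum>n<j. D (Suc n)) \<le> 2 * C * m * (\<Sum>n<j. s n)" if "j \<le> Suc N" for j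
    using that
  proof (induction j)
    case (Suc j)
    have "2 * C * s j * e (Suc j) \<le> 2 * C * s j * m"
      using C s[of j] m[OF Suc.prems] by (intro mult_left_mono) auto
    then show ?case using Suc energy[of j] by (simp add: algebra_simps)
  qed (simp add: e0)
  have sub: "(\<Sum>n<j. s n) \<le> ?S" if "j \<le> Suc N" for j
    using that s by (intro sum_mono2) auto
  have "m \<in> e ` {..Suc N}" unfolding m_def by (rule Max_in) auto
  then obtain j where j: "j \<le> Suc N" "m = e j" by auto
  have "(\<Sum>n<j. D (Suc n)) \<ge> 0" using D by (simp add: sum_nonneg)
  then have "0 \<le> 2 * \<tau> * (\<Sum>n<j. D (Suc n))" using \<tau> by simp
  then have "m\<^sup>2 \<le> 2 * C * m * (\<Sum>n<j. s n)" using tele[OF j(1)] unfolding j(2)[symmetric] by linarith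
  also have "\<dots> \<le> 2 * C * m * ?S" using sub[OF j(1)] C m0 by (intro mult_left_mono) auto
  finally have "m * m \<le> (2 * C * ?S) * m" by (simp add: power2_eq_square mult_ac)
  then have mS: "m \<le> 2 * C * ?S" using m0 C S0 by (cases "m = 0") (auto simp: mult_le_cancel_right)
  then show "e (Suc N) \<le> 2 * C * ?S" using m[of "Suc N"] by simp
  have "2 * \<tau> * (\<Sum>n\<le>N. D (Suc n)) \<le> 2 * C * m * ?S"
    using tele[of "Suc N"] zero_le_power2[of "e (Suc N)"] unfolding lessThan_Suc_atMost by linarith
  also have "\<dots> \<le> 2 * C * (2 * C * ?S) * ?S"
    using mS C S0 by (intro mult_right_mono mult_left_mono) auto
  finally have avg: "\<tau> * (\<Sum>n\<le>N. D (Suc n)) \<le> 2 * C\<^sup>2 * ?S\<^sup>2" by (simp add: power2_eq_square mult_ac)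
  obtain k where k: "k \<le> N" "\<And>n. n \<le> N \<Longrightarrow> D (Suc k) \<le> D (Suc n)"
  proof -
    have "Min ((\<lambda>n. D (Suc n)) ` {..N}) \<in> (\<lambda>n. D (Suc n)) ` {..N}" by (rule Min_in) auto
    then obtain i where "Min ((\<lambda>n. D (Suc n)) ` {..N}) = D (Suc i)" "i \<in> {..N}" by (rule imageE)
    then have "i \<le> N" "D (Suc i) = Min ((\<lambda>n. D (Suc n)) ` {..N})" by auto
    moreover have "Min ((\<lambda>n. D (Suc n)) ` {..N}) \<le> D (Suc n)" if "n \<le> N" for n
      using that by (intro Min_le) auto
    ultimately show thesis using that by metis
  qed
  have "real (N + 1) * D (Suc k) \<le> (\<Sum>n\<le>N. D (Suc n))"
    using sum_mono[of "{..N}" "\<lambda>n. D (Suc k)" "\<lambda>n. D (Suc n)"] k by simp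
  then have "\<tau> * (real (N + 1) * D (Suc k)) \<le> \<tau> * (\<Sum>n\<le>N. D (Suc n))"
    using \<tau> by (intro mult_left_mono) auto
  then have "\<tau> * (real (N + 1) * D (Suc k)) \<le> 2 * C\<^sup>2 * ?S\<^sup>2" using avg by linarith
  then have Dk: "D (Suc k) \<le> 2 * C\<^sup>2 * ?S\<^sup>2 / (real (N + 1) * \<tau>)"
    using \<tau> by (subst pos_le_divide_eq) (simp_all add: mult_ac)
  have "D (Suc N) \<le> D (Suc k) + (\<Sum>n=Suc k..N. C\<^sup>2 * (s n)\<^sup>2 / \<tau>)"
  proof -
    have "D (Suc N) - D (Suc k) = (\<Sum>n=Suc k..N. D (Suc n) - D n)"
      using k(1) by (subst sum_Suc_diff) auto
    also have "\<dots> \<le> (\<Sum>n=Suc k..N. C\<^sup>2 * (s n)\<^sup>2 / \<tau>)"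
      by (intro sum_mono grad) auto
    finally show ?thesis by simp
  qed
  also have "(\<Sum>n=Suc k..N. C\<^sup>2 * (s n)\<^sup>2 / \<tau>) \<le> (\<Sum>n=1..N. C\<^sup>2 * (s n)\<^sup>2 / \<tau>)"
    using \<tau> by (intro sum_mono2) auto
  also have "\<dots> = C\<^sup>2 * (\<Sum>n=1..N. (s n)\<^sup>2) / \<tau>" by (simp add: sum_distrib_left sum_divide_distrib)
  finally show "D (Suc N) \<le> 2 * C\<^sup>2 * ?S\<^sup>2 / (real (N + 1) * \<tau>) + C\<^sup>2 * (\<Sum>n=1..N. (s n)\<^sup>2) / \<tau>"
    using Dk by simp
qed


text \<open>The bilinear forms of the problem on abstract spaces. A triple collects displacement,
  total pressure and pressure; \<open>energy\<close> is the inner product belonging to the stored energy.\<close>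

locale poroelastic_forms =
  ip: semi_inner W ip + a: semi_inner S a + d: semi_inner D d
  for W :: "'w::real_vector set" and ip and S :: "'v::real_vector set" and a and D :: "'w set" and d +
  fixes b :: "'v \<Rightarrow> 'w \<Rightarrow> real" and lam alp c :: real
  assumes D_subset: "D \<subseteq> W" and pos: "lam > 0" "alp > 0" "c \<ge> 0"
begin

definition energy :: "'v \<times> 'w \<times> 'w \<Rightarrow> 'v \<times> 'w \<times> 'w \<Rightarrow> real" where
  "energy Z Z' = (case (Z, Z') of ((U, X, Q), (U', X', Q')) \<Rightarrow>
     c * ip Q Q' + (1 / lam) * ip (alp *\<^sub>R Q - X) (alp *\<^sub>R Q' - X') + a U U')"

sublocale en: semi_inner "S \<times> W \<times> W" energy
proof
  show "subspace (S \<times> W \<times> W)" by (intro subspace_Times a.subspace ip.subspace)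
  fix x y z :: "'v \<times> 'w \<times> 'w" and r :: real
  assume x: "x \<in> S \<times> W \<times> W"
  then show "0 \<le> energy x x" using pos
    by (auto simp: energy_def a.nonneg ip.nonneg intro!: add_nonneg_nonneg)
  assume y: "y \<in> S \<times> W \<times> W"
  show "energy x y = energy y x" using x y by (auto simp: energy_def ip.sym a.sym)
  obtain U X Q U' X' Q' where xy: "x = (U, X, Q)" "y = (U', X', Q')" by (metis prod_cases3)
  have m: "U \<in> S" "X \<in> W" "Q \<in> W" "U' \<in> S" "X' \<in> W" "Q' \<in> W" using x y xy by auto
  have e: "alp *\<^sub>R (r *\<^sub>R Q) - r *\<^sub>R X = r *\<^sub>R (alp *\<^sub>R Q - X)" by (simp add: algebra_simps)
  show "energy (r *\<^sub>R x) y = r * energy x y"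
  proof -
    have "ip (r *\<^sub>R (alp *\<^sub>R Q - X)) (alp *\<^sub>R Q' - X') = r * ip (alp *\<^sub>R Q - X) (alp *\<^sub>R Q' - X')"
      using m by (intro ip.scale) auto
    then show ?thesis
      unfolding energy_def xy scaleR_Pair prod.case e using m by (simp add: ip.scale a.scale distrib_left)
  qed
  assume z: "z \<in> S \<times> W \<times> W"
  obtain U'' X'' Q'' where zz: "z = (U'', X'', Q'')" by (metis prod_cases3)
  have m': "U'' \<in> S" "X'' \<in> W" "Q'' \<in> W" using z zz by auto
  have e': "alp *\<^sub>R (Q + Q') - (X + X') = (alp *\<^sub>R Q - X) + (alp *\<^sub>R Q' - X')" by (simp add: algebra_simps)
  show "energy (x + y) z = energy x z + energy y z"
    unfolding energy_def xy zz add_Pair prod.case e' using m m' pos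
    by (simp only: ip.add a.add ip.closed) (simp add: algebra_simps add_divide_distrib)
qed

text \<open>One time step, with data \<open>\<rho>\<close> and \<open>\<gamma>\<close>, tested with a triple \<open>(U, X, Q)\<close> that satisfies the
  elasticity equation: this equation replaces the elastic energy by the term with \<open>b\<close>, which the
  constraint equation expresses by the pressures, and the remaining terms form squares.\<close>

lemma step_identity:
  assumes m: "dU \<in> S" "dX \<in> W" "dQ \<in> W" "U \<in> S" "X \<in> W" "Q \<in> W"
    and elasticity: "a U dU = b dU X"
    and constraint: "b dU X + (1 / lam) * ip (dX - alp *\<^sub>R dQ) X = \<gamma>"
    and flow: "(c + alp\<^sup>2 / lam) * ip dQ Q - (alp / lam) * ip dX Q + \<delta> = \<rho>"
  shows "energy (dU, dX, dQ) (U, X, Q) + \<delta> = \<rho> + \<gamma>"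
proof -
  have "a dU U = b dU X" using elasticity m by (simp add: a.sym)
  then have "energy (dU, dX, dQ) (U, X, Q) = c * ip dQ Q + (1 / lam) * ip (alp *\<^sub>R dQ - dX) (alp *\<^sub>R Q - X) + b dU X"
    by (simp add: energy_def)
  also have "(1 / lam) * ip (alp *\<^sub>R dQ - dX) (alp *\<^sub>R Q - X) = 
      (alp\<^sup>2 / lam) * ip dQ Q - (alp / lam) * ip dX Q + (1 / lam) * ip (dX - alp *\<^sub>R dQ) X"
    using m pos by (simp add: ip.expand ip.closed field_simps power2_eq_square)
  finally show ?thesis using constraint flow by (simp add: algebra_simps)
qed

text \<open>By the inf-sup condition the total pressure is controlled by the displacement, hence the
  energy norm controls both pressures, also when the storage coefficient vanishes.\<close>

definition control :: "real \<Rightarrow> real" where "control Cs = Cs + (sqrt lam + Cs) / alp"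

lemma energy_control:
  assumes m: "U \<in> S" "X \<in> W" "Q \<in> W" and X: "ip.nrm X \<le> Cs * a.nrm U" and Cs: "Cs \<ge> 0"
  shows "a.nrm U \<le> en.nrm (U, X, Q)" "ip.nrm X \<le> control Cs * en.nrm (U, X, Q)" 
    "ip.nrm Q \<le> control Cs * en.nrm (U, X, Q)"
proof -
  let ?e = "en.nrm (U, X, Q)"
  have Z: "(U, X, Q) \<in> S \<times> W \<times> W" using m by auto
  have e0: "0 \<le> ?e" by (rule en.nrm_nonneg[OF Z])
  have sq: "?e\<^sup>2 = c * ip Q Q + (1 / lam) * ip (alp *\<^sub>R Q - X) (alp *\<^sub>R Q - X) + a U U"
    using en.nrm_sq[OF Z] by (simp add: energy_def)
  have nn: "0 \<le> c * ip Q Q" "0 \<le> (1 / lam) * ip (alp *\<^sub>R Q - X) (alp *\<^sub>R Q - X)" "0 \<le> a U U"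
    using m pos ip.nonneg[of "alp *\<^sub>R Q - X"] by (auto intro!: mult_nonneg_nonneg ip.nonneg a.nonneg)
  have "(a.nrm U)\<^sup>2 \<le> ?e\<^sup>2" using nn sq m by (simp add: a.nrm_sq)
  then show U: "a.nrm U \<le> ?e" using e0 by (rule power2_le_imp_le)
  have X': "ip.nrm X \<le> Cs * ?e" using X mult_left_mono[OF U Cs] by linarith
  have "(1 / lam) * ip (alp *\<^sub>R Q - X) (alp *\<^sub>R Q - X) \<le> ?e\<^sup>2" using nn sq by linarith
  then have "ip (alp *\<^sub>R Q - X) (alp *\<^sub>R Q - X) \<le> lam * ?e\<^sup>2" using pos by (simp add: field_simps)
  then have "(ip.nrm (alp *\<^sub>R Q - X))\<^sup>2 \<le> (sqrt lam * ?e)\<^sup>2"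
    using m pos by (simp add: ip.nrm_sq ip.closed power_mult_distrib del: ip.expand)
  then have "ip.nrm (alp *\<^sub>R Q - X) \<le> sqrt lam * ?e"
    by (rule power2_le_imp_le) (use e0 pos in simp)
  moreover have "ip.nrm (alp *\<^sub>R Q) \<le> ip.nrm (alp *\<^sub>R Q - X) + ip.nrm X"
    using ip.triangle[of "alp *\<^sub>R Q - X" X] m by simp
  ultimately have "alp * ip.nrm Q \<le> (sqrt lam + Cs) * ?e"
    using X' m pos by (simp add: ip.nrm_scale algebra_simps)
  then have Q: "ip.nrm Q \<le> (sqrt lam + Cs) / alp * ?e" using pos by (simp add: field_simps)
  have "0 \<le> (sqrt lam + Cs) / alp * ?e" "0 \<le> Cs * ?e" using pos Cs e0 by auto
  then show "ip.nrm X \<le> control Cs * ?e" "ip.nrm Q \<le> control Cs * ?e"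
    using X' Q by (simp_all add: control_def distrib_right)
qed

lemma (in -) half_square_bound: "(x::real) * y - x\<^sup>2 \<le> y\<^sup>2 / 4"
  using zero_le_power2[of "y / 2 - x"] by (simp add: power2_eq_square algebra_simps)

text \<open>The discrete error equations imply the error bounds: testing with the new error gives the
  estimate in the energy norm, testing with its increment the one of the pressure gradient.\<close>

lemma discrete_stability:
  fixes U :: "nat \<Rightarrow> 'v" and X Q :: "nat \<Rightarrow> 'w"
  assumes Vh: "\<And>n. n \<le> Suc N \<Longrightarrow> U n \<in> Vh" "subspace Vh" "Vh \<subseteq> S"
    and Wh: "\<And>n. n \<le> Suc N \<Longrightarrow> X n \<in> Wh" "subspace Wh" "Wh \<subseteq> W" 
    and Mh: "\<And>n. n \<le> Suc N \<Longrightarrow> Q n \<in> Mh" "subspace Mh" "Mh \<subseteq> D"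
    and init: "U 0 = 0" "X 0 = 0" "Q 0 = 0"
    and b_diff: "\<And>v x y. v \<in> Vh \<Longrightarrow> x \<in> Wh \<Longrightarrow> y \<in> Wh \<Longrightarrow> b v (x - y) = b v x - b v y"
    and elasticity: "\<And>n v. n \<le> Suc N \<Longrightarrow> v \<in> Vh \<Longrightarrow> a (U n) v = b v (X n)"
    and inf_sup: "\<And>u x. u \<in> Vh \<Longrightarrow> x \<in> Wh \<Longrightarrow> (\<And>v. v \<in> Vh \<Longrightarrow> a u v = b v x) \<Longrightarrow> ip.nrm x \<le> Cs * a.nrm u"
    and Cs: "Cs \<ge> 0" and \<tau>: "\<tau> > 0" and gr: "\<And>n. g n \<in> W" "\<And>n. r n \<in> W"
    and constraint: "\<And>n \<phi>. n \<le> N \<Longrightarrow> \<phi> \<in> Wh \<Longrightarrow> 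
      b (U (Suc n) - U n) \<phi> + (1 / lam) * ip ((X (Suc n) - X n) - alp *\<^sub>R (Q (Suc n) - Q n)) \<phi> = ip (g n) \<phi>"
    and flow: "\<And>n \<psi>. n \<le> N \<Longrightarrow> \<psi> \<in> Mh \<Longrightarrow> 
      (c + alp\<^sup>2 / lam) * ip (Q (Suc n) - Q n) \<psi> - (alp / lam) * ip (X (Suc n) - X n) \<psi> + \<tau> * d (Q (Suc n)) \<psi> = ip (r n) \<psi>"
    and s: "\<And>n. n \<le> N \<Longrightarrow> ip.nrm (r n) + ip.nrm (g n) \<le> s n"
  shows "en.nrm (U (Suc N), X (Suc N), Q (Suc N)) \<le> 2 * control Cs * (\<Sum>n\<le>N. s n)" (is ?energy)
    and "(d.nrm (Q (Suc N)))\<^sup>2 \<le> 2 * (control Cs)\<^sup>2 * (\<Sum>n\<le>N. s n)\<^sup>2 / (real (N + 1) * \<tau>) 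
            + (control Cs)\<^sup>2 * (\<Sum>n=1..N. (s n)\<^sup>2) / \<tau>" (is ?grad)
proof -
  let ?C = "control Cs"
  have C0: "?C \<ge> 0" using pos Cs by (simp add: control_def)
  have mem: "U n \<in> S" "X n \<in> W" "Q n \<in> W" "Q n \<in> D" if "n \<le> Suc N" for n
    using Vh(1,3) Wh(1,3) Mh(1,3) D_subset that by blast+
  define Z where "Z n = (U n, X n, Q n)" for n
  have Z: "Z n \<in> S \<times> W \<times> W" if "n \<le> Suc N" for n using mem[OF that] by (simp add: Z_def)
  have dZ: "Z (Suc n) - Z n = (U (Suc n) - U n, X (Suc n) - X n, Q (Suc n) - Q n)" for n
    by (simp add: Z_def)
  \<comment> \<open>to be used with the new error and with its increment\<close>
  have test: "energy (Z (Suc n) - Z n) (u, x, q) + \<tau> * d (Q (Suc n)) q \<le> ?C * s n * en.nrm (u, x, q)"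
    if n: "n \<le> N" and uxq: "u \<in> Vh" "x \<in> Wh" "q \<in> Mh" and el: "\<And>v. v \<in> Vh \<Longrightarrow> a u v = b v x" for n u x q
  proof -
    have S: "u \<in> S" "x \<in> W" "q \<in> W" using uxq Vh(3) Wh(3) Mh(3) D_subset by blast+
    have dU: "U (Suc n) - U n \<in> Vh" using n Vh(1,2) by (simp add: subspace_diff)
    have "energy (Z (Suc n) - Z n) (u, x, q) + \<tau> * d (Q (Suc n)) q = ip (r n) q + ip (g n) x"
      unfolding dZ
      by (rule step_identity[OF _ _ _ S el[OF dU] constraint[OF n uxq(2)] flow[OF n uxq(3)]]) (use mem n in auto)
    also have "\<dots> \<le> ip.nrm (r n) * ip.nrm q + ip.nrm (g n) * ip.nrm x"
      using ip.Cauchy_Schwarz[OF gr(2)[of n] S(3)] ip.Cauchy_Schwarz[OF gr(1)[of n] S(2)] by linarith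
    also have "\<dots> \<le> ip.nrm (r n) * (?C * en.nrm (u, x, q)) + ip.nrm (g n) * (?C * en.nrm (u, x, q))"
      using energy_control(2,3)[OF S inf_sup[OF uxq(1,2) el] Cs] gr
      by (intro add_mono mult_left_mono ip.nrm_nonneg) auto
    also have "\<dots> = (ip.nrm (r n) + ip.nrm (g n)) * (?C * en.nrm (u, x, q))" by (simp add: distrib_right)
    also have "\<dots> \<le> s n * (?C * en.nrm (u, x, q))"
      using s[OF n] C0 S by (intro mult_right_mono mult_nonneg_nonneg en.nrm_nonneg) auto
    finally show ?thesis by (simp add: mult_ac)
  qed
  \<comment> \<open>The sequences are set to zero after the final time, since their sign is required at all indices.\<close>
  define e where "e n = (if n \<le> Suc N then en.nrm (Z n) else 0)" for n
  define D' where "D' n = (if n \<le> Suc N then (d.nrm (Q n))\<^sup>2 else 0)" for n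
  define s' where "s' n = (if n \<le> N then s n else 0)" for n
  have s0: "0 \<le> s n" if "n \<le> N" for n
    using s[OF that] ip.nrm_nonneg[OF gr(1)[of n]] ip.nrm_nonneg[OF gr(2)[of n]] by linarith
  have energy: "(e (Suc n))\<^sup>2 - (e n)\<^sup>2 + 2 * \<tau> * D' (Suc n) \<le> 2 * ?C * s' n * e (Suc n)" if n: "n \<le> N" for n
  proof -
    have "energy (Z (Suc n) - Z n) (Z (Suc n)) + \<tau> * d (Q (Suc n)) (Q (Suc n)) \<le> ?C * s n * en.nrm (Z (Suc n))"
      unfolding Z_def[of "Suc n"] using n 
      by (subst Z_def[of "Suc n", symmetric], intro test Vh(1) Wh(1) Mh(1) elasticity) auto
    moreover have "energy (Z (Suc n) - Z n) (Z (Suc n)) \<ge> ((en.nrm (Z (Suc n)))\<^sup>2 - (en.nrm (Z n))\<^sup>2) / 2"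
    proof -
      have zz: "Z (Suc n) \<in> S \<times> W \<times> W" "Z n \<in> S \<times> W \<times> W" using Z n by auto
      have "0 \<le> energy (Z (Suc n) - Z n) (Z (Suc n) - Z n)" by (rule en.nonneg[OF en.closed(3)[OF zz]])
      then show ?thesis using zz en.sym[OF zz] by (simp add: en.expand en.closed en.nrm_sq field_simps)
    qed
    ultimately show ?thesis using n mem[of "Suc n"] by (simp add: e_def D'_def s'_def d.nrm_sq field_simps)
  qed
  have grad: "D' (Suc n) - D' n \<le> ?C\<^sup>2 * (s' n)\<^sup>2 / \<tau>" if n: "n \<le> N" for n
  proof -
    let ?dZ = "Z (Suc n) - Z n" and ?dQ = "Q (Suc n) - Q n"
    have zz: "?dZ \<in> S \<times> W \<times> W" using n by (intro en.closed(3) Z) auto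
    have q: "Q (Suc n) \<in> D" "Q n \<in> D" using mem n by auto
    have "energy ?dZ (U (Suc n) - U n, X (Suc n) - X n, ?dQ) + \<tau> * d (Q (Suc n)) ?dQ 
        \<le> ?C * s n * en.nrm (U (Suc n) - U n, X (Suc n) - X n, ?dQ)"
    proof (rule test[OF n])
      show "U (Suc n) - U n \<in> Vh" "X (Suc n) - X n \<in> Wh" "?dQ \<in> Mh"
        using n Vh(1,2) Wh(1,2) Mh(1,2) by (simp_all add: subspace_diff)
      fix v assume v: "v \<in> Vh"
      then have "v \<in> S" using Vh(3) by blast
      then have "a (U (Suc n) - U n) v = a (U (Suc n)) v - a (U n) v" using mem n by (intro a.diff) auto
      then show "a (U (Suc n) - U n) v = b v (X (Suc n) - X n)"
        using v n elasticity[of "Suc n" v] elasticity[of n v] b_diff[OF v, of "X (Suc n)" "X n"] Wh(1) by auto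
    qed
    then have "(en.nrm ?dZ)\<^sup>2 + \<tau> * d (Q (Suc n)) ?dQ \<le> ?C * s n * en.nrm ?dZ"
      using zz by (simp add: en.nrm_sq dZ)
    then have "\<tau> * d (Q (Suc n)) ?dQ \<le> en.nrm ?dZ * (?C * s n) - (en.nrm ?dZ)\<^sup>2" by (simp add: mult_ac)
    also have "\<dots> \<le> (?C * s n)\<^sup>2 / 4" by (rule half_square_bound)
    finally have "2 * d (Q (Suc n)) ?dQ \<le> (?C * s n)\<^sup>2 / (2 * \<tau>)" using \<tau> by (simp add: field_simps)
    also have "\<dots> \<le> (?C * s n)\<^sup>2 / \<tau>" using \<tau> by (intro divide_left_mono) auto
    finally have *: "2 * d (Q (Suc n)) ?dQ \<le> (?C * s n)\<^sup>2 / \<tau>" .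
    have "0 \<le> d ?dQ ?dQ" using q by (intro d.nonneg) blast
    then have "d (Q (Suc n)) (Q (Suc n)) - d (Q n) (Q n) \<le> 2 * d (Q (Suc n)) ?dQ"
      using q d.sym[OF q] by (simp add: d.expand)
    then show ?thesis using * n q by (simp add: D'_def s'_def d.nrm_sq power_mult_distrib)
  qed
  have "e 0 = 0" using init by (simp add: e_def Z_def energy_def en.nrm_def)
  moreover have "0 \<le> e n" "0 \<le> D' n" "0 \<le> s' n" for n
    using s0[of n] en.nrm_nonneg[OF Z[of n]] by (auto simp: e_def D'_def s'_def)
  ultimately have "e (Suc N) \<le> 2 * ?C * (\<Sum>n\<le>N. s' n)"
    "D' (Suc N) \<le> 2 * ?C\<^sup>2 * (\<Sum>n\<le>N. s' n)\<^sup>2 / (real (N + 1) * \<tau>) + ?C\<^sup>2 * (\<Sum>n=1..N. (s' n)\<^sup>2) / \<tau>"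
    using energy_summation[of e D' s' \<tau> ?C N] \<tau> C0 energy grad by auto
  then show ?energy ?grad by (simp_all add: e_def D'_def s'_def Z_def)
qed

end

section \<open>The error equations of the fully discrete scheme\<close>

text \<open>Projection errors are controlled through their initial value and their increments.\<close>

lemma (in semi_inner) nrm_telescope:
  assumes "\<And>n. \<rho> n \<in> S" "nrm (\<rho> 0) \<le> c" "\<And>n. n < m \<Longrightarrow> nrm (\<rho> (Suc n) - \<rho> n) \<le> f n"
  shows "nrm (\<rho> m) \<le> c + (\<Sum>n<m. f n)"
  using assms(3)
proof (induction m)
  case (Suc m)
  have "nrm (\<rho> (Suc m)) \<le> nrm (\<rho> m) + nrm (\<rho> (Suc m) - \<rho> m)"
    using triangle[of "\<rho> m" "\<rho> (Suc m) - \<rho> m"] assms(1) by simp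
  also have "\<dots> \<le> (c + (\<Sum>n<m. f n)) + f m"
    using Suc by (intro add_mono) auto
  finally show ?case by simp
qed (use assms(2) in simp)

text \<open>The setting as a locale, in which the abstract forms above are instantiated by those of the problem.\<close>

locale biot_problem =
  fixes P :: "'d::finite biot"
  assumes setting: "biot_setting P"
begin

sublocale bounded_domain "dom P"
  using setting by unfold_locales (auto simp: biot_setting_def polyhedral_domain_def)

lemma parameters: "mu P > 0" "lam P > 0" "alph P > 0" "c0 P \<ge> 0" "perm P > 0" "T_end P > 0"
  using setting by (auto simp: biot_setting_def)

lemma form_a1_semi_inner: "semi_inner (Sobolev (dom P) 1) (form_a1 P)"
  unfolding form_a1_def[abs_def]
  by (intro semi_inner_scale ae_linear_semi_inner ae_linear_strain) (use parameters in simp)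

lemma form_d_semi_inner: "semi_inner (Sobolev (dom P) 1) (form_d P)"
  unfolding form_d_def[abs_def]
  by (intro semi_inner_scale ae_linear_semi_inner ae_linear_grad) (use parameters in simp)

sublocale pf: poroelastic_forms "L2 (vol P)" "L2_inner (vol P)" "Sobolev (dom P) 1" "form_a1 P"
    "Sobolev (dom P) 1" "form_d P" "form_b P" "lam P" "alph P" "c0 P"
  rewrites "semi_inner.nrm (L2_inner (vol P)) = L2_norm (vol P)"
proof -
  show "poroelastic_forms (L2 (vol P)) (L2_inner (vol P)) (Sobolev (dom P) 1) (form_a1 P)
    (Sobolev (dom P) 1) (form_d P) (lam P) (alph P) (c0 P)"
    unfolding poroelastic_forms_def poroelastic_forms_axioms_def
    by (intro conjI L2_semi_inner form_a1_semi_inner form_d_semi_inner subsetI) 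
       (use parameters in \<open>auto intro: Sobolev_L2\<close>)
  show "semi_inner.nrm (L2_inner (vol P)) = L2_norm (vol P)"
    by (simp add: semi_inner.nrm_def[OF L2_semi_inner] fun_eq_iff L2_norm_inner)
qed

lemma elastic_norm: "pf.a.nrm u = sqrt (2 * mu P) * L2_norm (vol P) (strain (dom P) u)"
  by (simp add: pf.a.nrm_def form_a1_def L2_norm_inner real_sqrt_mult)

lemma flow_norm: "pf.d.nrm q = sqrt (perm P) * L2_norm (vol P) (grad (dom P) q)"
  by (simp add: pf.d.nrm_def form_d_def L2_norm_inner real_sqrt_mult)

lemma form_b_linear:
  assumes "v \<in> Sobolev (dom P) 1" "w \<in> Sobolev (dom P) 1" "\<phi> \<in> L2 (vol P)" "\<psi> \<in> L2 (vol P)"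
  shows "form_b P (v + w) \<phi> = form_b P v \<phi> + form_b P w \<phi>" "form_b P (v - w) \<phi> = form_b P v \<phi> - form_b P w \<phi>"
    "form_b P v (\<phi> - \<psi>) = form_b P v \<phi> - form_b P v \<psi>" "form_b P v (\<phi> + \<psi>) = form_b P v \<phi> + form_b P v \<psi>"
proof -
  note div = ae_linear_L2[OF ae_linear_divergence]
  have sym: "form_b P v \<phi> = L2_inner (vol P) (divergence (dom P) v) \<phi>" 
    if "v \<in> Sobolev (dom P) 1" "\<phi> \<in> L2 (vol P)" for v \<phi>
    unfolding form_b_def using div[OF that(1)] that(2) by (rule L2.sym[rotated])
  have add: "form_b P (v + w) \<phi> = form_b P v \<phi> + form_b P w \<phi>" 
    if "v \<in> Sobolev (dom P) 1" "w \<in> Sobolev (dom P) 1" for v w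
    using that assms(3) ae_linear_inner(1)[OF ae_linear_divergence that assms(3)] by (simp add: sym)
  show "form_b P (v + w) \<phi> = form_b P v \<phi> + form_b P w \<phi>" by (rule add[OF assms(1,2)])
  have "form_b P ((-1) *\<^sub>R w) \<phi> = - form_b P w \<phi>"
    using assms ae_linear_inner(2)[OF ae_linear_divergence assms(2,2,3), of "-1"] by (simp add: sym)
  then show "form_b P (v - w) \<phi> = form_b P v \<phi> - form_b P w \<phi>"
    using add[of v "- w"] assms by simp
  show "form_b P v (\<phi> - \<psi>) = form_b P v \<phi> - form_b P v \<psi>" "form_b P v (\<phi> + \<psi>) = form_b P v \<phi> + form_b P v \<psi>"
    using assms div by (simp_all add: form_b_def L2.diff L2.add)
qed

lemma spaces:
  "subspace (V_space P)" "subspace (W_space P)" "subspace (M_space P)"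
  "V_space P \<subseteq> Sobolev (dom P) 1" "W_space P = L2 (vol P)" "M_space P \<subseteq> Sobolev (dom P) 1"
  by (simp_all add: V_space_def W_space_def M_space_def subspace_Sobolev0 subspace_L2 Sobolev0_subset)

lemma discrete_spaces:
  "subspace (V_h P k \<T>)" "subspace (W_h P k \<T>)" "subspace (M_h P l \<T>)"
  "V_h P k \<T> \<subseteq> V_space P" "W_h P k \<T> \<subseteq> W_space P" "M_h P l \<T> \<subseteq> M_space P"
  unfolding V_h_def W_h_def M_h_def by (auto intro!: subspace_inter subspace_lagrange_space spaces)

lemma discrete_in_Sobolev:
  "v \<in> V_h P k \<T> \<Longrightarrow> v \<in> Sobolev (dom P) 1" "\<phi> \<in> W_h P k \<T> \<Longrightarrow> \<phi> \<in> L2 (vol P)" 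
  "\<psi> \<in> M_h P l \<T> \<Longrightarrow> \<psi> \<in> Sobolev (dom P) 1" "\<psi> \<in> M_h P l \<T> \<Longrightarrow> \<psi> \<in> L2 (vol P)"
  using discrete_spaces spaces Sobolev_L2 by blast+

lemma stokes_projection_add:
  assumes "is_stokes_projection P k \<T> u x w z" "is_stokes_projection P k \<T> u' x' w' z'"
    and m: "u \<in> Sobolev (dom P) 1" "u' \<in> Sobolev (dom P) 1" "x \<in> L2 (vol P)" "x' \<in> L2 (vol P)"
  shows "is_stokes_projection P k \<T> (u + u') (x + x') (w + w') (z + z')"
proof -
  have w: "w \<in> V_h P k \<T>" "w' \<in> V_h P k \<T>" "z \<in> W_h P k \<T>" "z' \<in> W_h P k \<T>"
    using assms by (auto simp: is_stokes_projection_def)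
  note w' = w(1,2)[THEN discrete_in_Sobolev(1)] discrete_in_Sobolev(2)[OF w(3)] discrete_in_Sobolev(2)[OF w(4)]
  have "w + w' \<in> V_h P k \<T>" "z + z' \<in> W_h P k \<T>" 
    using w discrete_spaces by (auto intro: subspace_add)
  moreover have "form_a1 P (w + w') v - form_b P v (z + z') = form_a1 P (u + u') v - form_b P v (x + x')" 
    if "v \<in> V_h P k \<T>" for v
  proof -
    have "form_a1 P w v - form_b P v z = form_a1 P u v - form_b P v x" 
      "form_a1 P w' v - form_b P v z' = form_a1 P u' v - form_b P v x'"
      using assms(1,2) that by (auto simp: is_stokes_projection_def)
    then show ?thesis using discrete_in_Sobolev(1)[OF that] w' m by (simp add: pf.a.add form_b_linear)
  qed
  moreover have "form_b P (w + w') \<phi> = form_b P (u + u') \<phi>" if "\<phi> \<in> W_h P k \<T>" for \<phi>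
    using assms(1,2) that discrete_in_Sobolev(2)[OF that] w' m
    by (simp add: is_stokes_projection_def form_b_linear)
  ultimately show ?thesis by (simp add: is_stokes_projection_def)
qed

lemma elliptic_projection_add:
  assumes "is_elliptic_projection P l \<T> p r" "is_elliptic_projection P l \<T> p' r'"
    and m: "p \<in> Sobolev (dom P) 1" "p' \<in> Sobolev (dom P) 1"
  shows "is_elliptic_projection P l \<T> (p + p') (r + r')"
proof -
  have r: "r \<in> M_h P l \<T>" "r' \<in> M_h P l \<T>" using assms by (auto simp: is_elliptic_projection_def)
  then have "r + r' \<in> M_h P l \<T>" using discrete_spaces(3) by (auto intro: subspace_add)
  moreover have "form_d P (r + r') \<psi> = form_d P (p + p') \<psi>" if "\<psi> \<in> M_h P l \<T>" for \<psi>
    using assms(1,2) that discrete_in_Sobolev(3)[OF that] discrete_in_Sobolev(3)[OF r(1)] discrete_in_Sobolev(3)[OF r(2)] m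
    by (simp add: is_elliptic_projection_def pf.d.add)
  ultimately show ?thesis by (simp add: is_elliptic_projection_def)
qed

text \<open>By the Cauchy--Schwarz inequality every quotient in the supremum is at most
  \<open>sqrt (2 \<mu>)\<close> times the elastic norm of \<open>u\<close>, as the strain of \<open>v\<close> is bounded by its $H^1$-norm.\<close>

lemma discrete_pressure_control:
  assumes inf_sup: "\<beta> > 0" "\<beta> * L2_norm (vol P) x \<le> (SUP v\<in>V_h P k \<T>. form_b P v x / Sobolev_norm (dom P) 1 v)"
    and u: "u \<in> V_h P k \<T>" and el: "\<And>v. v \<in> V_h P k \<T> \<Longrightarrow> form_a1 P u v = form_b P v x"
  shows "L2_norm (vol P) x \<le> sqrt (2 * mu P) / \<beta> * pf.a.nrm u"
proof -
  let ?c = "sqrt (2 * mu P) * pf.a.nrm u"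
  have uS: "u \<in> Sobolev (dom P) 1" by (rule discrete_in_Sobolev(1)[OF u])
  have c0: "0 \<le> ?c" using parameters pf.a.nrm_nonneg[OF uS] by simp
  have "(SUP v\<in>V_h P k \<T>. form_b P v x / Sobolev_norm (dom P) 1 v) \<le> ?c"
  proof (rule cSUP_least)
    show "V_h P k \<T> \<noteq> {}" using u by blast
    fix v assume v: "v \<in> V_h P k \<T>"
    then have vS: "v \<in> Sobolev (dom P) 1" by (rule discrete_in_Sobolev(1))
    have "form_b P v x \<le> pf.a.nrm u * pf.a.nrm v"
      using pf.a.Cauchy_Schwarz[OF uS vS] el[OF v] by simp
    also have "\<dots> \<le> pf.a.nrm u * (sqrt (2 * mu P) * Sobolev_norm (dom P) 1 v)"
      using L2_norm_strain_le[OF vS] parameters pf.a.nrm_nonneg[OF uS] 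
      unfolding elastic_norm[of v] by (intro mult_left_mono) auto
    finally have le: "form_b P v x \<le> ?c * Sobolev_norm (dom P) 1 v" by (simp add: mult_ac)
    show "form_b P v x / Sobolev_norm (dom P) 1 v \<le> ?c"
    proof (cases "Sobolev_norm (dom P) 1 v = 0")
      case False
      then have "Sobolev_norm (dom P) 1 v > 0" by (simp add: less_le)
      then show ?thesis using le by (simp add: divide_le_eq)
    qed (use c0 in simp)
  qed
  then show ?thesis using inf_sup by (simp add: field_simps)
qed

text \<open>The error on one mesh. The comparison functions are the sums of the projections of the
  increments of \<open>us\<close>, \<open>xs\<close>, \<open>ps\<close>. They satisfy the projection equations at every time, and by
  construction their increments inherit the approximation property, which for the projections of the
  values would need linearity of the projections. The numbers \<open>I n\<close> bound both the increments of the
  solution and the errors of its difference quotients.\<close>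

lemma discrete_error_estimate:
  fixes us uh :: "nat \<Rightarrow> real^'d \<Rightarrow> real^'d" and xs ps xh ph pt xt :: "nat \<Rightarrow> real^'d \<Rightarrow> real" and I :: "nat \<Rightarrow> real"
  assumes stokes: "\<And>v \<phi>. v \<in> V_space P \<Longrightarrow> \<phi> \<in> W_space P \<Longrightarrow> is_stokes_projection P k \<T> v \<phi> (ru v \<phi>) (rx v \<phi>)"
    and elliptic: "\<And>\<psi>. \<psi> \<in> M_space P \<Longrightarrow> is_elliptic_projection P l \<T> \<psi> (rp \<psi>)"
    and inf_sup: "\<beta> > 0" "\<And>\<phi>. \<phi> \<in> W_h P k \<T> \<Longrightarrow> 
      \<beta> * L2_norm (vol P) \<phi> \<le> (SUP v\<in>V_h P k \<T>. form_b P v \<phi> / Sobolev_norm (dom P) 1 v)"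
    and Cp: "Cp \<ge> 0" and h: "h \<ge> 0"
    and stokes_error: "\<And>v \<phi>. v \<in> Sobolev0 (dom P) (k + 1) (Gam_d P) \<Longrightarrow> \<phi> \<in> Sobolev (dom P) k \<Longrightarrow>
       Sobolev_norm (dom P) 1 (v - ru v \<phi>) + L2_norm (vol P) (\<phi> - rx v \<phi>)
       \<le> Cp * h ^ k * (Sobolev_norm (dom P) (k + 1) v + Sobolev_norm (dom P) k \<phi>)"
    and elliptic_error: "\<And>\<psi>. \<psi> \<in> Sobolev0 (dom P) (l + 1) (Gam_p P) \<Longrightarrow>
       Sobolev_norm (dom P) 1 (\<psi> - rp \<psi>) \<le> Cp * h ^ l * Sobolev_norm (dom P) (l + 1) \<psi> \<and>
       L2_norm (vol P) (\<psi> - rp \<psi>) \<le> Cp * h ^ (l + 1) * Sobolev_norm (dom P) (l + 1) \<psi>"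
    and mem: "\<And>n. us n \<in> V_space P" "\<And>n. xs n \<in> W_space P" "\<And>n. ps n \<in> M_space P"
      "\<And>n. n \<le> N \<Longrightarrow> pt n \<in> L2 (vol P)" "\<And>n. n \<le> N \<Longrightarrow> xt n \<in> L2 (vol P)"
    and reg0: "us 0 \<in> Sobolev0 (dom P) (k + 1) (Gam_d P)" "xs 0 \<in> Sobolev (dom P) k" 
      "ps 0 \<in> Sobolev0 (dom P) (l + 1) (Gam_p P)"
      "Sobolev_norm (dom P) (k + 1) (us 0) + Sobolev_norm (dom P) k (xs 0) \<le> A" 
      "Sobolev_norm (dom P) (l + 1) (ps 0) \<le> A"
    and reg: "\<And>n. n \<le> N \<Longrightarrow> us (Suc n) - us n \<in> Sobolev0 (dom P) (k + 1) (Gam_d P)" 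
      "\<And>n. n \<le> N \<Longrightarrow> xs (Suc n) - xs n \<in> Sobolev (dom P) k" 
      "\<And>n. n \<le> N \<Longrightarrow> ps (Suc n) - ps n \<in> Sobolev0 (dom P) (l + 1) (Gam_p P)"
      "\<And>n. n \<le> N \<Longrightarrow> Sobolev_norm (dom P) (k + 1) (us (Suc n) - us n) + Sobolev_norm (dom P) k (xs (Suc n) - xs n) \<le> I n"
      "\<And>n. n \<le> N \<Longrightarrow> Sobolev_norm (dom P) (l + 1) (ps (Suc n) - ps n) \<le> I n"
    and \<tau>: "\<tau> > 0"
    and consistency: "\<And>n. n \<le> N \<Longrightarrow> L2_norm (vol P) (ps (Suc n) - ps n - \<tau> *\<^sub>R pt n) \<le> \<tau> * I n"
      "\<And>n. n \<le> N \<Longrightarrow> L2_norm (vol P) (xs (Suc n) - xs n - \<tau> *\<^sub>R xt n) \<le> \<tau> * I n"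
    and cp: "\<And>n v. n \<le> N \<Longrightarrow> v \<in> V_space P \<Longrightarrow> form_a1 P (us (Suc n)) v - form_b P v (xs (Suc n)) = F n v"
      "\<And>n \<phi>. n \<le> N \<Longrightarrow> \<phi> \<in> W_space P \<Longrightarrow> form_b P (us (Suc n)) \<phi> + form_a2 P (xs (Suc n)) \<phi> - form_c P (ps (Suc n)) \<phi> = 0"
      "\<And>n \<psi>. n \<le> N \<Longrightarrow> \<psi> \<in> M_space P \<Longrightarrow> form_a3 P (pt n) \<psi> - form_c P \<psi> (xt n) + form_d P (ps (Suc n)) \<psi> = G n \<psi>"
    and init: "uh 0 = ru (us 0) (xs 0)" "xh 0 = rx (us 0) (xs 0)" "ph 0 = rp (ps 0)"
    and euler_mem: "\<And>n. n \<le> N \<Longrightarrow> uh (Suc n) \<in> V_h P k \<T>" "\<And>n. n \<le> N \<Longrightarrow> xh (Suc n) \<in> W_h P k \<T>" 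
      "\<And>n. n \<le> N \<Longrightarrow> ph (Suc n) \<in> M_h P l \<T>"
    and euler: "\<And>n v. n \<le> N \<Longrightarrow> v \<in> V_h P k \<T> \<Longrightarrow> form_a1 P (uh (Suc n)) v - form_b P v (xh (Suc n)) = F n v"
      "\<And>n \<phi>. n \<le> N \<Longrightarrow> \<phi> \<in> W_h P k \<T> \<Longrightarrow> form_b P (uh (Suc n)) \<phi> + form_a2 P (xh (Suc n)) \<phi> - form_c P (ph (Suc n)) \<phi> = 0"
      "\<And>n \<psi>. n \<le> N \<Longrightarrow> \<psi> \<in> M_h P l \<T> \<Longrightarrow> form_a3 P (\<lambda>x. (ph (Suc n) x - ph n x) / \<tau>) \<psi>
         - form_c P \<psi> (\<lambda>x. (xh (Suc n) x - xh n x) / \<tau>) + form_d P (ph (Suc n)) \<psi> = G n \<psi>"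
  defines "\<epsilon> \<equiv> \<tau> + h ^ k + h ^ (l + 1)"
    and "K \<equiv> (c0 P + (alph P)\<^sup>2 / lam P + 2 * (alph P / lam P) + 1 / lam P) * (Cp + 1)"
    and "C \<equiv> pf.control (sqrt (2 * mu P) / \<beta>)"
    and "Y \<equiv> (\<Sum>n\<le>N. I n) + A"
  shows "sqrt (2 * mu P) * L2_norm (vol P) (strain (dom P) (us (Suc N) - uh (Suc N))) 
           \<le> sqrt (2 * mu P) * (Cp * h ^ k * Y) + 2 * C * (K * \<epsilon> * Y)" (is ?error_u)
    and "L2_norm (vol P) (xs (Suc N) - xh (Suc N)) \<le> Cp * h ^ k * Y + C * (2 * C * (K * \<epsilon> * Y))" (is ?error_x)
    and "L2_norm (vol P) (ps (Suc N) - ph (Suc N)) \<le> Cp * h ^ (l + 1) * Y + C * (2 * C * (K * \<epsilon> * Y))" (is ?error_p)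
    and "sqrt (perm P) * L2_norm (vol P) (grad (dom P) (ps (Suc N) - ph (Suc N))) \<le> sqrt (perm P) * (Cp * h ^ l * Y)
           + C * K * \<epsilon> * sqrt (2 * Y\<^sup>2 / (real (N + 1) * \<tau>) + (\<Sum>n=1..N. (I n)\<^sup>2) / \<tau>)" (is ?error_grad)
proof -
  let ?L = "vol P" and ?S = "Sobolev (dom P) 1" and ?al = "alph P" and ?la = "lam P"
  let ?\<kappa> = "c0 P + ?al\<^sup>2 / ?la"
  define du dxi dp where "du n = us (Suc n) - us n" and "dxi n = xs (Suc n) - xs n" and "dp n = ps (Suc n) - ps n" for n
  define pu px pp where "pu n = ru (us 0) (xs 0) + (\<Sum>i<n. ru (du i) (dxi i))" 
    and "px n = rx (us 0) (xs 0) + (\<Sum>i<n. rx (du i) (dxi i))" and "pp n = rp (ps 0) + (\<Sum>i<n. rp (dp i))" for n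
  define \<rho>u \<rho>x \<rho>p where "\<rho>u n = us n - pu n" and "\<rho>x n = xs n - px n" and "\<rho>p n = ps n - pp n" for n
  define U X Q where "U n = pu n - uh n" and "X n = px n - xh n" and "Q n = pp n - ph n" for n
  \<comment> \<open>By induction on time, the sums of projections satisfy the projection equations.\<close>
  have memS: "us n \<in> ?S" "xs n \<in> L2 ?L" "ps n \<in> ?S" "ps n \<in> L2 ?L" for n
    using mem spaces Sobolev_L2 by blast+
  have dV: "du n \<in> V_space P" "dxi n \<in> W_space P" "dp n \<in> M_space P" for n
    unfolding du_def dxi_def dp_def using mem spaces(1,2,3) by (auto intro: subspace_diff)
  then have dS: "du n \<in> ?S" "dxi n \<in> L2 ?L" "dp n \<in> ?S" "dp n \<in> L2 ?L" for n
    using spaces Sobolev_L2 by blast+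
  have proj_Suc: "pu (Suc n) = pu n + ru (du n) (dxi n)" "px (Suc n) = px n + rx (du n) (dxi n)" "pp (Suc n) = pp n + rp (dp n)" for n
    by (simp_all only: pu_def px_def pp_def sum.lessThan_Suc add.assoc)
  have sol_Suc: "us n + du n = us (Suc n)" "xs n + dxi n = xs (Suc n)" "ps n + dp n = ps (Suc n)" for n
    by (simp_all add: du_def dxi_def dp_def)
  have stokes_n: "is_stokes_projection P k \<T> (us n) (xs n) (pu n) (px n)" for n
  proof (induction n)
    case 0
    then show ?case using stokes[OF mem(1,2)] by (simp add: pu_def px_def)
  next
    case (Suc n)
    have "is_stokes_projection P k \<T> (us n + du n) (xs n + dxi n) (pu n + ru (du n) (dxi n)) (px n + rx (du n) (dxi n))"
      by (rule stokes_projection_add[OF Suc stokes[OF dV(1,2)] memS(1) dS(1) memS(2) dS(2)])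
    then show ?case unfolding proj_Suc sol_Suc .
  qed
  have elliptic_n: "is_elliptic_projection P l \<T> (ps n) (pp n)" for n
  proof (induction n)
    case 0
    then show ?case using elliptic[OF mem(3)] by (simp add: pp_def)
  next
    case (Suc n)
    have "is_elliptic_projection P l \<T> (ps n + dp n) (pp n + rp (dp n))"
      by (rule elliptic_projection_add[OF Suc elliptic[OF dV(3)] memS(3) dS(3)])
    then show ?case unfolding proj_Suc sol_Suc .
  qed
  have pV: "pu n \<in> V_h P k \<T>" "px n \<in> W_h P k \<T>" "pp n \<in> M_h P l \<T>" for n
    using stokes_n[of n] elliptic_n[of n] by (auto simp: is_stokes_projection_def is_elliptic_projection_def)
  have pS: "pu n \<in> ?S" "px n \<in> L2 ?L" "pp n \<in> ?S" "pp n \<in> L2 ?L" for n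
    using discrete_in_Sobolev pV[of n] by blast+
  have hV: "uh n \<in> V_h P k \<T>" "xh n \<in> W_h P k \<T>" "ph n \<in> M_h P l \<T>" if "n \<le> Suc N" for n
    using that euler_mem pV[of 0] init by (cases n; simp add: pu_def px_def pp_def)+
  have hS: "uh n \<in> ?S" "xh n \<in> L2 ?L" "ph n \<in> ?S" "ph n \<in> L2 ?L" if "n \<le> Suc N" for n
    using discrete_in_Sobolev hV[OF that] by blast+
  have \<theta>V: "U n \<in> V_h P k \<T>" "X n \<in> W_h P k \<T>" "Q n \<in> M_h P l \<T>" if "n \<le> Suc N" for n
    unfolding U_def X_def Q_def using pV[of n] hV[OF that] discrete_spaces(1,2,3) by (auto intro: subspace_diff)
  have \<theta>S: "U n \<in> ?S" "X n \<in> L2 ?L" "Q n \<in> ?S" "Q n \<in> L2 ?L" if "n \<le> Suc N" for n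
    using discrete_in_Sobolev \<theta>V[OF that] by blast+
  have \<rho>S: "\<rho>u n \<in> ?S" "\<rho>x n \<in> L2 ?L" "\<rho>p n \<in> ?S" "\<rho>p n \<in> L2 ?L" for n
    unfolding \<rho>u_def \<rho>x_def \<rho>p_def using memS[of n] pS[of n] by auto
  have init0: "U 0 = 0" "X 0 = 0" "Q 0 = 0"
    using init by (simp_all add: U_def X_def Q_def pu_def px_def pp_def)
  \<comment> \<open>The projection errors at the final time are bounded by their initial values and increments.\<close>
  have d\<rho>: "\<rho>u (Suc n) - \<rho>u n = du n - ru (du n) (dxi n)" "\<rho>x (Suc n) - \<rho>x n = dxi n - rx (du n) (dxi n)"
    "\<rho>p (Suc n) - \<rho>p n = dp n - rp (dp n)" for n
    by (simp_all add: \<rho>u_def \<rho>x_def \<rho>p_def proj_Suc du_def dxi_def dp_def)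
  have hk: "0 \<le> Cp * h ^ j" for j using Cp h by simp
  have I0: "0 \<le> I n" if "n \<le> N" for n
    using reg(5)[OF that] Sobolev_norm_nonneg order_trans by blast
  have A0: "0 \<le> A" using reg0(5) Sobolev_norm_nonneg order_trans by blast
  have inc_ux: "Sobolev_norm (dom P) 1 (\<rho>u (Suc n) - \<rho>u n) + L2_norm ?L (\<rho>x (Suc n) - \<rho>x n) \<le> Cp * h ^ k * I n" 
    if "n \<le> N" for n
  proof -
    have "Sobolev_norm (dom P) 1 (du n - ru (du n) (dxi n)) + L2_norm ?L (dxi n - rx (du n) (dxi n))
        \<le> Cp * h ^ k * (Sobolev_norm (dom P) (k + 1) (du n) + Sobolev_norm (dom P) k (dxi n))"
      using reg(1,2)[OF that] unfolding du_def dxi_def by (rule stokes_error)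
    also have "\<dots> \<le> Cp * h ^ k * I n"
      using reg(4)[OF that] hk[of k] unfolding du_def dxi_def by (rule mult_left_mono)
    finally show ?thesis unfolding d\<rho> .
  qed
  have inc_u: "Sobolev_norm (dom P) 1 (\<rho>u (Suc n) - \<rho>u n) \<le> Cp * h ^ k * I n" 
    and inc_x: "L2_norm ?L (\<rho>x (Suc n) - \<rho>x n) \<le> Cp * h ^ k * I n" if "n \<le> N" for n
    using inc_ux[OF that] Sobolev_norm_nonneg[of 1 "\<rho>u (Suc n) - \<rho>u n"] L2_norm_nonneg[of ?L "\<rho>x (Suc n) - \<rho>x n"] 
    by linarith+
  have inc_p: "Sobolev_norm (dom P) 1 (\<rho>p (Suc n) - \<rho>p n) \<le> Cp * h ^ l * I n" 
    "L2_norm ?L (\<rho>p (Suc n) - \<rho>p n) \<le> Cp * h ^ (l + 1) * I n" if "n \<le> N" for n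
    using elliptic_error[OF reg(3)[OF that]] mult_left_mono[OF reg(5)[OF that] hk[of l]] mult_left_mono[OF reg(5)[OF that] hk[of "l + 1"]]
    unfolding d\<rho> dp_def by linarith+
  have \<rho>0: "Sobolev_norm (dom P) 1 (\<rho>u 0) + L2_norm ?L (\<rho>x 0) \<le> Cp * h ^ k * A"
    using stokes_error[OF reg0(1,2)] mult_left_mono[OF reg0(4) hk[of k]] by (simp add: \<rho>u_def \<rho>x_def pu_def px_def)
  have \<rho>0': "Sobolev_norm (dom P) 1 (\<rho>u 0) \<le> Cp * h ^ k * A" "L2_norm ?L (\<rho>x 0) \<le> Cp * h ^ k * A"
    using \<rho>0 Sobolev_norm_nonneg[of 1 "\<rho>u 0"] L2_norm_nonneg[of ?L "\<rho>x 0"] by linarith+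
  have \<rho>p0: "Sobolev_norm (dom P) 1 (\<rho>p 0) \<le> Cp * h ^ l * A" "L2_norm ?L (\<rho>p 0) \<le> Cp * h ^ (l + 1) * A"
    using elliptic_error[OF reg0(3)] mult_left_mono[OF reg0(5) hk[of l]] mult_left_mono[OF reg0(5) hk[of "l + 1"]]
    by (simp_all add: \<rho>p_def pp_def)
  have sumY: "c * A + (\<Sum>n<Suc N. c * I n) = c * Y" for c
    by (simp add: Y_def lessThan_Suc_atMost distrib_left sum_distrib_left)
  have \<rho>_bound: "Sobolev_norm (dom P) 1 (\<rho>u (Suc N)) \<le> Cp * h ^ k * Y" "L2_norm ?L (\<rho>x (Suc N)) \<le> Cp * h ^ k * Y"
    "Sobolev_norm (dom P) 1 (\<rho>p (Suc N)) \<le> Cp * h ^ l * Y" "L2_norm ?L (\<rho>p (Suc N)) \<le> Cp * h ^ (l + 1) * Y"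
    using Sob.nrm_telescope[where \<rho>=\<rho>u and m="Suc N" and f="\<lambda>n. Cp * h ^ k * I n", OF \<rho>S(1) \<rho>0'(1)] inc_u
      L2.nrm_telescope[where \<rho>=\<rho>x and m="Suc N" and f="\<lambda>n. Cp * h ^ k * I n", OF \<rho>S(2) \<rho>0'(2)] inc_x
      Sob.nrm_telescope[where \<rho>=\<rho>p and m="Suc N" and f="\<lambda>n. Cp * h ^ l * I n", OF \<rho>S(3) \<rho>p0(1)] 
      L2.nrm_telescope[where \<rho>=\<rho>p and m="Suc N" and f="\<lambda>n. Cp * h ^ (l + 1) * I n", OF \<rho>S(4) \<rho>p0(2)] inc_p
    unfolding sumY by auto
  \<comment> \<open>In the difference of the projection equations and the scheme the loads and sources cancel.\<close>
  have elasticity: "form_a1 P (U n) v = form_b P v (X n)" if "n \<le> Suc N" "v \<in> V_h P k \<T>" for n v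
  proof (cases n)
    case 0
    have vS: "v \<in> ?S" using that discrete_in_Sobolev by blast
    have "form_b P v 0 = 0" using form_b_linear(3)[of v v 0 0] vS by simp
    then show ?thesis using init0 0 vS by simp
  next
    case (Suc m)
    have vS: "v \<in> ?S" and vV: "v \<in> V_space P" using that discrete_in_Sobolev discrete_spaces(4) by blast+
    have "form_a1 P (pu n) v - form_b P v (px n) = F m v"
      using stokes_n[of n] that Suc cp(1)[of m v] vV by (simp add: is_stokes_projection_def)
    moreover have "form_a1 P (uh n) v - form_b P v (xh n) = F m v" using euler(1)[of m v] that Suc by simp
    ultimately show ?thesis unfolding U_def X_def
      using vS pS[of n] hS[OF that(1)] by (simp add: pf.a.diff form_b_linear)
  qed
  \<comment> \<open>At the initial time all discrete errors vanish, so the constraint holds with right-hand side \<open>0\<close>,\<close>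
  \<comment> \<open>although the projection errors do not vanish; the first increment of \<open>g\<close> is as large as these.\<close>
  define g where "g n = (if n = 0 then 0 else (?al / ?la) *\<^sub>R \<rho>p n - (1 / ?la) *\<^sub>R \<rho>x n)" for n :: nat
  have gL: "g n \<in> L2 ?L" for n unfolding g_def using \<rho>S[of n] by auto
  have constraint: "form_b P (U n) \<phi> + (1 / ?la) * L2_inner ?L (X n - ?al *\<^sub>R Q n) \<phi> = L2_inner ?L (g n) \<phi>"
    if "n \<le> Suc N" "\<phi> \<in> W_h P k \<T>" for n \<phi>
  proof (cases n)
    case 0
    have \<phi>L: "\<phi> \<in> L2 ?L" using that discrete_in_Sobolev by blast
    have "form_b P 0 \<phi> = 0" using form_b_linear(2)[of 0 0 \<phi> \<phi>] \<phi>L by simp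
    then show ?thesis using init0 0 \<phi>L by (simp add: g_def)
  next
    case (Suc m)
    have \<phi>L: "\<phi> \<in> L2 ?L" and \<phi>W: "\<phi> \<in> W_space P" using that discrete_in_Sobolev discrete_spaces(5) by blast+
    have "form_b P (pu n) \<phi> = form_b P (us n) \<phi>" using stokes_n[of n] that by (simp add: is_stokes_projection_def)
    moreover have "form_b P (us n) \<phi> + (1 / ?la) * L2_inner ?L (xs n) \<phi> - ?al / ?la * L2_inner ?L (ps n) \<phi> = 0"
      using cp(2)[of m \<phi>] \<phi>W that Suc by (simp add: form_a2_def form_c_def)
    moreover have "form_b P (uh n) \<phi> + (1 / ?la) * L2_inner ?L (xh n) \<phi> - ?al / ?la * L2_inner ?L (ph n) \<phi> = 0"
      using euler(2)[of m \<phi>] that Suc by (simp add: form_a2_def form_c_def)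
    ultimately show ?thesis unfolding U_def X_def Q_def g_def \<rho>x_def \<rho>p_def
      using Suc \<phi>L pS[of n] hS[OF that(1)] memS[of n] parameters
      by (simp add: L2.expand form_b_linear algebra_simps add_divide_distrib diff_divide_distrib)
  qed
  define r where "r n = (if n \<le> N then ?\<kappa> *\<^sub>R (rp (dp n) - \<tau> *\<^sub>R pt n) - (?al / ?la) *\<^sub>R (rx (du n) (dxi n) - \<tau> *\<^sub>R xt n) else 0)" for n
  have rL: "rp (dp n) \<in> L2 ?L" "rx (du n) (dxi n) \<in> L2 ?L" for n
    using elliptic[OF dV(3), of n] stokes[OF dV(1,2), of n n] discrete_in_Sobolev
    by (auto simp: is_elliptic_projection_def is_stokes_projection_def)
  have rL': "r n \<in> L2 ?L" for n using mem(4,5)[of n] rL[of n] by (auto simp: r_def)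
  have flow: "?\<kappa> * L2_inner ?L (Q (Suc n) - Q n) \<psi> - (?al / ?la) * L2_inner ?L (X (Suc n) - X n) \<psi> 
      + \<tau> * form_d P (Q (Suc n)) \<psi> = L2_inner ?L (r n) \<psi>" if n: "n \<le> N" and \<psi>: "\<psi> \<in> M_h P l \<T>" for n \<psi>
  proof -
    have \<psi>L: "\<psi> \<in> L2 ?L" and \<psi>S: "\<psi> \<in> ?S" and \<psi>M: "\<psi> \<in> M_space P" 
      using \<psi> discrete_in_Sobolev discrete_spaces(6) by blast+
    have n': "n \<le> Suc N" "Suc n \<le> Suc N" using n by auto
    note hn = hS[OF n'(1)] hS[OF n'(2)]
    have quot: "(\<lambda>x. (f x - f' x) / \<tau>) = (1 / \<tau>) *\<^sub>R (f - f')" for f f' :: "real^'d \<Rightarrow> real"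
      by (simp add: fun_eq_iff)
    have "?\<kappa> * ((1 / \<tau>) * L2_inner ?L (ph (Suc n) - ph n) \<psi>) - ?al / ?la * ((1 / \<tau>) * L2_inner ?L (xh (Suc n) - xh n) \<psi>)
        + form_d P (ph (Suc n)) \<psi> = G n \<psi>"
      using euler(3)[OF n \<psi>] hn \<psi>L L2.sym[of \<psi> ?L] unfolding form_a3_def form_c_def quot
      by (simp only: L2.scale L2.scale_right L2.closed L2.sym[of \<psi> ?L])
    moreover have "?\<kappa> * L2_inner ?L (pt n) \<psi> - ?al / ?la * L2_inner ?L (xt n) \<psi> + form_d P (ps (Suc n)) \<psi> = G n \<psi>"
      using cp(3)[OF n \<psi>M] \<psi>L mem(5)[OF n] L2.sym[of \<psi> ?L "xt n"] by (simp add: form_a3_def form_c_def)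
    moreover have "form_d P (ps (Suc n)) \<psi> = form_d P (pp (Suc n)) \<psi>"
      using elliptic_n[of "Suc n"] \<psi> by (simp add: is_elliptic_projection_def)
    ultimately have "\<tau> * (?\<kappa> * ((1 / \<tau>) * L2_inner ?L (ph (Suc n) - ph n) \<psi>) - ?al / ?la * ((1 / \<tau>) * L2_inner ?L (xh (Suc n) - xh n) \<psi>)
        + form_d P (ph (Suc n)) \<psi>) = \<tau> * (?\<kappa> * L2_inner ?L (pt n) \<psi> - ?al / ?la * L2_inner ?L (xt n) \<psi> + form_d P (pp (Suc n)) \<psi>)"
      by simp
    then have main: "?\<kappa> * L2_inner ?L (ph (Suc n) - ph n) \<psi> - ?al / ?la * L2_inner ?L (xh (Suc n) - xh n) \<psi> + \<tau> * form_d P (ph (Suc n)) \<psi>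
        = ?\<kappa> * (\<tau> * L2_inner ?L (pt n) \<psi>) - ?al / ?la * (\<tau> * L2_inner ?L (xt n) \<psi>) + \<tau> * form_d P (pp (Suc n)) \<psi>"
      using \<tau> by (simp add: distrib_left right_diff_distrib)
    have Qd: "Q (Suc n) - Q n = rp (dp n) - (ph (Suc n) - ph n)" and Xd: "X (Suc n) - X n = rx (du n) (dxi n) - (xh (Suc n) - xh n)"
      by (simp_all add: Q_def X_def proj_Suc)
    have d: "form_d P (Q (Suc n)) \<psi> = form_d P (pp (Suc n)) \<psi> - form_d P (ph (Suc n)) \<psi>"
      unfolding Q_def using pS hn \<psi>S by (intro pf.d.diff) auto
    have Qi: "L2_inner ?L (Q (Suc n) - Q n) \<psi> = L2_inner ?L (rp (dp n)) \<psi> - L2_inner ?L (ph (Suc n) - ph n) \<psi>"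
      "L2_inner ?L (X (Suc n) - X n) \<psi> = L2_inner ?L (rx (du n) (dxi n)) \<psi> - L2_inner ?L (xh (Suc n) - xh n) \<psi>"
      unfolding Qd Xd using rL[of n] hn \<psi>L by (auto intro!: L2.diff)
    have ri: "L2_inner ?L (r n) \<psi> = ?\<kappa> * (L2_inner ?L (rp (dp n)) \<psi> - \<tau> * L2_inner ?L (pt n) \<psi>) 
        - ?al / ?la * (L2_inner ?L (rx (du n) (dxi n)) \<psi> - \<tau> * L2_inner ?L (xt n) \<psi>)"
      using n rL[of n] mem(4,5)[OF n] \<psi>L by (simp add: r_def L2.diff L2.scale)
    have rearrange: "\<kappa> * (y1 - y2) - c * (z1 - z2) + \<tau> * (w1 - w2) = \<kappa> * (y1 - \<tau> * y3) - c * (z1 - \<tau> * z3)"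
      if "\<kappa> * y2 - c * z2 + \<tau> * w2 = \<kappa> * (\<tau> * y3) - c * (\<tau> * z3) + \<tau> * w1" for \<kappa> c y1 y2 y3 z1 z2 z3 w1 w2 :: real
      using that by (simp add: algebra_simps)
    show ?thesis unfolding Qi d ri by (rule rearrange[OF main])
  qed
  \<comment> \<open>The data are bounded by multiples of \<open>\<epsilon>\<close>, which absorbs the projection and the consistency errors.\<close>
  have eps: "h ^ k \<le> \<epsilon>" "h ^ (l + 1) \<le> \<epsilon>" "\<tau> \<le> \<epsilon>" "0 \<le> \<epsilon>" using h \<tau> by (auto simp: \<epsilon>_def)
  have Cpk: "Cp * h ^ k \<le> Cp * \<epsilon>" "Cp * h ^ (l + 1) \<le> Cp * \<epsilon>" 
    using Cp eps by (auto intro: mult_left_mono)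
  have \<kappa>0: "0 \<le> ?\<kappa>" "0 \<le> ?al / ?la" "0 \<le> 1 / ?la" using parameters by auto
  have r_bound: "L2_norm ?L (r n) \<le> (?\<kappa> + ?al / ?la) * (Cp + 1) * \<epsilon> * I n" if n: "n \<le> N" for n
  proof -
    have 1: "L2_norm ?L (rp (dp n) - \<tau> *\<^sub>R pt n) \<le> (Cp + 1) * \<epsilon> * I n"
    proof -
      have "rp (dp n) - \<tau> *\<^sub>R pt n = (dp n - \<tau> *\<^sub>R pt n) - (dp n - rp (dp n))" by simp
      then have "L2_norm ?L (rp (dp n) - \<tau> *\<^sub>R pt n) \<le> L2_norm ?L (dp n - \<tau> *\<^sub>R pt n) + L2_norm ?L (dp n - rp (dp n))"
        using L2.triangle_diff[of "dp n - \<tau> *\<^sub>R pt n" ?L "dp n - rp (dp n)"] dS[of n] rL[of n] mem(4)[OF n] by auto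
      also have "\<dots> \<le> \<tau> * I n + Cp * h ^ (l + 1) * I n"
        using consistency(1)[OF n] inc_p(2)[OF n] unfolding d\<rho> dp_def by (rule add_mono)
      also have "\<dots> \<le> \<epsilon> * I n + Cp * \<epsilon> * I n"
        using eps Cpk I0[OF n] by (intro add_mono mult_right_mono) auto
      finally show ?thesis by (simp add: algebra_simps)
    qed
    have 2: "L2_norm ?L (rx (du n) (dxi n) - \<tau> *\<^sub>R xt n) \<le> (Cp + 1) * \<epsilon> * I n"
    proof -
      have "rx (du n) (dxi n) - \<tau> *\<^sub>R xt n = (dxi n - \<tau> *\<^sub>R xt n) - (dxi n - rx (du n) (dxi n))" by simp
      then have "L2_norm ?L (rx (du n) (dxi n) - \<tau> *\<^sub>R xt n) \<le> L2_norm ?L (dxi n - \<tau> *\<^sub>R xt n) + L2_norm ?L (dxi n - rx (du n) (dxi n))"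
        using L2.triangle_diff[of "dxi n - \<tau> *\<^sub>R xt n" ?L "dxi n - rx (du n) (dxi n)"] dS[of n] rL[of n] mem(5)[OF n] by auto
      also have "\<dots> \<le> \<tau> * I n + Cp * h ^ k * I n"
        using consistency(2)[OF n] inc_x[OF n] unfolding d\<rho> dxi_def by (rule add_mono)
      also have "\<dots> \<le> \<epsilon> * I n + Cp * \<epsilon> * I n"
        using eps Cpk I0[OF n] by (intro add_mono mult_right_mono) auto
      finally show ?thesis by (simp add: algebra_simps)
    qed
    have "L2_norm ?L (r n) \<le> ?\<kappa> * L2_norm ?L (rp (dp n) - \<tau> *\<^sub>R pt n) + ?al / ?la * L2_norm ?L (rx (du n) (dxi n) - \<tau> *\<^sub>R xt n)"
    proof -
      have m: "rp (dp n) - \<tau> *\<^sub>R pt n \<in> L2 ?L" "rx (du n) (dxi n) - \<tau> *\<^sub>R xt n \<in> L2 ?L"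
        using rL[of n] mem(4,5)[OF n] by auto
      have "L2_norm ?L (r n) \<le> L2_norm ?L (?\<kappa> *\<^sub>R (rp (dp n) - \<tau> *\<^sub>R pt n)) + L2_norm ?L ((?al / ?la) *\<^sub>R (rx (du n) (dxi n) - \<tau> *\<^sub>R xt n))"
        unfolding r_def if_P[OF n] using m by (intro L2.triangle_diff L2.closed(4))
      then show ?thesis unfolding L2.nrm_scale[OF m(1)] L2.nrm_scale[OF m(2)] using \<kappa>0 by (simp only: abs_of_nonneg)
    qed
    also have "\<dots> \<le> ?\<kappa> * ((Cp + 1) * \<epsilon> * I n) + ?al / ?la * ((Cp + 1) * \<epsilon> * I n)"
      using 1 2 \<kappa>0 by (intro add_mono mult_left_mono)
    finally show ?thesis by (simp only: distrib_right mult.assoc)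
  qed
  have g_comb: "L2_norm ?L ((?al / ?la) *\<^sub>R p - (1 / ?la) *\<^sub>R x) \<le> (?al / ?la + 1 / ?la) * (Cp + 1) * \<epsilon> * J"
    if "p \<in> L2 ?L" "x \<in> L2 ?L" "L2_norm ?L p \<le> Cp * \<epsilon> * J" "L2_norm ?L x \<le> Cp * \<epsilon> * J" "0 \<le> J" for p x J
  proof -
    have c: "Cp * \<epsilon> * J \<le> (Cp + 1) * \<epsilon> * J" using eps that(5) by (simp add: mult_right_mono distrib_right)
    have "L2_norm ?L ((?al / ?la) *\<^sub>R p - (1 / ?la) *\<^sub>R x) \<le> ?al / ?la * L2_norm ?L p + 1 / ?la * L2_norm ?L x"
      using L2.triangle_diff[OF L2.closed(4)[OF that(1)] L2.closed(4)[OF that(2)], of "?al / ?la" "1 / ?la"]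
      unfolding L2.nrm_scale[OF that(1)] L2.nrm_scale[OF that(2)] using \<kappa>0 by (simp only: abs_of_nonneg)
    also have "\<dots> \<le> ?al / ?la * ((Cp + 1) * \<epsilon> * J) + 1 / ?la * ((Cp + 1) * \<epsilon> * J)"
      using that(3,4) c \<kappa>0 by (intro add_mono mult_left_mono) auto
    finally show ?thesis by (simp only: distrib_right mult.assoc)
  qed
  have g_bound: "L2_norm ?L (g (Suc n) - g n) \<le> (?al / ?la + 1 / ?la) * (Cp + 1) * \<epsilon> * (I n + (if n = 0 then A else 0))" 
    if n: "n \<le> N" for n
  proof (cases "n = 0")
    case True
    have "L2_norm ?L (\<rho>p (Suc 0)) \<le> Cp * h ^ (l + 1) * A + Cp * h ^ (l + 1) * I 0"
      using L2.nrm_telescope[where \<rho>=\<rho>p and m="Suc 0" and f="\<lambda>n. Cp * h ^ (l + 1) * I n", OF \<rho>S(4) \<rho>p0(2)] inc_p(2) by auto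
    also have "\<dots> \<le> Cp * \<epsilon> * (I 0 + A)"
      using mult_right_mono[OF Cpk(2), of "I 0 + A"] I0[of 0] A0 by (simp add: algebra_simps)
    finally have p: "L2_norm ?L (\<rho>p (Suc 0)) \<le> Cp * \<epsilon> * (I 0 + A)" .
    have "L2_norm ?L (\<rho>x (Suc 0)) \<le> Cp * h ^ k * A + Cp * h ^ k * I 0"
      using L2.nrm_telescope[where \<rho>=\<rho>x and m="Suc 0" and f="\<lambda>n. Cp * h ^ k * I n", OF \<rho>S(2) \<rho>0'(2)] inc_x by auto
    also have "\<dots> \<le> Cp * \<epsilon> * (I 0 + A)"
      using mult_right_mono[OF Cpk(1), of "I 0 + A"] I0[of 0] A0 by (simp add: algebra_simps)
    finally have x: "L2_norm ?L (\<rho>x (Suc 0)) \<le> Cp * \<epsilon> * (I 0 + A)" .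
    show ?thesis using g_comb[OF \<rho>S(4) \<rho>S(2) p x] I0[of 0] A0 True by (simp add: g_def)
  next
    case False
    have e: "g (Suc n) - g n = (?al / ?la) *\<^sub>R (\<rho>p (Suc n) - \<rho>p n) - (1 / ?la) *\<^sub>R (\<rho>x (Suc n) - \<rho>x n)"
      using False by (simp add: g_def scaleR_diff_right)
    have p: "L2_norm ?L (\<rho>p (Suc n) - \<rho>p n) \<le> Cp * \<epsilon> * I n"
      using inc_p(2)[OF n] mult_right_mono[OF Cpk(2) I0[OF n]] by linarith
    have x: "L2_norm ?L (\<rho>x (Suc n) - \<rho>x n) \<le> Cp * \<epsilon> * I n"
      using inc_x[OF n] mult_right_mono[OF Cpk(1) I0[OF n]] by linarith
    show ?thesis unfolding e using g_comb[OF L2.closed(3)[OF \<rho>S(4) \<rho>S(4)] L2.closed(3)[OF \<rho>S(2) \<rho>S(2)] p x I0[OF n]] False by simp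
  qed
  \<comment> \<open>The size of the data in each step; \<open>A\<close> is the contribution of the initial projection errors to the first.\<close>
  define s where "s n = K * \<epsilon> * (I n + (if n = 0 then A else 0))" for n :: nat
  have s_bound: "L2_norm ?L (r n) + L2_norm ?L (g (Suc n) - g n) \<le> s n" if n: "n \<le> N" for n
  proof -
    let ?J = "I n + (if n = 0 then A else 0)"
    have "(?\<kappa> + ?al / ?la) * (Cp + 1) * \<epsilon> * I n \<le> (?\<kappa> + ?al / ?la) * (Cp + 1) * \<epsilon> * ?J"
    proof (rule mult_left_mono)
      have "0 \<le> ?\<kappa> + ?al / ?la" "0 \<le> Cp + 1" using \<kappa>0 Cp by linarith+
      then show "0 \<le> (?\<kappa> + ?al / ?la) * (Cp + 1) * \<epsilon>" using eps(4) by (intro mult_nonneg_nonneg)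
    qed (use A0 in simp)
    then have "L2_norm ?L (r n) + L2_norm ?L (g (Suc n) - g n) 
        \<le> (?\<kappa> + ?al / ?la) * (Cp + 1) * \<epsilon> * ?J + (?al / ?la + 1 / ?la) * (Cp + 1) * \<epsilon> * ?J"
      using r_bound[OF n] g_bound[OF n] by linarith
    also have "\<dots> = s n" by (simp add: s_def K_def algebra_simps)
    finally show ?thesis .
  qed
  have Cs: "sqrt (2 * mu P) / \<beta> \<ge> 0" using parameters inf_sup(1) by simp
  have stab: "pf.en.nrm (U (Suc N), X (Suc N), Q (Suc N)) \<le> 2 * C * (\<Sum>n\<le>N. s n)"
    "(pf.d.nrm (Q (Suc N)))\<^sup>2 \<le> 2 * C\<^sup>2 * (\<Sum>n\<le>N. s n)\<^sup>2 / (real (N + 1) * \<tau>) + C\<^sup>2 * (\<Sum>n=1..N. (s n)\<^sup>2) / \<tau>"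
  proof -
    have c: "form_b P (U (Suc n) - U n) \<phi> + 1 / ?la * L2_inner ?L (X (Suc n) - X n - ?al *\<^sub>R (Q (Suc n) - Q n)) \<phi> 
        = L2_inner ?L (g (Suc n) - g n) \<phi>" if n: "n \<le> N" and \<phi>: "\<phi> \<in> W_h P k \<T>" for n \<phi>
    proof -
      have n': "n \<le> Suc N" "Suc n \<le> Suc N" using n by auto
      have \<phi>L: "\<phi> \<in> L2 ?L" using \<phi> discrete_in_Sobolev by blast
      have e: "X (Suc n) - X n - ?al *\<^sub>R (Q (Suc n) - Q n) = (X (Suc n) - ?al *\<^sub>R Q (Suc n)) - (X n - ?al *\<^sub>R Q n)"
        by (simp add: scaleR_diff_right)
      have "L2_inner ?L ((X (Suc n) - ?al *\<^sub>R Q (Suc n)) - (X n - ?al *\<^sub>R Q n)) \<phi> 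
          = L2_inner ?L (X (Suc n) - ?al *\<^sub>R Q (Suc n)) \<phi> - L2_inner ?L (X n - ?al *\<^sub>R Q n) \<phi>"
        using \<theta>S[OF n'(1)] \<theta>S[OF n'(2)] \<phi>L by (intro L2.diff) auto
      moreover have "form_b P (U (Suc n) - U n) \<phi> = form_b P (U (Suc n)) \<phi> - form_b P (U n) \<phi>"
        using \<theta>S[OF n'(1)] \<theta>S[OF n'(2)] \<phi>L by (intro form_b_linear) auto
      moreover have "L2_inner ?L (g (Suc n) - g n) \<phi> = L2_inner ?L (g (Suc n)) \<phi> - L2_inner ?L (g n) \<phi>"
        using gL \<phi>L by (intro L2.diff) auto
      ultimately show ?thesis unfolding e using constraint[OF n'(1) \<phi>] constraint[OF n'(2) \<phi>]
        by (simp add: right_diff_distrib)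
    qed
    have b_diff: "form_b P v (x - y) = form_b P v x - form_b P v y" 
      if "v \<in> V_h P k \<T>" "x \<in> W_h P k \<T>" "y \<in> W_h P k \<T>" for v x y
      using form_b_linear(3)[of v v x y] that discrete_in_Sobolev by blast
    have sub: "V_h P k \<T> \<subseteq> ?S" "W_h P k \<T> \<subseteq> L2 ?L" "M_h P l \<T> \<subseteq> ?S" using discrete_in_Sobolev by blast+
    note st = pf.discrete_stability[of N U "V_h P k \<T>" X "W_h P k \<T>" Q "M_h P l \<T>", 
        OF \<theta>V(1) discrete_spaces(1) sub(1) \<theta>V(2) discrete_spaces(2) sub(2) \<theta>V(3) discrete_spaces(3) sub(3)
          init0 b_diff elasticity discrete_pressure_control[OF inf_sup(1) inf_sup(2)] Cs \<tau> _ rL' c flow s_bound]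
    show "pf.en.nrm (U (Suc N), X (Suc N), Q (Suc N)) \<le> 2 * C * (\<Sum>n\<le>N. s n)"
      unfolding C_def by (rule st(1)) (use gL in auto)
    show "(pf.d.nrm (Q (Suc N)))\<^sup>2 \<le> 2 * C\<^sup>2 * (\<Sum>n\<le>N. s n)\<^sup>2 / (real (N + 1) * \<tau>) + C\<^sup>2 * (\<Sum>n=1..N. (s n)\<^sup>2) / \<tau>"
      unfolding C_def by (rule st(2)) (use gL in auto)
  qed
  have sum_s: "(\<Sum>n\<le>N. s n) = K * \<epsilon> * Y"
  proof -
    have "(\<Sum>n\<le>N. I n + (if n = 0 then A else 0)) = Y" by (simp add: sum.distrib Y_def)
    then show ?thesis unfolding s_def sum_distrib_left[symmetric] by simp
  qed
  have sum_s2: "(\<Sum>n=1..N. (s n)\<^sup>2) = (K * \<epsilon>)\<^sup>2 * (\<Sum>n=1..N. (I n)\<^sup>2)"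
    unfolding sum_distrib_left by (intro sum.cong) (auto simp: s_def power_mult_distrib)
  have N: "Suc N \<le> Suc N" by simp
  have u_split: "us (Suc N) - uh (Suc N) = \<rho>u (Suc N) + U (Suc N)" "xs (Suc N) - xh (Suc N) = \<rho>x (Suc N) + X (Suc N)"
    "ps (Suc N) - ph (Suc N) = \<rho>p (Suc N) + Q (Suc N)"
    by (simp_all add: \<rho>u_def \<rho>x_def \<rho>p_def U_def X_def Q_def)
  have energy: "pf.en.nrm (U (Suc N), X (Suc N), Q (Suc N)) \<le> 2 * C * (K * \<epsilon> * Y)" using stab(1) sum_s by simp
  have C0: "0 \<le> C" using parameters inf_sup(1) by (simp add: C_def pf.control_def)
  note control = pf.energy_control[OF \<theta>S(1)[OF N] \<theta>S(2)[OF N] \<theta>S(4)[OF N] 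
      discrete_pressure_control[OF inf_sup(1) inf_sup(2)[OF \<theta>V(2)[OF N]] \<theta>V(1)[OF N] elasticity[OF N]] Cs]
  have CE: "C * pf.en.nrm (U (Suc N), X (Suc N), Q (Suc N)) \<le> C * (2 * C * (K * \<epsilon> * Y))" by (rule mult_left_mono[OF energy C0])
  show ?error_u
  proof -
    have "pf.a.nrm (us (Suc N) - uh (Suc N)) \<le> pf.a.nrm (\<rho>u (Suc N)) + pf.a.nrm (U (Suc N))"
      unfolding u_split by (rule pf.a.triangle[OF \<rho>S(1) \<theta>S(1)[OF N]])
    also have "pf.a.nrm (\<rho>u (Suc N)) \<le> sqrt (2 * mu P) * (Cp * h ^ k * Y)"
      unfolding elastic_norm using L2_norm_strain_le[OF \<rho>S(1)[of "Suc N"]] \<rho>_bound(1) parameters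
      by (intro mult_left_mono) auto
    finally show ?thesis using control(1) energy unfolding elastic_norm by linarith
  qed
  show ?error_x
    using L2.triangle[OF \<rho>S(2)[of "Suc N"] \<theta>S(2)[OF N]] \<rho>_bound(2) control(2) CE unfolding u_split C_def[symmetric] by linarith
  show ?error_p
    using L2.triangle[OF \<rho>S(4)[of "Suc N"] \<theta>S(4)[OF N]] \<rho>_bound(4) control(3) CE unfolding u_split C_def[symmetric] by linarith
  show ?error_grad
  proof -
    let ?R = "2 * Y\<^sup>2 / (real (N + 1) * \<tau>) + (\<Sum>n=1..N. (I n)\<^sup>2) / \<tau>"
    have K0: "0 \<le> K" using \<kappa>0 Cp by (simp add: K_def)
    have R0: "0 \<le> ?R" using \<tau> by (intro add_nonneg_nonneg divide_nonneg_nonneg sum_nonneg) auto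
    have "(pf.d.nrm (Q (Suc N)))\<^sup>2 \<le> (C * K * \<epsilon>)\<^sup>2 * ?R"
      using stab(2) unfolding sum_s sum_s2 by (simp add: power_mult_distrib algebra_simps)
    also have "\<dots> = (C * K * \<epsilon> * sqrt ?R)\<^sup>2" using R0 by (simp add: power_mult_distrib)
    finally have Qb: "pf.d.nrm (Q (Suc N)) \<le> C * K * \<epsilon> * sqrt ?R"
      by (rule power2_le_imp_le) (use C0 K0 eps R0 in \<open>auto intro!: mult_nonneg_nonneg\<close>)
    have "pf.d.nrm (ps (Suc N) - ph (Suc N)) \<le> pf.d.nrm (\<rho>p (Suc N)) + pf.d.nrm (Q (Suc N))"
      unfolding u_split by (rule pf.d.triangle[OF \<rho>S(3) \<theta>S(3)[OF N]])
    also have "pf.d.nrm (\<rho>p (Suc N)) \<le> sqrt (perm P) * (Cp * h ^ l * Y)"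
      unfolding flow_norm using L2_norm_grad_le[OF \<rho>S(3)[of "Suc N"]] \<rho>_bound(3) parameters
      by (intro mult_left_mono) auto
    finally show ?thesis using Qb unfolding flow_norm by linarith
  qed
qed

end

section \<open>Sampling the solution in time\<close>

text \<open>The solution takes its initial values only almost everywhere, while the discrete initial values are
  projections of the given functions themselves.\<close>

definition sampled :: "'a \<Rightarrow> (real \<Rightarrow> 'a) \<Rightarrow> (nat \<Rightarrow> real) \<Rightarrow> nat \<Rightarrow> 'a" where
  "sampled u0 u s n = (if n = 0 then u0 else u (s n))"

text \<open>The Cauchy--Schwarz inequality on each step gives the factor \<open>\<tau>\<close> in the second estimate.\<close>

lemma uniform_partition_integrals:
  fixes y :: "real \<Rightarrow> real" and N :: nat
  assumes T: "T > 0" and y: "y \<in> L2 (lebesgue_on {0<..<T})" and pos: "\<And>r. 0 \<le> y r"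
  defines "\<tau> \<equiv> T / real (N + 1)"
  shows "(\<Sum>n\<le>N. integral {real n * \<tau>..real (Suc n) * \<tau>} y) = integral {0..T} y"
    and "(\<Sum>n\<le>N. (integral {real n * \<tau>..real (Suc n) * \<tau>} y)\<^sup>2) \<le> \<tau> * integral {0..T} (\<lambda>r. (y r)\<^sup>2)"
proof -
  let ?M = "lebesgue_on {0<..<T}"
  have \<tau>: "\<tau> > 0" "real (N + 1) * \<tau> = T" using T by (auto simp: \<tau>_def)
  have iy: "integrable ?M y" by (rule L2_integrable[OF finite_measure_interval y])
  have iy2: "integrable ?M (\<lambda>r. (y r)\<^sup>2)" using L2_norm_sq_integrable[OF y] by simp
  have sum: "(\<Sum>n<m. integral {real n * \<tau>..real (Suc n) * \<tau>} f) = integral {0..real m * \<tau>} f"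
    if f: "integrable ?M f" and m: "m \<le> Suc N" for f :: "real \<Rightarrow> real" and m
    using m
  proof (induction m)
    case (Suc m)
    have le: "real m * \<tau> \<le> real (Suc m) * \<tau>" "real (Suc m) * \<tau> \<le> T"
      using Suc.prems \<tau> mult_right_mono[of "real (Suc m)" "real (N + 1)" \<tau>] by auto
    have "f integrable_on {0..T}"
      using integrable_on_lebesgue_on[OF f] by (simp add: integrable_on_Icc_iff_Ioo)
    then have "f integrable_on {0..real (Suc m) * \<tau>}" by (rule integrable_on_subinterval) (use le in auto)
    then have "integral {0..real m * \<tau>} f + integral {real m * \<tau>..real (Suc m) * \<tau>} f = integral {0..real (Suc m) * \<tau>} f"
      using le \<tau> by (intro Henstock_Kurzweil_Integration.integral_combine) auto
    then show ?case using Suc by simp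
  qed simp
  show "(\<Sum>n\<le>N. integral {real n * \<tau>..real (Suc n) * \<tau>} y) = integral {0..T} y"
    using sum[OF iy, of "Suc N"] \<tau>(2) by (simp add: lessThan_Suc_atMost)
  have "(integral {real n * \<tau>..real (Suc n) * \<tau>} y)\<^sup>2 \<le> \<tau> * integral {real n * \<tau>..real (Suc n) * \<tau>} (\<lambda>r. (y r)\<^sup>2)" 
    if n: "n \<le> N" for n
  proof -
    let ?a = "real n * \<tau>" and ?b = "real (Suc n) * \<tau>"
    let ?M' = "lebesgue_on {?a<..<?b}"
    have ab: "0 \<le> ?a" "?b \<le> T" "?b - ?a = \<tau>"
      using n \<tau> mult_right_mono[of "real (Suc n)" "real (N + 1)" \<tau>] by (auto simp: algebra_simps)
    have "y \<in> L2 ?M'"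
      using integral_subinterval(1)[OF iy ab(1,2)] integral_subinterval(1)[OF iy2 ab(1,2)] by (auto simp: L2_def)
    then have "(LINT r|?M'. norm (y r)) \<le> sqrt (measure ?M' (space ?M')) * L2_norm ?M' y"
      by (rule L2_integral_norm_le[OF finite_measure_interval])
    moreover have "measure ?M' (space ?M') = \<tau>" using ab \<tau> by (simp add: measure_restrict_space)
    moreover have "(LINT r|?M'. norm (y r)) = integral {?a..?b} y"
      using integral_subinterval(2)[OF iy ab(1,2)] pos by simp
    moreover have "L2_norm ?M' y = sqrt (integral {?a..?b} (\<lambda>r. (y r)\<^sup>2))"
      using integral_subinterval(2)[OF iy2 ab(1,2)] by (simp add: L2_norm_def)
    ultimately have le: "integral {?a..?b} y \<le> sqrt (\<tau> * integral {?a..?b} (\<lambda>r. (y r)\<^sup>2))" by (simp add: real_sqrt_mult)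
    have "0 \<le> (LINT r|?M'. y r)" using pos by simp
    then have y0: "0 \<le> integral {?a..?b} y" using integral_subinterval(2)[OF iy ab(1,2)] by simp
    have "0 \<le> (LINT r|?M'. (y r)\<^sup>2)" by (rule Bochner_Integration.integral_nonneg) simp
    then have "0 \<le> integral {?a..?b} (\<lambda>r. (y r)\<^sup>2)" by (simp only: integral_subinterval(2)[OF iy2 ab(1,2)])
    then show ?thesis using power_mono[OF le y0, of 2] \<tau>(1) by simp
  qed
  then have "(\<Sum>n\<le>N. (integral {real n * \<tau>..real (Suc n) * \<tau>} y)\<^sup>2) 
      \<le> (\<Sum>n\<le>N. \<tau> * integral {real n * \<tau>..real (Suc n) * \<tau>} (\<lambda>r. (y r)\<^sup>2))" by (intro sum_mono) auto
  also have "\<dots> = \<tau> * integral {0..T} (\<lambda>r. (y r)\<^sup>2)"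
    using sum[OF iy2, of "Suc N"] \<tau>(2) by (simp add: lessThan_Suc_atMost flip: sum_distrib_left)
  finally show "(\<Sum>n\<le>N. (integral {real n * \<tau>..real (Suc n) * \<tau>} y)\<^sup>2) \<le> \<tau> * integral {0..T} (\<lambda>r. (y r)\<^sup>2)" .
qed

lemma L2_time_norm_in_L2:
  assumes v: "v \<in> L2_time T X N" and N: "\<And>f. 0 \<le> N f"
  shows "(\<lambda>t. N (v t)) \<in> L2 (lebesgue_on {0<..<T})"
  using L2_time_integrable_norm[OF v N] v by (auto simp: L2_def L2_time_def)

context bounded_domain
begin

lemma sampled_increment_AE:
  fixes u :: "real \<Rightarrow> real^'d \<Rightarrow> 'b::euclidean_space"
  assumes u: "time_continuous T \<Omega> u" and u0: "u0 \<in> L2 dx" "AE x in dx. u 0 x = u0 x" 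
    and s: "s 0 = 0" "0 \<le> s n" "s n \<le> s (Suc n)" "s (Suc n) \<le> T"
  shows "AE x in dx. (u (s (Suc n)) - u (s n)) x = (sampled u0 u s (Suc n) - sampled u0 u s n) x"
    and "u (s (Suc n)) - u (s n) \<in> L2 dx" and "sampled u0 u s (Suc n) - sampled u0 u s n \<in> L2 dx"
proof -
  have L: "u (s (Suc n)) \<in> L2 dx" "u (s n) \<in> L2 dx" using u s by (auto simp: time_continuous_def)
  show "AE x in dx. (u (s (Suc n)) - u (s n)) x = (sampled u0 u s (Suc n) - sampled u0 u s n) x"
    using u0(2) by eventually_elim (use s(1) in \<open>auto simp: sampled_def\<close>)
  show "u (s (Suc n)) - u (s n) \<in> L2 dx" "sampled u0 u s (Suc n) - sampled u0 u s n \<in> L2 dx"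
    using L u0(1) by (auto simp: sampled_def)
qed

lemma sampled_increment_Sobolev:
  fixes u v :: "real \<Rightarrow> real^'d \<Rightarrow> 'b::euclidean_space"
  assumes T: "T > 0" and u: "time_continuous T \<Omega> u" and uv: "has_weak_time_deriv T \<Omega> u v" 
    and v: "v \<in> L2_time T X (Sobolev_norm \<Omega> m)" "subspace X" "X \<subseteq> Sobolev \<Omega> m"
    and u0: "u0 \<in> L2 dx" "AE x in dx. u 0 x = u0 x" 
    and s: "s 0 = 0" "0 \<le> s n" "s n \<le> s (Suc n)" "s (Suc n) \<le> T"
  shows "sampled u0 u s (Suc n) - sampled u0 u s n \<in> Sobolev \<Omega> m" 
    and "Sobolev_norm \<Omega> m (sampled u0 u s (Suc n) - sampled u0 u s n) \<le> integral {s n..s (Suc n)} (\<lambda>r. Sobolev_norm \<Omega> m (v r))"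
proof -
  note ae = sampled_increment_AE[where u=u and n=n, OF u u0 s]
  note inc = time_increment_Sobolev[OF T u uv v s(2,3,4)]
  show "sampled u0 u s (Suc n) - sampled u0 u s n \<in> Sobolev \<Omega> m"
    by (rule Sobolev_cong[OF ae(1) inc(1) L2_measurable[OF ae(3)]])
  show "Sobolev_norm \<Omega> m (sampled u0 u s (Suc n) - sampled u0 u s n) \<le> integral {s n..s (Suc n)} (\<lambda>r. Sobolev_norm \<Omega> m (v r))"
    using inc(2) Sobolev_norm_cong[OF ae(1) L2_measurable[OF ae(2)] L2_measurable[OF ae(3)]] by simp
qed

lemma sampled_consistency:
  fixes u v :: "real \<Rightarrow> real^'d \<Rightarrow> 'b::euclidean_space"
  assumes T: "T > 0" and u: "time_continuous T \<Omega> u" and uv: "has_weak_time_deriv T \<Omega> u v" 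
    and v: "v \<in> L2_time T X N" "dominating_norm X N" and vc: "time_continuous T \<Omega> v"
    and vz: "has_weak_time_deriv T \<Omega> v z" and z: "z \<in> L2_time T Y N'" "dominating_norm Y N'" 
    and u0: "u0 \<in> L2 dx" "AE x in dx. u 0 x = u0 x" 
    and s: "s 0 = 0" "0 \<le> s n" "s n \<le> s (Suc n)" "s (Suc n) \<le> T"
  shows "L2_norm dx (sampled u0 u s (Suc n) - sampled u0 u s n - (s (Suc n) - s n) *\<^sub>R v (s (Suc n))) 
    \<le> (s (Suc n) - s n) * integral {s n..s (Suc n)} (\<lambda>r. N' (z r))"
proof -
  note ae = sampled_increment_AE[where u=u and n=n, OF u u0 s]
  have vL: "v (s (Suc n)) \<in> L2 dx" using vc s by (auto simp: time_continuous_def)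
  have "L2_norm dx (u (s (Suc n)) - u (s n) - (s (Suc n) - s n) *\<^sub>R v (s (Suc n)))
      = L2_norm dx (sampled u0 u s (Suc n) - sampled u0 u s n - (s (Suc n) - s n) *\<^sub>R v (s (Suc n)))"
  proof (rule L2_norm_cong_AE)
    show "AE x in dx. (u (s (Suc n)) - u (s n) - (s (Suc n) - s n) *\<^sub>R v (s (Suc n))) x
      = (sampled u0 u s (Suc n) - sampled u0 u s n - (s (Suc n) - s n) *\<^sub>R v (s (Suc n))) x"
      using ae(1) by eventually_elim simp
  qed (intro L2_measurable L2.closed(3,4) ae vL)+
  then show ?thesis using backward_difference_error[OF T u uv v vc vz z s(2,3,4)] by simp
qed

text \<open>The function has the regularity at some time, and the increments up to this time have it as well.\<close>

lemma initial_regularity: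
  fixes u v :: "real \<Rightarrow> real^'d \<Rightarrow> 'b::euclidean_space"
  assumes T: "T > 0" and u: "time_continuous T \<Omega> u" and uv: "has_weak_time_deriv T \<Omega> u v" 
    and v: "v \<in> L2_time T X (Sobolev_norm \<Omega> m)" "subspace X" "X \<subseteq> Sobolev \<Omega> m"
    and ae: "AE t in lebesgue_on {0<..<T}. u t \<in> Sobolev \<Omega> m"
    and u0: "u0 \<in> L2 dx" "AE x in dx. u 0 x = u0 x"
  shows "u0 \<in> Sobolev \<Omega> m"
proof -
  have "\<exists>t\<in>{0<..<T}. u t \<in> Sobolev \<Omega> m"
  proof (rule ccontr)
    assume no: "\<not> (\<exists>t\<in>{0<..<T}. u t \<in> Sobolev \<Omega> m)"
    have "AE t in lebesgue_on {0<..<T}. False"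
      by (rule AE_mp[OF ae AE_I2]) (use no in auto)
    then have "emeasure (lebesgue_on {0<..<T}) (space (lebesgue_on {0<..<T})) = 0"
      unfolding trivial_limit_def[symmetric] ae_filter_eq_bot_iff[symmetric] by (simp add: trivial_limit_def)
    then show False using T by (simp add: emeasure_restrict_space)
  qed
  then obtain t where t: "t \<in> {0<..<T}" "u t \<in> Sobolev \<Omega> m" by blast
  have "u t - u 0 \<in> Sobolev \<Omega> m" using t by (intro time_increment_Sobolev(1)[OF T u uv v]) auto
  from Sob.closed(3)[OF t(2) this] have "u 0 \<in> Sobolev \<Omega> m" by simp
  then show ?thesis using u0 by (intro Sobolev_cong[OF u0(2)] L2_measurable)
qed

lemma Sobolev0_upgrade: "v \<in> Sobolev \<Omega> m \<Longrightarrow> v \<in> Sobolev0 \<Omega> 1 \<Gamma> \<Longrightarrow> v \<in> Sobolev0 \<Omega> m \<Gamma>"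
  by (auto simp: Sobolev0_def)

end

text \<open>The upper bound is used to estimate \<open>h^(l + 1)\<close> by a multiple of \<open>h^l\<close>.\<close>

lemma mesh_size_bounds:
  assumes "mesh_of \<Omega> \<T>" "bounded \<Omega>" "\<Omega> \<noteq> {}"
  shows "0 \<le> mesh_size \<T>" "mesh_size \<T> \<le> diameter (closure \<Omega>)"
proof -
  have fin: "finite \<T>" and un: "\<Union>\<T> = closure \<Omega>" using assms(1) by (auto simp: mesh_of_def)
  have ne: "\<T> \<noteq> {}"
  proof
    assume "\<T> = {}"
    then have "closure \<Omega> = \<Union>{}" using un by (simp only:)
    then show False using assms(3) closure_subset[of \<Omega>] by simp
  qed
  have b: "bounded (closure \<Omega>)" using assms(2) by (rule bounded_closure)
  have "mesh_size \<T> \<in> diameter ` \<T>" unfolding mesh_size_def using fin ne by (intro Max_in) auto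
  then obtain K where K: "K \<in> \<T>" "mesh_size \<T> = diameter K" by auto
  have sub: "K \<subseteq> closure \<Omega>" using K un by auto
  show "mesh_size \<T> \<le> diameter (closure \<Omega>)" unfolding K(2) by (rule diameter_subset[OF sub b])
  show "0 \<le> mesh_size \<T>" unfolding K(2) using bounded_subset[OF b sub] by (rule diameter_ge_0)
qed

theorem theorem4p3:
  fixes P :: "'d::finite biot"
    and k l :: nat
    and meshes :: "(real^'d) set set set"
    and Ru :: "(real^'d) set set \<Rightarrow> (real^'d \<Rightarrow> real^'d) \<Rightarrow> (real^'d \<Rightarrow> real) \<Rightarrow> real^'d \<Rightarrow> real^'d"
    and R\<xi> :: "(real^'d) set set \<Rightarrow> (real^'d \<Rightarrow> real^'d) \<Rightarrow> (real^'d \<Rightarrow> real) \<Rightarrow> real^'d \<Rightarrow> real"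
    and Rp :: "(real^'d) set set \<Rightarrow> (real^'d \<Rightarrow> real) \<Rightarrow> real^'d \<Rightarrow> real"
    and Ck \<beta> \<beta>' Cproj :: real
    and u ut utt :: "real \<Rightarrow> real^'d \<Rightarrow> real^'d"
    and \<xi> \<xi>t \<xi>tt p pt ptt :: "real \<Rightarrow> real^'d \<Rightarrow> real"
  assumes setting: "biot_setting P"
    and degrees: "k \<ge> 2" "l \<ge> 1"
    and meshes: "\<forall>\<T>\<in>meshes. mesh_of (dom P) \<T>"
    \<comment> \<open>the projections\<close>
    and stokes_projection:
      "\<forall>\<T>\<in>meshes. \<forall>v\<in>V_space P. \<forall>\<phi>\<in>W_space P.
         is_stokes_projection P k \<T> v \<phi> (Ru \<T> v \<phi>) (R\<xi> \<T> v \<phi>)"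
    and elliptic_projection:
      "\<forall>\<T>\<in>meshes. \<forall>\<psi>\<in>M_space P. is_elliptic_projection P l \<T> \<psi> (Rp \<T> \<psi>)"
    \<comment> \<open>standing facts for the family of meshes; in the suprema, \<open>v = 0\<close> contributes \<open>0 / 0 = 0\<close>\<close>
    and korn: "\<forall>v\<in>V_space P. Sobolev_norm (dom P) 1 v \<le> Ck * L2_norm (vol P) (strain (dom P) v)"
    and inf_sup: "\<beta> > 0"
      "\<forall>\<phi>\<in>W_space P. (SUP v\<in>V_space P. form_b P v \<phi> / Sobolev_norm (dom P) 1 v) \<ge> \<beta> * L2_norm (vol P) \<phi>"
    and discrete_inf_sup: "\<beta>' > 0"
      "\<forall>\<T>\<in>meshes. \<forall>\<phi>\<in>W_h P k \<T>.
         (SUP v\<in>V_h P k \<T>. form_b P v \<phi> / Sobolev_norm (dom P) 1 v) \<ge> \<beta>' * L2_norm (vol P) \<phi>"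
    and stokes_projection_error:
      "\<forall>\<T>\<in>meshes. \<forall>v\<in>Sobolev0 (dom P) (k + 1) (Gam_d P). \<forall>\<phi>\<in>Sobolev (dom P) k.
         Sobolev_norm (dom P) 1 (\<lambda>x. v x - Ru \<T> v \<phi> x) + L2_norm (vol P) (\<lambda>x. \<phi> x - R\<xi> \<T> v \<phi> x)
         \<le> Cproj * mesh_size \<T> ^ k * (Sobolev_norm (dom P) (k + 1) v + Sobolev_norm (dom P) k \<phi>)"
    and elliptic_projection_error:
      "\<forall>\<T>\<in>meshes. \<forall>\<psi>\<in>Sobolev0 (dom P) (l + 1) (Gam_p P).
         Sobolev_norm (dom P) 1 (\<lambda>x. \<psi> x - Rp \<T> \<psi> x)
           \<le> Cproj * mesh_size \<T> ^ l * Sobolev_norm (dom P) (l + 1) \<psi> \<and>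
         L2_norm (vol P) (\<lambda>x. \<psi> x - Rp \<T> \<psi> x)
           \<le> Cproj * mesh_size \<T> ^ (l + 1) * Sobolev_norm (dom P) (l + 1) \<psi>"
    \<comment> \<open>the solution of (CP) and its regularity\<close>
    and solution: "cp_solution P u \<xi> p \<xi>t pt"
    and time_derivatives:
      "has_weak_time_deriv (T_end P) (dom P) u ut" "has_weak_time_deriv (T_end P) (dom P) ut utt"
      "has_weak_time_deriv (T_end P) (dom P) \<xi>t \<xi>tt" "has_weak_time_deriv (T_end P) (dom P) pt ptt"
    and regularity_u:
      "u \<in> Linf_time (T_end P) (Sobolev0 (dom P) (k + 1) (Gam_d P)) (Sobolev_norm (dom P) (k + 1))"
      "ut \<in> L2_time (T_end P) (Sobolev0 (dom P) (k + 1) (Gam_d P)) (Sobolev_norm (dom P) (k + 1))"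
      "utt \<in> L2_time (T_end P) (Sobolev0 (dom P) 1 (Gam_d P)) (Sobolev_norm (dom P) 1)"
    and regularity_\<xi>:
      "\<xi> \<in> Linf_time (T_end P) (Sobolev (dom P) k) (Sobolev_norm (dom P) k)"
      "\<xi>t \<in> L2_time (T_end P) (Sobolev (dom P) k) (Sobolev_norm (dom P) k)"
      "\<xi>tt \<in> L2_time (T_end P) (L2 (vol P)) (L2_norm (vol P))"
    and regularity_p:
      "p \<in> Linf_time (T_end P) (Sobolev0 (dom P) (l + 1) (Gam_p P)) (Sobolev_norm (dom P) (l + 1))"
      "pt \<in> L2_time (T_end P) (Sobolev0 (dom P) (l + 1) (Gam_p P)) (Sobolev_norm (dom P) (l + 1))"
      "ptt \<in> L2_time (T_end P) (L2 (vol P)) (L2_norm (vol P))"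
  shows "\<exists>C>0. \<forall>\<T>\<in>meshes. \<forall>N uh \<xi>h ph.
    uh 0 = Ru \<T> (u_init P) (xi_init P) \<longrightarrow> \<xi>h 0 = R\<xi> \<T> (u_init P) (xi_init P) \<longrightarrow>
    ph 0 = Rp \<T> (p_init P) \<longrightarrow> backward_euler P k l \<T> N uh \<xi>h ph \<longrightarrow>
      (let h = mesh_size \<T>; dt = time_step P N;
           e_u = (\<lambda>x. u (grid P N (N + 1)) x - uh (N + 1) x);
           e_\<xi> = (\<lambda>x. \<xi> (grid P N (N + 1)) x - \<xi>h (N + 1) x);
           e_p = (\<lambda>x. p (grid P N (N + 1)) x - ph (N + 1) x)
       in L2_norm (vol P) (strain (dom P) e_u) + L2_norm (vol P) e_\<xi> + L2_norm (vol P) e_p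
            \<le> C * (dt + h ^ k + h ^ (l + 1)) \<and>
          L2_norm (vol P) (grad (dom P) e_p) \<le> C * (dt + h ^ k + h ^ l))"
proof -
  interpret biot_problem P by unfold_locales (rule setting)
  let ?L = "vol P" and ?T = "T_end P" and ?N = "Sobolev_norm (dom P)"
  have T: "?T > 0" by (rule parameters)
  note cp = solution[unfolded cp_solution_def]
  have tc: "time_continuous ?T (dom P) u" "time_continuous ?T (dom P) \<xi>" "time_continuous ?T (dom P) p"
    "time_continuous ?T (dom P) \<xi>t" "time_continuous ?T (dom P) pt" 
    and wd: "has_weak_time_deriv ?T (dom P) \<xi> \<xi>t" "has_weak_time_deriv ?T (dom P) p pt"
    and init: "AE x in ?L. u 0 x = u_init P x" "AE x in ?L. \<xi> 0 x = xi_init P x" "AE x in ?L. p 0 x = p_init P x"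
    using cp by blast+
  have eqs: "u t \<in> V_space P" "\<xi> t \<in> W_space P" "p t \<in> M_space P"
    "\<And>v. v \<in> V_space P \<Longrightarrow> form_a1 P (u t) v - form_b P v (\<xi> t) = load_term P t v"
    "\<And>\<phi>. \<phi> \<in> W_space P \<Longrightarrow> form_b P (u t) \<phi> + form_a2 P (\<xi> t) \<phi> - form_c P (p t) \<phi> = 0"
    "\<And>\<psi>. \<psi> \<in> M_space P \<Longrightarrow> form_a3 P (pt t) \<psi> - form_c P \<psi> (\<xi>t t) + form_d P (p t) \<psi> = supply_term P t \<psi>"
    if "t \<in> {0..?T}" for t using cp that by blast+
  let ?XU = "Sobolev0 (dom P) (k + 1) (Gam_d P) :: (real^'d \<Rightarrow> real^'d) set" and ?XX = "Sobolev (dom P) k :: (real^'d \<Rightarrow> real) set"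
    and ?XP = "Sobolev0 (dom P) (l + 1) (Gam_p P) :: (real^'d \<Rightarrow> real) set"
  have X: "subspace ?XU" "?XU \<subseteq> Sobolev (dom P) (k + 1)" "subspace ?XX" "?XX \<subseteq> Sobolev (dom P) k"
    "subspace ?XP" "?XP \<subseteq> Sobolev (dom P) (l + 1)"
    by (simp_all add: subspace_Sobolev0 Sobolev0_subset subspace_Sobolev)
  \<comment> \<open>The initial values inherit the regularity in space, so that the projections approximate them.\<close>
  have uV: "u_init P \<in> V_space P" and pM: "p_init P \<in> M_space P" using setting by (auto simp: biot_setting_def)
  have u0S: "u_init P \<in> Sobolev (dom P) 1" using uV spaces(4) by blast
  have u0L: "u_init P \<in> L2 ?L" by (rule Sobolev_L2[OF u0S])
  have p0L: "p_init P \<in> L2 ?L" using pM spaces(6) Sobolev_L2 by blast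
  have x0L: "xi_init P \<in> L2 ?L"
  proof -
    have "xi_init P = alph P *\<^sub>R p_init P - lam P *\<^sub>R divergence (dom P) (u_init P)" by (simp add: fun_eq_iff xi_init_def)
    moreover have "alph P *\<^sub>R p_init P - lam P *\<^sub>R divergence (dom P) (u_init P) \<in> L2 ?L"
      by (intro L2.closed(3,4) p0L ae_linear_L2[OF ae_linear_divergence u0S])
    ultimately show ?thesis by (simp only:)
  qed
  have AE_Linf: "AE t in lebesgue_on {0<..<?T}. f t \<in> Y" if "f \<in> Linf_time ?T X' n" "X' \<subseteq> Y" for f :: "real \<Rightarrow> real^'d \<Rightarrow> 'b::euclidean_space" and X' Y n
  proof -
    have "AE t in lebesgue_on {0<..<?T}. f t \<in> X'" using that(1) by (simp add: Linf_time_def strongly_measurable_def)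
    then show ?thesis by eventually_elim (use that(2) in blast)
  qed
  have reg0: "u_init P \<in> ?XU" "xi_init P \<in> ?XX" "p_init P \<in> ?XP"
  proof -
    have "u_init P \<in> Sobolev (dom P) (k + 1)"
      by (rule initial_regularity[OF T tc(1) time_derivatives(1) regularity_u(2) X(1,2) AE_Linf[OF regularity_u(1) X(2)] u0L init(1)])
    then show "u_init P \<in> ?XU" using uV unfolding V_space_def by (rule Sobolev0_upgrade)
    show "xi_init P \<in> ?XX"
      by (rule initial_regularity[OF T tc(2) wd(1) regularity_\<xi>(2) X(3,4) AE_Linf[OF regularity_\<xi>(1) X(4)] x0L init(2)])
    have "p_init P \<in> Sobolev (dom P) (l + 1)"
      by (rule initial_regularity[OF T tc(3) wd(2) regularity_p(2) X(5,6) AE_Linf[OF regularity_p(1) X(6)] p0L init(3)])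
    then show "p_init P \<in> ?XP" using pM unfolding M_space_def by (rule Sobolev0_upgrade)
  qed
  \<comment> \<open>one function of time that dominates all the norms needed\<close>
  define y where "y r = ?N (k + 1) (ut r) + ?N k (\<xi>t r) + ?N (l + 1) (pt r) + L2_norm ?L (\<xi>tt r) + L2_norm ?L (ptt r)" for r
  have yparts: "(\<lambda>r. ?N (k + 1) (ut r)) \<in> L2 (lebesgue_on {0<..<?T})" "(\<lambda>r. ?N k (\<xi>t r)) \<in> L2 (lebesgue_on {0<..<?T})"
    "(\<lambda>r. ?N (l + 1) (pt r)) \<in> L2 (lebesgue_on {0<..<?T})" "(\<lambda>r. L2_norm ?L (\<xi>tt r)) \<in> L2 (lebesgue_on {0<..<?T})"
    "(\<lambda>r. L2_norm ?L (ptt r)) \<in> L2 (lebesgue_on {0<..<?T})"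
    using L2_time_norm_in_L2[OF regularity_u(2) Sobolev_norm_nonneg] L2_time_norm_in_L2[OF regularity_\<xi>(2) Sobolev_norm_nonneg]
      L2_time_norm_in_L2[OF regularity_p(2) Sobolev_norm_nonneg] L2_time_norm_in_L2[OF regularity_\<xi>(3) L2_norm_nonneg]
      L2_time_norm_in_L2[OF regularity_p(3) L2_norm_nonneg] by auto
  have yL: "y \<in> L2 (lebesgue_on {0<..<?T})"
    using L2.closed(2)[OF L2.closed(2)[OF L2.closed(2)[OF L2.closed(2)[OF yparts(1,2)] yparts(3)] yparts(4)] yparts(5)]
    by (simp add: y_def[abs_def] plus_fun_def)
  have y0: "0 \<le> y r" for r by (simp add: y_def)
  have hk: "f integrable_on {a..b}" if "f \<in> L2 (lebesgue_on {0<..<?T})" "0 \<le> a" "b \<le> ?T" for f :: "real \<Rightarrow> real" and a b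
    using integrable_on_lebesgue_on[OF integral_subinterval(1)[OF L2_integrable[OF finite_measure_interval that(1)] that(2,3)]]
    by (simp add: integrable_on_Icc_iff_Ioo)
  \<comment> \<open>The constants depend on the solution and on the parameters, but not on the mesh or the number of steps.\<close>
  define A where "A = ?N (k + 1) (u_init P) + ?N k (xi_init P) + ?N (l + 1) (p_init P)"
  define Y where "Y = integral {0..?T} y + A"
  define Z where "Z = integral {0..?T} (\<lambda>r. (y r)\<^sup>2)"
  define c where "c = \<bar>Cproj\<bar>"
  define K where "K = (c0 P + (alph P)\<^sup>2 / lam P + 2 * (alph P / lam P) + 1 / lam P) * (c + 1)"
  define S where "S = pf.control (sqrt (2 * mu P) / \<beta>')"
  define \<delta> where "\<delta> = 1 + diameter (closure (dom P))"
  define c1 where "c1 = c * Y + 2 * S * (K * Y) / sqrt (2 * mu P)"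
  define c2 where "c2 = c * Y + S * (2 * S * (K * Y))"
  define c3 where "c3 = c * Y + S * K * \<delta> * sqrt (2 * Y\<^sup>2 / ?T + Z) / sqrt (perm P)"
  have A0: "0 \<le> A" by (simp add: A_def)
  have Y0: "0 \<le> Y" using A0 Henstock_Kurzweil_Integration.integral_nonneg[OF hk[OF yL, of 0 ?T]] y0 by (simp add: Y_def)
  have Z0: "0 \<le> Z" unfolding Z_def
    by (rule Henstock_Kurzweil_Integration.integral_nonneg)
      (use integrable_on_lebesgue_on[OF L2_norm_sq_integrable[OF yL]] in \<open>auto simp: integrable_on_Icc_iff_Ioo\<close>)
  have c: "0 \<le> c" by (simp add: c_def)
  have K0: "0 \<le> K" using parameters c by (auto simp: K_def intro!: mult_nonneg_nonneg add_nonneg_nonneg)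
  have S0: "0 \<le> S" using parameters discrete_inf_sup(1) by (simp add: S_def pf.control_def)
  have dom: "bounded (dom P)" "dom P \<noteq> {}" using setting by (auto simp: biot_setting_def polyhedral_domain_def)
  have \<delta>: "1 \<le> \<delta>" using diameter_ge_0[of "closure (dom P)"] dom by (simp add: \<delta>_def bounded_closure)
  have R0: "0 \<le> 2 * Y\<^sup>2 / ?T + Z" using T Z0 by simp
  have c123: "0 \<le> c1" "0 \<le> c2" "0 \<le> c3"
    using c Y0 S0 K0 \<delta> R0 parameters by (auto simp: c1_def c2_def c3_def intro!: add_nonneg_nonneg divide_nonneg_nonneg mult_nonneg_nonneg)
  show ?thesis
  proof (intro exI[of _ "c1 + 2 * c2 + c3 + 1"] conjI ballI allI impI)
    show "0 < c1 + 2 * c2 + c3 + 1" using c123 by simp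
    fix \<T> N uh \<xi>h ph
    assume \<T>: "\<T> \<in> meshes" and h0: "uh 0 = Ru \<T> (u_init P) (xi_init P)" "\<xi>h 0 = R\<xi> \<T> (u_init P) (xi_init P)" "ph 0 = Rp \<T> (p_init P)"
      and be: "backward_euler P k l \<T> N uh \<xi>h ph"
    let ?h = "mesh_size \<T>" and ?\<tau> = "time_step P N"
    have h: "0 \<le> ?h" "?h \<le> diameter (closure (dom P))" using mesh_size_bounds[OF _ dom] meshes \<T> by blast+
    have \<tau>: "?\<tau> > 0" "real (N + 1) * ?\<tau> = ?T" using T by (auto simp: time_step_def)
    \<comment> \<open>the grid, continued constantly after the final time so that it stays in the time interval\<close>
    define s where "s n = real (min n (N + 1)) * ?\<tau>" for n
    have s: "s 0 = 0" "0 \<le> s n" "s n \<le> s (Suc n)" "s n \<le> ?T" for n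
    proof -
      show "s 0 = 0" "0 \<le> s n" "s n \<le> s (Suc n)" using \<tau> by (auto simp: s_def intro!: mult_right_mono)
      have "s n \<le> real (N + 1) * ?\<tau>" using \<tau> unfolding s_def by (intro mult_right_mono) auto
      then show "s n \<le> ?T" using \<tau> by simp
    qed
    have s_eq: "s n = real n * ?\<tau>" "s (Suc n) = real (Suc n) * ?\<tau>" "s (Suc n) - s n = ?\<tau>" "s (Suc n) = grid P N (n + 1)" if "n \<le> N" for n
      using that by (auto simp: s_def grid_def min_def algebra_simps)
    have sT: "s n \<in> {0..?T}" for n using s by simp
    let ?us = "sampled (u_init P) u s" and ?xs = "sampled (xi_init P) \<xi> s" and ?ps = "sampled (p_init P) p s"
    define I where "I n = integral {s n..s (Suc n)} y" for n
    have part: "integral {s n..s (Suc n)} f \<le> I n" if "f \<in> L2 (lebesgue_on {0<..<?T})" "\<And>r. f r \<le> y r" for f n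
      unfolding I_def using that s by (intro integral_le hk yL) auto
    have sumI: "(\<Sum>n\<le>N. I n) = integral {0..?T} y" "(\<Sum>n\<le>N. (I n)\<^sup>2) \<le> ?\<tau> * Z"
    proof -
      have "I n = integral {real n * ?\<tau>..real (Suc n) * ?\<tau>} y" if "n \<le> N" for n
        using s_eq[OF that] by (simp add: I_def)
      then show "(\<Sum>n\<le>N. I n) = integral {0..?T} y" "(\<Sum>n\<le>N. (I n)\<^sup>2) \<le> ?\<tau> * Z"
        using uniform_partition_integrals[OF T yL y0, of N] by (simp_all add: Z_def time_step_def)
    qed
    have inc_u: "?us (Suc n) - ?us n \<in> Sobolev (dom P) (k + 1)" 
      "?N (k + 1) (?us (Suc n) - ?us n) \<le> integral {s n..s (Suc n)} (\<lambda>r. ?N (k + 1) (ut r))" for n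
      using sampled_increment_Sobolev[where n=n, OF T tc(1) time_derivatives(1) regularity_u(2) X(1,2) u0L init(1) s(1) s(2) s(3) s(4)] by auto
    have inc_x: "?xs (Suc n) - ?xs n \<in> Sobolev (dom P) k" 
      "?N k (?xs (Suc n) - ?xs n) \<le> integral {s n..s (Suc n)} (\<lambda>r. ?N k (\<xi>t r))" for n
      using sampled_increment_Sobolev[where n=n, OF T tc(2) wd(1) regularity_\<xi>(2) X(3,4) x0L init(2) s(1) s(2) s(3) s(4)] by auto
    have inc_p: "?ps (Suc n) - ?ps n \<in> Sobolev (dom P) (l + 1)" 
      "?N (l + 1) (?ps (Suc n) - ?ps n) \<le> integral {s n..s (Suc n)} (\<lambda>r. ?N (l + 1) (pt r))" for n
      using sampled_increment_Sobolev[where n=n, OF T tc(3) wd(2) regularity_p(2) X(5,6) p0L init(3) s(1) s(2) s(3) s(4)] by auto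
    have memV: "?us n \<in> V_space P" "?xs n \<in> W_space P" "?ps n \<in> M_space P" for n
      using eqs(1-3)[OF sT] uV pM x0L spaces(5) by (auto simp: sampled_def)
    have dV: "?us (Suc n) - ?us n \<in> V_space P" "?ps (Suc n) - ?ps n \<in> M_space P" for n
      using memV spaces(1,3) by (auto intro: subspace_diff)
    have e1: "is_stokes_projection P k \<T> v \<phi> (Ru \<T> v \<phi>) (R\<xi> \<T> v \<phi>)" if "v \<in> V_space P" "\<phi> \<in> W_space P" for v \<phi>
      using stokes_projection \<T> that by blast
    have e2: "is_elliptic_projection P l \<T> \<psi> (Rp \<T> \<psi>)" if "\<psi> \<in> M_space P" for \<psi>
      using elliptic_projection \<T> that by blast
    have e3: "\<beta>' * L2_norm ?L \<phi> \<le> (SUP v\<in>V_h P k \<T>. form_b P v \<phi> / ?N 1 v)" if "\<phi> \<in> W_h P k \<T>" for \<phi>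
      using discrete_inf_sup(2) \<T> that by blast
    have enlarge: "Cproj * a * b \<le> c * a * b" if "0 \<le> a" "0 \<le> b" for a b
      using that by (intro mult_right_mono) (auto simp: c_def)
    have e4: "?N 1 (v - Ru \<T> v \<phi>) + L2_norm ?L (\<phi> - R\<xi> \<T> v \<phi>) \<le> c * ?h ^ k * (?N (k + 1) v + ?N k \<phi>)"
      if "v \<in> ?XU" "\<phi> \<in> ?XX" for v \<phi>
    proof -
      have "?N 1 (v - Ru \<T> v \<phi>) + L2_norm ?L (\<phi> - R\<xi> \<T> v \<phi>) \<le> Cproj * ?h ^ k * (?N (k + 1) v + ?N k \<phi>)"
        using stokes_projection_error \<T> that unfolding fun_diff_def by blast
      also have "\<dots> \<le> c * ?h ^ k * (?N (k + 1) v + ?N k \<phi>)" using h by (intro enlarge) auto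
      finally show ?thesis .
    qed
    have e5: "?N 1 (\<psi> - Rp \<T> \<psi>) \<le> c * ?h ^ l * ?N (l + 1) \<psi> \<and> L2_norm ?L (\<psi> - Rp \<T> \<psi>) \<le> c * ?h ^ (l + 1) * ?N (l + 1) \<psi>"
      if "\<psi> \<in> ?XP" for \<psi>
    proof -
      have "?N 1 (\<psi> - Rp \<T> \<psi>) \<le> Cproj * ?h ^ l * ?N (l + 1) \<psi>" "L2_norm ?L (\<psi> - Rp \<T> \<psi>) \<le> Cproj * ?h ^ (l + 1) * ?N (l + 1) \<psi>"
        using elliptic_projection_error \<T> that unfolding fun_diff_def by blast+
      moreover have "Cproj * ?h ^ l * ?N (l + 1) \<psi> \<le> c * ?h ^ l * ?N (l + 1) \<psi>" 
        "Cproj * ?h ^ (l + 1) * ?N (l + 1) \<psi> \<le> c * ?h ^ (l + 1) * ?N (l + 1) \<psi>" using h by (intro enlarge; simp)+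
      ultimately show ?thesis by linarith
    qed
    have derL: "pt (s (Suc n)) \<in> L2 ?L" "\<xi>t (s (Suc n)) \<in> L2 ?L" for n
      using tc(4,5) sT by (auto simp: time_continuous_def)
    have r0: "?us 0 \<in> ?XU" "?xs 0 \<in> ?XX" "?ps 0 \<in> ?XP" "?N (k + 1) (?us 0) + ?N k (?xs 0) \<le> A" "?N (l + 1) (?ps 0) \<le> A"
      using reg0 by (simp_all add: sampled_def A_def)
    have r1: "?us (Suc n) - ?us n \<in> ?XU" "?ps (Suc n) - ?ps n \<in> ?XP" for n
      using dV[of n] inc_u(1)[of n] inc_p(1)[of n] unfolding V_space_def M_space_def by (blast intro: Sobolev0_upgrade)+
    have sumUX: "(\<lambda>r. ?N (k + 1) (ut r) + ?N k (\<xi>t r)) \<in> L2 (lebesgue_on {0<..<?T})"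
      using L2.closed(2)[OF yparts(1,2)] by (simp add: plus_fun_def)
    have r2: "?N (k + 1) (?us (Suc n) - ?us n) + ?N k (?xs (Suc n) - ?xs n) \<le> I n" for n
    proof -
      have "?N (k + 1) (?us (Suc n) - ?us n) + ?N k (?xs (Suc n) - ?xs n) 
          \<le> integral {s n..s (Suc n)} (\<lambda>r. ?N (k + 1) (ut r)) + integral {s n..s (Suc n)} (\<lambda>r. ?N k (\<xi>t r))"
        using inc_u(2)[of n] inc_x(2)[of n] by (rule add_mono)
      also have "\<dots> = integral {s n..s (Suc n)} (\<lambda>r. ?N (k + 1) (ut r) + ?N k (\<xi>t r))"
        by (intro Henstock_Kurzweil_Integration.integral_add[symmetric] hk yparts s)
      also have "\<dots> \<le> I n" by (rule part[OF sumUX]) (simp add: y_def)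
      finally show ?thesis .
    qed
    have r3: "?N (l + 1) (?ps (Suc n) - ?ps n) \<le> I n" for n
      using inc_p(2)[of n] part[OF yparts(3), of n] by (force simp: y_def)
    have dU: "dominating_norm ?XP (?N (l + 1))" "dominating_norm ?XX (?N k)"
      by (rule dominating_norm_Sobolev[OF X(5,6)], rule dominating_norm_Sobolev[OF X(3,4)])
    have con_p: "L2_norm ?L (?ps (Suc n) - ?ps n - ?\<tau> *\<^sub>R pt (s (Suc n))) \<le> ?\<tau> * I n" if n: "n \<le> N" for n
    proof -
      have "L2_norm ?L (?ps (Suc n) - ?ps n - (s (Suc n) - s n) *\<^sub>R pt (s (Suc n))) 
          \<le> (s (Suc n) - s n) * integral {s n..s (Suc n)} (\<lambda>r. L2_norm ?L (ptt r))"
        by (rule sampled_consistency[OF T tc(3) wd(2) regularity_p(2) dU(1) tc(5) time_derivatives(4) regularity_p(3) 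
              dominating_norm_L2 p0L init(3) s(1) s(2) s(3) s(4)])
      also have "\<dots> \<le> ?\<tau> * I n"
        unfolding s_eq(3)[OF n] using \<tau>(1) by (intro mult_left_mono part[OF yparts(5)]) (auto simp: y_def)
      finally show ?thesis unfolding s_eq(3)[OF n] .
    qed
    have con_x: "L2_norm ?L (?xs (Suc n) - ?xs n - ?\<tau> *\<^sub>R \<xi>t (s (Suc n))) \<le> ?\<tau> * I n" if n: "n \<le> N" for n
    proof -
      have "L2_norm ?L (?xs (Suc n) - ?xs n - (s (Suc n) - s n) *\<^sub>R \<xi>t (s (Suc n))) 
          \<le> (s (Suc n) - s n) * integral {s n..s (Suc n)} (\<lambda>r. L2_norm ?L (\<xi>tt r))"
        by (rule sampled_consistency[OF T tc(2) wd(1) regularity_\<xi>(2) dU(2) tc(4) time_derivatives(3) regularity_\<xi>(3) 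
              dominating_norm_L2 x0L init(2) s(1) s(2) s(3) s(4)])
      also have "\<dots> \<le> ?\<tau> * I n"
        unfolding s_eq(3)[OF n] using \<tau>(1) by (intro mult_left_mono part[OF yparts(4)]) (auto simp: y_def)
      finally show ?thesis unfolding s_eq(3)[OF n] .
    qed
    have us_Suc: "?us (Suc n) = u (s (Suc n))" "?xs (Suc n) = \<xi> (s (Suc n))" "?ps (Suc n) = p (s (Suc n))" for n
      by (simp_all add: sampled_def)
    have ce1: "form_a1 P (?us (Suc n)) v - form_b P v (?xs (Suc n)) = load_term P (s (Suc n)) v" 
      if "v \<in> V_space P" for n v unfolding us_Suc by (rule eqs(4)[OF sT that])
    have ce2: "form_b P (?us (Suc n)) \<phi> + form_a2 P (?xs (Suc n)) \<phi> - form_c P (?ps (Suc n)) \<phi> = 0" 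
      if "\<phi> \<in> W_space P" for n \<phi> unfolding us_Suc by (rule eqs(5)[OF sT that])
    have ce3: "form_a3 P (pt (s (Suc n))) \<psi> - form_c P \<psi> (\<xi>t (s (Suc n))) + form_d P (?ps (Suc n)) \<psi> = supply_term P (s (Suc n)) \<psi>" 
      if "\<psi> \<in> M_space P" for n \<psi> unfolding us_Suc by (rule eqs(6)[OF sT that])
    have h0': "uh 0 = Ru \<T> (?us 0) (?xs 0)" "\<xi>h 0 = R\<xi> \<T> (?us 0) (?xs 0)" "ph 0 = Rp \<T> (?ps 0)"
      using h0 by (simp_all add: sampled_def)
    have be_n: "uh (Suc n) \<in> V_h P k \<T>" "\<xi>h (Suc n) \<in> W_h P k \<T>" "ph (Suc n) \<in> M_h P l \<T>"
      "\<And>v. v \<in> V_h P k \<T> \<Longrightarrow> form_a1 P (uh (Suc n)) v - form_b P v (\<xi>h (Suc n)) = load_term P (s (Suc n)) v"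
      "\<And>\<phi>. \<phi> \<in> W_h P k \<T> \<Longrightarrow> form_b P (uh (Suc n)) \<phi> + form_a2 P (\<xi>h (Suc n)) \<phi> - form_c P (ph (Suc n)) \<phi> = 0"
      "\<And>\<psi>. \<psi> \<in> M_h P l \<T> \<Longrightarrow> form_a3 P (\<lambda>x. (ph (Suc n) x - ph n x) / ?\<tau>) \<psi>
         - form_c P \<psi> (\<lambda>x. (\<xi>h (Suc n) x - \<xi>h n x) / ?\<tau>) + form_d P (ph (Suc n)) \<psi> = supply_term P (s (Suc n)) \<psi>"
      if n: "n \<le> N" for n
      using be[unfolded backward_euler_def, rule_format, OF n, folded s_eq(4)[OF n], folded Suc_eq_plus1] by blast+
    note est = discrete_error_estimate[where us="?us" and xs="?xs" and ps="?ps" and N=N and uh=uh and xh=\<xi>h and ph=ph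
        and pt="\<lambda>n. pt (s (Suc n))" and xt="\<lambda>n. \<xi>t (s (Suc n))" and I=I and ru="Ru \<T>" and rx="R\<xi> \<T>" and rp="Rp \<T>"
        and F="\<lambda>n. load_term P (s (Suc n))" and G="\<lambda>n. supply_term P (s (Suc n))",
        OF e1 e2 discrete_inf_sup(1) e3 c h(1) e4 e5 memV derL r0 r1(1) inc_x(1) r1(2) r2 r3 \<tau>(1) con_p con_x 
          ce1 ce2 ce3 h0' be_n(1) be_n(2) be_n(3) be_n(4) be_n(5) be_n(6), folded K_def S_def]
    have last: "?us (Suc N) = u (grid P N (N + 1))" "?xs (Suc N) = \<xi> (grid P N (N + 1))" "?ps (Suc N) = p (grid P N (N + 1))"
      using us_Suc s_eq(4)[of N] by simp_all
    let ?e = "?\<tau> + ?h ^ k + ?h ^ (l + 1)" and ?e' = "?\<tau> + ?h ^ k + ?h ^ l"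
    have e: "0 \<le> ?e" "?h ^ k \<le> ?e" "?h ^ (l + 1) \<le> ?e" "?h ^ l \<le> ?e'" "0 \<le> ?e'" using h \<tau> by auto
    have ee: "?e \<le> \<delta> * ?e'"
    proof -
      have "?h * ?h ^ l \<le> (\<delta> - 1) * ?h ^ l" using h by (intro mult_right_mono) (auto simp: \<delta>_def)
      moreover have "1 * ?e' \<le> \<delta> * ?e'" "(\<delta> - 1) * ?h ^ l \<le> (\<delta> - 1) * ?e'"
        using \<delta> e by (intro mult_right_mono mult_left_mono; simp)+
      moreover have "?\<tau> + ?h ^ k \<le> ?e'" using h by simp
      ultimately show ?thesis by (simp add: algebra_simps)
    qed
    have YY: "(\<Sum>n\<le>N. I n) + A = Y" using sumI(1) by (simp add: Y_def)
    have bound_u: "L2_norm ?L (strain (dom P) (?us (Suc N) - uh (Suc N))) \<le> c1 * ?e"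
    proof -
      have m: "sqrt (2 * mu P) > 0" using parameters by simp
      have "L2_norm ?L (strain (dom P) (?us (Suc N) - uh (Suc N))) \<le> c * ?h ^ k * Y + 2 * S * (K * ?e * Y) / sqrt (2 * mu P)"
        using est(1) m unfolding YY by (simp add: field_simps)
      also have "c * ?h ^ k * Y \<le> c * ?e * Y" using c Y0 e by (intro mult_right_mono mult_left_mono)
      finally show ?thesis by (simp add: c1_def algebra_simps)
    qed
    have "c * ?h ^ k * Y \<le> c * ?e * Y" "c * ?h ^ (l + 1) * Y \<le> c * ?e * Y" 
      using c Y0 e by (intro mult_right_mono mult_left_mono; simp)+
    then have bound_x: "L2_norm ?L (?xs (Suc N) - \<xi>h (Suc N)) \<le> c2 * ?e" and bound_p: "L2_norm ?L (?ps (Suc N) - ph (Suc N)) \<le> c2 * ?e"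
      using est(2,3) unfolding YY by (simp_all add: c2_def algebra_simps)
    have bound_grad: "L2_norm ?L (grad (dom P) (?ps (Suc N) - ph (Suc N))) \<le> c3 * ?e'"
    proof -
      let ?R = "2 * Y\<^sup>2 / (real (N + 1) * ?\<tau>) + (\<Sum>n=1..N. (I n)\<^sup>2) / ?\<tau>" and ?q = "sqrt (2 * Y\<^sup>2 / ?T + Z)"
      have m: "sqrt (perm P) > 0" using parameters by simp
      have "(\<Sum>n=1..N. (I n)\<^sup>2) \<le> (\<Sum>n\<le>N. (I n)\<^sup>2)" by (intro sum_mono2) auto
      then have "(\<Sum>n=1..N. (I n)\<^sup>2) / ?\<tau> \<le> Z" using sumI(2) \<tau>(1) by (simp add: divide_le_eq mult.commute)
      then have R: "sqrt ?R \<le> ?q" unfolding \<tau>(2) by simp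
      have "L2_norm ?L (grad (dom P) (?ps (Suc N) - ph (Suc N))) \<le> c * ?h ^ l * Y + S * K * ?e * sqrt ?R / sqrt (perm P)"
        using est(4) m unfolding YY by (simp add: field_simps)
      also have "c * ?h ^ l * Y \<le> c * ?e' * Y" using c Y0 e by (intro mult_right_mono mult_left_mono)
      also have "S * K * ?e * sqrt ?R / sqrt (perm P) \<le> S * K * (\<delta> * ?e') * ?q / sqrt (perm P)"
      proof (rule divide_right_mono)
        have "S * K * ?e \<le> S * K * (\<delta> * ?e')" using ee S0 K0 by (intro mult_left_mono mult_nonneg_nonneg)
        moreover have "0 \<le> S * K * (\<delta> * ?e')" using S0 K0 \<delta> e(5) by (intro mult_nonneg_nonneg) auto
        moreover have "0 \<le> ?R" using \<tau>(1) by (intro add_nonneg_nonneg divide_nonneg_nonneg sum_nonneg) auto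
        then have "0 \<le> sqrt ?R" by (rule real_sqrt_ge_zero)
        ultimately show "S * K * ?e * sqrt ?R \<le> S * K * (\<delta> * ?e') * ?q" using R by - (rule mult_mono)
      qed (use m in simp)
      finally show ?thesis by (simp add: c3_def algebra_simps)
    qed
    have le: "a * ?e \<le> (c1 + 2 * c2 + c3 + 1) * ?e" if "a \<le> c1 + 2 * c2 + c3 + 1" for a
      using that e(1) by (rule mult_right_mono)
    have "c1 * ?e + c2 * ?e + c2 * ?e \<le> (c1 + 2 * c2 + c3 + 1) * ?e"
      using le[of "c1 + 2 * c2"] c123 by (simp add: distrib_right)
    moreover have "c3 * ?e' \<le> (c1 + 2 * c2 + c3 + 1) * ?e'" using c123 e(5) by (intro mult_right_mono) auto
    moreover note bound_u[unfolded last fun_diff_def] bound_x[unfolded last fun_diff_def]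
      bound_p[unfolded last fun_diff_def] bound_grad[unfolded last fun_diff_def]
    ultimately show "let h = ?h; dt = ?\<tau>;
           e_u = (\<lambda>x. u (grid P N (N + 1)) x - uh (N + 1) x);
           e_\<xi> = (\<lambda>x. \<xi> (grid P N (N + 1)) x - \<xi>h (N + 1) x);
           e_p = (\<lambda>x. p (grid P N (N + 1)) x - ph (N + 1) x)
       in L2_norm ?L (strain (dom P) e_u) + L2_norm ?L e_\<xi> + L2_norm ?L e_p
            \<le> (c1 + 2 * c2 + c3 + 1) * (dt + h ^ k + h ^ (l + 1)) \<and>
          L2_norm ?L (grad (dom P) e_p) \<le> (c1 + 2 * c2 + c3 + 1) * (dt + h ^ k + h ^ l)"
      unfolding Let_def Suc_eq_plus1[symmetric] last by (intro conjI; linarith)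
  qed
qed

end
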